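(* For every $1\le r\le n$ and every $0\le i\le n-r$, the refined Hodge–Poincaré polynomial $\underline{\mathsf H}^i_{U_{r,n}}(x)$ has only real zeros (i.e. all of its complex zeros are real).
   Context: Let $U_{r,n}$ be the uniform matroid of rank $r\ge1$ on $[n]=\{1,\dots,n\}$; its proper flats are the subsets of $[n]$ of cardinality at most $r-1$. **Bergman fan.** Let $\underline N=\mathbb Z^n/\mathbb Z(e_1+\cdots+e_n)$. The Bergman fan $\underline\Sigma_{U_{r,n}}$ is the unimodular fan in $\underline N_{\mathbb R}$ whose rays are spanned by the images of $e_F=\sum_{i\in F}e_i$ (equivalently of $-e_{[n]\setminus F}$) for nonempty $F\subseteq[n]$ with $|F|\le r-1$, and whose cones are spanned by the rays of the chains of such sets. The dual space $\underline N^\vee_{\mathbb Q}$ is the space of $\sum_ia_i\ell_i$ with $\sum_ia_i=0$, where $\ell_i$ is dual to $e_i$. **Koszul homology.** The Stanley–Reisner ring $\mathbb Q[\underline\Sigma_{U_{r,n}}]$ is the quotient of $\mathbb Q[x_F:\varnothing\ne F\subseteq[n],|F|\le r-1]$ by the ideal generated by the products $x_Fx_G$ with $F,G$ incomparable. The Koszul complex is $K_i(\mathbb Q[\underline\Sigma_{U_{r,n}}])_j=\mathbb Q[\underline\Sigma_{U_{r,n}}]_{j-i}\otimes\bigwedge^i\underline N^\vee_{\mathbb Q}$, with differential the graded derivation with $d(x)=0$ for $x\in\mathbb Q[\underline\Sigma_{U_{r,n}}]$ and $d(m)=\sum_F\langle m,e_F\rangle x_F$ for $m\in\underline N^\vee_{\mathbb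 Q}$. Its homology is the singular cohomology ring of the toric variety $X_{\underline\Sigma_{U_{r,n}}}$, and $H_i(K(\mathbb Q[\underline\Sigma_{U_{r,n}}]))_j\cong\operatorname{Gr}^W_{2j}H^{2j-i}(X_{\underline\Sigma_{U_{r,n}}})$ for the weight filtration $W$. **Refined Hodge–Poincaré polynomial.** $\underline{\mathsf H}^i_{U_{r,n}}(x)=\sum_j\dim_{\mathbb Q}H_i(K(\mathbb Q[\underline\Sigma_{U_{r,n}}]))_j\,x^{j-i}$. *)

theory Defs
  imports
    Complex_Main
    "HOL-Computational_Algebra.Polynomial"
    "HOL-Library.Poly_Mapping"
    "HOL-Library.Function_Algebras"
begin

section \<open>The Stanley--Reisner ring of the Bergman fan\<close>

text \<open>The index set of the rays of the Bergman fan of \<open>U\<^sub>r\<^sub>,\<^sub>n\<close>: the nonempty proper flats.\<close>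

definition flats :: "nat \<Rightarrow> nat \<Rightarrow> nat set set" where
  "flats r n = {F. F \<subseteq> {1..n} \<and> F \<noteq> {} \<and> card F \<le> r - 1}"

type_synonym monomial = "nat set \<Rightarrow>\<^sub>0 nat"
type_synonym flat_poly = "monomial \<Rightarrow>\<^sub>0 rat"

definition xvar :: "nat set \<Rightarrow> flat_poly" where
  "xvar F = Poly_Mapping.single (Poly_Mapping.single F 1) 1"

definition mdeg :: "monomial \<Rightarrow> nat" where
  "mdeg a = (\<Sum>F\<in>Poly_Mapping.keys a. Poly_Mapping.lookup a F)"

text \<open>The type \<open>flat_poly\<close> has a variable for every set of naturals; \<open>poly_ring r n\<close> is
  the subring of polynomials in the variables \<open>xvar F\<close> with \<open>F \<in> flats r n\<close>.\<close>

definition poly_ring :: "nat \<Rightarrow> nat \<Rightarrow> flat_poly set" where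
  "poly_ring r n = {p. \<forall>a\<in>Poly_Mapping.keys p. Poly_Mapping.keys a \<subseteq> flats r n}"

definition homogeneous :: "nat \<Rightarrow> flat_poly set" where
  "homogeneous k = {p. \<forall>a\<in>Poly_Mapping.keys p. mdeg a = k}"

text \<open>The ideal of \<open>poly_ring r n\<close> defining the Stanley--Reisner ring.\<close>

inductive_set sr_ideal :: "nat \<Rightarrow> nat \<Rightarrow> flat_poly set" for r n where
  zero: "0 \<in> sr_ideal r n"
| add: "p \<in> sr_ideal r n \<Longrightarrow> q \<in> sr_ideal r n \<Longrightarrow> p + q \<in> sr_ideal r n"
| gen: "F \<in> flats r n \<Longrightarrow> G \<in> flats r n \<Longrightarrow> \<not> F \<subseteq> G \<Longrightarrow> \<not> G \<subseteq> F \<Longrightarrow> q \<in> poly_ring r n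
    \<Longrightarrow> q * (xvar F * xvar G) \<in> sr_ideal r n"

section \<open>Exterior algebra and Koszul differential\<close>

text \<open>An element of \<open>\<rat>[x\<^sub>F] \<otimes> \<And>(\<rat>\<ell>\<^sub>1 \<oplus> \<dots> \<oplus> \<rat>\<ell>\<^sub>n)\<close> is represented by its coordinate function:
  \<open>w\<close> stands for the sum over \<open>S \<subseteq> {1..n}\<close> of \<open>w S \<otimes> \<ell>\<^sub>S\<close>, where \<open>\<ell>\<^sub>S\<close> is the wedge product of
  the \<open>\<ell>\<^sub>s\<close>, \<open>s \<in> S\<close>, in increasing order.  Addition of such functions is pointwise.\<close>

type_synonym form = "nat set \<Rightarrow> flat_poly"

definition rscale :: "rat \<Rightarrow> form \<Rightarrow> form" where
  "rscale c w = (\<lambda>S. Poly_Mapping.single 0 c * w S)"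

global_interpretation form: vector_space rscale
  by unfold_locales
    (simp_all add: rscale_def fun_eq_iff algebra_simps single_add mult_single
      flip: mult.assoc)

definition pscale :: "flat_poly \<Rightarrow> form \<Rightarrow> form" where
  "pscale p w = (\<lambda>S. p * w S)"

definition one_form :: form where
  "one_form = (\<lambda>S. if S = {} then 1 else 0)"

text \<open>The dual lattice space, a functional \<open>\<Sum>\<^sub>i m\<^sub>i \<ell>\<^sub>i\<close> being given by its coefficients.\<close>

definition dualN :: "nat \<Rightarrow> (nat \<Rightarrow> rat) set" where
  "dualN n = {m. (\<forall>i. i \<notin> {1..n} \<longrightarrow> m i = 0) \<and> (\<Sum>i\<in>{1..n}. m i) = 0}"

definition pairing :: "(nat \<Rightarrow> rat) \<Rightarrow> nat set \<Rightarrow> rat" where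
  "pairing m F = (\<Sum>i\<in>F. m i)"

text \<open>The sign with \<open>\<ell>\<^sub>t \<and> \<ell>\<^sub>S = sgn_ins S t \<ell>\<^bsub>insert t S\<^esub>\<close> for \<open>t \<notin> S\<close>.\<close>

definition sgn_ins :: "nat set \<Rightarrow> nat \<Rightarrow> flat_poly" where
  "sgn_ins S t = (-1) ^ card {u \<in> S. u < t}"

text \<open>Left multiplication by a functional, \<open>w \<mapsto> m \<and> w\<close>, and the product of a list of
  functionals.\<close>

definition wedge :: "nat \<Rightarrow> (nat \<Rightarrow> rat) \<Rightarrow> form \<Rightarrow> form" where
  "wedge n m w =
     (\<lambda>S. \<Sum>t\<in>S \<inter> {1..n}. sgn_ins (S - {t}) t * Poly_Mapping.single 0 (m t) * w (S - {t}))"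

definition wedges :: "nat \<Rightarrow> (nat \<Rightarrow> rat) list \<Rightarrow> form" where
  "wedges n ms = foldr (wedge n) ms one_form"

text \<open>The Koszul differential is the \<open>\<rat>[x\<^sub>F]\<close>-linear graded derivation with
  \<open>d \<ell>\<^sub>t = \<Sum>\<^sub>F \<langle>\<ell>\<^sub>t, e\<^sub>F\<rangle> x\<^sub>F\<close>, the sum over the flats \<open>F\<close> that contain \<open>t\<close>; here it is written in the
  basis \<open>\<ell>\<^sub>S\<close>.  Its defining properties are \<open>koszul_d_one\<close>, \<open>koszul_d_add\<close>, \<open>koszul_d_pscale\<close>
  and \<open>koszul_d_wedge\<close> below.\<close>

definition koszul_d :: "nat \<Rightarrow> nat \<Rightarrow> form \<Rightarrow> form" where
  "koszul_d r n w =
     (\<lambda>S. \<Sum>t\<in>{1..n} - S. sgn_ins S t * (\<Sum>F | F \<in> flats r n \<and> t \<in> F. xvar F) * w (insert t S))"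

text \<open>\<open>d m = \<Sum>\<^sub>F \<langle>m, e\<^sub>F\<rangle> x\<^sub>F\<close> for a functional \<open>m\<close>.\<close>

definition theta :: "nat \<Rightarrow> nat \<Rightarrow> (nat \<Rightarrow> rat) \<Rightarrow> flat_poly" where
  "theta r n m = (\<Sum>F\<in>flats r n. Poly_Mapping.single 0 (pairing m F) * xvar F)"

text \<open>\<open>A \<otimes> \<And>\<^sup>i N\<^sup>\<or>\<close> for a subspace \<open>A\<close> of the polynomial ring.\<close>

definition tens :: "nat \<Rightarrow> flat_poly set \<Rightarrow> nat \<Rightarrow> form set" where
  "tens n A i =
     form.span {pscale p (wedges n ms) | p ms. p \<in> A \<and> length ms = i \<and> set ms \<subseteq> dualN n}"

section \<open>Koszul homology\<close>

text \<open>Writing \<open>R\<close> for \<open>poly_ring r n\<close> and \<open>I\<close> for \<open>sr_ideal r n\<close>, the degree \<open>j\<close> part of the \<open>i\<close>-th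
  term of the Koszul complex of \<open>R / I\<close> is the quotient
  \<open>(R\<^bsub>j-i\<^esub> \<otimes> \<And>\<^sup>i N\<^sup>\<or>) / (I\<^bsub>j-i\<^esub> \<otimes> \<And>\<^sup>i N\<^sup>\<or>)\<close>, whose numerator and denominator
  are \<open>K_num\<close> and \<open>K_den\<close>.  Both vanish for \<open>j < i\<close>.\<close>

definition K_num :: "nat \<Rightarrow> nat \<Rightarrow> nat \<Rightarrow> nat \<Rightarrow> form set" where
  "K_num r n i j = (if i \<le> j then tens n (poly_ring r n \<inter> homogeneous (j - i)) i else {0})"

definition K_den :: "nat \<Rightarrow> nat \<Rightarrow> nat \<Rightarrow> nat \<Rightarrow> form set" where
  "K_den r n i j = (if i \<le> j then tens n (sr_ideal r n \<inter> homogeneous (j - i)) i else {0})"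

text \<open>The preimages in \<open>K_num\<close> of the kernel and of the image of the differential on the
  quotients.  For \<open>i = 0\<close> the differential is zero, so the truncated \<open>i - 1\<close> is harmless.\<close>

definition koszul_cycles :: "nat \<Rightarrow> nat \<Rightarrow> nat \<Rightarrow> nat \<Rightarrow> form set" where
  "koszul_cycles r n i j = {w \<in> K_num r n i j. koszul_d r n w \<in> K_den r n (i - 1) j}"

definition koszul_boundaries :: "nat \<Rightarrow> nat \<Rightarrow> nat \<Rightarrow> nat \<Rightarrow> form set" where
  "koszul_boundaries r n i j =
     {koszul_d r n u + v | u v. u \<in> K_num r n (i + 1) j \<and> v \<in> K_den r n i j}"

text \<open>By the third isomorphism theorem the kernel modulo the image in the quotient complex is
  \<open>koszul_cycles / koszul_boundaries\<close>; this is the dimension of \<open>H\<^sub>i(K(R / I))\<^sub>j\<close>.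
  The subtraction is meaningful by \<open>boundaries_subset_cycles\<close> and \<open>K_num_finite_dim\<close>
  below.\<close>

definition koszul_betti :: "nat \<Rightarrow> nat \<Rightarrow> nat \<Rightarrow> nat \<Rightarrow> nat" where
  "koszul_betti r n i j = form.dim (koszul_cycles r n i j) - form.dim (koszul_boundaries r n i j)"

text \<open>For fixed \<open>i\<close> only finitely many of the homology groups are nonzero, because the polynomials
  \<open>theta r n m\<close> contain a linear system of parameters of \<open>R / I\<close>, so the sum is finite.  The guard
  \<open>i \<le> j\<close> costs nothing, since \<open>K_num r n i j = {0}\<close> otherwise.\<close>

definition hodge_poincare :: "nat \<Rightarrow> nat \<Rightarrow> nat \<Rightarrow> real poly" where
  "hodge_poincare r n i =
     (\<Sum>j | i \<le> j \<and> koszul_betti r n i j \<noteq> 0. monom (real (koszul_betti r n i j)) (j - i))"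

section \<open>Adequacy of the definitions\<close>

lemma finite_flats: "finite (flats r n)"
  by (rule finite_subset[of _ "Pow {1..n}"]) (auto simp: flats_def)

lemma koszul_d_one: "koszul_d r n (pscale p one_form) = 0"
  by (simp add: koszul_d_def pscale_def one_form_def fun_eq_iff)

lemma koszul_d_add: "koszul_d r n (u + v) = koszul_d r n u + koszul_d r n v"
  by (simp add: koszul_d_def fun_eq_iff algebra_simps sum.distrib)

lemma koszul_d_pscale: "koszul_d r n (pscale p w) = pscale p (koszul_d r n w)"
  by (simp add: koszul_d_def pscale_def fun_eq_iff sum_distrib_left mult_ac)

lemma wedge_add: "wedge n m (u + v) = wedge n m u + wedge n m v"
  by (simp add: wedge_def fun_eq_iff algebra_simps sum.distrib)

lemma wedge_pscale: "wedge n m (pscale p w) = pscale p (wedge n m w)"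
  by (simp add: wedge_def pscale_def fun_eq_iff sum_distrib_left mult_ac)

lemma rscale_eq_pscale: "rscale c = pscale (Poly_Mapping.single 0 c)"
  by (simp add: rscale_def pscale_def fun_eq_iff)

lemma sum_single: "(\<Sum>x\<in>A. Poly_Mapping.single k (f x)) = Poly_Mapping.single k (\<Sum>x\<in>A. f x)"
  by (induction A rule: infinite_finite_induct) (simp_all add: single_add)

lemma theta_alt:
  "theta r n m = (\<Sum>t\<in>{1..n}. Poly_Mapping.single 0 (m t) * (\<Sum>F | F \<in> flats r n \<and> t \<in> F. xvar F))"
proof -
  have "(\<Sum>t\<in>{1..n}. Poly_Mapping.single 0 (m t) * (\<Sum>F | F \<in> flats r n \<and> t \<in> F. xvar F))
      = (\<Sum>t\<in>{1..n}. \<Sum>F | F \<in> flats r n \<and> t \<in> F. Poly_Mapping.single 0 (m t) * xvar F)"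
    by (simp add: sum_distrib_left)
  also have "\<dots> = (\<Sum>F\<in>flats r n. \<Sum>t | t \<in> {1..n} \<and> t \<in> F. Poly_Mapping.single 0 (m t) * xvar F)"
    by (rule sum.swap_restrict) (simp_all add: finite_flats)
  also have "\<dots> = (\<Sum>F\<in>flats r n. Poly_Mapping.single 0 (pairing m F) * xvar F)"
  proof (rule sum.cong)
    fix F assume "F \<in> flats r n"
    then have "{t. t \<in> {1..n} \<and> t \<in> F} = F" by (auto simp: flats_def)
    then show "(\<Sum>t | t \<in> {1..n} \<and> t \<in> F. Poly_Mapping.single 0 (m t) * xvar F)
        = Poly_Mapping.single 0 (pairing m F) * xvar F"
      by (simp add: pairing_def sum_distrib_right flip: sum_single)
  qed simp
  finally show ?thesis by (simp add: theta_def)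
qed

lemma sgn_ins_square: "sgn_ins S t * sgn_ins S t = 1"
  by (simp add: sgn_ins_def flip: power_add mult_2)

lemma sgn_ins_swap:
  assumes "t \<notin> S" "s \<in> S"
  shows "sgn_ins S t * sgn_ins (insert t S - {s}) s = - (sgn_ins (S - {s}) s * sgn_ins (S - {s}) t)"
proof -
  have fin: "finite {u \<in> A. u < k}" for A :: "nat set" and k by simp
  show ?thesis
  proof (cases "s < t")
    case True
    have "{u \<in> S. u < t} = insert s {u \<in> S - {s}. u < t}" using assms True by auto
    moreover have "s \<notin> {u \<in> S - {s}. u < t}" by simp
    ultimately have "card {u \<in> S. u < t} = Suc (card {u \<in> S - {s}. u < t})"
      using fin by (metis card_insert_disjoint)
    moreover have "{u \<in> insert t S - {s}. u < s} = {u \<in> S - {s}. u < s}" using True by auto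
    ultimately show ?thesis by (simp add: sgn_ins_def mult_ac)
  next
    case False
    with assms have ts: "t < s" by (metis linorder_neqE_nat)
    have "{u \<in> insert t S - {s}. u < s} = insert t {u \<in> S - {s}. u < s}" using ts by auto
    moreover have "t \<notin> {u \<in> S - {s}. u < s}" using assms by simp
    ultimately have "card {u \<in> insert t S - {s}. u < s} = Suc (card {u \<in> S - {s}. u < s})"
      using fin by (metis card_insert_disjoint)
    moreover have "{u \<in> S. u < t} = {u \<in> S - {s}. u < t}" using ts by auto
    ultimately show ?thesis by (simp add: sgn_ins_def mult_ac)
  qed
qed

lemma koszul_d_wedge:
  "koszul_d r n (wedge n m w) = pscale (theta r n m) w - wedge n m (koszul_d r n w)"
proof
  fix S
  define th where "th t = (\<Sum>F | F \<in> flats r n \<and> t \<in> F. xvar F)" for t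
  define c where "c t = Poly_Mapping.single (0::monomial) (m t)" for t
  let ?N = "{1..n}"
  let ?e = "\<lambda>t s. sgn_ins S t * sgn_ins (insert t S - {s}) s * th t * c s * w (insert t S - {s})"
  let ?f = "\<lambda>s t. sgn_ins (S - {s}) s * sgn_ins (S - {s}) t * th t * c s * w (insert t (S - {s}))"
  have "koszul_d r n (wedge n m w) S = (\<Sum>t\<in>?N - S. \<Sum>s\<in>insert t S \<inter> ?N. ?e t s)"
    by (simp add: koszul_d_def wedge_def th_def[symmetric] c_def[symmetric] sum_distrib_left mult_ac
        del: Int_insert_left_if0 Int_insert_left_if1 Int_insert_left sum.insert)
  also have "\<dots> = (\<Sum>t\<in>?N - S. c t * th t * w S + (\<Sum>s\<in>S \<inter> ?N. ?e t s))"
  proof (rule sum.cong)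
    fix t assume t: "t \<in> ?N - S"
    have "(insert t S \<inter> ?N) = insert t (S \<inter> ?N)" using t by auto
    then have "(\<Sum>s\<in>insert t S \<inter> ?N. ?e t s) = ?e t t + (\<Sum>s\<in>S \<inter> ?N. ?e t s)"
      using t by simp
    also have "?e t t = (sgn_ins S t * sgn_ins S t) * (c t * th t * w S)"
      using t by (simp add: mult_ac)
    finally show "(\<Sum>s\<in>insert t S \<inter> ?N. ?e t s) = c t * th t * w S + (\<Sum>s\<in>S \<inter> ?N. ?e t s)"
      by (simp add: sgn_ins_square)
  qed simp
  finally have 1: "koszul_d r n (wedge n m w) S =
      (\<Sum>t\<in>?N - S. c t * th t * w S) + (\<Sum>t\<in>?N - S. \<Sum>s\<in>S \<inter> ?N. ?e t s)"
    by (simp add: sum.distrib)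
  have "wedge n m (koszul_d r n w) S = (\<Sum>s\<in>S \<inter> ?N. \<Sum>t\<in>?N - (S - {s}). ?f s t)"
    by (simp add: koszul_d_def wedge_def th_def[symmetric] c_def[symmetric] sum_distrib_left mult_ac)
  also have "\<dots> = (\<Sum>s\<in>S \<inter> ?N. c s * th s * w S + (\<Sum>t\<in>?N - S. ?f s t))"
  proof (rule sum.cong)
    fix s assume s: "s \<in> S \<inter> ?N"
    have "?N - (S - {s}) = insert s (?N - S)" using s by auto
    then have "(\<Sum>t\<in>?N - (S - {s}). ?f s t) = ?f s s + (\<Sum>t\<in>?N - S. ?f s t)"
      using s by simp
    also have "?f s s = (sgn_ins (S - {s}) s * sgn_ins (S - {s}) s) * (c s * th s * w S)"
      using s by (simp add: mult_ac insert_absorb)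
    finally show "(\<Sum>t\<in>?N - (S - {s}). ?f s t) = c s * th s * w S + (\<Sum>t\<in>?N - S. ?f s t)"
      by (simp add: sgn_ins_square)
  qed simp
  finally have 2: "wedge n m (koszul_d r n w) S =
      (\<Sum>s\<in>S \<inter> ?N. c s * th s * w S) + (\<Sum>t\<in>?N - S. \<Sum>s\<in>S \<inter> ?N. ?f s t)"
    by (simp add: sum.distrib) (rule sum.swap)
  have 3: "?e t s = - ?f s t" if "t \<in> ?N - S" "s \<in> S \<inter> ?N" for t s
  proof -
    have "insert t S - {s} = insert t (S - {s})" using that by auto
    then show ?thesis using sgn_ins_swap[of t S s] that by simp
  qed
  have "(\<Sum>t\<in>?N - S. \<Sum>s\<in>S \<inter> ?N. ?e t s) = - (\<Sum>t\<in>?N - S. \<Sum>s\<in>S \<inter> ?N. ?f s t)"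
    unfolding sum_negf[symmetric] by (intro sum.cong refl 3)
  moreover have "theta r n m * w S =
      (\<Sum>t\<in>?N - S. c t * th t * w S) + (\<Sum>s\<in>S \<inter> ?N. c s * th s * w S)"
  proof -
    have "?N = (?N - S) \<union> (S \<inter> ?N)" by auto
    then have "(\<Sum>t\<in>?N. c t * th t * w S) = (\<Sum>t\<in>(?N - S) \<union> (S \<inter> ?N). c t * th t * w S)" by simp
    also have "\<dots> = (\<Sum>t\<in>?N - S. c t * th t * w S) + (\<Sum>s\<in>S \<inter> ?N. c s * th s * w S)"
      by (rule sum.union_disjoint) auto
    finally show ?thesis
      by (simp add: theta_alt th_def[symmetric] c_def[symmetric] sum_distrib_right)
  qed
  ultimately show "koszul_d r n (wedge n m w) S
      = (pscale (theta r n m) w - wedge n m (koszul_d r n w)) S"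
    using 1 2 by (simp add: pscale_def)
qed


lemma wedge_zero: "wedge n m 0 = 0"
  by (simp add: wedge_def fun_eq_iff)

lemma koszul_d_zero: "koszul_d r n 0 = 0"
  by (simp add: koszul_d_def fun_eq_iff)

lemma koszul_d_rscale: "koszul_d r n (rscale c w) = rscale c (koszul_d r n w)"
  by (simp add: rscale_eq_pscale koszul_d_pscale)

lemma wedge_rscale: "wedge n m (rscale c w) = rscale c (wedge n m w)"
  by (simp add: rscale_eq_pscale wedge_pscale)

lemma wedge_diff: "wedge n m (u - v) = wedge n m u - wedge n m v"
  using wedge_add[of n m "u - v" v] by (simp add: eq_diff_eq)

lemma koszul_d_diff: "koszul_d r n (u - v) = koszul_d r n u - koszul_d r n v"
  using koszul_d_add[of r n "u - v" v] by (simp add: eq_diff_eq)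

lemma pscale_pscale: "pscale p (pscale q w) = pscale (p * q) w"
  by (simp add: pscale_def fun_eq_iff mult.assoc)

lemma koszul_d_d_wedges: "koszul_d r n (koszul_d r n (wedges n ms)) = 0"
proof (induction ms)
  case Nil
  have "koszul_d r n one_form = 0"
    using koszul_d_one[of r n 1] by (simp add: pscale_def)
  then show ?case by (simp only: wedges_def foldr.simps id_apply koszul_d_zero)
next
  case (Cons m ms)
  have "wedges n (m # ms) = wedge n m (wedges n ms)" by (simp add: wedges_def)
  with Cons show ?case
    by (simp only: koszul_d_wedge koszul_d_diff koszul_d_pscale wedge_zero diff_self diff_0_right)
qed

lemma tens_subspace: "form.subspace (tens n A i)"
  by (simp add: tens_def)

lemma tens_zero: "0 \<in> tens n A i"
  by (simp add: tens_def form.span_zero)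

lemma tens_base:
  "p \<in> A \<Longrightarrow> length ms = i \<Longrightarrow> set ms \<subseteq> dualN n \<Longrightarrow> pscale p (wedges n ms) \<in> tens n A i"
  unfolding tens_def by (rule form.span_base) auto

lemma tens_induct [consumes 1, case_names subspace base]:
  assumes "w \<in> tens n A i" and "form.subspace {w. P w}"
    and "\<And>p ms. p \<in> A \<Longrightarrow> length ms = i \<Longrightarrow> set ms \<subseteq> dualN n \<Longrightarrow> P (pscale p (wedges n ms))"
  shows "P w"
proof -
  have "tens n A i \<subseteq> {w. P w}"
    unfolding tens_def by (rule form.span_minimal) (use assms in auto)
  with assms(1) show ?thesis by auto
qed

lemma tens_mono: "A \<subseteq> B \<Longrightarrow> tens n A i \<subseteq> tens n B i"
  unfolding tens_def by (rule form.span_mono) auto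

lemma koszul_d_d_tens: "w \<in> tens n A i \<Longrightarrow> koszul_d r n (koszul_d r n w) = 0"
proof (induction rule: tens_induct)
  case subspace
  show ?case
    by (rule form.subspaceI)
      (simp_all only: mem_Collect_eq koszul_d_zero koszul_d_add koszul_d_rscale
        form.scale_zero_right add_0_left)
next
  case (base p ms)
  show ?case by (simp add: koszul_d_pscale koszul_d_d_wedges) (simp add: pscale_def fun_eq_iff)
qed

lemma wedge_tens:
  assumes "w \<in> tens n A i" "m \<in> dualN n"
  shows "wedge n m w \<in> tens n A (Suc i)"
  using assms(1)
proof (induction rule: tens_induct)
  case subspace
  show ?case
    using tens_subspace[of n A "Suc i"]
    by (auto simp: form.subspace_def wedge_zero wedge_add wedge_rscale)
next
  case (base p ms)
  then show ?case
    using assms(2) tens_base[of p A "m # ms" "Suc i" n]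
    by (simp add: wedges_def wedge_pscale)
qed

lemma koszul_d_wedges_tens:
  assumes "\<And>m p. p \<in> A \<Longrightarrow> theta r n m * p \<in> B"
  shows "p \<in> A \<Longrightarrow> set ms \<subseteq> dualN n \<Longrightarrow>
    koszul_d r n (pscale p (wedges n ms)) \<in> tens n B (length ms - 1)"
proof (induction ms)
  case Nil
  then show ?case by (simp only: wedges_def foldr.simps id_apply koszul_d_one tens_zero)
next
  case (Cons m ms)
  have eq: "koszul_d r n (pscale p (wedges n (m # ms))) =
      pscale (theta r n m * p) (wedges n ms) - wedge n m (koszul_d r n (pscale p (wedges n ms)))"
    by (simp add: wedges_def koszul_d_wedge pscale_pscale flip: wedge_pscale)
  have "wedge n m (koszul_d r n (pscale p (wedges n ms))) \<in> tens n B (length ms)"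
  proof (cases "ms = []")
    case True
    then show ?thesis by (simp add: wedges_def koszul_d_one wedge_zero tens_zero)
  next
    case False
    then have "Suc (length ms - 1) = length ms" by (cases ms) auto
    then show ?thesis using wedge_tens[of _ n B "length ms - 1" m] Cons by auto
  qed
  moreover have "pscale (theta r n m * p) (wedges n ms) \<in> tens n B (length ms)"
    using Cons.prems assms by (intro tens_base) auto
  ultimately show ?case
    unfolding eq list.size add_0_right add_Suc_right diff_Suc_1
    by (metis form.subspace_diff tens_subspace)
qed

lemma koszul_d_tens:
  assumes "\<And>m p. p \<in> A \<Longrightarrow> theta r n m * p \<in> B" and "w \<in> tens n A i"
  shows "koszul_d r n w \<in> tens n B (i - 1)"
  using assms(2)
proof (induction rule: tens_induct)
  case subspace
  show ?case
    using tens_subspace[of n B "i - 1"]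
    by (auto simp: form.subspace_def koszul_d_zero koszul_d_add koszul_d_rscale)
next
  case (base p ms)
  then show ?case using koszul_d_wedges_tens[of A r n B p ms] assms(1) by blast
qed

lemma mdeg_superset:
  "finite A \<Longrightarrow> Poly_Mapping.keys a \<subseteq> A \<Longrightarrow> mdeg a = (\<Sum>F\<in>A. Poly_Mapping.lookup a F)"
  unfolding mdeg_def by (rule sum.mono_neutral_left) (auto simp: in_keys_iff)

lemma mdeg_add: "mdeg (a + b) = mdeg a + mdeg b"
proof -
  let ?A = "Poly_Mapping.keys a \<union> Poly_Mapping.keys b"
  have "Poly_Mapping.keys (a + b) \<subseteq> ?A" by (rule Poly_Mapping.keys_add)
  then show ?thesis
    using mdeg_superset[of ?A "a + b"] mdeg_superset[of ?A a] mdeg_superset[of ?A b]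
    by (simp add: lookup_add sum.distrib)
qed

lemma poly_ring_mult:
  assumes "p \<in> poly_ring r n" "q \<in> poly_ring r n"
  shows "p * q \<in> poly_ring r n"
proof -
  have "Poly_Mapping.keys c \<subseteq> flats r n" if c: "c \<in> Poly_Mapping.keys (p * q)" for c
  proof -
    obtain a b where "c = a + b" "a \<in> Poly_Mapping.keys p" "b \<in> Poly_Mapping.keys q"
      using keys_mult[of p q] c by auto
    with assms show ?thesis
      using Poly_Mapping.keys_add[of a b] by (fastforce simp: poly_ring_def)
  qed
  then show ?thesis by (simp add: poly_ring_def)
qed

lemma homogeneous_mult:
  assumes "p \<in> homogeneous k" "q \<in> homogeneous l"
  shows "p * q \<in> homogeneous (k + l)"
  using assms keys_mult[of p q] by (fastforce simp: homogeneous_def mdeg_add)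

lemma theta_keys:
  assumes "a \<in> Poly_Mapping.keys (theta r n m)"
  shows "\<exists>F\<in>flats r n. a = Poly_Mapping.single F 1"
proof (rule ccontr)
  assume "\<not> ?thesis"
  then have "Poly_Mapping.lookup (theta r n m) a = 0"
    by (auto simp: theta_def lookup_sum xvar_def mult_single lookup_single when_def
        intro!: sum.neutral)
  with assms show False by (simp add: in_keys_iff)
qed

lemma theta_poly_ring: "theta r n m \<in> poly_ring r n"
  using theta_keys[of _ r n m] by (fastforce simp: poly_ring_def)

lemma theta_homogeneous: "theta r n m \<in> homogeneous 1"
  using theta_keys[of _ r n m] by (fastforce simp: homogeneous_def mdeg_def)

lemma xvar_poly_ring: "F \<in> flats r n \<Longrightarrow> xvar F \<in> poly_ring r n"
  by (simp add: xvar_def poly_ring_def)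

lemma sr_ideal_mult: "p \<in> sr_ideal r n \<Longrightarrow> q \<in> poly_ring r n \<Longrightarrow> q * p \<in> sr_ideal r n"
proof (induction rule: sr_ideal.induct)
  case zero
  then show ?case by (simp add: sr_ideal.zero)
next
  case (add p p')
  then show ?case by (simp add: distrib_left sr_ideal.add)
next
  case (gen F G q')
  then show ?case
    using sr_ideal.gen[of F r n G "q * q'"] poly_ring_mult by (simp add: mult.assoc)
qed

lemma poly_ring_add: "p \<in> poly_ring r n \<Longrightarrow> q \<in> poly_ring r n \<Longrightarrow> p + q \<in> poly_ring r n"
  using Poly_Mapping.keys_add[of p q] by (auto simp: poly_ring_def)

lemma sr_ideal_subset: "sr_ideal r n \<subseteq> poly_ring r n"
proof
  fix p assume "p \<in> sr_ideal r n"
  then show "p \<in> poly_ring r n"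
  proof (induction rule: sr_ideal.induct)
    case zero
    then show ?case by (simp add: poly_ring_def)
  qed (simp_all add: poly_ring_add poly_ring_mult xvar_poly_ring)
qed

lemma theta_mult_num:
  "p \<in> poly_ring r n \<inter> homogeneous k \<Longrightarrow> theta r n m * p \<in> poly_ring r n \<inter> homogeneous (Suc k)"
  using poly_ring_mult[OF theta_poly_ring] homogeneous_mult[OF theta_homogeneous] by auto

lemma theta_mult_den:
  "p \<in> sr_ideal r n \<inter> homogeneous k \<Longrightarrow> theta r n m * p \<in> sr_ideal r n \<inter> homogeneous (Suc k)"
  using sr_ideal_mult[OF _ theta_poly_ring] homogeneous_mult[OF theta_homogeneous] by auto

lemma koszul_d_tens_0: "w \<in> tens n A 0 \<Longrightarrow> koszul_d r n w = 0"
proof (induction rule: tens_induct)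
  case subspace
  show ?case
    by (rule form.subspaceI)
      (simp_all only: mem_Collect_eq koszul_d_zero koszul_d_add koszul_d_rscale
        form.scale_zero_right add_0_left)
next
  case (base p ms)
  then show ?case by (simp add: wedges_def koszul_d_one)
qed

lemma K_den_subspace: "form.subspace (K_den r n i j)"
  by (simp add: K_den_def tens_subspace form.subspace_single_0)

lemma K_num_subspace: "form.subspace (K_num r n i j)"
  by (simp add: K_num_def tens_subspace form.subspace_single_0)

lemma K_den_subset_K_num: "K_den r n i j \<subseteq> K_num r n i j"
  using tens_mono[of "sr_ideal r n \<inter> homogeneous (j - i)" "poly_ring r n \<inter> homogeneous (j - i)" n i]
    sr_ideal_subset[of r n]
  by (simp add: K_den_def K_num_def le_infI1)

lemma koszul_d_den:
  assumes "w \<in> K_den r n i j"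
  shows "koszul_d r n w \<in> K_den r n (i - 1) j"
proof -
  have z: "0 \<in> K_den r n (i - 1) j" by (rule form.subspace_0[OF K_den_subspace])
  show ?thesis
  proof (cases "i \<le> j")
    case False
    with assms z show ?thesis by (simp add: K_den_def koszul_d_zero split: if_splits)
  next
    case ij: True
    then have w: "w \<in> tens n (sr_ideal r n \<inter> homogeneous (j - i)) i"
      using assms by (simp add: K_den_def)
    show ?thesis
    proof (cases "i = 0")
      case True
      with w have "koszul_d r n w = 0" using koszul_d_tens_0 by blast
      with z show ?thesis by simp
    next
      case False
      with ij have "i - 1 \<le> j" "j - (i - 1) = Suc (j - i)" by auto
      then show ?thesis
        using koszul_d_tens[OF theta_mult_den w] by (simp add: K_den_def)
    qed
  qed
qed

lemma koszul_d_num: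
  assumes "w \<in> K_num r n (i + 1) j"
  shows "koszul_d r n w \<in> K_num r n i j"
proof (cases "i + 1 \<le> j")
  case True
  then have w: "w \<in> tens n (poly_ring r n \<inter> homogeneous (j - (i + 1))) (i + 1)"
    using assms by (simp add: K_num_def)
  have "i \<le> j" "j - i = Suc (j - (i + 1))" using True by auto
  then show ?thesis
    using koszul_d_tens[OF theta_mult_num w] by (simp add: K_num_def)
next
  case False
  with assms show ?thesis
    by (simp add: K_num_def koszul_d_zero tens_zero)
qed

theorem boundaries_subset_cycles: "koszul_boundaries r n i j \<subseteq> koszul_cycles r n i j"
proof
  fix w assume "w \<in> koszul_boundaries r n i j"
  then obtain u v where w: "w = koszul_d r n u + v"
    and u: "u \<in> K_num r n (i + 1) j" and v: "v \<in> K_den r n i j"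
    by (auto simp: koszul_boundaries_def)
  have "koszul_d r n (koszul_d r n u) = 0"
    using u koszul_d_d_tens[of u n _ "i + 1" r]
    by (auto simp: K_num_def koszul_d_zero split: if_splits)
  then have "koszul_d r n w \<in> K_den r n (i - 1) j"
    using koszul_d_den[OF v] by (simp add: w koszul_d_add)
  moreover have "w \<in> K_num r n i j"
    unfolding w using koszul_d_num[OF u] subsetD[OF K_den_subset_K_num v]
    by (rule form.subspace_add[OF K_num_subspace])
  ultimately show "w \<in> koszul_cycles r n i j" by (simp add: koszul_cycles_def)
qed

lemma wedges_coordinates:
  "\<exists>c. wedges n ms = (\<lambda>S. if S \<subseteq> {1..n} then Poly_Mapping.single 0 (c S) else 0)"
proof (induction ms)
  case Nil
  have "wedges n [] S = (if S \<subseteq> {1..n} then Poly_Mapping.single 0 (if S = {} then 1 else 0) else 0)"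
    for S by (cases "S = {}") (simp_all add: wedges_def one_form_def)
  then show ?case by (intro exI[of _ "\<lambda>S. if S = {} then 1 else 0"] ext)
next
  case (Cons m ms)
  from Cons.IH obtain c
    where "wedges n ms = (\<lambda>S. if S \<subseteq> {1..n} then Poly_Mapping.single 0 (c S) else 0)" ..
  then have c: "wedges n ms S = (if S \<subseteq> {1..n} then Poly_Mapping.single 0 (c S) else 0)" for S
    by simp
  have Cons_eq: "wedges n (m # ms) = wedge n m (wedges n ms)" by (simp add: wedges_def)
  define c' where
    "c' S = (\<Sum>t\<in>S. (-1) ^ card {u \<in> S - {t}. u < t} * m t * c (S - {t}))" for S
  have sg: "sgn_ins S t = Poly_Mapping.single 0 ((-1) ^ card {u \<in> S. u < t})" for S t
  proof -
    have "(-1) ^ k = Poly_Mapping.single (0::monomial) ((-1::rat) ^ k)" for k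
      by (induction k) (simp_all add: single_uminus)
    then show ?thesis by (simp add: sgn_ins_def)
  qed
  have "wedges n (m # ms) S = (if S \<subseteq> {1..n} then Poly_Mapping.single 0 (c' S) else 0)" for S
  proof (cases "S \<subseteq> {1..n}")
    case True
    then have "S \<inter> {1..n} = S" "\<And>t. S - {t} \<subseteq> {1..n}" by auto
    with True show ?thesis
      by (simp add: Cons_eq wedge_def c c'_def sg mult_single flip: sum_single)
  next
    case False
    then have "\<not> S - {t} \<subseteq> {1..n}" if "t \<in> S \<inter> {1..n}" for t using that by auto
    with False show ?thesis
      by (auto simp: Cons_eq wedge_def c intro!: sum.neutral)
  qed
  then show ?case by (intro exI[of _ c'] ext)
qed

lemma finite_monomials: "finite {a. Poly_Mapping.keys a \<subseteq> flats r n \<and> mdeg a = k}" (is "finite ?M")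
proof (rule finite_imageD)
  have "Poly_Mapping.lookup a F \<le> k" if "a \<in> ?M" for a F
  proof (cases "F \<in> Poly_Mapping.keys a")
    case True
    have "Poly_Mapping.lookup a F \<le> mdeg a"
      unfolding mdeg_def by (rule member_le_sum) (use True in auto)
    with that show ?thesis by simp
  qed (simp add: in_keys_iff)
  then have "Poly_Mapping.lookup ` ?M \<subseteq>
      {f. \<forall>F. (F \<in> flats r n \<longrightarrow> f F \<in> {..k}) \<and> (F \<notin> flats r n \<longrightarrow> f F = 0)}"
    by (auto simp: in_keys_iff)
  then show "finite (Poly_Mapping.lookup ` ?M)"
    by (rule finite_subset) (intro finite_set_of_finite_funs finite_flats finite_atMost)
  show "inj_on Poly_Mapping.lookup ?M"
    by (rule inj_onI) (simp only: Poly_Mapping.lookup_inject)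
qed

theorem K_num_finite_dim: "\<exists>B. finite B \<and> K_num r n i j \<subseteq> form.span B"
proof -
  define M where "M = {a. Poly_Mapping.keys a \<subseteq> flats r n \<and> mdeg a = j - i}"
  define E :: "nat set \<Rightarrow> monomial \<Rightarrow> form" where
    "E S a = (\<lambda>T. if T = S then Poly_Mapping.single a 1 else 0)" for S a
  define B where "B = (\<lambda>(S, a). E S a) ` (Pow {1..n} \<times> M)"
  have sum_fun: "(\<Sum>x\<in>A. f x) T = (\<Sum>x\<in>A. f x T)" for f :: "'x \<Rightarrow> form" and A T
    by (induction A rule: infinite_finite_induct) auto
  have "pscale p (wedges n ms) \<in> form.span B" if p: "p \<in> poly_ring r n \<inter> homogeneous (j - i)" for p ms
  proof -
    obtain c where c: "wedges n ms = (\<lambda>S. if S \<subseteq> {1..n} then Poly_Mapping.single 0 (c S) else 0)"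
      using wedges_coordinates[of n ms] ..
    have p_eq: "p = (\<Sum>a\<in>Poly_Mapping.keys p. Poly_Mapping.single a (Poly_Mapping.lookup p a))"
      by (rule poly_mapping_eqI) (auto simp: lookup_sum lookup_single when_def in_keys_iff)
    have "pscale p (wedges n ms) =
        (\<Sum>S\<in>Pow {1..n}. \<Sum>a\<in>Poly_Mapping.keys p. rscale (c S * Poly_Mapping.lookup p a) (E S a))"
      (is "?l = ?r")
    proof
      fix T
      have "?r T = (\<Sum>S\<in>Pow {1..n}. \<Sum>a\<in>Poly_Mapping.keys p.
          rscale (c S * Poly_Mapping.lookup p a) (E S a) T)"
        by (simp only: sum_fun)
      also have "\<dots> = (\<Sum>S\<in>Pow {1..n}. if T = S then
          (\<Sum>a\<in>Poly_Mapping.keys p. Poly_Mapping.single a (c S * Poly_Mapping.lookup p a)) else 0)"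
        by (intro sum.cong refl) (simp add: rscale_def E_def mult_single)
      also have "\<dots> = (if T \<subseteq> {1..n} then
          (\<Sum>a\<in>Poly_Mapping.keys p. Poly_Mapping.single a (c T * Poly_Mapping.lookup p a)) else 0)"
        by (subst sum.delta') auto
      also have "\<dots> = (if T \<subseteq> {1..n} then Poly_Mapping.single 0 (c T) * p else 0)"
        by (subst (3) p_eq) (simp add: sum_distrib_left mult_single)
      finally show "?l T = ?r T" by (simp add: pscale_def c mult.commute)
    qed
    also have "\<dots> \<in> form.span B"
    proof (intro form.span_sum form.span_scale form.span_base)
      fix S a assume "S \<in> Pow {1..n}" "a \<in> Poly_Mapping.keys p"
      then show "E S a \<in> B"
        using p unfolding B_def M_def by (intro image_eqI[of _ _ "(S, a)"]) (auto simp: poly_ring_def homogeneous_def)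
    qed
    finally show ?thesis .
  qed
  then have "tens n (poly_ring r n \<inter> homogeneous (j - i)) i \<subseteq> form.span B"
    unfolding tens_def by (intro form.span_minimal form.subspace_span) auto
  then have "K_num r n i j \<subseteq> form.span B"
    by (auto simp: K_num_def form.span_zero)
  moreover have "finite B"
    unfolding B_def M_def by (intro finite_imageI finite_cartesian_product finite_monomials) auto
  ultimately show ?thesis by blast
qed

end

theory Submission
  imports Defs "HOL-Computational_Algebra.Formal_Power_Series"
begin

text \<open>The polynomial is computed in closed form and then shown to have real zeros.

\<^bold>\<open>The ring.\<close> Let \<open>R / I\<close> be the Stanley--Reisner ring and let \<open>\<theta>\<^sub>t\<close> be the sum of the variables of
the flats that contain \<open>t\<close>; the Koszul differential sends \<open>\<ell>\<^sub>t\<close> to \<open>\<theta>\<^sub>t\<close>.  Over the polynomial ring in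
\<open>\<theta>\<^sub>1, \<dots>, \<theta>\<^sub>n\<close> the ring \<open>R / I\<close> splits as a direct sum of modules generated by the Feichtner--Yuzvinsky
monomials: if \<open>F\<close> is the union of the sets that occur in such a monomial \<open>a\<close>, the products
\<open>a \<theta>\<^sup>b\<close> with \<open>card (supp b \<union> F) < r\<close> are a basis of its summand, and all other \<open>a \<theta>\<^sup>b\<close> vanish.
The products span because a power of a variable that is too high can be rewritten
(\<open>relation_in_sr_ideal\<close>, \<open>single_in_fy_span\<close>), and they are independent because there are not
more of them than monomials supported on chains (\<open>card_fy_index_le\<close>, \<open>fy_independent\<close>).

\<^bold>\<open>Homology.\<close> The Koszul complex splits accordingly (\<open>koszul_betti_eq_sum\<close>).  The summand of \<open>a\<close>
depends only on \<open>\<rho> = r - card F\<close> and \<open>\<nu> = n - card F\<close>: it is the Koszul complex of a polynomial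
ring truncated at supports that are too large.  Two homotopies of Euler type (\<open>skel_betti_low\<close>,
\<open>skel_betti_high\<close>) confine its homology to the polynomial degrees below \<open>\<rho>\<close> for \<open>i = 0\<close>, and to the
polynomial degree \<open>\<rho> - 1\<close> for \<open>i > 0\<close>.  The Euler characteristic then gives the Betti numbers
(\<open>skel_betti_formula\<close>).

\<^bold>\<open>The closed form.\<close> The Feichtner--Yuzvinsky monomials with a given union of size \<open>s\<close> are counted
by degree by the derangement polynomial \<open>derange s\<close> (\<open>card_fy_top\<close>).  Hence, by
\<open>hodge_poincare_eq\<close>, the polynomial is
\<open>\<Sum>\<^bsub>s<r\<^esub> (n choose s) d\<^sub>s(x) \<beta>\<^bsub>i,s\<^esub> x\<^bsup>r-1-s\<^esup>\<close> for \<open>i > 0\<close>, and for \<open>i = 0\<close> the last two factors are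
replaced by \<open>1 + x + \<dots> + x\<^bsup>r-1-s\<^esup>\<close>.

\<^bold>\<open>Real zeros.\<close> Let \<open>q\<^sub>k\<close> enumerate by excedances the permutations of \<open>m = r - 1\<close> letters that fix none
of \<open>k\<close> chosen letters; \<open>q\<^sub>0\<close> is the Eulerian polynomial.  For \<open>m \<ge> 2\<close>, an induction on \<open>m\<close>
(\<open>interlaced_step\<close>) shows that all these polynomials have simple real zeros and that for \<open>k > 0\<close> each \<open>q\<^sub>k\<close>
alternates in sign along the zeros of \<open>q\<^sub>0\<close> (\<open>eulerian_interlaces_pderange\<close>); so does every positive
combination of them.  For \<open>i > 0\<close> the
reversed Hodge--Poincare polynomial is such a combination (\<open>betti_link_expand\<close>), and for \<open>i = 0\<close> it
is a symmetrisation of one, to which the same sign argument applies because the zeros of \<open>q\<^sub>0\<close> are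
closed under inversion.\<close>

section \<open>Derangement polynomials and permutations with few fixed points\<close>

text \<open>The enumerator of the derangements of \<open>m\<close> letters by excedances.  It is defined by its
differential recursion because this is the form that controls roots.\<close>

fun derange :: "nat \<Rightarrow> real poly" where
  "derange 0 = 1"
| "derange (Suc 0) = 0"
| "derange (Suc (Suc m)) = [:0, real (Suc m):] * (derange (Suc m) + derange m)
     + [:0, 1, -1:] * pderiv (derange (Suc m))"

lemma derange_Suc:
  "derange (Suc m) = [:0, real m:] * (derange m + derange (m - 1)) + [:0, 1, -1:] * pderiv (derange m)"
  by (cases m) (simp_all add: pderiv_1)

text \<open>The enumerator by excedances of the permutations of \<open>a + k\<close> letters that fix none of \<open>k\<close>
chosen letters: each of the other letters is fixed or not, whence the recursion.  For \<open>k = 0\<close> it is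
the Eulerian polynomial.\<close>

fun pderange :: "nat \<Rightarrow> nat \<Rightarrow> real poly" where
  "pderange 0 k = derange k"
| "pderange (Suc a) k = pderange a (Suc k) + pderange a k"

text \<open>The recursion of \<open>derange\<close> is linear, so it passes to the sums that make up
\<open>pderange\<close>; the coefficients of \<open>a\<close> and \<open>k\<close> adjust in each step.\<close>

lemma pderange_step:
  "pderange a (Suc k) = [:0, real (a + k):] * pderange a k + [:0, 1, -1:] * pderiv (pderange a k)
     + [:0, real k:] * pderange a (k - 1)"
proof (induction a arbitrary: k)
  case 0
  then show ?case by (simp add: derange_Suc algebra_simps)
next
  case (Suc a)
  have k: "[:0, real k:] * pderange (Suc a) (k - 1) = [:0, real k:] * (pderange a k + pderange a (k - 1))"
    by (cases k) auto
  have e: "[:0, real (Suc a + k):] = [:0, real (a + k):] + [:0, 1:]"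
    "[:0, real (a + Suc k):] = [:0, real (a + k):] + [:0, 1:]"
    "[:0, real (Suc k):] = [:0, real k:] + [:0, 1:]" by simp_all
  have "pderange (Suc a) (Suc k) = pderange a (Suc (Suc k)) + pderange a (Suc k)" by simp
  also have "pderange a (Suc (Suc k)) = ([:0, real (a + k):] + [:0, 1:]) * pderange a (Suc k)
     + [:0, 1, -1:] * pderiv (pderange a (Suc k)) + ([:0, real k:] + [:0, 1:]) * pderange a k"
    using Suc[of "Suc k"] by (simp only: e diff_Suc_1)
  finally have "pderange (Suc a) (Suc k) = ([:0, real (a + k):] + [:0, 1:]) * pderange a (Suc k)
     + [:0, 1, -1:] * pderiv (pderange a (Suc k)) + ([:0, real k:] + [:0, 1:]) * pderange a k
     + ([:0, real (a + k):] * pderange a k + [:0, 1, -1:] * pderiv (pderange a k) + [:0, real k:] * pderange a (k - 1))"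
    by (subst (asm) (2) Suc) 
  then show ?case
    unfolding k e pderange.simps(2)[of a k] pderiv_add by (simp only: ring_distribs ac_simps)
qed

lemma pderange_Suc_left:
  "pderange (Suc a) k = [:1, real (a + k):] * pderange a k + [:0, 1, -1:] * pderiv (pderange a k)
     + [:0, real k:] * pderange a (k - 1)"
proof -
  have e: "[:1, real (a + k):] = 1 + [:0, real (a + k):]" by (simp add: one_pCons)
  show ?thesis unfolding e pderange.simps(2) pderange_step by (simp add: ring_distribs)
qed

lemma pderange_0: "poly (pderange a k) 0 = (if k = 0 then 1 else 0)"
proof -
  have d: "poly (derange k) 0 = (if k = 0 then 1 else 0)" for k
    by (cases k) (auto simp: derange_Suc)
  show ?thesis by (induction a arbitrary: k) (auto simp: d)
qed

text \<open>A permutation with a letter that is not fixed has an excedance, so there is a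
factor \<open>x\<close> for \<open>k > 0\<close>.  The root statements concern the quotient.\<close>

definition pderange_div_x :: "nat \<Rightarrow> nat \<Rightarrow> real poly" where
  "pderange_div_x a k = pderange a k div [:0, 1:]"

lemma pderange_eq_pderange_div_x: assumes "0 < k" shows "pderange a k = [:0, 1:] * pderange_div_x a k"
proof -
  have "[:-0, 1:] dvd pderange a k"
    using assms pderange_0[of a k] by (subst poly_eq_0_iff_dvd[symmetric]) simp
  then show ?thesis unfolding pderange_div_x_def by (simp only: minus_zero dvd_mult_div_cancel)
qed

lemma x_cancel: "[:0, 1:] * p = [:0, 1:] * (q :: real poly) \<Longrightarrow> p = q"
  by simp

lemma pderange_div_x_rec: "pderange_div_x (Suc a) (Suc k) = [:2, real (a + k):] * pderange_div_x a (Suc k)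
    + [:0, 1, -1:] * pderiv (pderange_div_x a (Suc k)) + smult (real (Suc k)) (pderange a k)"
proof (rule x_cancel)
  have "[:0, 1:] * pderange_div_x (Suc a) (Suc k) = pderange (Suc a) (Suc k)"
    by (rule pderange_eq_pderange_div_x[symmetric]) simp
  also have "\<dots> = [:1, real (a + Suc k):] * ([:0, 1:] * pderange_div_x a (Suc k))
      + [:0, 1, -1:] * pderiv ([:0, 1:] * pderange_div_x a (Suc k)) + [:0, real (Suc k):] * pderange a k"
    unfolding pderange_Suc_left[of a "Suc k"] by (simp only: pderange_eq_pderange_div_x diff_Suc_1)
  also have "\<dots> = [:0, 1:] * ([:2, real (a + k):] * pderange_div_x a (Suc k)
    + [:0, 1, -1:] * pderiv (pderange_div_x a (Suc k)) + smult (real (Suc k)) (pderange a k))"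
    by (rule poly_eq_poly_eq_iff[THEN iffD1], rule ext) (simp add: pderiv_mult pderiv_pCons algebra_simps)
  finally show "[:0, 1:] * pderange_div_x (Suc a) (Suc k) = \<dots>" .
qed

lemma pderange_div_x_Suc: "pderange_div_x (Suc a) (Suc k) = pderange_div_x a (Suc (Suc k)) + pderange_div_x a (Suc k)"
proof (rule x_cancel)
  show "[:0, 1:] * pderange_div_x (Suc a) (Suc k) = [:0, 1:] * (pderange_div_x a (Suc (Suc k)) + pderange_div_x a (Suc k))"
    unfolding distrib_left pderange_eq_pderange_div_x[OF zero_less_Suc, symmetric] by (simp only: pderange.simps)
qed

section \<open>Sign changes and simple real roots\<close>

text \<open>The simple roots are listed in increasing order, so that interlacing becomes a statement
about indices.\<close>

definition has_roots :: "real poly \<Rightarrow> nat \<Rightarrow> (nat \<Rightarrow> real) \<Rightarrow> bool" where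
  "has_roots p N g \<longleftrightarrow> strict_mono_on {..<N} g \<and> p = (\<Prod>i<N. [:- g i, 1:])"

lemma degree_prod_linear: "degree (\<Prod>i<N. [:- g i, 1:]) = (N::nat)" for g :: "nat \<Rightarrow> real"
proof (induction N)
  case (Suc N)
  have "(\<Prod>i<N. [:- g i, 1:]) \<noteq> 0" by simp
  then have "degree ((\<Prod>i<N. [:- g i, 1:]) * [:- g N, 1:]) = N + 1"
    using Suc by (subst degree_mult_eq) auto
  then show ?case by (simp only: prod.lessThan_Suc Suc_eq_plus1[symmetric])
qed simp

lemma lead_prod_linear: "lead_coeff (\<Prod>i<N. [:- g i, 1:]) = 1" for g :: "nat \<Rightarrow> real"
  by (simp add: lead_coeff_prod)

lemma has_roots_degree: "has_roots p N g \<Longrightarrow> degree p = N"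
  by (simp add: has_roots_def degree_prod_linear)

lemma has_roots_lead: "has_roots p N g \<Longrightarrow> coeff p N = 1"
  using lead_prod_linear[of g N] by (simp add: has_roots_def degree_prod_linear)

lemma has_roots_less: "has_roots p N g \<Longrightarrow> i < j \<Longrightarrow> j < N \<Longrightarrow> g i < g j"
  by (auto simp: has_roots_def strict_mono_on_def)

lemma has_roots_zero_iff: "has_roots p N g \<Longrightarrow> poly p x = 0 \<longleftrightarrow> (\<exists>i<N. x = g i)"
  by (auto simp: has_roots_def poly_prod)

lemma has_roots_root: "has_roots p N g \<Longrightarrow> i < N \<Longrightarrow> poly p (g i) = 0"
  using has_roots_zero_iff by blast

lemma dvd_linear_prod:
  fixes p :: "real poly" and g :: "nat \<Rightarrow> real" and N :: nat
  assumes "inj_on g {..<N}" "\<And>i. i < N \<Longrightarrow> poly p (g i) = 0"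
  shows "(\<Prod>i<N. [:- g i, 1:]) dvd p"
  using assms
proof (induction N arbitrary: p)
  case (Suc N)
  obtain q where q: "p = [:- g N, 1:] * q"
    using Suc.prems(2)[of N] by (auto simp: poly_eq_0_iff_dvd)
  have "poly q (g i) = 0" if "i < N" for i
  proof -
    have "g i \<noteq> g N" using Suc.prems(1) that by (auto simp: inj_on_def)
    moreover have "poly p (g i) = 0" using Suc.prems(2) that by simp
    ultimately show ?thesis by (simp add: q)
  qed
  moreover have "inj_on g {..<N}" using Suc.prems(1) by (auto simp: inj_on_def)
  ultimately have "(\<Prod>i<N. [:- g i, 1:]) dvd q" using Suc.IH by blast
  then show ?case unfolding q prod.lessThan_Suc mult.commute[of _ "[:- g N, 1:]"]
    by (rule mult_dvd_mono[OF dvd_refl])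
qed simp

lemma has_rootsI:
  fixes p :: "real poly"
  assumes d: "degree p \<le> N" "coeff p N = 1" and g: "\<And>i. Suc i < N \<Longrightarrow> g i < g (Suc i)"
    and z: "\<And>i. i < N \<Longrightarrow> poly p (g i) = 0"
  shows "has_roots p N g"
proof -
  have less: "g i < g j" if "i < j" "j < N" for i j
    using that
  proof (induction j)
    case (Suc j)
    then show ?case using g[of j] by (cases "i = j") force+
  qed simp
  then have mono: "strict_mono_on {..<N} g" by (auto simp: strict_mono_on_def)
  then have "inj_on g {..<N}" by (rule strict_mono_on_imp_inj_on)
  then obtain q where q: "p = (\<Prod>i<N. [:- g i, 1:]) * q"
    using dvd_linear_prod z by (metis dvdE)
  have p0: "p \<noteq> 0" using d by auto
  have deg: "degree p = N" using d by (metis le_antisym le_degree zero_neq_one)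
  have "degree p = N + degree q"
    using p0 unfolding q by (subst degree_mult_eq) (auto simp: degree_prod_linear)
  then have "degree q = 0" using deg by simp
  then obtain c where c: "q = [:c:]" by (rule degree_eq_zeroE)
  have "lead_coeff p = c"
    unfolding q c lead_coeff_mult lead_prod_linear by simp
  then have "c = 1" using deg d by simp
  then show ?thesis using mono by (simp add: has_roots_def q c one_pCons[symmetric])
qed

lemma has_roots_unique:
  assumes "has_roots p N g" "has_roots p N g'" "i < N"
  shows "g i = g' i"
proof -
  have le: "g' i \<le> g i" if r: "has_roots p N g" "has_roots p N g'" and "i < N" for g g' i
    using \<open>i < N\<close>
  proof (induction i rule: less_induct)
    case (less i)
    have "poly p (g i) = 0" using has_roots_root[OF r(1)] less.prems by blast
    then obtain j where j: "j < N" "g i = g' j" using has_roots_zero_iff[OF r(2)] by blast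
    show ?case
    proof (cases "j < i")
      case True
      then have "g' j \<le> g j" using less by simp
      moreover have "g j < g i" using has_roots_less r(1) True less by blast
      ultimately show ?thesis using j by simp
    next
      case False
      then show ?thesis using j has_roots_less[OF r(2), of i j] by (cases "i = j") auto
    qed
  qed
  show ?thesis using le[OF assms(1,2,3)] le[OF assms(2,1,3)] by simp
qed

lemma sign_prod:
  fixes g :: "nat \<Rightarrow> real"
  assumes "j \<le> N" "\<And>i. i < j \<Longrightarrow> g i < y" "\<And>i. j \<le> i \<Longrightarrow> i < N \<Longrightarrow> y < g i"
  shows "0 < (-1) ^ (N - j) * (\<Prod>i<N. y - g i)"
  using assms
proof (induction N)
  case (Suc N)
  show ?case
  proof (cases "j = Suc N")
    case True
    then show ?thesis using Suc.prems by (auto simp del: prod.lessThan_Suc intro!: prod_pos)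
  next
    case False
    then have "0 < (-1) ^ (N - j) * (\<Prod>i<N. y - g i)" "y < g N" using Suc by auto
    then have "0 < ((-1) ^ (N - j) * (\<Prod>i<N. y - g i)) * (g N - y)" by simp
    then show ?thesis using False Suc.prems by (simp add: Suc_diff_le algebra_simps)
  qed
qed simp

text \<open>A monic polynomial is positive to the right of its roots and changes sign at each of
them; \<open>N - j\<close> roots lie to the right of \<open>y\<close>.\<close>

lemma sign_between:
  assumes "has_roots p N g" "j \<le> N" "0 < j \<Longrightarrow> g (j - 1) < y" "j < N \<Longrightarrow> y < g j"
  shows "0 < (-1) ^ (N - j) * poly p y"
proof -
  have "g i < y" if "i < j" for i
  proof (cases "i = j - 1")
    case False
    then have "i < j - 1" "j - 1 < N" using that assms(2) by auto
    then have "g i < g (j - 1)" using has_roots_less[OF assms(1)] by blast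
    also have "\<dots> < y" using assms(3) that by simp
    finally show ?thesis .
  qed (use that assms(3) in simp)
  moreover have "y < g i" if "j \<le> i" "i < N" for i
    using that assms has_roots_less[OF assms(1), of j i] by (cases "i = j") auto
  ultimately have "0 < (-1) ^ (N - j) * (\<Prod>i<N. y - g i)"
    using assms(2) by (intro sign_prod) auto
  then show ?thesis using assms(1) by (simp add: has_roots_def poly_prod)
qed

text \<open>The derivative at a simple root is the product of the differences to the other roots.\<close>

lemma sign_deriv:
  assumes "has_roots p N g" "i < N"
  shows "0 < (-1) ^ (N - 1 - i) * poly (pderiv p) (g i)"
proof -
  let ?P = "\<lambda>A y. \<Prod>j\<in>A. y - g j"
  have p: "p = [:- g i, 1:] * (\<Prod>j\<in>{..<N} - {i}. [:- g j, 1:])"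
    using assms by (simp add: has_roots_def prod.remove[of "{..<N}" i])
  have "poly (pderiv p) (g i) = ?P ({..<N} - {i}) (g i)"
    unfolding p pderiv_mult by (simp add: pderiv_pCons poly_prod)
  also have "\<dots> = ?P {..<i} (g i) * ?P {i<..<N} (g i)"
    using assms(2) by (subst prod.union_disjoint[symmetric]) (auto intro!: prod.cong)
  also have "?P {i<..<N} (g i) = (-1) ^ (N - 1 - i) * (\<Prod>j\<in>{i<..<N}. g j - g i)"
  proof -
    have "?P {i<..<N} (g i) = (\<Prod>j\<in>{i<..<N}. (-1) * (g j - g i))" by (rule prod.cong) auto
    also have "\<dots> = (-1) ^ card {i<..<N} * (\<Prod>j\<in>{i<..<N}. g j - g i)"
      by (simp only: prod.distrib prod_constant)
    also have "card {i<..<N} = N - 1 - i" by simp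
    finally show ?thesis .
  qed
  finally have "(-1) ^ (N - 1 - i) * poly (pderiv p) (g i) =
     (((-1) ^ (N - 1 - i)) * ((-1) ^ (N - 1 - i))) * (?P {..<i} (g i) * (\<Prod>j\<in>{i<..<N}. g j - g i))"
    by (simp add: mult_ac)
  also have "((-1) ^ (N - 1 - i)) * ((-1) ^ (N - 1 - i)) = (1::real)"
    by (simp flip: power_mult_distrib)
  also have "0 < 1 * (?P {..<i} (g i) * (\<Prod>j\<in>{i<..<N}. g j - g i))"
    using has_roots_less[OF assms(1)] assms(2) by (auto intro!: mult_pos_pos prod_pos)
  finally show ?thesis .
qed

lemma ivt_sign:
  fixes p :: "real poly"
  assumes "a < b" "0 < s * poly p a" "0 < - s * poly p b"
  shows "\<exists>x. a < x \<and> x < b \<and> poly p x = 0"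
proof -
  have "poly p a * poly p b < 0" using assms(2,3) by (auto simp: zero_less_mult_iff mult_less_0_iff)
  then show ?thesis using poly_IVT[OF assms(1)] by blast
qed

text \<open>Each gap between consecutive points with opposite signs contains a root, and the
degree leaves room for no other.\<close>

lemma roots_between:
  fixes p :: "real poly"
  assumes d: "degree p \<le> N" "coeff p N = 1" and y: "\<And>i. i < N \<Longrightarrow> y i < y (Suc i)"
    and s: "\<And>i. i \<le> N \<Longrightarrow> 0 < (-1) ^ (N - i) * poly p (y i)"
  obtains g where "has_roots p N g" "\<And>i. i < N \<Longrightarrow> y i < g i" "\<And>i. i < N \<Longrightarrow> g i < y (Suc i)"
proof -
  have "\<exists>x. y i < x \<and> x < y (Suc i) \<and> poly p x = 0" if "i < N" for i
  proof (rule ivt_sign[OF y[OF that]])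
    show "0 < (-1) ^ (N - i) * poly p (y i)" using s that by simp
    have "(-1) ^ (N - i) = - ((-1::real) ^ (N - Suc i))"
      using that by (simp add: Suc_diff_Suc[symmetric])
    then show "0 < - ((-1) ^ (N - i)) * poly p (y (Suc i))" using s[of "Suc i"] that by simp
  qed
  then obtain g where g: "\<And>i. i < N \<Longrightarrow> y i < g i \<and> g i < y (Suc i) \<and> poly p (g i) = 0" by metis
  have "has_roots p N g"
  proof (rule has_rootsI[OF d])
    show "g i < g (Suc i)" if "Suc i < N" for i
      using g[of i] g[of "Suc i"] that by simp
    show "poly p (g i) = 0" if "i < N" for i using g that by blast
  qed
  with that g show ?thesis by blast
qed

lemma sign_at_minus_infinity:
  fixes p :: "real poly"
  assumes "degree p \<le> N" "coeff p N = 1"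
  obtains y where "y < b" "0 < (-1) ^ N * poly p y"
proof -
  define q where "q = smult ((-1) ^ N) (p \<circ>\<^sub>p [:0, -1:])"
  have dN: "degree p = N" using assms by (metis le_antisym le_degree zero_neq_one)
  have "lead_coeff q = (-1) ^ N * ((-1) ^ N * 1)"
    unfolding q_def lead_coeff_smult by (subst lead_coeff_comp) (use assms dN in auto)
  then have "lead_coeff q > 0" by (simp flip: power_mult_distrib)
  then obtain n where n: "\<And>x. n \<le> x \<Longrightarrow> lead_coeff q \<le> poly q x"
    using poly_pinfty_gt_lc by blast
  have "0 < poly q (max n (1 - b))" using n[of "max n (1 - b)"] \<open>lead_coeff q > 0\<close> by force
  then have "0 < (-1) ^ N * poly p (- max n (1 - b))" by (simp add: q_def poly_pcompose)
  moreover have "- max n (1 - b) < b" by (simp add: max_def)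
  ultimately show ?thesis using that by blast
qed

text \<open>Here the leftmost point is supplied by the sign of the polynomial near minus infinity,
so that \<open>N\<close> points suffice.\<close>

lemma roots_interlacing:
  fixes p :: "real poly"
  assumes d: "degree p \<le> N" "coeff p N = 1" and N: "0 < N"
    and y: "\<And>i. Suc i < N \<Longrightarrow> y i < y (Suc i)"
    and s: "\<And>i. i < N \<Longrightarrow> 0 < (-1) ^ (N - 1 - i) * poly p (y i)"
  obtains g where "has_roots p N g" "\<And>i. i < N \<Longrightarrow> g i < y i" "\<And>i. Suc i < N \<Longrightarrow> y i < g (Suc i)"
proof -
  obtain b where b: "b < y 0" "0 < (-1) ^ N * poly p b" using sign_at_minus_infinity[OF d] by blast
  define z where "z i = (case i of 0 \<Rightarrow> b | Suc j \<Rightarrow> y j)" for i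
  obtain g where g: "has_roots p N g" "\<And>i. i < N \<Longrightarrow> z i < g i" "\<And>i. i < N \<Longrightarrow> g i < z (Suc i)"
  proof (rule roots_between[OF d, of z])
    show "z i < z (Suc i)" if "i < N" for i
      using that b(1) y by (cases i) (auto simp: z_def)
    show "0 < (-1) ^ (N - i) * poly p (z i)" if "i \<le> N" for i
      using that b(2) s by (cases i) (auto simp: z_def)
  qed blast
  show ?thesis
  proof (rule that[OF g(1)])
    show "g i < y i" if "i < N" for i using g(3)[OF that] by (simp add: z_def)
    show "y i < g (Suc i)" if "Suc i < N" for i using g(2)[OF that] by (simp add: z_def)
  qed
qed

section \<open>Palindromic symmetry\<close>

lemma coeff_derange_Suc:
  "coeff (derange (Suc m)) (Suc j) = (real m - real j) * coeff (derange m) j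
     + real m * coeff (derange (m - 1)) j + real (Suc j) * coeff (derange m) (Suc j)"
  unfolding derange_Suc
  by (cases j) (simp_all add: coeff_pderiv algebra_simps)

lemma coeff_derange_Suc_0: "coeff (derange (Suc m)) 0 = 0"
  using pderange_0[of 0 "Suc m"] by (simp add: poly_0_coeff_0)

text \<open>Inversion of a permutation exchanges excedances and anti-excedances, and in a derangement
of \<open>m\<close> letters these add up to \<open>m\<close>.  The proof follows the recursion of the coefficients.\<close>

lemma derange_palindromic:
  "(\<forall>j>m. coeff (derange m) j = 0) \<and> (\<forall>j\<le>m. coeff (derange m) (m - j) = coeff (derange m) j)"
proof (induction m rule: less_induct)
  case (less m)
  show ?case
  proof (cases m)
    case (Suc l)
    have hi: "coeff (derange l) j = 0" if "j > l" for j using less[of l] that Suc by auto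
    have hi1: "coeff (derange (l - 1)) j = 0" if "j > l - 1" for j using less[of "l - 1"] that Suc by auto
    have sy: "coeff (derange l) (l - j) = coeff (derange l) j" if "j \<le> l" for j
      using less[of l] that Suc by auto
    have sy1: "coeff (derange (l - 1)) (l - 1 - j) = coeff (derange (l - 1)) j" if "j \<le> l - 1" for j
      using less[of "l - 1"] that Suc by auto
    have A: "coeff (derange (Suc l)) j = 0" if "j > Suc l" for j
    proof -
      obtain i where i: "j = Suc i" "i > l" using \<open>j > Suc l\<close> by (cases j) auto
      then show ?thesis using hi1[of i] by (simp add: coeff_derange_Suc hi)
    qed
    have top: "coeff (derange (Suc l)) (Suc l) = 0"
    proof (cases "l = 0")
      case False
      then show ?thesis using hi1[of l] by (simp add: coeff_derange_Suc hi)
    qed simp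
    have B: "coeff (derange (Suc l)) (Suc l - j) = coeff (derange (Suc l)) j" if "j \<le> Suc l" for j
    proof (cases "j = 0 \<or> j = Suc l")
      case True
      then show ?thesis using top coeff_derange_Suc_0[of l] by auto
    next
      case False
      then obtain i where i: "j = Suc i" "i < l" using \<open>j \<le> Suc l\<close> by (cases j) auto
      have e: "Suc l - j = Suc (l - 1 - i)" "Suc (l - 1 - i) = l - i" using i by auto
      have "l - 1 - i = l - Suc i" using i by simp
      then have "coeff (derange l) (l - 1 - i) = coeff (derange l) (Suc i)"
        using sy[of "Suc i"] i by simp
      moreover have "coeff (derange l) (l - i) = coeff (derange l) i" using sy[of i] i by simp
      moreover have "coeff (derange (l - 1)) (l - 1 - i) = coeff (derange (l - 1)) i"
        using sy1[of i] i by simp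
      moreover have "real (l - 1 - i) = real l - 1 - real i" using i by (simp add: of_nat_diff)
      ultimately show ?thesis
        using coeff_derange_Suc[of l "l - 1 - i"] coeff_derange_Suc[of l i] i(2)
        unfolding e(1) i(1) unfolding e(2) by (simp add: algebra_simps of_nat_diff)
    qed
    show ?thesis using A B Suc by blast
  qed auto
qed

lemma degree_derange: "degree (derange m) \<le> m"
  using derange_palindromic by (intro degree_le) auto

lemma poly_as_sum: "degree p \<le> m \<Longrightarrow> poly p x = (\<Sum>j\<le>m. coeff p j * x ^ j)"
  for x :: "'a::comm_semiring_1"
  unfolding poly_altdef by (rule sum.mono_neutral_left) (auto simp: coeff_eq_0)

lemma derange_reverse:
  fixes x :: real
  assumes "x \<noteq> 0"
  shows "x ^ m * poly (derange m) (1 / x) = poly (derange m) x"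
proof -
  have "x ^ m * poly (derange m) (1 / x) = (\<Sum>j\<le>m. coeff (derange m) j * x ^ (m - j))"
    unfolding poly_as_sum[OF degree_derange] sum_distrib_left
    using assms by (intro sum.cong refl) (simp add: power_diff power_divide field_simps)
  also have "\<dots> = (\<Sum>j\<le>m. coeff (derange m) (m - j) * x ^ j)"
    by (rule sum.reindex_bij_witness[of _ "\<lambda>j. m - j" "\<lambda>j. m - j"]) auto
  also have "\<dots> = poly (derange m) x"
    unfolding poly_as_sum[OF degree_derange] using derange_palindromic[of m]
    by (intro sum.cong) auto
  finally show ?thesis .
qed

lemma sum_choose_Suc:
  fixes f :: "nat \<Rightarrow> 'a::comm_semiring_1"
  shows "(\<Sum>j\<le>Suc a. of_nat (Suc a choose j) * f j)
     = (\<Sum>j\<le>a. of_nat (a choose j) * f j) + (\<Sum>j\<le>a. of_nat (a choose j) * f (Suc j))"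
proof -
  have "(\<Sum>j\<le>Suc a. of_nat (Suc a choose j) * f j)
      = f 0 + (\<Sum>j\<le>a. of_nat (Suc a choose Suc j) * f (Suc j))"
    by (subst sum.atMost_Suc_shift) simp
  also have "\<dots> = (f 0 + (\<Sum>j\<le>a. of_nat (a choose Suc j) * f (Suc j)))
      + (\<Sum>j\<le>a. of_nat (a choose j) * f (Suc j))"
    by (simp add: algebra_simps sum.distrib)
  also have "f 0 + (\<Sum>j\<le>a. of_nat (a choose Suc j) * f (Suc j)) = (\<Sum>j\<le>Suc a. of_nat (a choose j) * f j)"
    by (subst sum.atMost_Suc_shift) simp
  also have "\<dots> = (\<Sum>j\<le>a. of_nat (a choose j) * f j)" by (simp add: binomial_eq_0)
  finally show ?thesis .
qed

lemma pderange_sum: "pderange a k = (\<Sum>j\<le>a. of_nat (a choose j) * derange (j + k))"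
proof (induction a arbitrary: k)
  case (Suc a)
  then show ?case by (simp only: pderange.simps sum_choose_Suc) (simp add: add.commute)
qed simp

text \<open>The variant of \<open>pderange\<close> in which every fixed point has weight \<open>x\<close>, that is, in which weak
excedances are counted.\<close>

fun pderange_weak :: "nat \<Rightarrow> nat \<Rightarrow> real poly" where
  "pderange_weak 0 k = derange k"
| "pderange_weak (Suc a) k = pderange_weak a (Suc k) + [:0, 1:] * pderange_weak a k"

lemma pderange_weak_sum: "pderange_weak a k = (\<Sum>j\<le>a. of_nat (a choose j) * (derange (j + k) * [:0, 1:] ^ (a - j)))"
proof (induction a arbitrary: k)
  case (Suc a)
  have "(\<Sum>j\<le>a. of_nat (a choose j) * (derange (j + k) * [:0, 1:] ^ (Suc a - j)))
      = [:0, 1:] * pderange_weak a k"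
    unfolding Suc sum_distrib_left by (intro sum.cong refl) (simp only: atMost_iff Suc_diff_le power_Suc ac_simps)
  then show ?case unfolding sum_choose_Suc pderange_weak.simps Suc[of "Suc k"]
    by (simp only: add_Suc add_Suc_right diff_Suc_Suc add.commute)
qed simp

lemma pderange_weak_Suc: "pderange_weak (Suc a) k = [:0, real (a + k + 1):] * pderange_weak a k + [:0, 1, -1:] * pderiv (pderange_weak a k)
     + [:0, real k:] * pderange_weak a (k - 1)"
proof (induction a arbitrary: k)
  case 0
  have "[:0, real (0 + k + 1):] = [:0, real k:] + [:0, 1:]" by simp
  then show ?case by (simp only: pderange_weak.simps derange_Suc ring_distribs ac_simps)
next
  case (Suc a)
  have k: "[:0, real k:] * pderange_weak (Suc a) (k - 1) = [:0, real k:] * (pderange_weak a k + [:0, 1:] * pderange_weak a (k - 1))"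
    by (cases k) auto
  have x: "[:0, 1, -1:] = [:0, 1:] - [:0, 1:] * [:0, 1 :: real:]" by simp
  have e: "[:0, real (Suc a + k + 1):] = [:0, real (a + k + 1):] + [:0, 1:]"
    "[:0, real (a + Suc k + 1):] = [:0, real (a + k + 1):] + [:0, 1:]"
    "[:0, real (Suc k):] = [:0, real k:] + [:0, 1:]" by simp_all
  have "pderange_weak (Suc (Suc a)) k = pderange_weak (Suc a) (Suc k) + [:0, 1:] * pderange_weak (Suc a) k" by simp
  also have "\<dots> = ([:0, real (a + k + 1):] + [:0, 1:]) * pderange_weak a (Suc k)
     + [:0, 1, -1:] * pderiv (pderange_weak a (Suc k)) + ([:0, real k:] + [:0, 1:]) * pderange_weak a k
     + [:0, 1:] * ([:0, real (a + k + 1):] * pderange_weak a k + [:0, 1, -1:] * pderiv (pderange_weak a k) + [:0, real k:] * pderange_weak a (k - 1))"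
    unfolding Suc[of "Suc k"] Suc[of k] e diff_Suc_1 by (rule refl)
  also have "\<dots> = [:0, real (Suc a + k + 1):] * pderange_weak (Suc a) k + [:0, 1, -1:] * pderiv (pderange_weak (Suc a) k)
     + [:0, real k:] * pderange_weak (Suc a) (k - 1)"
    unfolding k e(1) pderange_weak.simps(2)[of a k] pderiv_add pderiv_mult
    by (rule poly_eq_poly_eq_iff[THEN iffD1], rule ext) (simp add: pderiv_pCons algebra_simps)
  finally show ?case .
qed

text \<open>Both sides satisfy the same differential recursion in \<open>a\<close>.  In words, weak
excedances are distributed as excedances plus one.\<close>

lemma pderange_weak_eq_pderange: "0 < a \<Longrightarrow> pderange_weak a 0 = [:0, 1:] * pderange a 0"
proof (induction a rule: nat_induct_non_zero)
  case 1
  then show ?case by (simp add: one_pCons)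
next
  case (Suc n)
  have "pderange_weak (Suc n) 0 = [:0, real n + 1:] * ([:0, 1:] * pderange n 0) + [:0, 1, -1:] * pderiv ([:0, 1:] * pderange n 0)"
    using Suc by (simp add: pderange_weak_Suc add.commute del: pderange_weak.simps)
  also have "\<dots> = [:0, 1:] * ([:1, real n:] * pderange n 0 + [:0, 1, -1:] * pderiv (pderange n 0))"
    by (rule poly_eq_poly_eq_iff[THEN iffD1], rule ext) (simp add: pderiv_mult pderiv_pCons algebra_simps)
  also have "\<dots> = [:0, 1:] * pderange (Suc n) 0" by (simp add: pderange_Suc_left del: pderange.simps)
  finally show ?case .
qed

text \<open>Reversing the summands of \<open>pderange m 0\<close>, which are palindromic of different degrees,
turns the weight 1 of a fixed point into the weight \<open>x\<close>.\<close>

lemma eulerian_reverse: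
  fixes x :: real
  assumes "x \<noteq> 0" "0 < m"
  shows "x * poly (pderange m 0) x = x ^ m * poly (pderange m 0) (1 / x)"
proof -
  have "x ^ m * poly (pderange m 0) (1 / x)
     = (\<Sum>j\<le>m. of_nat (m choose j) * (x ^ (m - j) * (x ^ j * poly (derange j) (1 / x))))"
    unfolding pderange_sum poly_sum sum_distrib_left
  proof (intro sum.cong refl)
    fix j assume "j \<in> {..m}"
    then have "x ^ m = x ^ (m - j) * x ^ j" by (simp flip: power_add)
    then show "x ^ m * poly (of_nat (m choose j) * derange (j + 0)) (1 / x)
      = of_nat (m choose j) * (x ^ (m - j) * (x ^ j * poly (derange j) (1 / x)))"
      by (simp add: mult_ac)
  qed
  also have "\<dots> = poly (pderange_weak m 0) x"
    unfolding pderange_weak_sum poly_sum derange_reverse[OF assms(1)]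
    by (intro sum.cong refl) (simp add: mult_ac)
  finally show ?thesis using assms(2) by (simp add: pderange_weak_eq_pderange)
qed

section \<open>Interlacing\<close>

text \<open>The induction hypothesis.  The roots \<open>\<gamma> 1\<close> are separated by the roots \<open>\<alpha>\<close> of the Eulerian
polynomial, and the roots \<open>\<gamma> k\<close> move to the right as \<open>k\<close> grows, without passing the next root for the previous
\<open>k\<close>.\<close>

definition interlaced :: "nat \<Rightarrow> (nat \<Rightarrow> real) \<Rightarrow> (nat \<Rightarrow> nat \<Rightarrow> real) \<Rightarrow> bool" where
  "interlaced m \<alpha> \<gamma> \<longleftrightarrow>
     has_roots (pderange m 0) (m - 1) \<alpha> \<and> (\<forall>i<m - 1. \<alpha> i < 0) \<and>
     (\<forall>k\<in>{1..m}. has_roots (pderange_div_x (m - k) k) (m - 2) (\<gamma> k) \<and> (\<forall>i<m - 2. \<gamma> k i < 0)) \<and>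
     (\<forall>i<m - 2. \<alpha> i < \<gamma> 1 i \<and> \<gamma> 1 i < \<alpha> (Suc i)) \<and>
     (\<forall>k\<in>{1..<m}. (\<forall>i<m - 2. \<gamma> k i < \<gamma> (Suc k) i) \<and> (\<forall>i. Suc i < m - 2 \<longrightarrow> \<gamma> (Suc k) i < \<gamma> k (Suc i)))"

text \<open>The operators in the recursions raise the degree by at most one; this keeps track of
the leading coefficient.\<close>

lemma coeff_derivative_step:
  fixes p :: "real poly"
  assumes "degree p \<le> n"
  shows "degree ([:b, c:] * p + [:0, 1, -1:] * pderiv p) \<le> Suc n"
    and "coeff ([:b, c:] * p + [:0, 1, -1:] * pderiv p) (Suc n) = (c - real n) * coeff p n"
proof -
  have z: "coeff p j = 0" if "n < j" for j using assms that by (intro coeff_eq_0) auto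
  have c: "coeff ([:b, c:] * p + [:0, 1, -1:] * pderiv p) (Suc j)
      = b * coeff p (Suc j) + c * coeff p j + real (Suc j) * coeff p (Suc j) - real j * coeff p j" for j
    by (cases j) (simp_all add: coeff_pderiv algebra_simps)
  show "degree ([:b, c:] * p + [:0, 1, -1:] * pderiv p) \<le> Suc n"
  proof (rule degree_le, intro allI impI)
    fix j assume "Suc n < j"
    then obtain i where "j = Suc i" "n < i" by (cases j) auto
    then show "coeff ([:b, c:] * p + [:0, 1, -1:] * pderiv p) j = 0" by (simp only: c z)
  qed
  show "coeff ([:b, c:] * p + [:0, 1, -1:] * pderiv p) (Suc n) = (c - real n) * coeff p n"
    unfolding c by (simp add: z algebra_simps)
qed

lemma monic_diff_degree:
  fixes p q :: "real poly"
  assumes "degree p \<le> n" "degree q \<le> n" "coeff p n = 1" "coeff q n = 1"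
  shows "degree (p - q) \<le> n" "coeff (p - q) n = 0"
  using assms by (auto intro: degree_diff_le)

lemma coeff_x_times: "degree p \<le> n \<Longrightarrow> coeff p n = 1 \<Longrightarrow>
    degree ([:0, 1:] * p) \<le> Suc n \<and> coeff ([:0, 1:] * p) (Suc n) = 1"
  for p :: "real poly"
  by (simp add: degree_pCons_eq_if)

text \<open>The recursions for a further letter are evaluated at the old roots.  The sign of every
surviving term there is known from the old interlacing, so \<open>roots_interlacing\<close> and \<open>roots_between\<close>
produce the new roots.\<close>

lemma interlaced_step:
  assumes "interlaced m \<alpha> \<gamma>" "2 \<le> m"
  obtains \<alpha>' \<gamma>' where "interlaced (Suc m) \<alpha>' \<gamma>'"
proof -
  have A: "has_roots (pderange m 0) (m - 1) \<alpha>" and A0: "\<And>i. i < m - 1 \<Longrightarrow> \<alpha> i < 0"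
    and G: "\<And>k. 1 \<le> k \<Longrightarrow> k \<le> m \<Longrightarrow> has_roots (pderange_div_x (m - k) k) (m - 2) (\<gamma> k)"
    and G0: "\<And>k i. 1 \<le> k \<Longrightarrow> k \<le> m \<Longrightarrow> i < m - 2 \<Longrightarrow> \<gamma> k i < 0"
    and AG: "\<And>i. i < m - 2 \<Longrightarrow> \<alpha> i < \<gamma> 1 i" "\<And>i. i < m - 2 \<Longrightarrow> \<gamma> 1 i < \<alpha> (Suc i)"
    and GG: "\<And>k i. 1 \<le> k \<Longrightarrow> k < m \<Longrightarrow> i < m - 2 \<Longrightarrow> \<gamma> k i < \<gamma> (Suc k) i"
      "\<And>k i. 1 \<le> k \<Longrightarrow> k < m \<Longrightarrow> Suc i < m - 2 \<Longrightarrow> \<gamma> (Suc k) i < \<gamma> k (Suc i)"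
    using assms(1) unfolding interlaced_def by auto
  have q_deg: "degree (pderange (m - k) k) \<le> m - 1 \<and> coeff (pderange (m - k) k) (m - 1) = 1" if "k \<le> m" for k
  proof (cases "k = 0")
    case True
    then show ?thesis using has_roots_degree[OF A] has_roots_lead[OF A] by simp
  next
    case False
    then have h: "has_roots (pderange_div_x (m - k) k) (m - 2) (\<gamma> k)" using G that by simp
    have "degree ([:0, 1:] * pderange_div_x (m - k) k) \<le> Suc (m - 2) \<and> coeff ([:0, 1:] * pderange_div_x (m - k) k) (Suc (m - 2)) = 1"
      using has_roots_degree[OF h] has_roots_lead[OF h] by (intro coeff_x_times) simp_all
    moreover have "Suc (m - 2) = m - 1" using assms(2) by simp
    ultimately show ?thesis using False by (simp only: pderange_eq_pderange_div_x gr0_conv_Suc) (simp add: pderange_eq_pderange_div_x)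
  qed
  have low: "degree (pderange a k) \<le> m - 1 \<and> coeff (pderange a k) (m - 1) = 0" if "Suc (a + k) = m" for a k
  proof -
    have "pderange a k = pderange (m - k) k - pderange (m - Suc k) (Suc k)"
      using that by (auto simp flip: that)
    then show ?thesis using monic_diff_degree[of _ "m - 1"] q_deg[of k] q_deg[of "Suc k"] that by auto
  qed
  have x0: "0 < poly (pderange_div_x (m - k) k) 0" if "1 \<le> k" "k \<le> m" for k
    using sign_between[OF G[OF that], of "m - 2" 0] G0[OF that] by auto
  \<comment> \<open>At a root of the Eulerian polynomial only the derivative survives in the recursion.\<close>
  have dA: "degree (pderange (Suc m) 0) \<le> m" "coeff (pderange (Suc m) 0) m = 1"
  proof -
    have eq: "pderange (Suc m) 0 = [:1, real m:] * pderange m 0 + [:0, 1, -1:] * pderiv (pderange m 0)"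
      unfolding pderange_Suc_left by simp
    have m: "Suc (m - 1) = m" "real m - real (m - 1) = 1" using assms(2) by auto
    have "degree (pderange m 0) \<le> m - 1" "coeff (pderange m 0) (m - 1) = 1" using q_deg[of 0] by auto
    then show "degree (pderange (Suc m) 0) \<le> m" "coeff (pderange (Suc m) 0) m = 1"
      using coeff_derivative_step[of "pderange m 0" "m - 1" 1 "real m"] unfolding eq m by auto
  qed
  obtain \<beta> where B: "has_roots (pderange (Suc m) 0) m \<beta>"
    and B1: "\<And>i. i < m - 1 \<Longrightarrow> \<beta> i < \<alpha> i" and B2: "\<And>i. i < m - 1 \<Longrightarrow> \<alpha> i < \<beta> (Suc i)"
    and B0: "\<And>i. i < m \<Longrightarrow> \<beta> i < 0"
  proof -
    define y where "y i = (if i < m - 1 then \<alpha> i else 0)" for i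
    obtain g where g: "has_roots (pderange (Suc m) 0) m g" "\<And>i. i < m \<Longrightarrow> g i < y i"
      "\<And>i. Suc i < m \<Longrightarrow> y i < g (Suc i)"
    proof (rule roots_interlacing[OF dA, of y])
      show "0 < m" using assms(2) by simp
      show "y i < y (Suc i)" if "Suc i < m" for i
        using that has_roots_less[OF A, of i "Suc i"] A0[of i] by (auto simp: y_def)
      show "0 < (-1) ^ (m - 1 - i) * poly (pderange (Suc m) 0) (y i)" if "i < m" for i
      proof (cases "i < m - 1")
        case True
        have e: "m - 1 - i = Suc (m - 1 - 1 - i)" using True by simp
        have "0 < (-1) ^ (m - 1 - 1 - i) * poly (pderiv (pderange m 0)) (\<alpha> i)"
          using sign_deriv[OF A True] .
        moreover have "0 < - \<alpha> i * (1 - \<alpha> i)" using A0[OF True] by (intro mult_pos_pos) auto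
        ultimately have "0 < (- \<alpha> i * (1 - \<alpha> i)) * ((-1) ^ (m - 1 - 1 - i) * poly (pderiv (pderange m 0)) (\<alpha> i))"
          by (rule mult_pos_pos[rotated])
        moreover have "poly (pderange (Suc m) 0) (\<alpha> i) = \<alpha> i * (1 - \<alpha> i) * poly (pderiv (pderange m 0)) (\<alpha> i)"
          using has_roots_root[OF A True] by (simp add: pderange_Suc_left algebra_simps del: pderange.simps)
        ultimately show ?thesis using True unfolding e by (simp add: y_def mult_ac del: pderange.simps)
      next
        case False
        then show ?thesis using that by (simp add: y_def pderange_0 del: pderange.simps)
      qed
    qed blast
    show ?thesis
    proof (rule that[OF g(1)])
      show "g i < \<alpha> i" if "i < m - 1" for i using g(2)[of i] that by (simp add: y_def)
      show "\<alpha> i < g (Suc i)" if "i < m - 1" for i using g(3)[of i] that by (simp add: y_def)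
      show "g i < 0" if "i < m" for i using g(2)[OF that] A0[of i] by (auto simp: y_def split: if_splits)
    qed
  qed
  \<comment> \<open>At the roots for \<open>k\<close>, the derivative term and the one with \<open>k - 1\<close> have equal signs.\<close>
  have rec: "pderange_div_x (Suc (m - Suc k)) (Suc k) = [:2, real (m - 1):] * pderange_div_x (m - Suc k) (Suc k)
      + [:0, 1, -1:] * pderiv (pderange_div_x (m - Suc k) (Suc k)) + smult (real (Suc k)) (pderange (m - Suc k) k)"
    if "k < m" for k
  proof -
    have "m - Suc k + k = m - 1" using that by simp
    then show ?thesis by (simp only: pderange_div_x_rec)
  qed
  have ex: "\<exists>g. has_roots (pderange_div_x (Suc (m - k)) k) (m - 1) g \<and> (\<forall>i<m - 2. g i < \<gamma> k i \<and> \<gamma> k i < g (Suc i))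
      \<and> (\<forall>i<m - 1. g i < 0)" if k: "1 \<le> k" "k \<le> m" for k
  proof -
    obtain l where l: "k = Suc l" using k by (cases k) auto
    define p where "p = pderange_div_x (Suc (m - k)) k"
    have p: "p = [:2, real (m - 1):] * pderange_div_x (m - k) k
      + [:0, 1, -1:] * pderiv (pderange_div_x (m - k) k) + smult (real k) (pderange (m - k) l)"
      using rec[of l] k by (simp only: l p_def Suc_le_eq)
    note Gk = G[OF k]
    have lowl: "degree (pderange (m - k) l) \<le> m - 1" "coeff (pderange (m - k) l) (m - 1) = 0"
      using low[of "m - k" l] k l by auto
    have e2: "Suc (m - 2) = m - 1" "real (m - 1) - real (m - 2) = 1" using assms(2) by auto
    note st = coeff_derivative_step[of "pderange_div_x (m - k) k" "m - 2" 2 "real (m - 1)", unfolded e2]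
    have "degree p \<le> m - 1"
      unfolding p
    proof (rule degree_add_le)
      show "degree ([:2, real (m - 1):] * pderange_div_x (m - k) k + [:0, 1, -1:] * pderiv (pderange_div_x (m - k) k)) \<le> m - 1"
        by (rule st(1)) (simp add: has_roots_degree[OF Gk])
    qed (use lowl in \<open>auto intro: order_trans[OF degree_smult_le]\<close>)
    moreover have "coeff p (m - 1) = 1"
      unfolding p coeff_add using st(2) has_roots_degree[OF Gk] has_roots_lead[OF Gk] lowl by simp
    ultimately have dp: "degree p \<le> m - 1" "coeff p (m - 1) = 1" by auto
    have m1: "0 < m - 1" using assms(2) by simp
    define y where "y i = (if i < m - 2 then \<gamma> k i else 0)" for i
    obtain g where g: "has_roots p (m - 1) g" "\<And>i. i < m - 1 \<Longrightarrow> g i < y i"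
      "\<And>i. Suc i < m - 1 \<Longrightarrow> y i < g (Suc i)"
    proof (rule roots_interlacing[OF dp m1, of y])
      show "y i < y (Suc i)" if "Suc i < m - 1" for i
        using that has_roots_less[OF Gk, of i "Suc i"] G0[OF k, of i] by (auto simp: y_def)
      show "0 < (-1) ^ (m - 1 - 1 - i) * poly p (y i)" if "i < m - 1" for i
      proof (cases "i < m - 2")
        case True
        let ?y = "\<gamma> k i"
        have y0: "?y < 0" using G0[OF k True] .
        have e: "m - 1 - 1 - i = Suc (m - 2 - 1 - i)" using True by simp
        have "0 < (-1) ^ (m - 2 - 1 - i) * poly (pderiv (pderange_div_x (m - k) k)) ?y"
          using sign_deriv[OF Gk True] .
        moreover have "0 < - ?y * (1 - ?y)" using y0 by (intro mult_pos_pos) auto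
        ultimately have 1: "0 < (- ?y * (1 - ?y)) * ((-1) ^ (m - 2 - 1 - i) * poly (pderiv (pderange_div_x (m - k) k)) ?y)"
          by (rule mult_pos_pos[rotated])
        have "poly (pderange_div_x (m - k) k) ?y = 0" using has_roots_root[OF Gk True] .
        then have z: "poly (pderange (m - k) k) ?y = 0" using k by (simp add: pderange_eq_pderange_div_x)
        have kl: "Suc (m - k) = m - l" using l k by simp
        have "poly (pderange (m - k) l) ?y = poly (pderange (m - l) l) ?y"
          using z unfolding kl[symmetric] pderange.simps l[symmetric] by simp
        moreover have 2: "0 < (-1) ^ (m - 1 - 1 - i) * poly (pderange (m - l) l) ?y"
        proof (cases "l = 0")
          case True
          then have "k = 1" using l by simp
          then have "0 < (-1) ^ (m - 1 - Suc i) * poly (pderange m 0) ?y"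
            using AG[OF \<open>i < m - 2\<close>] \<open>i < m - 2\<close>
            by (intro sign_between[OF A]) auto
          then show ?thesis using True by (simp del: pderange.simps)
        next
          case False
          then have l1: "1 \<le> l" "l \<le> m" "l < m" using l k by auto
          have "0 < (-1) ^ (m - 2 - Suc i) * poly (pderange_div_x (m - l) l) ?y"
            using GG[of l i] l1 \<open>i < m - 2\<close> GG(2)[of l i] l
            by (intro sign_between[OF G[OF l1(1,2)]]) auto
          moreover have "0 < - ?y" using y0 by simp
          ultimately have "0 < (- ?y) * ((-1) ^ (m - 2 - Suc i) * poly (pderange_div_x (m - l) l) ?y)"
            by (rule mult_pos_pos[rotated])
          moreover have "m - 2 - 1 - i = m - 2 - Suc i" by simp
          ultimately show ?thesis using False unfolding e
            by (simp add: pderange_eq_pderange_div_x mult_ac)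
        qed
        ultimately have "0 < (-1) ^ (m - 1 - 1 - i) * poly (pderange (m - k) l) ?y" by simp
        moreover have "0 < real k" using k by simp
        ultimately have "0 < real k * ((-1) ^ (m - 1 - 1 - i) * poly (pderange (m - k) l) ?y)"
          by (rule mult_pos_pos[rotated])
        then have "0 < (- ?y * (1 - ?y)) * ((-1) ^ (m - 2 - 1 - i) * poly (pderiv (pderange_div_x (m - k) k)) ?y)
            + real k * ((-1) ^ (m - 1 - 1 - i) * poly (pderange (m - k) l) ?y)"
          by (rule add_pos_pos[OF 1])
        also have "\<dots> = (-1) ^ (m - 1 - 1 - i) * poly p ?y"
          using \<open>poly (pderange_div_x (m - k) k) ?y = 0\<close> unfolding p e by (simp add: algebra_simps)
        finally show ?thesis using True by (simp add: y_def)
      next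
        case False
        then have "i = m - 2" using that by simp
        moreover have "0 < poly p 0" using x0[OF k] unfolding p by (simp add: pderange_0)
        ultimately show ?thesis by (simp add: y_def)
      qed
    qed blast
    have "g i < 0" if "i < m - 1" for i using g(2)[OF that] G0[OF k, of i] by (auto simp: y_def split: if_splits)
    moreover have "g i < \<gamma> k i \<and> \<gamma> k i < g (Suc i)" if "i < m - 2" for i
      using g(2,3)[of i] that by (simp add: y_def)
    ultimately show ?thesis using g(1) unfolding p_def by blast
  qed
  then have "\<forall>k. \<exists>g. 1 \<le> k \<and> k \<le> m \<longrightarrow> has_roots (pderange_div_x (Suc (m - k)) k) (m - 1) g
      \<and> (\<forall>i<m - 2. g i < \<gamma> k i \<and> \<gamma> k i < g (Suc i)) \<and> (\<forall>i<m - 1. g i < 0)" by blast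
  from choice[OF this] obtain \<delta> where \<delta>: "\<And>k. 1 \<le> k \<and> k \<le> m \<longrightarrow> has_roots (pderange_div_x (Suc (m - k)) k) (m - 1) (\<delta> k)
      \<and> (\<forall>i<m - 2. \<delta> k i < \<gamma> k i \<and> \<gamma> k i < \<delta> k (Suc i)) \<and> (\<forall>i<m - 1. \<delta> k i < 0)" by blast
  have D: "\<And>k. 1 \<le> k \<Longrightarrow> k \<le> m \<Longrightarrow> has_roots (pderange_div_x (Suc (m - k)) k) (m - 1) (\<delta> k)"
    and D1: "\<And>k i. 1 \<le> k \<Longrightarrow> k \<le> m \<Longrightarrow> i < m - 2 \<Longrightarrow> \<delta> k i < \<gamma> k i"
    and D2: "\<And>k i. 1 \<le> k \<Longrightarrow> k \<le> m \<Longrightarrow> i < m - 2 \<Longrightarrow> \<gamma> k i < \<delta> k (Suc i)"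
    and D0: "\<And>k i. 1 \<le> k \<Longrightarrow> k \<le> m \<Longrightarrow> i < m - 1 \<Longrightarrow> \<delta> k i < 0"
    using \<delta> by blast+
  \<comment> \<open>Forbidding one more fixed point subtracts the old polynomial, whose signs at the new
    roots \<open>\<delta> k\<close> are known.\<close>
  have ex2: "\<exists>g. has_roots (pderange_div_x (m - k) (Suc k)) (m - 1) g \<and> (\<forall>i<m - 1. \<delta> k i < g i \<and> g i < 0)
       \<and> (\<forall>i. Suc i < m - 1 \<longrightarrow> g i < \<delta> k (Suc i))" if k: "1 \<le> k" "k \<le> m" for k
  proof -
    obtain l where l: "k = Suc l" using k by (cases k) auto
    define p where "p = pderange_div_x (m - k) (Suc k)"
    have p: "p = pderange_div_x (Suc (m - k)) k - pderange_div_x (m - k) k"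
      using pderange_div_x_Suc[of "m - k" l] unfolding p_def l by simp
    have d2: "degree (pderange_div_x (m - k) k) < m - 1" using has_roots_degree[OF G[OF k]] assms(2) by simp
    have "degree p \<le> m - 1" unfolding p
      using has_roots_degree[OF D[OF k]] d2 by (intro degree_diff_le) auto
    moreover have "coeff p (m - 1) = 1" unfolding p
      using has_roots_lead[OF D[OF k]] coeff_eq_0[OF d2] by simp
    ultimately have dp: "degree p \<le> m - 1" "coeff p (m - 1) = 1" by auto
    define y where "y i = (if i < m - 1 then \<delta> k i else 0)" for i
    obtain g where g: "has_roots p (m - 1) g" "\<And>i. i < m - 1 \<Longrightarrow> y i < g i"
      "\<And>i. i < m - 1 \<Longrightarrow> g i < y (Suc i)"
    proof (rule roots_between[OF dp, of y])
      show "y i < y (Suc i)" if "i < m - 1" for i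
        using that has_roots_less[OF D[OF k], of i "Suc i"] D0[OF k, of i] by (auto simp: y_def)
      show "0 < (-1) ^ (m - 1 - i) * poly p (y i)" if "i \<le> m - 1" for i
      proof (cases "i < m - 1")
        case True
        have e: "m - 1 - i = Suc (m - 2 - i)" using True by simp
        have "0 < (-1) ^ (m - 2 - i) * poly (pderange_div_x (m - k) k) (\<delta> k i)"
          using True D2[OF k, of "i - 1"] D1[OF k, of i]
          by (intro sign_between[OF G[OF k]]) auto
        then show ?thesis using True has_roots_root[OF D[OF k] True] unfolding e p by (simp add: y_def)
      next
        case False
        have "poly (pderange_div_x (Suc (m - k)) k) 0 = 2 * poly (pderange_div_x (m - k) k) 0 + real k * poly (pderange (m - k) l) 0"
          using rec[of l] k unfolding l by simp
        then have "0 < poly p 0" unfolding p using x0[OF k] by (simp add: pderange_0)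
        then show ?thesis using False that by (simp add: y_def)
      qed
    qed blast
    have "\<delta> k i < g i" if "i < m - 1" for i using g(2)[OF that] that by (simp add: y_def)
    moreover have "g i < 0" if "i < m - 1" for i
      using g(3)[OF that] D0[OF k, of "Suc i"] by (auto simp: y_def split: if_splits)
    moreover have "g i < \<delta> k (Suc i)" if "Suc i < m - 1" for i using g(3)[of i] that by (simp add: y_def)
    ultimately show ?thesis using g(1) unfolding p_def by blast
  qed
  then have "\<forall>k. \<exists>g. 1 \<le> k \<and> k \<le> m \<longrightarrow> has_roots (pderange_div_x (m - k) (Suc k)) (m - 1) g
      \<and> (\<forall>i<m - 1. \<delta> k i < g i \<and> g i < 0) \<and> (\<forall>i. Suc i < m - 1 \<longrightarrow> g i < \<delta> k (Suc i))" by blast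
  from choice[OF this] obtain \<epsilon> where \<epsilon>: "\<And>k. 1 \<le> k \<and> k \<le> m \<longrightarrow> has_roots (pderange_div_x (m - k) (Suc k)) (m - 1) (\<epsilon> k)
      \<and> (\<forall>i<m - 1. \<delta> k i < \<epsilon> k i \<and> \<epsilon> k i < 0) \<and> (\<forall>i. Suc i < m - 1 \<longrightarrow> \<epsilon> k i < \<delta> k (Suc i))" by blast
  have E: "\<And>k. 1 \<le> k \<Longrightarrow> k \<le> m \<Longrightarrow> has_roots (pderange_div_x (m - k) (Suc k)) (m - 1) (\<epsilon> k)"
    and E1: "\<And>k i. 1 \<le> k \<Longrightarrow> k \<le> m \<Longrightarrow> i < m - 1 \<Longrightarrow> \<delta> k i < \<epsilon> k i"
    and E2: "\<And>k i. 1 \<le> k \<Longrightarrow> k \<le> m \<Longrightarrow> Suc i < m - 1 \<Longrightarrow> \<epsilon> k i < \<delta> k (Suc i)"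
    and E0: "\<And>k i. 1 \<le> k \<Longrightarrow> k \<le> m \<Longrightarrow> i < m - 1 \<Longrightarrow> \<epsilon> k i < 0"
    using \<epsilon> by blast+
  have DE: "\<delta> (Suc k) i = \<epsilon> k i" if "1 \<le> k" "k < m" "i < m - 1" for k i
  proof -
    have "Suc (m - Suc k) = m - k" using that by simp
    then have "has_roots (pderange_div_x (m - k) (Suc k)) (m - 1) (\<delta> (Suc k))" using D[of "Suc k"] that by simp
    then show ?thesis using has_roots_unique[OF _ E] that by simp
  qed
  define \<gamma>' where "\<gamma>' k = (if k \<le> m then \<delta> k else \<epsilon> m)" for k
  have \<gamma>'_Suc: "\<gamma>' (Suc k) i = \<epsilon> k i" if "1 \<le> k" "k \<le> m" "i < m - 1" for k i
    using DE[of k i] that by (auto simp: \<gamma>'_def le_less)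
  have AG': "\<beta> i < \<delta> 1 i \<and> \<delta> 1 i < \<beta> (Suc i)" if "i < m - 1" for i
  proof -
    have m1: "1 \<le> m" "Suc (m - 1) = m" using assms(2) by auto
    note D' = D[OF order_refl m1(1), unfolded m1]
    have d: "degree (pderange_div_x m 1) \<le> m - 1" "coeff (pderange_div_x m 1) (m - 1) = 1"
      using has_roots_degree[OF D'] has_roots_lead[OF D'] by auto
    obtain g where g: "has_roots (pderange_div_x m 1) (m - 1) g" "\<And>i. i < m - 1 \<Longrightarrow> \<beta> i < g i"
      "\<And>i. i < m - 1 \<Longrightarrow> g i < \<beta> (Suc i)"
    proof (rule roots_between[OF d, of \<beta>])
      show "\<beta> i < \<beta> (Suc i)" if "i < m - 1" for i using has_roots_less[OF B] that by simp
      show "0 < (-1) ^ (m - 1 - i) * poly (pderange_div_x m 1) (\<beta> i)" if "i \<le> m - 1" for i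
      proof -
        have im: "i < m" using that assms(2) by simp
        have "0 < (-1) ^ (m - 1 - i) * poly (pderange m 0) (\<beta> i)"
          using that B1[of i] B2[of "i - 1"] by (intro sign_between[OF A]) auto
        moreover have "poly (pderange m 0) (\<beta> i) = - \<beta> i * poly (pderange_div_x m 1) (\<beta> i)"
          using has_roots_root[OF B im] pderange_eq_pderange_div_x[of 1 m] by (simp add: algebra_simps)
        ultimately have "0 < - \<beta> i * ((-1) ^ (m - 1 - i) * poly (pderange_div_x m 1) (\<beta> i))"
          by (simp add: mult_ac)
        then show ?thesis using B0[OF im] by (simp only: zero_less_mult_iff) auto
      qed
    qed blast
    show ?thesis using g(2,3)[OF that] has_roots_unique[OF g(1) D' that] by simp
  qed
  have "interlaced (Suc m) \<beta> \<gamma>'"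
    unfolding interlaced_def
  proof (intro conjI ballI allI impI)
    show "has_roots (pderange (Suc m) 0) (Suc m - 1) \<beta>" using B by simp
    show "\<beta> i < 0" if "i < Suc m - 1" for i using B0 that by simp
    have e: "Suc m - 2 = m - 1" by simp
    show "has_roots (pderange_div_x (Suc m - k) k) (Suc m - 2) (\<gamma>' k)" if "k \<in> {1..Suc m}" for k
      using that D[of k] E[of m] assms(2) unfolding e
      by (cases "k \<le> m") (auto simp: \<gamma>'_def Suc_diff_le le_Suc_eq)
    show "\<gamma>' k i < 0" if "k \<in> {1..Suc m}" "i < Suc m - 2" for k i
      using that D0[of k i] E0[of m i] assms(2) unfolding e by (auto simp: \<gamma>'_def)
    show "\<beta> i < \<gamma>' 1 i" "\<gamma>' 1 i < \<beta> (Suc i)" if "i < Suc m - 2" for i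
      using AG'[of i] that assms(2) by (auto simp: \<gamma>'_def)
    show "\<gamma>' k i < \<gamma>' (Suc k) i" if "k \<in> {1..<Suc m}" "i < Suc m - 2" for k i
      using E1[of k i] that \<gamma>'_Suc[of k i] by (auto simp: \<gamma>'_def)
    show "\<gamma>' (Suc k) i < \<gamma>' k (Suc i)" if "k \<in> {1..<Suc m}" "Suc i < Suc m - 2" for k i
      using E2[of k i] that \<gamma>'_Suc[of k i] by (auto simp: \<gamma>'_def)
  qed
  then show ?thesis by (rule that)
qed

lemma interlaced_exists: "2 \<le> m \<Longrightarrow> \<exists>\<alpha> \<gamma>. interlaced m \<alpha> \<gamma>"
proof (induction m rule: nat_induct_at_least)
  case base
  have d2: "derange (Suc (Suc 0)) = [:0, 1:]" by (simp add: pderiv_0)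
  have p: "pderange 2 0 = [:1, 1:]" "pderange 1 1 = [:0, 1:]" "pderange 0 2 = [:0, 1:]"
    by (simp_all add: numeral_2_eq_2 d2 one_pCons del: derange.simps(3))
  have "pderange_div_x 1 1 = 1" "pderange_div_x 0 2 = 1" unfolding pderange_div_x_def p by simp_all
  then have "has_roots (pderange 2 0) (2 - 1) (\<lambda>_. -1)" 
    "\<forall>k\<in>{1..2}. has_roots (pderange_div_x (2 - k) k) 0 (\<lambda>_. 0)"
    unfolding p by (auto simp: has_roots_def strict_mono_on_def le_Suc_eq numeral_2_eq_2)
  then have "interlaced 2 (\<lambda>_. -1) (\<lambda>_ _. 0)" unfolding interlaced_def by auto
  then show ?case by blast
next
  case (Suc m)
  then show ?case using interlaced_step by metis
qed

text \<open>On the negative axis inversion is a decreasing bijection, so it reverses the list of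
roots.\<close>

lemma has_roots_inverse:
  fixes p :: "real poly"
  assumes p: "has_roots p N g" and neg: "\<And>i. i < N \<Longrightarrow> g i < 0"
    and inv: "\<And>x. x < 0 \<Longrightarrow> poly p x = 0 \<Longrightarrow> poly p (1 / x) = 0" and i: "i < N"
  shows "g (N - Suc i) = 1 / g i"
proof -
  define h where "h i = 1 / g (N - Suc i)" for i
  have "has_roots p N h"
  proof (rule has_rootsI)
    show "degree p \<le> N" "coeff p N = 1" using has_roots_degree[OF p] has_roots_lead[OF p] by auto
    show "h i < h (Suc i)" if "Suc i < N" for i
    proof -
      have "g (N - Suc (Suc i)) < g (N - Suc i)" using that by (intro has_roots_less[OF p]) auto
      moreover have "g (N - Suc i) < 0" using neg that by simp
      ultimately show ?thesis by (simp add: h_def divide_simps)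
    qed
    show "poly p (h i) = 0" if "i < N" for i
      unfolding h_def using that by (intro inv neg has_roots_root[OF p]) auto
  qed
  then have "g i = h i" using has_roots_unique[OF p] i by blast
  then show ?thesis by (simp add: h_def)
qed

text \<open>As \<open>k\<close> grows the roots move to the right, so they stay to the right of those of the
Eulerian polynomial.  At \<open>k = m\<close> both polynomials are palindromic and inversion turns this lower
bound into an upper bound, which by monotonicity holds for all \<open>k\<close>.  Hence every interval between
consecutive Eulerian roots contains exactly one root of each quotient.\<close>

lemma eulerian_interlaces_pderange:
  assumes m: "2 \<le> m"
  obtains \<alpha> where "has_roots (pderange m 0) (m - 1) \<alpha>" "\<And>i. i < m - 1 \<Longrightarrow> \<alpha> i < 0"
    "\<And>i. i < m - 1 \<Longrightarrow> \<alpha> (m - 2 - i) = 1 / \<alpha> i"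
    "\<And>k i. 1 \<le> k \<Longrightarrow> k \<le> m \<Longrightarrow> i < m - 1 \<Longrightarrow> 0 < (-1) ^ (m - 1 - i) * poly (pderange (m - k) k) (\<alpha> i)"
proof -
  obtain \<alpha> \<gamma> where I: "interlaced m \<alpha> \<gamma>" using interlaced_exists[OF m] by blast
  have A: "has_roots (pderange m 0) (m - 1) \<alpha>" and A0: "\<And>i. i < m - 1 \<Longrightarrow> \<alpha> i < 0"
    and G: "\<And>k. 1 \<le> k \<Longrightarrow> k \<le> m \<Longrightarrow> has_roots (pderange_div_x (m - k) k) (m - 2) (\<gamma> k)"
    and G0: "\<And>k i. 1 \<le> k \<Longrightarrow> k \<le> m \<Longrightarrow> i < m - 2 \<Longrightarrow> \<gamma> k i < 0"
    and AG: "\<And>i. i < m - 2 \<Longrightarrow> \<alpha> i < \<gamma> 1 i"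
    and GG: "\<And>k i. 1 \<le> k \<Longrightarrow> k < m \<Longrightarrow> i < m - 2 \<Longrightarrow> \<gamma> k i < \<gamma> (Suc k) i"
    using I unfolding interlaced_def by auto
  have mono: "\<gamma> k i \<le> \<gamma> l i" if "1 \<le> k" "k \<le> l" "l \<le> m" "i < m - 2" for k l i
    using that(2,3)
  proof (induction l rule: dec_induct)
    case (step l)
    then show ?case using GG[of l i] that by simp
  qed simp
  have Ainv: "\<alpha> (m - 2 - i) = 1 / \<alpha> i" if "i < m - 1" for i
  proof -
    have "\<alpha> (m - 1 - Suc i) = 1 / \<alpha> i"
    proof (intro has_roots_inverse[OF A A0] that)
      show "poly (pderange m 0) (1 / x) = 0" if "x < 0" "poly (pderange m 0) x = 0" for x
        using eulerian_reverse[of x m] m that by (auto simp del: pderange.simps)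
    qed auto
    moreover have "m - 1 - Suc i = m - 2 - i" by simp
    ultimately show ?thesis by simp
  qed
  \<comment> \<open>At \<open>k = m\<close> the quotient of the palindromic \<open>derange m\<close> by \<open>x\<close> has roots closed under inversion.\<close>
  have Ginv: "\<gamma> m (m - 3 - i) = 1 / \<gamma> m i" if "i < m - 2" for i
  proof -
    have Gm: "has_roots (pderange_div_x 0 m) (m - 2) (\<gamma> m)" using G[of m] m by simp
    have d: "poly (derange m) x = x * poly (pderange_div_x 0 m) x" for x
      using pderange_eq_pderange_div_x[of m 0] m by simp
    have "poly (pderange_div_x 0 m) (1 / x) = 0" if "x < 0" "poly (pderange_div_x 0 m) x = 0" for x
    proof -
      have "x ^ m * poly (derange m) (1 / x) = 0"
        using derange_reverse[of x m] that by (simp add: d)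
      then show ?thesis using that by (simp add: d)
    qed
    then have "\<gamma> m (m - 2 - Suc i) = 1 / \<gamma> m i"
      using m that G0 by (intro has_roots_inverse[OF Gm]) auto
    moreover have "m - 2 - Suc i = m - 3 - i" by simp
    ultimately show ?thesis by simp
  qed
  have lower: "\<alpha> i < \<gamma> k i" if "1 \<le> k" "k \<le> m" "i < m - 2" for k i
    using AG[of i] mono[of 1 k i] that by simp
  have upper: "\<gamma> k i < \<alpha> (Suc i)" if k: "1 \<le> k" "k \<le> m" and i: "i < m - 2" for k i
  proof -
    have "\<gamma> k i \<le> \<gamma> m i" using mono[of k m i] that by simp
    also have "\<gamma> m i = 1 / \<gamma> m (m - 3 - i)" using Ginv[OF i] by simp
    also have "\<dots> < 1 / \<alpha> (m - 3 - i)"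
    proof -
      have "m - 3 - i < m - 2" "m - 3 - i < m - 1" using i by auto
      then have "\<alpha> (m - 3 - i) < \<gamma> m (m - 3 - i)" "\<gamma> m (m - 3 - i) < 0" "\<alpha> (m - 3 - i) < 0"
        using lower[of m "m - 3 - i"] G0[of m "m - 3 - i"] A0[of "m - 3 - i"] m by auto
      then show ?thesis by (simp add: divide_simps)
    qed
    also have "\<dots> = \<alpha> (Suc i)"
    proof -
      have "m - 2 - Suc i = m - 3 - i" by simp
      then show ?thesis using Ainv[of "Suc i"] i by simp
    qed
    finally show ?thesis .
  qed
  have "0 < (-1) ^ (m - 1 - i) * poly (pderange (m - k) k) (\<alpha> i)" if k: "1 \<le> k" "k \<le> m" and i: "i < m - 1" for k i
  proof -
    have "0 < (-1) ^ (m - 2 - i) * poly (pderange_div_x (m - k) k) (\<alpha> i)"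
      using lower[OF k, of i] upper[OF k, of "i - 1"] i
      by (intro sign_between[OF G[OF k]]) auto
    moreover have "0 < - \<alpha> i" using A0[OF i] by simp
    ultimately have "0 < (- \<alpha> i) * ((-1) ^ (m - 2 - i) * poly (pderange_div_x (m - k) k) (\<alpha> i))"
      by (rule mult_pos_pos[rotated])
    moreover have "m - 1 - i = Suc (m - 2 - i)" using i by simp
    ultimately show ?thesis using k by (simp add: pderange_eq_pderange_div_x mult_ac)
  qed
  then show ?thesis using that[of \<alpha>] A A0 Ainv by blast
qed

lemma pderange_monic: assumes "2 \<le> m" "k \<le> m"
  shows "degree (pderange (m - k) k) \<le> m - 1" "coeff (pderange (m - k) k) (m - 1) = 1"
proof -
  obtain \<alpha> \<gamma> where I: "interlaced m \<alpha> \<gamma>" using interlaced_exists assms by blast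
  have "degree (pderange (m - k) k) \<le> m - 1 \<and> coeff (pderange (m - k) k) (m - 1) = 1"
  proof (cases "k = 0")
    case True
    then show ?thesis using I by (auto simp: interlaced_def dest: has_roots_degree has_roots_lead)
  next
    case False
    then have h: "has_roots (pderange_div_x (m - k) k) (m - 2) (\<gamma> k)"
      using I assms by (auto simp: interlaced_def)
    have "degree ([:0, 1:] * pderange_div_x (m - k) k) \<le> Suc (m - 2) \<and> coeff ([:0, 1:] * pderange_div_x (m - k) k) (Suc (m - 2)) = 1"
      using has_roots_degree[OF h] has_roots_lead[OF h] by (intro coeff_x_times) simp_all
    moreover have "Suc (m - 2) = m - 1" using assms(1) by simp
    ultimately show ?thesis using False by (simp add: pderange_eq_pderange_div_x)
  qed
  then show "degree (pderange (m - k) k) \<le> m - 1" "coeff (pderange (m - k) k) (m - 1) = 1" by auto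
qed

lemma has_roots_real:
  assumes "has_roots p N g" "poly (map_poly complex_of_real p) z = 0"
  shows "z \<in> \<real>"
proof -
  have "map_poly complex_of_real (\<Prod>i\<in>A. [:- g i, 1:]) = (\<Prod>i\<in>A. [:- complex_of_real (g i), 1:])" for A
  proof (induction A rule: infinite_finite_induct)
    case (insert i A)
    have "map_poly complex_of_real ([:- g i, 1:] * q) = [:- complex_of_real (g i), 1:] * map_poly complex_of_real q" for q
      by (rule poly_eqI) (simp add: coeff_map_poly coeff_pCons split: nat.splits)
    then show ?case using insert by simp
  qed simp_all
  then have "(\<Prod>i<N. z - complex_of_real (g i)) = 0"
    using assms by (simp add: has_roots_def poly_prod)
  then show ?thesis by (auto simp: Reals_def)
qed

definition pderange_comb :: "nat \<Rightarrow> (nat \<Rightarrow> real) \<Rightarrow> real poly" where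
  "pderange_comb m a = (\<Sum>k\<le>m. smult (a k) (pderange (m - k) k))"

lemma pderange_comb_0: "poly (pderange_comb m a) 0 = a 0"
  by (simp add: pderange_comb_def poly_sum pderange_0 if_distrib sum.delta cong: if_cong)

lemma pderange_comb_sign:
  assumes m: "2 \<le> m" and a: "\<And>k. k \<le> m \<Longrightarrow> 0 < a k"
    and A: "has_roots (pderange m 0) (m - 1) \<alpha>"
    and s: "\<And>k i. 1 \<le> k \<Longrightarrow> k \<le> m \<Longrightarrow> i < m - 1 \<Longrightarrow> 0 < (-1) ^ (m - 1 - i) * poly (pderange (m - k) k) (\<alpha> i)"
    and i: "i < m - 1"
  shows "0 < (-1) ^ (m - 1 - i) * poly (pderange_comb m a) (\<alpha> i)"
proof -
  have z: "poly (pderange m 0) (\<alpha> i) = 0" using has_roots_root[OF A i] .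
  have "(-1) ^ (m - 1 - i) * poly (pderange_comb m a) (\<alpha> i)
      = (\<Sum>k\<le>m. a k * ((-1) ^ (m - 1 - i) * poly (pderange (m - k) k) (\<alpha> i)))"
    by (simp add: pderange_comb_def poly_sum sum_distrib_left mult_ac)
  also have "0 < \<dots>"
  proof (rule sum_pos2[of _ 1])
    show "0 < a 1 * ((-1) ^ (m - 1 - i) * poly (pderange (m - 1) 1) (\<alpha> i))"
      by (rule mult_pos_pos[OF a s]) (use i m in auto)
    show "0 \<le> a k * ((-1) ^ (m - 1 - i) * poly (pderange (m - k) k) (\<alpha> i))" if "k \<in> {..m}" for k
    proof (cases "k = 0")
      case False
      then have "0 < a k * ((-1) ^ (m - 1 - i) * poly (pderange (m - k) k) (\<alpha> i))"
        by (intro mult_pos_pos[OF a s]) (use i that in auto)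
      then show ?thesis by simp
    qed (simp add: z)
  qed (use m in auto)
  finally show ?thesis .
qed

text \<open>At every root of the Eulerian polynomial all summands with \<open>k > 0\<close> have the same sign and
the one with \<open>k = 0\<close> vanishes, so the combination alternates along these roots.\<close>

lemma pderange_comb_real_rooted:
  assumes a: "\<And>k. k \<le> m \<Longrightarrow> 0 < a k"
    and z: "poly (map_poly complex_of_real (pderange_comb m a)) z = 0"
  shows "z \<in> \<real>"
proof (cases "2 \<le> m")
  case m: True
  define c where "c = (\<Sum>k\<le>m. a k)"
  have c: "0 < c" unfolding c_def using a by (intro sum_pos) auto
  define p where "p = smult (1 / c) (pderange_comb m a)"
  obtain \<alpha> where A: "has_roots (pderange m 0) (m - 1) \<alpha>" and A0: "\<And>i. i < m - 1 \<Longrightarrow> \<alpha> i < 0"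
    and Ai: "\<And>i. i < m - 1 \<Longrightarrow> \<alpha> (m - 2 - i) = 1 / \<alpha> i"
    and s: "\<And>k i. 1 \<le> k \<Longrightarrow> k \<le> m \<Longrightarrow> i < m - 1 \<Longrightarrow> 0 < (-1) ^ (m - 1 - i) * poly (pderange (m - k) k) (\<alpha> i)"
    by (rule eulerian_interlaces_pderange[OF m]) (rule that)
  have "degree (pderange_comb m a) \<le> m - 1"
    unfolding pderange_comb_def using pderange_monic[OF m] by (intro degree_sum_le) (auto intro: order_trans[OF degree_smult_le])
  then have d: "degree p \<le> m - 1" unfolding p_def by (intro order_trans[OF degree_smult_le])
  have "coeff (pderange_comb m a) (m - 1) = c"
    unfolding pderange_comb_def c_def coeff_sum using pderange_monic[OF m] by (intro sum.cong) auto
  then have l: "coeff p (m - 1) = 1" using c by (simp add: p_def)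
  define y where "y i = (if i < m - 1 then \<alpha> i else 0)" for i
  obtain g where g: "has_roots p (m - 1) g"
  proof (rule roots_between[OF d l, of y])
    show "y i < y (Suc i)" if "i < m - 1" for i
      using that has_roots_less[OF A, of i "Suc i"] A0[of i] by (auto simp: y_def)
    show "0 < (-1) ^ (m - 1 - i) * poly p (y i)" if "i \<le> m - 1" for i
    proof (cases "i < m - 1")
      case True
      then show ?thesis using pderange_comb_sign[OF m a A s True] c by (simp add: y_def p_def zero_less_divide_iff)
    next
      case False
      then show ?thesis using that c a[of 0] by (simp add: y_def p_def pderange_comb_0)
    qed
  qed blast
  have "map_poly complex_of_real p = smult (complex_of_real (1 / c)) (map_poly complex_of_real (pderange_comb m a))"
    unfolding p_def by (rule poly_eqI) (simp add: coeff_map_poly)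
  then show ?thesis using has_roots_real[OF g, of z] z by simp
next
  case False
  then have "m = 0 \<or> m = 1" by auto
  then have "pderange_comb m a = [:a 0:]" by (auto simp: pderange_comb_def smult_one)
  then show ?thesis using a[of 0] z by (simp add: map_poly_pCons)
qed

text \<open>At the roots of the Eulerian polynomial both terms on the right-hand side of the functional
equation have the same sign, because these roots are negative and closed under inversion.  So \<open>h\<close>
alternates along them.\<close>

lemma symmetrised_pderange_comb_real_rooted:
  assumes m: "2 \<le> m" and a: "\<And>k. k \<le> m \<Longrightarrow> 0 < a k"
    and d: "degree h \<le> m" "coeff h m = 1" and h0: "poly h 0 = 1"
    and h: "\<And>x. x \<noteq> 0 \<Longrightarrow> (1 - x) * poly h x = poly (pderange_comb m a) x - x ^ Suc m * poly (pderange_comb m a) (1 / x)"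
    and z: "poly (map_poly complex_of_real h) z = 0"
  shows "z \<in> \<real>"
proof -
  obtain \<alpha> where A: "has_roots (pderange m 0) (m - 1) \<alpha>" and A0: "\<And>i. i < m - 1 \<Longrightarrow> \<alpha> i < 0"
    and Ai: "\<And>i. i < m - 1 \<Longrightarrow> \<alpha> (m - 2 - i) = 1 / \<alpha> i"
    and s: "\<And>k i. 1 \<le> k \<Longrightarrow> k \<le> m \<Longrightarrow> i < m - 1 \<Longrightarrow> 0 < (-1) ^ (m - 1 - i) * poly (pderange (m - k) k) (\<alpha> i)"
    by (rule eulerian_interlaces_pderange[OF m]) (rule that)
  define y where "y i = (if i < m - 1 then \<alpha> i else 0)" for i
  have m0: "0 < m" using m by simp
  obtain g where g: "has_roots h m g"
  proof (rule roots_interlacing[OF d m0, of y])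
    show "y i < y (Suc i)" if "Suc i < m" for i
      using that has_roots_less[OF A, of i "Suc i"] A0[of i] by (auto simp: y_def)
    show "0 < (-1) ^ (m - 1 - i) * poly h (y i)" if "i < m" for i
    proof (cases "i < m - 1")
      case True
      let ?x = "\<alpha> i" and ?Q = "pderange_comb m a"
      have x: "?x < 0" using A0 True by blast
      have i': "m - 2 - i < m - 1" using m by simp
      have e: "m - 1 - (m - 2 - i) = Suc i" using True by simp
      have 1: "0 < (-1) ^ (m - 1 - i) * poly ?Q ?x" using pderange_comb_sign[OF m a A s True] .
      have 2: "0 < (-1) ^ Suc i * poly ?Q (1 / ?x)"
        using pderange_comb_sign[OF m a A s i'] unfolding e Ai[OF True] .
      have "0 < (- ?x) ^ Suc m * ((-1) ^ Suc i * poly ?Q (1 / ?x))"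
        by (rule mult_pos_pos[OF zero_less_power 2]) (use x in simp)
      also have "(- ?x) ^ Suc m = (-1) ^ Suc m * ?x ^ Suc m" by (rule power_minus)
      also have "(-1) ^ Suc m * ?x ^ Suc m * ((-1) ^ Suc i * poly ?Q (1 / ?x))
          = ((-1) ^ Suc m * (-1) ^ Suc i) * (?x ^ Suc m * poly ?Q (1 / ?x))" by (simp only: ac_simps)
      also have "(-1) ^ Suc m * (-1) ^ Suc i = - ((-1::real) ^ (m - 1 - i))"
      proof -
        have "Suc m + Suc i = (m - 1 - i) + 1 + 2 * (i + 1)" using True by simp
        then have "(-1::real) ^ (Suc m + Suc i) = (-1) ^ (m - 1 - i) * (-1) * ((-1) ^ 2) ^ (i + 1)"
          by (simp only: power_add power_mult power_one_right)
        then show ?thesis by (simp add: power_add)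
      qed
      finally have "0 < (-1) ^ (m - 1 - i) * (poly ?Q ?x - ?x ^ Suc m * poly ?Q (1 / ?x))"
        using 1 by (simp add: algebra_simps)
      also have "poly ?Q ?x - ?x ^ Suc m * poly ?Q (1 / ?x) = (1 - ?x) * poly h ?x" using h x by simp
      finally have "0 < (1 - ?x) * ((-1) ^ (m - 1 - i) * poly h ?x)" by (simp only: ac_simps)
      then have "0 < (-1) ^ (m - 1 - i) * poly h ?x" using x by (simp only: zero_less_mult_iff) auto
      then show ?thesis using True by (simp add: y_def)
    next
      case False
      then show ?thesis using that h0 by (simp add: y_def)
    qed
  qed blast
  then show ?thesis using has_roots_real z by blast
qed

section \<open>A positive expansion of the alternating sums\<close>

lemma gbinomial_negative: "(- (of_nat (Suc a)) :: real) gchoose j = (-1) ^ j * of_nat ((a + j) choose j)"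
proof -
  have "of_nat (Suc a) + of_nat j - 1 = (of_nat (a + j) :: real)" by simp
  then show ?thesis by (simp only: gbinomial_minus binomial_gbinomial)
qed

text \<open>The Vandermonde convolution with negative upper arguments.\<close>

lemma sum_choose_choose:
  "(\<Sum>j\<le>e. ((a + j) choose j) * ((b + (e - j)) choose (e - j))) = (a + b + 1 + e) choose e"
proof -
  have "(\<Sum>j\<le>e. (-1) ^ e * real (((a + j) choose j) * ((b + (e - j)) choose (e - j))))
      = (\<Sum>j\<le>e. ((- (of_nat (Suc a)) :: real) gchoose j) * ((- (of_nat (Suc b)) :: real) gchoose (e - j)))"
  proof (intro sum.cong refl)
    fix j assume "j \<in> {..e}"
    then have "(-1::real) ^ e = (-1) ^ j * (-1) ^ (e - j)" by (simp flip: power_add)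
    then show "(-1) ^ e * real (((a + j) choose j) * ((b + (e - j)) choose (e - j)))
      = ((- (of_nat (Suc a)) :: real) gchoose j) * ((- (of_nat (Suc b)) :: real) gchoose (e - j))"
      unfolding gbinomial_negative by simp
  qed
  also have "\<dots> = ((- of_nat (Suc a) + - of_nat (Suc b)) gchoose e)"
    by (simp only: gbinomial_Vandermonde atMost_atLeast0)
  also have "(- of_nat (Suc a) + - of_nat (Suc b)) = - (of_nat (Suc (a + b + 1)) :: real)" by simp
  also have "(- (of_nat (Suc (a + b + 1)) :: real)) gchoose e = (-1) ^ e * real ((a + b + 1 + e) choose e)"
    by (rule gbinomial_negative)
  finally have "(-1) ^ e * (\<Sum>j\<le>e. real (((a + j) choose j) * ((b + (e - j)) choose (e - j))))
     = (-1) ^ e * real ((a + b + 1 + e) choose e)" by (simp only: sum_distrib_left)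
  then have "real (\<Sum>j\<le>e. ((a + j) choose j) * ((b + (e - j)) choose (e - j))) = real ((a + b + 1 + e) choose e)"
    by simp
  then show ?thesis by (simp only: of_nat_eq_iff)
qed

text \<open>The Vandermonde convolution with one negative upper argument.\<close>

lemma sum_choose_alternating:
  assumes "c < n"
  shows "(\<Sum>q\<le>M. (-1) ^ q * real ((n choose (M - q)) * ((c + q) choose q))) = real ((n - Suc c) choose M)"
proof -
  have "(\<Sum>q\<le>M. (-1) ^ q * real ((n choose (M - q)) * ((c + q) choose q)))
      = (\<Sum>q\<le>M. ((- (of_nat (Suc c)) :: real) gchoose q) * (of_nat n gchoose (M - q)))"
    unfolding gbinomial_negative by (simp add: binomial_gbinomial mult_ac)
  also have "\<dots> = (- of_nat (Suc c) + of_nat n :: real) gchoose M"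
    by (simp only: gbinomial_Vandermonde atMost_atLeast0)
  also have "- of_nat (Suc c) + of_nat n = (of_nat (n - Suc c) :: real)" using assms by (simp add: of_nat_diff)
  finally show ?thesis by (simp only: binomial_gbinomial[symmetric])
qed

text \<open>A coefficient of the expansion \<open>betti_link_expand\<close>, written as a sum of positive terms.\<close>

definition expansion_coeff :: "nat \<Rightarrow> nat \<Rightarrow> nat \<Rightarrow> nat \<Rightarrow> nat" where
  "expansion_coeff i e M k = (\<Sum>j\<le>e. ((i + (e - j)) choose (e - j)) * ((k + j) choose j) * ((i + e + M + 1 - k - j) choose (M - k)))"

lemma expansion_coeff_pos: "k \<le> M \<Longrightarrow> 0 < expansion_coeff i e M k"
  unfolding expansion_coeff_def by (rule sum_pos2[of _ e]) (auto simp: zero_less_binomial_iff)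

text \<open>Splitting the second binomial coefficient by \<open>sum_choose_choose\<close> makes the sum over
\<open>p\<close> an instance of \<open>sum_choose_alternating\<close>.\<close>

lemma expansion_coeff_alternating:
  assumes k: "k \<le> M"
  shows "(\<Sum>p\<le>M. (-1) ^ (p + k) * real (((i + e + M + 2) choose (M - p)) * ((Suc i + e + p) choose e) * (p choose k)))
    = real (expansion_coeff i e M k)"
proof -
  let ?n = "i + e + M + 2"
  let ?c = "\<lambda>j. (i + (e - j)) choose (e - j)"
  have ins_sign: "(-1::real) ^ (p + k) = (-1) ^ (p - k)" if "k \<le> p" for p
  proof -
    have "p + k = (p - k) + 2 * k" using that by simp
    then show ?thesis by (simp only: power_add power_mult) simp
  qed
  have "(\<Sum>p\<le>M. (-1) ^ (p + k) * real ((?n choose (M - p)) * ((Suc i + e + p) choose e) * (p choose k)))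
     = (\<Sum>p\<in>{k..M}. (-1) ^ (p + k) * real ((?n choose (M - p)) * ((Suc i + e + p) choose e) * (p choose k)))"
    by (rule sum.mono_neutral_right) auto
  also have "\<dots> = (\<Sum>q\<le>M - k. (-1) ^ q * real ((?n choose (M - k - q)) * ((k + q + i + 1 + e) choose e) * ((k + q) choose k)))"
    by (rule sum.reindex_bij_witness[of _ "\<lambda>q. q + k" "\<lambda>p. p - k"])
      (use k ins_sign in \<open>auto simp: algebra_simps\<close>)
  also have "\<dots> = (\<Sum>q\<le>M - k. \<Sum>j\<le>e. real (?c j * ((k + j) choose j)) * ((-1) ^ q * real ((?n choose (M - k - q)) * ((k + j + q) choose q))))"
  proof (intro sum.cong refl)
    fix q
    have ch: "((k + q + j) choose j) * ((k + q) choose k) = ((k + j) choose j) * ((k + j + q) choose q)" for j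
    proof -
      have "real (((k + q + j) choose j) * ((k + q) choose k)) = real (((k + j) choose j) * ((k + j + q) choose q))"
        by (simp add: binomial_fact field_simps)
      then show ?thesis by (simp only: of_nat_eq_iff)
    qed
    have "((k + q + i + 1 + e) choose e) * ((k + q) choose k)
        = (\<Sum>j\<le>e. ((k + q + j) choose j) * ?c j) * ((k + q) choose k)"
      using sum_choose_choose[of "k + q" i e] by simp
    also have "\<dots> = (\<Sum>j\<le>e. ?c j * (((k + q + j) choose j) * ((k + q) choose k)))"
      unfolding sum_distrib_right by (simp add: mult_ac)
    also have "\<dots> = (\<Sum>j\<le>e. ?c j * ((k + j) choose j) * ((k + j + q) choose q))"
      unfolding ch by (simp add: mult_ac)
    finally have e: "((k + q + i + 1 + e) choose e) * ((k + q) choose k)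
      = (\<Sum>j\<le>e. ?c j * ((k + j) choose j) * ((k + j + q) choose q))" .
    show "(-1) ^ q * real ((?n choose (M - k - q)) * ((k + q + i + 1 + e) choose e) * ((k + q) choose k))
       = (\<Sum>j\<le>e. real (?c j * ((k + j) choose j)) * ((-1) ^ q * real ((?n choose (M - k - q)) * ((k + j + q) choose q))))"
      unfolding mult.assoc e by (simp add: sum_distrib_left mult_ac)
  qed
  also have "\<dots> = (\<Sum>j\<le>e. real (?c j * ((k + j) choose j)) * (\<Sum>q\<le>M - k. (-1) ^ q * real ((?n choose (M - k - q)) * ((k + j + q) choose q))))"
    unfolding sum_distrib_left by (rule sum.swap)
  also have "\<dots> = (\<Sum>j\<le>e. real (?c j * ((k + j) choose j)) * real ((?n - Suc (k + j)) choose (M - k)))"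
    using k by (intro sum.cong refl arg_cong2[where f="(*)"] sum_choose_alternating) auto
  also have "\<dots> = real (expansion_coeff i e M k)"
    by (simp add: expansion_coeff_def)
  finally show ?thesis .
qed

text \<open>The \<open>i\<close>-th Betti number, for \<open>i > 0\<close>, of the truncated polynomial ring with parameters
\<open>\<rho> = r - card F\<close> and \<open>\<nu> = n - card F\<close>, in the form in which the Euler characteristic yields it; see
\<open>skel_betti_formula\<close>.\<close>

definition betti_link :: "nat \<Rightarrow> nat \<Rightarrow> nat \<Rightarrow> real" where
  "betti_link i \<rho> \<nu> = (\<Sum>l<\<rho>. (-1) ^ (\<rho> - 1 - l) * real ((\<nu> choose l) * ((\<nu> - 1 - l) choose (i + \<rho> - 1 - l))))"

lemma coeff_one_plus_power: "coeff ([:1, 1:] ^ m) s = of_nat (m choose s)"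
  for s :: nat
proof (induction m arbitrary: s)
  case (Suc m)
  then show ?case by (cases s) (simp_all add: algebra_simps)
qed (auto simp: binomial_eq_0)

lemma smult_sum_right: "smult c (\<Sum>x\<in>A. f x) = (\<Sum>x\<in>A. smult c (f x))"
  by (induction A rule: infinite_finite_induct) (simp_all add: smult_add_right)

lemma pderange_comb_expand:
  "pderange_comb M a = (\<Sum>s\<le>M. smult (\<Sum>k\<le>s. a k * real ((M - k) choose (s - k))) (derange s))"
proof -
  have "pderange_comb M a = (\<Sum>k\<le>M. \<Sum>j\<le>M - k. smult (a k * real ((M - k) choose j)) (derange (j + k)))"
    unfolding pderange_comb_def pderange_sum smult_sum_right by (simp add: of_nat_poly)
  also have "\<dots> = (\<Sum>k\<le>M. \<Sum>s\<in>{k..M}. smult (a k * real ((M - k) choose (s - k))) (derange s))"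
  proof (rule sum.cong[OF refl])
    fix k assume "k \<in> {..M}"
    then show "(\<Sum>j\<le>M - k. smult (a k * real ((M - k) choose j)) (derange (j + k)))
        = (\<Sum>s\<in>{k..M}. smult (a k * real ((M - k) choose (s - k))) (derange s))"
      by (intro sum.reindex_bij_witness[of _ "\<lambda>s. s - k" "\<lambda>j. j + k"]) auto
  qed
  also have "\<dots> = (\<Sum>s\<le>M. \<Sum>k\<le>s. smult (a k * real ((M - k) choose (s - k))) (derange s))"
    by (subst (1 2) sum.Sigma) (auto intro!: sum.reindex_bij_witness[of _ "\<lambda>(s, k). (k, s)" "\<lambda>(k, s). (s, k)"])
  also have "\<dots> = (\<Sum>s\<le>M. smult (\<Sum>k\<le>s. a k * real ((M - k) choose (s - k))) (derange s))"
    by (simp add: smult_sum)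
  finally show ?thesis .
qed

text \<open>The left-hand side is the coefficient at \<open>x\<^sup>s\<close> of a combination of the powers
\<open>(1 + x)\<^sup>m\<close> with \<open>m \<le> M\<close>.  Multiplying the \<open>m\<close>-th of them by \<open>((1 + x) - x)\<^bsup>M-m\<^esup> = 1\<close> rewrites it in
terms of \<open>x\<^sup>k (1 + x)\<^bsup>M-k\<^esup>\<close>, and there the coefficients are positive.\<close>

lemma betti_link_expand:
  assumes s: "s \<le> M" and n: "n = i + e + M + 2"
  shows "real (n choose s) * betti_link (Suc i) (Suc M - s) (n - s)
     = (\<Sum>k\<le>s. real (expansion_coeff i e M k) * real ((M - k) choose (s - k)))"
proof -
  \<comment> \<open>The terms of \<open>betti_link\<close> are re-indexed by \<open>m = s + l\<close>, which makes the coefficients independent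
    of \<open>s\<close>.\<close>
  define c where "c m = (-1) ^ (M - m) * real ((n choose m) * ((n - 1 - m) choose (Suc i + M - m)))" for m
  have a: "(\<Sum>m\<le>M. c m * ((-1) ^ k * real ((M - m) choose k))) = real (expansion_coeff i e M k)" if "k \<le> M" for k
  proof -
    have "(\<Sum>m\<le>M. c m * ((-1) ^ k * real ((M - m) choose k)))
      = (\<Sum>p\<le>M. c (M - p) * ((-1) ^ k * real (p choose k)))"
      by (rule sum.reindex_bij_witness[of _ "\<lambda>p. M - p" "\<lambda>p. M - p"]) auto
    also have "\<dots> = (\<Sum>p\<le>M. (-1) ^ (p + k) * real (((i + e + M + 2) choose (M - p)) * ((Suc i + e + p) choose e) * (p choose k)))"
    proof (intro sum.cong refl)
      fix p assume "p \<in> {..M}"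
      then have 1: "M - (M - p) = p" "n - 1 - (M - p) = Suc i + e + p" "Suc i + M - (M - p) = Suc i + p"
        using n by auto
      have "(Suc i + e + p) choose (Suc i + p) = (Suc i + e + p) choose e"
        using binomial_symmetric[of e "Suc i + e + p"] by simp
      then show "c (M - p) * ((-1) ^ k * real (p choose k))
         = (-1) ^ (p + k) * real (((i + e + M + 2) choose (M - p)) * ((Suc i + e + p) choose e) * (p choose k))"
        unfolding c_def 1 by (simp only: n power_add of_nat_mult ac_simps)
    qed
    finally show ?thesis using expansion_coeff_alternating[OF that] by simp
  qed
  have "(\<Sum>m\<le>M. smult (c m) ([:1, 1:] ^ m))
     = (\<Sum>m\<le>M. \<Sum>k\<le>M. smult (c m * ((-1) ^ k * real ((M - m) choose k))) (monom 1 k * [:1, 1:] ^ (M - k)))"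
  proof (intro sum.cong refl)
    fix m assume m: "m \<in> {..M}"
    have "- monom 1 1 + [:1, 1:] = (1::real poly)"
      by (simp add: monom_Suc monom_0 one_pCons)
    then have "(1::real poly) = (- monom 1 1 + [:1, 1:]) ^ (M - m)" by simp
    also have "\<dots> = (\<Sum>k\<le>M - m. of_nat ((M - m) choose k) * (- monom 1 1) ^ k * [:1, 1:] ^ (M - m - k))"
      by (rule binomial_ring)
    also have "\<dots> = (\<Sum>k\<le>M - m. smult ((-1) ^ k * real ((M - m) choose k)) (monom 1 k * [:1, 1:] ^ (M - m - k)))"
    proof (intro sum.cong refl)
      fix k
      have "(- monom 1 1) ^ k = smult ((-1) ^ k) (monom (1::real) k)"
      proof (induction k)
        case (Suc k)
        then show ?case by (simp add: monom_Suc monom_0)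
      qed simp
      then show "of_nat ((M - m) choose k) * (- monom 1 1) ^ k * [:1, 1:] ^ (M - m - k)
        = smult ((-1) ^ k * real ((M - m) choose k)) (monom 1 k * [:1, 1:] ^ (M - m - k))"
        by (simp add: of_nat_poly mult_ac)
    qed
    finally have 1: "1 = (\<Sum>k\<le>M - m. smult ((-1) ^ k * real ((M - m) choose k)) (monom 1 k * [:1, 1:] ^ (M - m - k)))" .
    have "smult (c m) ([:1, 1:] ^ m) = smult (c m) ([:1, 1:] ^ m * 1)" by simp
    also have "\<dots> = (\<Sum>k\<le>M - m. smult (c m * ((-1) ^ k * real ((M - m) choose k))) ([:1, 1:] ^ m * (monom 1 k * [:1, 1:] ^ (M - m - k))))"
      by (subst 1) (simp add: sum_distrib_left smult_sum_right)
    also have "\<dots> = (\<Sum>k\<le>M - m. smult (c m * ((-1) ^ k * real ((M - m) choose k))) (monom 1 k * [:1, 1:] ^ (M - k)))"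
    proof (intro sum.cong refl)
      fix k assume "k \<in> {..M - m}"
      then have "M - k = m + (M - m - k)" using m by auto
      then show "smult (c m * ((-1) ^ k * real ((M - m) choose k))) ([:1, 1:] ^ m * (monom 1 k * [:1, 1:] ^ (M - m - k)))
         = smult (c m * ((-1) ^ k * real ((M - m) choose k))) (monom 1 k * [:1, 1:] ^ (M - k))"
        by (simp only: power_add ac_simps)
    qed
    also have "\<dots> = (\<Sum>k\<le>M. smult (c m * ((-1) ^ k * real ((M - m) choose k))) (monom 1 k * [:1, 1:] ^ (M - k)))"
      by (rule sum.mono_neutral_left) (auto simp: binomial_eq_0)
    finally show "smult (c m) ([:1, 1:] ^ m)
       = (\<Sum>k\<le>M. smult (c m * ((-1) ^ k * real ((M - m) choose k))) (monom 1 k * [:1, 1:] ^ (M - k)))" .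
  qed
  also have "\<dots> = (\<Sum>k\<le>M. smult (\<Sum>m\<le>M. c m * ((-1) ^ k * real ((M - m) choose k))) (monom 1 k * [:1, 1:] ^ (M - k)))"
    by (subst sum.swap) (simp add: smult_sum)
  also have "\<dots> = (\<Sum>k\<le>M. smult (real (expansion_coeff i e M k)) (monom 1 k * [:1, 1:] ^ (M - k)))"
    using a by (intro sum.cong refl) simp
  finally have eq: "coeff (\<Sum>m\<le>M. smult (c m) ([:1, 1:] ^ m)) s
     = coeff (\<Sum>k\<le>M. smult (real (expansion_coeff i e M k)) (monom 1 k * [:1, 1:] ^ (M - k))) s" by simp
  have "coeff (\<Sum>k\<le>M. smult (real (expansion_coeff i e M k)) (monom 1 k * [:1, 1:] ^ (M - k))) s
     = (\<Sum>k\<le>M. if k \<le> s then real (expansion_coeff i e M k) * real ((M - k) choose (s - k)) else 0)"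
    unfolding coeff_sum
    by (intro sum.cong refl) (auto simp: coeff_monom_mult coeff_one_plus_power)
  also have "\<dots> = (\<Sum>k\<le>s. real (expansion_coeff i e M k) * real ((M - k) choose (s - k)))"
    using s by (intro sum.mono_neutral_cong_right) auto
  finally have r: "coeff (\<Sum>k\<le>M. smult (real (expansion_coeff i e M k)) (monom 1 k * [:1, 1:] ^ (M - k))) s
     = (\<Sum>k\<le>s. real (expansion_coeff i e M k) * real ((M - k) choose (s - k)))" .
  have "real (n choose s) * betti_link (Suc i) (Suc M - s) (n - s)
     = (\<Sum>l<Suc M - s. c (l + s) * real ((l + s) choose s))"
    unfolding betti_link_def sum_distrib_left
  proof (intro sum.cong refl)
    fix l assume l: "l \<in> {..<Suc M - s}"
    then have le: "s \<le> l + s" "l + s \<le> n" using n by auto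
    have "(n choose (l + s)) * ((l + s) choose s) = (n choose s) * ((n - s) choose l)"
      using choose_mult[OF le] by simp
    then have c1: "real (n choose s) * real ((n - s) choose l) = real (n choose (l + s)) * real ((l + s) choose s)"
      by (simp only: of_nat_mult[symmetric])
    have e: "Suc M - s - 1 - l = M - (l + s)" "n - s - 1 - l = n - 1 - (l + s)"
      "Suc i + (Suc M - s) - 1 - l = Suc i + M - (l + s)" using l s by auto
    have "real (n choose s) * ((-1) ^ (Suc M - s - 1 - l) * real (((n - s) choose l) * ((n - s - 1 - l) choose (Suc i + (Suc M - s) - 1 - l))))
       = (real (n choose s) * real ((n - s) choose l)) * ((-1) ^ (M - (l + s)) * real ((n - 1 - (l + s)) choose (Suc i + M - (l + s))))"
      unfolding e by (simp only: of_nat_mult ac_simps)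
    also have "\<dots> = c (l + s) * real ((l + s) choose s)"
      unfolding c1 c_def by (simp only: of_nat_mult ac_simps)
    finally show "real (n choose s) * ((-1) ^ (Suc M - s - 1 - l) * real (((n - s) choose l) * ((n - s - 1 - l) choose (Suc i + (Suc M - s) - 1 - l))))
       = c (l + s) * real ((l + s) choose s)" .
  qed
  also have "\<dots> = (\<Sum>m\<in>{s..M}. c m * real (m choose s))"
    by (rule sum.reindex_bij_witness[of _ "\<lambda>m. m - s" "\<lambda>l. l + s"]) (use s in auto)
  also have "\<dots> = (\<Sum>m\<le>M. c m * real (m choose s))"
    by (rule sum.mono_neutral_left) (auto simp: binomial_eq_0)
  also have "\<dots> = coeff (\<Sum>m\<le>M. smult (c m) ([:1, 1:] ^ m)) s"
    by (simp add: coeff_sum coeff_one_plus_power)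
  finally show ?thesis using eq r by simp
qed

section \<open>Real zeros of the closed form\<close>

abbreviation cpoly :: "real poly \<Rightarrow> complex poly" where
  "cpoly \<equiv> map_poly complex_of_real"

lemma cpoly_add: "cpoly (p + q) = cpoly p + cpoly q"
  by (rule poly_eqI) (simp add: coeff_map_poly)

lemma cpoly_mult: "cpoly (p * q) = cpoly p * cpoly q"
  by (rule poly_eqI) (simp add: coeff_map_poly coeff_mult)

lemma cpoly_smult: "cpoly (smult c p) = smult (complex_of_real c) (cpoly p)"
  by (rule poly_eqI) (simp add: coeff_map_poly)

lemma cpoly_monom: "cpoly (monom c k) = monom (complex_of_real c) k"
  by (rule poly_eqI) (simp add: coeff_map_poly)

lemma cpoly_sum: "cpoly (\<Sum>x\<in>A. f x) = (\<Sum>x\<in>A. cpoly (f x))"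
  by (induction A rule: infinite_finite_induct) (simp_all add: cpoly_add)

lemma derange_reverse_complex:
  fixes z :: complex
  assumes "z \<noteq> 0"
  shows "z ^ m * poly (cpoly (derange m)) (1 / z) = poly (cpoly (derange m)) z"
proof -
  have d: "degree (cpoly (derange m)) \<le> m"
    using degree_derange[of m] by (simp add: degree_map_poly)
  have "z ^ m * poly (cpoly (derange m)) (1 / z) = (\<Sum>j\<le>m. coeff (cpoly (derange m)) j * z ^ (m - j))"
    unfolding poly_as_sum[OF d] sum_distrib_left
    using assms by (intro sum.cong refl) (simp add: power_diff power_divide field_simps)
  also have "\<dots> = (\<Sum>j\<le>m. coeff (cpoly (derange m)) (m - j) * z ^ j)"
    by (rule sum.reindex_bij_witness[of _ "\<lambda>j. m - j" "\<lambda>j. m - j"]) auto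
  also have "\<dots> = poly (cpoly (derange m)) z"
    unfolding poly_as_sum[OF d] using derange_palindromic[of m]
    by (intro sum.cong) (auto simp: coeff_map_poly)
  finally show ?thesis .
qed

text \<open>The closed form of \<open>hodge_poincare\<close>; the index \<open>s\<close> is the size of the union of the sets in
a Feichtner--Yuzvinsky monomial.\<close>

definition hodge_formula :: "nat \<Rightarrow> nat \<Rightarrow> nat \<Rightarrow> real poly" where
  "hodge_formula r n i = (\<Sum>s<r. smult (real (n choose s)) (derange s *
     (if i = 0 then (\<Sum>e<r - s. monom 1 e) else monom (betti_link i (r - s) (n - s)) (r - 1 - s))))"

text \<open>Since \<open>derange s\<close> is palindromic, the zeros different from 0 are the inverses of
those of \<open>\<Sum>\<^bsub>s<r\<^esub> (n choose s) \<beta>\<^sub>s d\<^sub>s(x)\<close>, which by \<open>betti_link_expand\<close> is a positive combination of the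
polynomials \<open>pderange\<close>.\<close>

lemma hodge_formula_pos_real_rooted:
  assumes r: "1 \<le> r" and i: "1 \<le> i" "r + i \<le> n"
    and z: "poly (cpoly (hodge_formula r n i)) z = 0"
  shows "z \<in> \<real>"
proof (cases "z = 0")
  case False
  define M where "M = r - 1"
  define e where "e = n - r - i"
  have M: "r = Suc M" "n = (i - 1) + e + M + 2" using r i by (auto simp: M_def e_def)
  have i1: "Suc (i - 1) = i" using i by simp
  let ?R = "pderange_comb M (\<lambda>k. real (expansion_coeff (i - 1) e M k))"
  have R: "?R = (\<Sum>s<r. smult (real (n choose s) * betti_link i (r - s) (n - s)) (derange s))"
    unfolding pderange_comb_expand M(1) lessThan_Suc_atMost
    using betti_link_expand[OF _ M(2), unfolded i1] by (intro sum.cong refl) (simp del: of_nat_mult)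
  have "poly (cpoly (hodge_formula r n i)) z
     = (\<Sum>s<r. complex_of_real (real (n choose s) * betti_link i (r - s) (n - s)) * (poly (cpoly (derange s)) z * z ^ (r - 1 - s)))"
    using i by (simp add: hodge_formula_def cpoly_sum cpoly_smult cpoly_mult cpoly_monom poly_sum poly_monom mult_ac)
  also have "\<dots> = (\<Sum>s<r. complex_of_real (real (n choose s) * betti_link i (r - s) (n - s)) * (z ^ M * poly (cpoly (derange s)) (1 / z)))"
  proof (intro sum.cong refl)
    fix s assume "s \<in> {..<r}"
    then have "z ^ M = z ^ (r - 1 - s) * z ^ s" by (simp add: M flip: power_add)
    then show "complex_of_real (real (n choose s) * betti_link i (r - s) (n - s)) * (poly (cpoly (derange s)) z * z ^ (r - 1 - s))
      = complex_of_real (real (n choose s) * betti_link i (r - s) (n - s)) * (z ^ M * poly (cpoly (derange s)) (1 / z))"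
      by (simp add: derange_reverse_complex[OF False, symmetric] mult_ac)
  qed
  also have "\<dots> = z ^ M * poly (cpoly ?R) (1 / z)"
    unfolding R by (simp add: cpoly_sum cpoly_smult poly_sum sum_distrib_left mult_ac)
  finally have "poly (cpoly ?R) (1 / z) = 0" using z False by simp
  then have "1 / z \<in> \<real>" by (rule pderange_comb_real_rooted[rotated]) (simp add: expansion_coeff_pos)
  then have "1 / (1 / z) \<in> \<real>" by (rule Reals_divide[OF Reals_1])
  moreover have "1 / (1 / z) = z" by simp
  ultimately show ?thesis by (simp only:)
qed simp

lemma coeff_derange_top: "0 < s \<Longrightarrow> s \<le> j \<Longrightarrow> coeff (derange s) j = 0"
  using derange_palindromic[of s] coeff_derange_Suc_0[of "s - 1"] by (cases "j = s") auto

text \<open>Multiplication by \<open>1 - x\<close> telescopes the geometric sums, and the palindromic symmetry of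
\<open>derange s\<close> turns the subtracted part into the reversal of the first one.\<close>

lemma hodge_formula_0_real_rooted:
  assumes r: "1 \<le> r" "r \<le> n" and z: "poly (cpoly (hodge_formula r n 0)) z = 0"
  shows "z \<in> \<real>"
proof -
  define M where "M = r - 1"
  have M: "r = Suc M" using r by (simp add: M_def)
  define geo where "geo s = (\<Sum>e<r - s. monom (1::real) e)" for s
  have geo: "(1 - x) * poly (geo s) x = 1 - x ^ (r - s)" for s x
    unfolding geo_def by (simp add: poly_sum poly_monom one_diff_power_eq)
  have h: "hodge_formula r n 0 = (\<Sum>s<r. smult (real (n choose s)) (derange s * geo s))"
    by (simp add: hodge_formula_def geo_def)
  have cg: "coeff (geo s) j = (if j < r - s then 1 else 0)" for s j
    unfolding geo_def by (simp add: coeff_sum sum.delta)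
  have top: "coeff (derange s * geo s) j = (if s = 0 \<and> j = M then 1 else 0)" if "M \<le> j" "s < r" for s j
  proof (cases "s = 0")
    case True
    then show ?thesis using that by (simp add: cg M)
  next
    case False
    have "coeff (derange s) l * coeff (geo s) (j - l) = 0" if "l \<le> j" for l
      using coeff_derange_top[of s l] False \<open>M \<le> j\<close> that by (cases "s \<le> l") (auto simp: cg M)
    then have "coeff (derange s * geo s) j = 0" unfolding coeff_mult by (intro sum.neutral) auto
    then show ?thesis using False by simp
  qed
  have c: "coeff (hodge_formula r n 0) j = (if j = M then 1 else 0)" if "M \<le> j" for j
  proof -
    have "coeff (hodge_formula r n 0) j = (\<Sum>s<r. if s = 0 then (if j = M then 1 else 0) else 0)"
      unfolding h coeff_sum coeff_smult using top[OF that] by (intro sum.cong refl) auto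
    then show ?thesis using r by (simp add: sum.delta)
  qed
  have d: "degree (hodge_formula r n 0) \<le> M" "coeff (hodge_formula r n 0) M = 1"
    using c by (auto intro: degree_le)
  have h0: "poly (hodge_formula r n 0) 0 = 1"
  proof -
    have "poly (hodge_formula r n 0) 0 = (\<Sum>s<r. if s = 0 then 1 else 0)"
      unfolding h poly_sum poly_smult poly_mult
      using pderange_0[of 0] r cg by (intro sum.cong refl) (auto simp: poly_0_coeff_0)
    then show ?thesis using r by (simp add: sum.delta)
  qed
  show ?thesis
  proof (cases "2 \<le> M")
    case True
    let ?a = "\<lambda>k. real ((n - r + k) choose k)"
    have Q: "pderange_comb M ?a = (\<Sum>s<r. smult (real (n choose s)) (derange s))"
      unfolding pderange_comb_expand M lessThan_Suc_atMost
    proof (intro sum.cong refl arg_cong2[where f = smult])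
      fix s assume s: "s \<in> {..M}"
      have "(\<Sum>k\<le>s. ((n - r + k) choose k) * ((M - k) choose (s - k)))
          = (\<Sum>k\<le>s. ((n - r + k) choose k) * ((M - s + (s - k)) choose (s - k)))"
        using s by (intro sum.cong refl) auto
      also have "\<dots> = n choose s"
        using sum_choose_choose[of "n - r" "M - s" s] s r M by simp
      finally have "(\<Sum>k\<le>s. ((n - r + k) choose k) * ((M - k) choose (s - k))) = n choose s" .
      then show "(\<Sum>k\<le>s. real ((n - Suc M + k) choose k) * real ((M - k) choose (s - k))) = real (n choose s)"
        unfolding M[symmetric] by (simp only: of_nat_mult[symmetric] of_nat_sum[symmetric])
    qed
    show ?thesis
    proof (rule symmetrised_pderange_comb_real_rooted[OF True _ d h0 _ z])
      show "0 < ?a k" for k by (simp add: zero_less_binomial_iff)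
      fix x :: real assume x: "x \<noteq> 0"
      have "(1 - x) * poly (hodge_formula r n 0) x
          = (\<Sum>s<r. real (n choose s) * (poly (derange s) x * ((1 - x) * poly (geo s) x)))"
        by (simp add: h poly_sum sum_distrib_left mult_ac)
      also have "\<dots> = (\<Sum>s<r. real (n choose s) * poly (derange s) x)
          - (\<Sum>s<r. real (n choose s) * (x ^ (r - s) * poly (derange s) x))"
        unfolding geo by (simp add: algebra_simps sum_subtractf)
      also have "(\<Sum>s<r. real (n choose s) * (x ^ (r - s) * poly (derange s) x))
          = (\<Sum>s<r. real (n choose s) * (x ^ r * poly (derange s) (1 / x)))"
      proof (intro sum.cong refl)
        fix s assume "s \<in> {..<r}"
        then have "x ^ r = x ^ (r - s) * x ^ s" by (simp flip: power_add)
        then show "real (n choose s) * (x ^ (r - s) * poly (derange s) x) = real (n choose s) * (x ^ r * poly (derange s) (1 / x))"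
          by (simp add: derange_reverse[OF x, symmetric] mult_ac)
      qed
      also have "(\<Sum>s<r. real (n choose s) * poly (derange s) x)
          - (\<Sum>s<r. real (n choose s) * (x ^ r * poly (derange s) (1 / x)))
          = poly (pderange_comb M ?a) x - x ^ Suc M * poly (pderange_comb M ?a) (1 / x)"
        unfolding Q M[symmetric] by (simp add: poly_sum sum_distrib_left mult_ac)
      finally show "(1 - x) * poly (hodge_formula r n 0) x
          = poly (pderange_comb M ?a) x - x ^ Suc M * poly (pderange_comb M ?a) (1 / x)" .
    qed
  next
    case False
    then have "M = 0 \<or> M = 1" by auto
    then have "has_roots (hodge_formula r n 0) M (\<lambda>_. -1)"
    proof
      assume "M = 0"
      then show ?thesis using d by (intro has_rootsI) auto
    next
      assume M1: "M = 1"
      have "hodge_formula r n 0 = [:1, 1:]"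
      proof (rule poly_eqI)
        fix j show "coeff (hodge_formula r n 0) j = coeff [:1, 1:] j"
          using c[of j] h0 M1 by (cases j) (auto simp: poly_0_coeff_0 coeff_pCons split: nat.splits)
      qed
      then show ?thesis using M1 by (intro has_rootsI) auto
    qed
    then show ?thesis using has_roots_real z by blast
  qed
qed

section \<open>Finite-dimensional subspaces\<close>

text \<open>The ambient spaces of functions are infinite-dimensional, so finiteness is required of
the subspace.\<close>

definition (in vector_space) fin_dim :: "'b set \<Rightarrow> bool" where
  "fin_dim V \<longleftrightarrow> subspace V \<and> (\<exists>B. finite B \<and> V \<subseteq> span B)"

context vector_space
begin

lemma fin_dim_basis:
  assumes "fin_dim V"
  obtains B where "finite B" "B \<subseteq> V" "independent B" "span B = V" "card B = dim V"
proof -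
  obtain W where W: "finite W" "V \<subseteq> span W" and V: "subspace V" using assms by (auto simp: fin_dim_def)
  obtain B where B: "B \<subseteq> V" "independent B" "V \<subseteq> span B" using maximal_independent_subset by blast
  have "finite B" using independent_span_bound[OF W(1) B(2)] B(1) W(2) by auto
  moreover have "span B = V" using B V by (metis span_minimal subset_antisym)
  moreover have "card B = dim V" using B basis_card_eq_dim by blast
  ultimately show ?thesis using that B by blast
qed

lemma fin_dim_mono: "fin_dim V \<Longrightarrow> subspace U \<Longrightarrow> U \<subseteq> V \<Longrightarrow> fin_dim U"
  by (auto simp: fin_dim_def)

lemma fin_dim_span: "finite B \<Longrightarrow> fin_dim (span B)"
  by (auto simp: fin_dim_def)

lemma extend_basis:
  assumes "fin_dim V" "A \<subseteq> V" "independent A"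
  obtains B where "A \<subseteq> B" "finite B" "independent B" "span B = V"
proof -
  obtain B where B: "A \<subseteq> B" "B \<subseteq> V" "independent B" "V \<subseteq> span B"
    using maximal_independent_subset_extend[OF assms(2,3)] by blast
  obtain W where W: "finite W" "V \<subseteq> span W" and V: "subspace V" using assms by (auto simp: fin_dim_def)
  have "finite B" using independent_span_bound[OF W(1) B(3)] B(2) W(2) by auto
  moreover have "span B = V" using B V by (metis span_minimal subset_antisym)
  ultimately show ?thesis using that B by blast
qed

lemma dim_mono_fin: 
  assumes "fin_dim V" "subspace U" "U \<subseteq> V"
  shows "dim U \<le> dim V"
proof -
  obtain A where A: "finite A" "A \<subseteq> U" "independent A" "span A = U" "card A = dim U"
    using fin_dim_basis[OF fin_dim_mono[OF assms]] by blast
  obtain B where B: "A \<subseteq> B" "finite B" "independent B" "span B = V"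
    using extend_basis[OF assms(1), of A] A assms(3) by blast
  have "card A \<le> card B" using B by (intro card_mono)
  also have "card B = dim V" using B dim_span_eq_card_independent by metis
  finally show ?thesis using A by simp
qed

lemma span_Int_independent:
  assumes "independent B" "A \<subseteq> B" "x \<in> span A" "x \<in> span (B - A)"
  shows "x = 0"
proof -
  have "representation B x = representation A x" "representation B x = representation (B - A) x"
    using representation_extend[OF assms(1,3,2)] representation_extend[OF assms(1,4)] by auto
  then have z: "representation A x v = 0" for v
    using representation_ne_zero[of A x v] representation_ne_zero[of "B - A" x v] by fastforce
  have "independent A" using assms(1,2) independent_mono by blast
  then have "(\<Sum>b | representation A x b \<noteq> 0. representation A x b *s b) = x"
    using assms(3) by (rule sum_nonzero_representation_eq)
  then show ?thesis by (simp add: z)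
qed

lemma independent_Un_disjoint:
  assumes "fin_dim U" "fin_dim V" "U \<inter> V = {0}"
    and A: "finite A" "independent A" "span A = U" and C: "finite C" "independent C" "span C = V"
  shows "independent (A \<union> C)" "A \<inter> C = {}"
proof -
  have AU: "A \<subseteq> U" "C \<subseteq> V" using A C span_superset by auto
  have "0 \<notin> A" using A(2) dependent_zero by blast
  show d: "A \<inter> C = {}"
  proof (rule equals0I)
    fix x assume "x \<in> A \<inter> C"
    then have "x \<in> U \<inter> V" using AU by auto
    then show False using assms(3) \<open>0 \<notin> A\<close> \<open>x \<in> A \<inter> C\<close> by auto
  qed
  have sU: "subspace U" "subspace V" using assms(1,2) by (auto simp: fin_dim_def)
  show "independent (A \<union> C)"
  proof (rule independent_if_scalars_zero)
    fix f x assume s: "(\<Sum>x\<in>A \<union> C. f x *s x) = 0" and x: "x \<in> A \<union> C"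
    have e: "(\<Sum>x\<in>A. f x *s x) + (\<Sum>x\<in>C. f x *s x) = 0"
      using s d A C by (simp add: sum.union_disjoint)
    have a: "(\<Sum>x\<in>A. f x *s x) \<in> U" using AU sU by (intro subspace_sum subspace_scale) auto
    have c: "(\<Sum>x\<in>C. f x *s x) \<in> V" using AU sU by (intro subspace_sum subspace_scale) auto
    have "(\<Sum>x\<in>A. f x *s x) = - (\<Sum>x\<in>C. f x *s x)" using e by (simp add: eq_neg_iff_add_eq_0)
    then have "(\<Sum>x\<in>A. f x *s x) \<in> V" using c sU subspace_neg by simp
    then have zA: "(\<Sum>x\<in>A. f x *s x) = 0" using a assms(3) by blast
    then have zC: "(\<Sum>x\<in>C. f x *s x) = 0" using e by simp
    show "f x = 0" using x independentD[OF A(2,1) order_refl zA] independentD[OF C(2,1) order_refl zC] by blast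
  qed (use A C in simp)
qed

text \<open>The union of bases of the two summands is a basis of the sum.\<close>

lemma dim_direct_sum:
  assumes "fin_dim U" "fin_dim V" "U \<inter> V = {0}"
  shows "dim {u + v | u v. u \<in> U \<and> v \<in> V} = dim U + dim V"
proof -
  obtain A where A: "finite A" "A \<subseteq> U" "independent A" "span A = U" "card A = dim U"
    using fin_dim_basis[OF assms(1)] by blast
  obtain C where C: "finite C" "C \<subseteq> V" "independent C" "span C = V" "card C = dim V"
    using fin_dim_basis[OF assms(2)] by blast
  note i = independent_Un_disjoint[OF assms A(1,3,4) C(1,3,4)]
  have "{u + v | u v. u \<in> U \<and> v \<in> V} = span (A \<union> C)" by (simp add: span_Un A C)
  then show ?thesis using i A C by (simp add: dim_eq_card_independent card_Un_disjoint)
qed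

end

context vector_space_pair
begin

lemma fin_dim_image:
  assumes "Vector_Spaces.linear s1 s2 f" "vs1.fin_dim V"
  shows "vs2.fin_dim (f ` V)"
proof -
  interpret f: Vector_Spaces.linear s1 s2 f by fact
  obtain B where B: "finite B" "vs1.span B = V" using vs1.fin_dim_basis[OF assms(2)] by metis
  then have "f ` V = vs2.span (f ` B)" by (simp add: f.span_image flip: B(2))
  then show ?thesis using B vs2.fin_dim_span by simp
qed

lemma dim_image_inj:
  assumes "Vector_Spaces.linear s1 s2 f" "vs1.fin_dim V" "\<And>v. v \<in> V \<Longrightarrow> f v = 0 \<Longrightarrow> v = 0"
  shows "vs2.dim (f ` V) = vs1.dim V"
proof -
  interpret f: Vector_Spaces.linear s1 s2 f by fact
  obtain B where B: "finite B" "B \<subseteq> V" "vs1.independent B" "vs1.span B = V" "card B = vs1.dim V"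
    using vs1.fin_dim_basis[OF assms(2)] by blast
  have V: "vs1.subspace V" using assms(2) by (simp add: vs1.fin_dim_def)
  have inj: "inj_on f V"
  proof (rule inj_onI)
    fix x y assume "x \<in> V" "y \<in> V" "f x = f y"
    then have "x - y \<in> V" "f (x - y) = 0" using V vs1.subspace_diff f.diff by auto
    then show "x = y" using assms(3) by force
  qed
  then have "vs2.independent (f ` B)" using f.independent_injective_image[OF B(3)] B(4) by simp
  moreover have "vs2.span (f ` B) = f ` V" using f.span_image B(4) by simp
  moreover have "card (f ` B) = card B" using inj B(2) by (intro card_image) (auto intro: inj_on_subset)
  ultimately show ?thesis using vs2.dim_span_eq_card_independent B(5) by metis
qed

text \<open>A basis of the kernel is extended to one of \<open>V\<close>; the map is injective on the span of the
added vectors.\<close>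

lemma rank_nullity:
  assumes "Vector_Spaces.linear s1 s2 f" "vs1.fin_dim V"
  shows "vs1.dim V = vs1.dim {v \<in> V. f v = 0} + vs2.dim (f ` V)"
proof -
  interpret f: Vector_Spaces.linear s1 s2 f by fact
  have V: "vs1.subspace V" using assms(2) by (simp add: vs1.fin_dim_def)
  let ?K = "{v \<in> V. f v = 0}"
  have K: "vs1.subspace ?K"
    using V by (auto simp: vs1.subspace_def f.add f.scale f.zero)
  obtain A where A: "finite A" "A \<subseteq> ?K" "vs1.independent A" "vs1.span A = ?K" "card A = vs1.dim ?K"
    using vs1.fin_dim_basis[OF vs1.fin_dim_mono[OF assms(2) K]] by blast
  obtain B where B: "A \<subseteq> B" "finite B" "vs1.independent B" "vs1.span B = V"
    using vs1.extend_basis[OF assms(2), of A] A by blast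
  let ?W = "vs1.span (B - A)"
  have W: "?W \<subseteq> V" using vs1.span_mono[of "B - A" B] B(4) by auto
  have "vs2.dim (f ` ?W) = vs1.dim ?W"
  proof (rule dim_image_inj[OF assms(1)])
    show "vs1.fin_dim ?W" using B(2) vs1.fin_dim_span by simp
    fix v assume v: "v \<in> ?W" "f v = 0"
    then have "v \<in> vs1.span A" using A(4) W by auto
    then show "v = 0" using vs1.span_Int_independent[OF B(3,1)] v(1) by blast
  qed
  also have "vs1.dim ?W = card (B - A)"
    using B(3) by (intro vs1.dim_span_eq_card_independent) (metis vs1.independent_mono Diff_subset)
  also have "f ` ?W = f ` V"
  proof
    show "f ` V \<subseteq> f ` ?W"
    proof (rule image_subsetI)
      fix v assume "v \<in> V"
      then have "v \<in> vs1.span (A \<union> (B - A))" using B(1,4) by (simp add: Un_absorb1)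
      then obtain x y where "v = x + y" "x \<in> vs1.span A" "y \<in> ?W"
        unfolding vs1.span_Un by blast
      then have "f v = f y" using A(4) f.add by auto
      then show "f v \<in> f ` ?W" using \<open>y \<in> ?W\<close> by blast
    qed
  qed (use W in auto)
  finally have "vs2.dim (f ` V) = card B - card A" using B A by (simp add: card_Diff_subset)
  moreover have "vs1.dim V = card B" using B vs1.dim_span_eq_card_independent by metis
  moreover have "card A \<le> card B" using B by (intro card_mono)
  ultimately show ?thesis using A(5) by simp
qed

end

section \<open>Spaces of rational functions\<close>

definition fscale :: "rat \<Rightarrow> ('x \<Rightarrow> rat) \<Rightarrow> 'x \<Rightarrow> rat" where
  "fscale c f = (\<lambda>x. c * f x)"

global_interpretation fs: vector_space fscale
  by unfold_locales (simp_all add: fscale_def fun_eq_iff algebra_simps)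

lemma fscale_apply: "fscale c f x = c * f x"
  by (simp add: fscale_def)

global_interpretation fsp: vector_space_pair fscale fscale
  by unfold_locales

lemma fs_linearI:
  assumes "\<And>u v. f (u + v) = f u + f v" "\<And>c v. f (fscale c v) = fscale c (f v)"
  shows "Vector_Spaces.linear fscale fscale f"
  using assms by unfold_locales (auto simp: fscale_def)

lemma fs_subspaceI:
  assumes "(\<lambda>_. 0) \<in> V" "\<And>u v. u \<in> V \<Longrightarrow> v \<in> V \<Longrightarrow> (\<lambda>x. u x + v x) \<in> V" "\<And>c v. v \<in> V \<Longrightarrow> (\<lambda>x. c * v x) \<in> V"
  shows "fs.subspace V"
  using assms by (auto simp: fs.subspace_def fscale_def zero_fun_def plus_fun_def)

lemma fs_subspaceD:
  assumes "fs.subspace V"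
  shows "(\<lambda>_. 0) \<in> V" "u \<in> V \<Longrightarrow> v \<in> V \<Longrightarrow> (\<lambda>x. u x + v x) \<in> V" "v \<in> V \<Longrightarrow> (\<lambda>x. c * v x) \<in> V"
  using fs.subspace_0[OF assms] fs.subspace_add[OF assms, of u v] fs.subspace_scale[OF assms, of v c]
  by (auto simp: fscale_def zero_fun_def plus_fun_def)

definition supported :: "'x set \<Rightarrow> ('x \<Rightarrow> rat) set" where
  "supported X = {f. \<forall>x. x \<notin> X \<longrightarrow> f x = 0}"

lemma subspace_supported: "fs.subspace (supported X)"
  by (rule fs_subspaceI) (auto simp: supported_def)

lemma dim_supported:
  assumes "finite X"
  shows "fs.fin_dim (supported X)" "fs.dim (supported X) = card X"
proof -
  define e :: "'a \<Rightarrow> 'a \<Rightarrow> rat" where "e x = (\<lambda>y. if y = x then 1 else 0)" for x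
  have inj: "inj e" by (rule injI) (auto simp: e_def fun_eq_iff split: if_splits)
  have s: "(\<Sum>x\<in>A. fscale (c x) (e x)) y = (if y \<in> A then c y else 0)" if "finite A" for A c y
    using that by (induction A rule: finite_induct) (auto simp: e_def fscale_apply)
  have ind: "fs.independent (e ` X)"
  proof (rule fs.independent_if_scalars_zero)
    fix f v assume z: "(\<Sum>v\<in>e ` X. fscale (f v) v) = 0" and "v \<in> e ` X"
    then obtain x where x: "v = e x" "x \<in> X" by auto
    have "(\<Sum>x\<in>X. fscale (f (e x)) (e x)) x = 0"
      using z inj by (subst (asm) sum.reindex) (auto intro: inj_on_subset)
    then show "f v = 0" using s[OF assms, of "\<lambda>x. f (e x)" x] x by simp
  qed (use assms in simp)
  have sp: "fs.span (e ` X) = supported X"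
  proof
    show "fs.span (e ` X) \<subseteq> supported X"
      by (rule fs.span_minimal[OF _ subspace_supported]) (auto simp: e_def supported_def)
    show "supported X \<subseteq> fs.span (e ` X)"
    proof
      fix f assume f: "f \<in> supported X"
      have "f = (\<Sum>x\<in>X. fscale (f x) (e x))"
      proof
        fix y
        show "f y = (\<Sum>x\<in>X. fscale (f x) (e x)) y" using f assms s[OF assms, of f y] by (simp add: supported_def)
      qed
      also have "\<dots> \<in> fs.span (e ` X)" by (intro fs.span_sum fs.span_scale fs.span_base) auto
      finally show "f \<in> fs.span (e ` X)" .
    qed
  qed
  show "fs.fin_dim (supported X)" using assms fs.fin_dim_span[of "e ` X"] sp by simp
  show "fs.dim (supported X) = card X"
    using fs.dim_span_eq_card_independent[OF ind] sp inj by (simp add: card_image inj_on_subset)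
qed

definition family :: "'a set \<Rightarrow> ('a \<Rightarrow> ('x \<Rightarrow> rat) set) \<Rightarrow> ('a \<times> 'x \<Rightarrow> rat) set" where
  "family A V = {w. (\<forall>a\<in>A. (\<lambda>x. w (a, x)) \<in> V a) \<and> (\<forall>a x. a \<notin> A \<longrightarrow> w (a, x) = 0)}"

text \<open>The families are a direct sum, from which one index is split off at a time.\<close>

lemma dim_family:
  fixes V :: "'a \<Rightarrow> ('x \<Rightarrow> rat) set"
  assumes "finite A" "\<And>a. a \<in> A \<Longrightarrow> fs.fin_dim (V a)"
  shows "fs.fin_dim (family A V) \<and> fs.dim (family A V) = (\<Sum>a\<in>A. fs.dim (V a))"
  using assms(1,2)
proof (induction A rule: finite_induct)
  case empty
  have "family {} V = supported {}" by (auto simp: family_def supported_def)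
  then show ?case using dim_supported[of "{}"] by simp
next
  case (insert a A)
  have sub: "(\<lambda>_. 0) \<in> V b" "u \<in> V b \<Longrightarrow> v \<in> V b \<Longrightarrow> (\<lambda>x. u x + v x) \<in> V b"
    "v \<in> V b \<Longrightarrow> (\<lambda>x. c * v x) \<in> V b" if "b \<in> insert a A" for b u v c
    using insert.prems[OF that] fs_subspaceD[of "V b"] unfolding fs.fin_dim_def by blast+
  define inc :: "('x \<Rightarrow> rat) \<Rightarrow> 'a \<times> 'x \<Rightarrow> rat" where
    "inc v = (\<lambda>(b, x). if b = a then v x else 0)" for v
  have lin: "Vector_Spaces.linear fscale fscale inc"
    by (rule fs_linearI) (auto simp: inc_def fun_eq_iff fscale_apply)
  have fa: "fs.fin_dim (V a)" using insert.prems by simp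
  have I1: "fs.fin_dim (inc ` V a)" using fsp.fin_dim_image[OF lin fa] .
  have I2: "fs.dim (inc ` V a) = fs.dim (V a)"
  proof (rule fsp.dim_image_inj[OF lin fa])
    fix v assume "inc v = 0"
    then have "inc v (a, x) = 0" for x by simp
    then show "v = 0" by (auto simp: inc_def)
  qed
  have IH: "fs.fin_dim (family A V)" "fs.dim (family A V) = (\<Sum>a\<in>A. fs.dim (V a))" using insert by auto
  have int: "inc ` V a \<inter> family A V = {0}"
  proof -
    have "inc v = 0" if "inc v \<in> family A V" for v
    proof
      fix y :: "'a \<times> 'x"
      obtain b x where y: "y = (b, x)" by (cases y)
      have "inc v (a, x) = 0" using that insert.hyps by (simp add: family_def)
      then show "inc v y = 0 y" by (auto simp: y inc_def)
    qed
    moreover have "0 \<in> inc ` V a" using I1 fs.subspace_0 by (auto simp: fs.fin_dim_def)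
    moreover have "0 \<in> family A V" using IH fs.subspace_0 by (auto simp: fs.fin_dim_def)
    ultimately show ?thesis by auto
  qed
  have sum: "{u + v | u v. u \<in> inc ` V a \<and> v \<in> family A V} = family (insert a A) V"
  proof (intro set_eqI iffI)
    fix w assume "w \<in> {u + v | u v. u \<in> inc ` V a \<and> v \<in> family A V}"
    then obtain v u where w: "w = inc v + u" "v \<in> V a" "u \<in> family A V" by auto
    have e1: "(\<lambda>x. w (a, x)) = v" using w insert.hyps by (auto simp: inc_def family_def)
    have e2: "(\<lambda>x. w (b, x)) = (\<lambda>x. u (b, x))" if "b \<noteq> a" for b using that w by (auto simp: inc_def)
    have "(\<lambda>x. w (b, x)) \<in> V b" if "b \<in> insert a A" for b
      using that w(2,3) e1 e2[of b] by (cases "b = a") (auto simp: family_def)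
    moreover have "w (b, x) = 0" if "b \<notin> insert a A" for b x
      using that w(3) e2[of b] by (auto simp: family_def fun_eq_iff)
    ultimately show "w \<in> family (insert a A) V" by (auto simp: family_def)
  next
    fix w assume w: "w \<in> family (insert a A) V"
    define u where "u = (\<lambda>(b, x). if b = a then 0 else w (b, x))"
    have "w = inc (\<lambda>x. w (a, x)) + u" by (auto simp: u_def inc_def)
    moreover have "u \<in> family A V"
    proof -
      have e: "(\<lambda>x. u (b, x)) = (\<lambda>x. w (b, x))" if "b \<noteq> a" for b using that by (auto simp: u_def)
      have "(\<lambda>x. u (b, x)) \<in> V b" if "b \<in> A" for b
      proof -
        have "b \<noteq> a" using that insert.hyps by auto
        then show ?thesis using e[of b] w that by (simp add: family_def)
      qed
      moreover have "u (b, x) = 0" if "b \<notin> A" for b x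
        using that w by (auto simp: u_def family_def)
      ultimately show ?thesis by (auto simp: family_def)
    qed
    moreover have "(\<lambda>x. w (a, x)) \<in> V a" using w by (simp add: family_def)
    ultimately show "w \<in> {u + v | u v. u \<in> inc ` V a \<and> v \<in> family A V}" by blast
  qed
  have "fs.dim (family (insert a A) V) = fs.dim (V a) + (\<Sum>a\<in>A. fs.dim (V a))"
    using fs.dim_direct_sum[OF I1 IH(1) int] sum I2 IH(2) by simp
  moreover have "fs.fin_dim (family (insert a A) V)"
  proof -
    obtain B C where "finite B" "fs.span B = inc ` V a" "finite C" "fs.span C = family A V"
      using fs.fin_dim_basis[OF I1] fs.fin_dim_basis[OF IH(1)] by metis
    then have "family (insert a A) V = fs.span (B \<union> C)" "finite (B \<union> C)" unfolding sum[symmetric] fs.span_Un by auto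
    then show ?thesis using fs.fin_dim_span[of "B \<union> C"] by (simp only:)
  qed
  ultimately show ?case using insert.hyps by simp
qed

section \<open>Exterior powers of the dual lattice space as a kernel\<close>

text \<open>The rational number that \<open>sgn_ins\<close> embeds into the polynomial ring.\<close>

definition ins_sign :: "nat set \<Rightarrow> nat \<Rightarrow> rat" where
  "ins_sign S t = (-1) ^ card {u \<in> S. u < t}"

lemma sgn_ins_ins_sign: "sgn_ins S t = Poly_Mapping.single 0 (ins_sign S t)"
proof -
  have "(-1) ^ k = Poly_Mapping.single (0::monomial) ((-1::rat) ^ k)" for k
    by (induction k) (simp_all add: single_uminus)
  then show ?thesis by (simp add: sgn_ins_def ins_sign_def)
qed

lemma single_0_eq_iff: "Poly_Mapping.single (0::monomial) (a::rat) = Poly_Mapping.single 0 b \<longleftrightarrow> a = b"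
  by (metis lookup_single_eq)

lemma ins_sign_square: "ins_sign S t * ins_sign S t = 1"
  by (simp add: ins_sign_def flip: power_add mult_2)

lemma ins_sign_square_left: "ins_sign S t * (ins_sign S t * x) = x"
  by (simp add: ins_sign_square flip: mult.assoc)

lemma ins_sign_nz: "ins_sign S t \<noteq> 0"
  by (simp add: ins_sign_def)

lemma ins_sign_swap:
  assumes "t \<notin> S" "s \<in> S"
  shows "ins_sign S t * ins_sign (insert t S - {s}) s = - (ins_sign (S - {s}) s * ins_sign (S - {s}) t)"
  using sgn_ins_swap[OF assms]
  by (simp only: sgn_ins_ins_sign mult_single single_uminus[symmetric] add_0_left single_0_eq_iff)

lemma ins_sign_insert_swap:
  assumes "t \<notin> S" "u \<notin> S" "t \<noteq> u"
  shows "ins_sign S t * ins_sign (insert t S) u = - (ins_sign S u * ins_sign (insert u S) t)"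
proof -
  have e: "insert t (insert u S) - {u} = insert t S" "insert u S - {u} = S" using assms by auto
  have a: "ins_sign (insert u S) t * ins_sign (insert t S) u = - (ins_sign S u * ins_sign S t)"
    using ins_sign_swap[of t "insert u S" u] assms unfolding e by simp
  have "ins_sign S t * ins_sign (insert t S) u = ins_sign S t * ins_sign (insert u S) t * (ins_sign (insert u S) t * ins_sign (insert t S) u)"
    using ins_sign_square[of "insert u S" t] by simp
  also have "\<dots> = - (ins_sign S t * ins_sign S t) * (ins_sign S u * ins_sign (insert u S) t)" unfolding a by simp
  finally show ?thesis by (simp add: ins_sign_square)
qed

lemma sum_antisymmetric:
  fixes f :: "nat \<Rightarrow> nat \<Rightarrow> rat"
  assumes "finite A" "\<And>t u. t \<in> A \<Longrightarrow> u \<in> A \<Longrightarrow> t \<noteq> u \<Longrightarrow> f t u = - f u t"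
  shows "(\<Sum>t\<in>A. \<Sum>u\<in>A - {t}. f t u) = 0"
proof -
  let ?g = "\<lambda>t u. if t = u then 0 else f t u"
  have "(\<Sum>t\<in>A. \<Sum>u\<in>A. ?g t u) = (\<Sum>u\<in>A. \<Sum>t\<in>A. ?g t u)" by (rule sum.swap)
  also have "\<dots> = (\<Sum>u\<in>A. \<Sum>t\<in>A. - ?g u t)"
  proof (intro sum.cong refl)
    fix u t assume "u \<in> A" "t \<in> A"
    then show "?g t u = - ?g u t" using assms(2)[of t u] by auto
  qed
  finally have "(\<Sum>t\<in>A. \<Sum>u\<in>A. ?g t u) = 0" by (simp add: sum_negf)
  moreover have "(\<Sum>u\<in>A. ?g t u) = (\<Sum>u\<in>A - {t}. f t u)" if "t \<in> A" for t
    using assms(1) that by (subst sum.remove[of A t]) (auto intro!: sum.cong)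
  ultimately show ?thesis by simp
qed

text \<open>The interior product with \<open>e\<^sub>1 + \<dots> + e\<^sub>n\<close>.  The dual lattice space consists of the
functionals that vanish on this vector, so its exterior powers lie in the kernel.\<close>

definition contraction :: "nat \<Rightarrow> form \<Rightarrow> form" where
  "contraction n w = (\<lambda>S. \<Sum>t\<in>{1..n} - S. sgn_ins S t * w (insert t S))"

lemma contraction_add: "contraction n (u + v) = contraction n u + contraction n v"
  by (simp add: contraction_def fun_eq_iff algebra_simps sum.distrib)

lemma contraction_pscale: "contraction n (pscale p w) = pscale p (contraction n w)"
  by (simp add: contraction_def pscale_def fun_eq_iff sum_distrib_left mult_ac)

lemma contraction_zero: "contraction n 0 = 0"
  by (simp add: contraction_def fun_eq_iff)

text \<open>The contraction is an antiderivation, and the functional \<open>m\<close> pairs to zero with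
\<open>e\<^sub>1 + \<dots> + e\<^sub>n\<close>.\<close>

lemma contraction_wedge:
  assumes m: "m \<in> dualN n" and w: "contraction n w = 0"
  shows "contraction n (wedge n m w) = 0"
proof
  fix S
  define c where "c t = Poly_Mapping.single (0::monomial) (m t)" for t
  let ?N = "{1..n}"
  have w0: "(\<Sum>t\<in>?N - S. sgn_ins S t * w (insert t S)) = 0" for S
    using fun_cong[OF w, of S] by (simp add: contraction_def)
  have "contraction n (wedge n m w) S = (\<Sum>t\<in>?N - S. \<Sum>s\<in>insert t S \<inter> ?N. sgn_ins S t * (sgn_ins (insert t S - {s}) s * c s * w (insert t S - {s})))"
    unfolding contraction_def wedge_def c_def sum_distrib_left by (rule refl)
  also have "\<dots> = (\<Sum>t\<in>?N - S. c t * w S + (\<Sum>s\<in>S \<inter> ?N. - (sgn_ins (S - {s}) s * c s * (sgn_ins (S - {s}) t * w (insert t (S - {s}))))))"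
  proof (rule sum.cong[OF refl])
    fix t assume t: "t \<in> ?N - S"
    have e: "insert t S \<inter> ?N = insert t (S \<inter> ?N)" "insert t S - {t} = S" using t by auto
    have "sgn_ins S t * (sgn_ins (insert t S - {s}) s * c s * w (insert t S - {s}))
       = - (sgn_ins (S - {s}) s * c s * (sgn_ins (S - {s}) t * w (insert t (S - {s}))))" if s: "s \<in> S \<inter> ?N" for s
    proof -
      have eq: "insert t S - {s} = insert t (S - {s})" using s t by auto
      have sw: "sgn_ins S t * sgn_ins (insert t S - {s}) s = - (sgn_ins (S - {s}) s * sgn_ins (S - {s}) t)"
        using s t by (intro sgn_ins_swap) auto
      have "sgn_ins S t * (sgn_ins (insert t S - {s}) s * c s * w (insert t S - {s}))
         = (sgn_ins S t * sgn_ins (insert t S - {s}) s) * (c s * w (insert t S - {s}))" by (simp only: mult.assoc)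
      also have "\<dots> = - (sgn_ins (S - {s}) s * sgn_ins (S - {s}) t) * (c s * w (insert t (S - {s})))"
        unfolding sw unfolding eq by (rule refl)
      finally show ?thesis by (simp add: mult_ac)
    qed
    then have "(\<Sum>s\<in>S \<inter> ?N. sgn_ins S t * (sgn_ins (insert t S - {s}) s * c s * w (insert t S - {s})))
       = (\<Sum>s\<in>S \<inter> ?N. - (sgn_ins (S - {s}) s * c s * (sgn_ins (S - {s}) t * w (insert t (S - {s})))))"
      by (intro sum.cong refl)
    moreover have "sgn_ins S t * (sgn_ins (insert t S - {t}) t * c t * w (insert t S - {t})) = c t * w S"
      unfolding e(2) using sgn_ins_square[of S t] by (simp only: mult.assoc[symmetric] mult_1)
    moreover have "t \<notin> S \<inter> ?N" "finite (S \<inter> ?N)" using t by auto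
    ultimately show "(\<Sum>s\<in>insert t S \<inter> ?N. sgn_ins S t * (sgn_ins (insert t S - {s}) s * c s * w (insert t S - {s})))
       = c t * w S + (\<Sum>s\<in>S \<inter> ?N. - (sgn_ins (S - {s}) s * c s * (sgn_ins (S - {s}) t * w (insert t (S - {s})))))"
      unfolding e(1) by (simp only: sum.insert if_False simp_thms)
  qed
  also have "\<dots> = (\<Sum>t\<in>?N - S. c t * w S) - (\<Sum>s\<in>S \<inter> ?N. sgn_ins (S - {s}) s * c s * (\<Sum>t\<in>?N - S. sgn_ins (S - {s}) t * w (insert t (S - {s}))))"
    unfolding sum.distrib sum_distrib_left sum_negf by (subst sum.swap) simp
  also have "\<dots> = (\<Sum>t\<in>?N - S. c t * w S) - (\<Sum>s\<in>S \<inter> ?N. - (c s * w S))"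
  proof -
    have "sgn_ins (S - {s}) s * c s * (\<Sum>t\<in>?N - S. sgn_ins (S - {s}) t * w (insert t (S - {s}))) = - (c s * w S)"
      if s: "s \<in> S \<inter> ?N" for s
    proof -
      have "?N - (S - {s}) = insert s (?N - S)" "insert s (S - {s}) = S" using s by auto
      then have "sgn_ins (S - {s}) s * w S + (\<Sum>t\<in>?N - S. sgn_ins (S - {s}) t * w (insert t (S - {s}))) = 0"
        using w0[of "S - {s}"] s by simp
      then have "(\<Sum>t\<in>?N - S. sgn_ins (S - {s}) t * w (insert t (S - {s}))) = - (sgn_ins (S - {s}) s * w S)"
        by (simp add: eq_neg_iff_add_eq_0 add.commute)
      then have "sgn_ins (S - {s}) s * c s * (\<Sum>t\<in>?N - S. sgn_ins (S - {s}) t * w (insert t (S - {s})))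
        = - ((sgn_ins (S - {s}) s * sgn_ins (S - {s}) s) * (c s * w S))" by (simp add: mult_ac)
      then show ?thesis by (simp only: sgn_ins_square mult_1)
    qed
    then show ?thesis by simp
  qed
  also have "\<dots> = (\<Sum>t\<in>?N. c t) * w S"
  proof -
    have "?N = (?N - S) \<union> (S \<inter> ?N)" by auto
    then have "(\<Sum>t\<in>?N. c t * w S) = (\<Sum>t\<in>(?N - S) \<union> (S \<inter> ?N). c t * w S)" by simp
    also have "\<dots> = (\<Sum>t\<in>?N - S. c t * w S) + (\<Sum>s\<in>S \<inter> ?N. c s * w S)"
      by (rule sum.union_disjoint) auto
    finally show ?thesis by (simp add: sum_distrib_right sum_negf)
  qed
  also have "(\<Sum>t\<in>?N. c t) = 0"
    unfolding c_def sum_single using m by (simp add: dualN_def)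
  finally show "contraction n (wedge n m w) S = 0 S" by simp
qed

lemma wedges_supported: "w = wedges n ms \<Longrightarrow> w S \<noteq> 0 \<Longrightarrow> S \<subseteq> {1..n} \<and> card S = length ms"
proof (induction ms arbitrary: w S)
  case Nil
  then show ?case by (auto simp: wedges_def one_form_def split: if_splits)
next
  case (Cons m ms)
  have "wedges n (m # ms) S = (\<Sum>t\<in>S \<inter> {1..n}. sgn_ins (S - {t}) t * Poly_Mapping.single 0 (m t) * wedges n ms (S - {t}))"
    by (simp add: wedges_def wedge_def)
  then have "(\<Sum>t\<in>S \<inter> {1..n}. sgn_ins (S - {t}) t * Poly_Mapping.single 0 (m t) * wedges n ms (S - {t})) \<noteq> 0"
    using Cons.prems by simp
  then obtain t where t: "t \<in> S \<inter> {1..n}"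
    "sgn_ins (S - {t}) t * Poly_Mapping.single 0 (m t) * wedges n ms (S - {t}) \<noteq> 0"
    by (rule sum.not_neutral_contains_not_neutral)
  then have "wedges n ms (S - {t}) \<noteq> 0" by auto
  then have s: "S - {t} \<subseteq> {1..n}" "card (S - {t}) = length ms" using Cons.IH[OF refl] by auto
  then have "S \<subseteq> {1..n}" using t by auto
  moreover from this have "finite S" by (rule finite_subset) simp
  ultimately show ?case using s(2) t(1) card_Suc_Diff1[of S t] by simp
qed

lemma contraction_wedges: "set ms \<subseteq> dualN n \<Longrightarrow> contraction n (wedges n ms) = 0"
proof (induction ms)
  case Nil
  show ?case by (simp add: wedges_def contraction_def one_form_def fun_eq_iff)
next
  case (Cons m ms)
  have "wedges n (m # ms) = wedge n m (wedges n ms)" by (simp add: wedges_def)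
  moreover have "contraction n (wedge n m (wedges n ms)) = 0" using Cons by (intro contraction_wedge) auto
  ultimately show ?case by (simp only:)
qed

text \<open>The contraction at \<open>S - {z}\<close> contains the coordinate at \<open>S\<close>, and all its other
terms belong to sets without \<open>z\<close>.\<close>

lemma contraction_determined:
  assumes w: "contraction n w = 0" and z: "z \<in> {1..n}" "\<And>S. z \<notin> S \<Longrightarrow> w S = 0"
  shows "w = 0"
proof
  fix S
  show "w S = 0 S"
  proof (cases "z \<in> S")
    case True
    define S0 where "S0 = S - {z}"
    have S: "S = insert z S0" "z \<notin> S0" using True by (auto simp: S0_def)
    have "0 = (\<Sum>t\<in>{1..n} - S0. sgn_ins S0 t * w (insert t S0))"
      using fun_cong[OF w, of S0] by (simp add: contraction_def)
    also have "\<dots> = sgn_ins S0 z * w S + (\<Sum>t\<in>{1..n} - S0 - {z}. sgn_ins S0 t * w (insert t S0))"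
      using z(1) S by (subst sum.remove[of _ z]) auto
    also have "(\<Sum>t\<in>{1..n} - S0 - {z}. sgn_ins S0 t * w (insert t S0)) = 0"
      using z(2) S(2) by (intro sum.neutral) auto
    finally have "sgn_ins S0 z * (sgn_ins S0 z * w S) = 0" by simp
    then show ?thesis by (simp add: sgn_ins_square flip: mult.assoc)
  qed (use z in simp)
qed

definition coeff_space :: "flat_poly set \<Rightarrow> bool" where
  "coeff_space A \<longleftrightarrow> 0 \<in> A \<and> (\<forall>p\<in>A. \<forall>q\<in>A. p + q \<in> A) \<and> (\<forall>c. \<forall>p\<in>A. Poly_Mapping.single 0 c * p \<in> A)"

text \<open>The kernel of the contraction, with coefficients in \<open>A\<close>, in exterior degree \<open>i\<close>.\<close>

definition forms :: "nat \<Rightarrow> flat_poly set \<Rightarrow> nat \<Rightarrow> form set" where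
  "forms n A i = {w. (\<forall>S. w S \<in> A) \<and> (\<forall>S. w S \<noteq> 0 \<longrightarrow> S \<subseteq> {1..n} \<and> card S = i) \<and> contraction n w = 0}"

lemma forms_subspace:
  assumes "coeff_space A"
  shows "form.subspace (forms n A i)"
proof (rule form.subspaceI)
  show "0 \<in> forms n A i" using assms by (simp add: forms_def coeff_space_def contraction_zero)
  show "u + v \<in> forms n A i" if u: "u \<in> forms n A i" and v: "v \<in> forms n A i" for u v
    unfolding forms_def
  proof (intro CollectI conjI allI impI)
    fix S
    show "(u + v) S \<in> A" using u v assms by (simp add: forms_def coeff_space_def)
    assume "(u + v) S \<noteq> 0"
    then have "u S \<noteq> 0 \<or> v S \<noteq> 0" by auto
    then show "S \<subseteq> {1..n}" "card S = i" using u v unfolding forms_def by blast+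
  next
    show "contraction n (u + v) = 0" unfolding contraction_add using u v by (simp add: forms_def)
  qed
  show "rscale c u \<in> forms n A i" if u: "u \<in> forms n A i" for c u
    unfolding forms_def
  proof (intro CollectI conjI allI impI)
    fix S
    show "rscale c u S \<in> A" using u assms by (simp add: forms_def coeff_space_def rscale_def)
    assume "rscale c u S \<noteq> 0"
    then have "u S \<noteq> 0" by (auto simp: rscale_def)
    then show "S \<subseteq> {1..n}" "card S = i" using u unfolding forms_def by blast+
  next
    have "contraction n u = 0" using u by (simp add: forms_def)
    then have "contraction n (rscale c u) = pscale (Poly_Mapping.single 0 c) 0" unfolding rscale_eq_pscale contraction_pscale by (rule arg_cong)
    then show "contraction n (rscale c u) = 0" by (simp add: pscale_def fun_eq_iff)
  qed
qed

text \<open>The functional \<open>\<ell>\<^sub>s - \<ell>\<^sub>1\<close>; those with \<open>s \<ge> 2\<close> form a basis of the dual lattice space.\<close>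

definition eta :: "nat \<Rightarrow> nat \<Rightarrow> rat" where
  "eta s = (\<lambda>t. (if t = s then 1 else 0) - (if t = 1 then 1 else 0))"

lemma eta_dualN: "s \<in> {1..n} \<Longrightarrow> eta s \<in> dualN n"
  by (auto simp: dualN_def eta_def sum_subtractf)

text \<open>At sets that avoid 1 the terms \<open>\<ell>\<^sub>1\<close> do not contribute, so there the products of the
\<open>\<ell>\<^sub>s - \<ell>\<^sub>1\<close> look like coordinate vectors.\<close>

lemma wedges_eta:
  assumes "sorted_wrt (<) xs" "set xs \<subseteq> {2..n}" "1 \<notin> S"
  shows "wedges n (map eta xs) S = (if S = set xs then 1 else 0)"
  using assms
proof (induction xs arbitrary: S)
  case Nil
  then show ?case by (simp add: wedges_def one_form_def)
next
  case (Cons x xs)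
  have IH: "wedges n (map eta xs) T = (if T = set xs then 1 else 0)" if "1 \<notin> T" for T
    using Cons that by simp
  have "wedges n (map eta (x # xs)) S
     = (\<Sum>t\<in>S \<inter> {1..n}. sgn_ins (S - {t}) t * Poly_Mapping.single 0 (eta x t) * wedges n (map eta xs) (S - {t}))"
    by (simp add: wedges_def wedge_def)
  also have "\<dots> = (\<Sum>t\<in>S \<inter> {1..n}. if t = x then sgn_ins (S - {x}) x * wedges n (map eta xs) (S - {x}) else 0)"
    using Cons.prems by (intro sum.cong refl) (auto simp: eta_def)
  also have "\<dots> = (if x \<in> S then sgn_ins (S - {x}) x * wedges n (map eta xs) (S - {x}) else 0)"
    using Cons.prems by (subst sum.delta) auto
  also have "\<dots> = (if S = set (x # xs) then 1 else 0)"
  proof (cases "x \<in> S \<and> S - {x} = set xs")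
    case True
    then have "{u \<in> S - {x}. u < x} = {}" using Cons.prems by auto
    then have "sgn_ins (S - {x}) x = 1" unfolding sgn_ins_def by (simp only: card.empty power_0)
    then show ?thesis using True IH[of "S - {x}"] Cons.prems by auto
  next
    case False
    moreover have "x \<notin> set xs" using Cons.prems by auto
    ultimately have "S \<noteq> set (x # xs)" by auto
    then show ?thesis using False IH[of "S - {x}"] Cons.prems by auto
  qed
  finally show ?case .
qed

text \<open>An element of the kernel is determined by its coordinates at sets that avoid 1
(\<open>contraction_determined\<close>), and products of the functionals \<open>\<ell>\<^sub>s - \<ell>\<^sub>1\<close> attain all such coordinates
(\<open>wedges_eta\<close>).  This replaces a span by a condition that can be checked coordinatewise.\<close>

theorem tens_eq_forms:
  assumes A: "coeff_space A" and n: "1 \<le> n"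
  shows "tens n A i = forms n A i"
proof
  show "tens n A i \<subseteq> forms n A i"
    unfolding tens_def
  proof (rule form.span_minimal[OF _ forms_subspace[OF A]], clarify)
    fix p ms assume p: "p \<in> A" and ms: "set ms \<subseteq> dualN n"
    obtain c where c: "wedges n ms = (\<lambda>S. if S \<subseteq> {1..n} then Poly_Mapping.single 0 (c S) else 0)"
      using wedges_coordinates[of n ms] ..
    have "pscale p (wedges n ms) S \<in> A" for S
      using p A by (auto simp: pscale_def c coeff_space_def mult.commute[of p])
    moreover have "S \<subseteq> {1..n} \<and> card S = length ms" if "pscale p (wedges n ms) S \<noteq> 0" for S
    proof -
      have "wedges n ms S \<noteq> 0" using that by (auto simp: pscale_def)
      then show ?thesis using wedges_supported[OF refl] by blast
    qed
    moreover have "contraction n (pscale p (wedges n ms)) = 0"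
      unfolding contraction_pscale contraction_wedges[OF ms] by (simp add: pscale_def fun_eq_iff)
    ultimately show "pscale p (wedges n ms) \<in> forms n A (length ms)" by (simp add: forms_def)
  qed
  show "forms n A i \<subseteq> tens n A i"
  proof
    fix w assume w: "w \<in> forms n A i"
    let ?I = "{S. S \<subseteq> {2..n} \<and> card S = i}"
    define E where "E S = wedges n (map eta (sorted_list_of_set S))" for S
    define v where "v = (\<Sum>S\<in>?I. pscale (w S) (E S))"
    have fin: "finite ?I" by (rule finite_subset[of _ "Pow {2..n}"]) auto
    have mem: "pscale (w S) (E S) \<in> tens n A i" if "S \<in> ?I" for S
    proof -
      have S: "finite S" using that finite_subset[of S "{2..n}"] by auto
      have "set (map eta (sorted_list_of_set S)) \<subseteq> dualN n"
      proof -
        have "eta s \<in> dualN n" if "s \<in> S" for s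
          using that \<open>S \<in> ?I\<close> by (intro eta_dualN) auto
        then show ?thesis using S by auto
      qed
      then show ?thesis using w that S unfolding E_def
        by (intro tens_base) (auto simp: forms_def)
    qed
    have v: "v \<in> tens n A i"
      unfolding v_def using mem by (intro form.subspace_sum[OF tens_subspace]) auto
    have E: "E S T = (if T = S then 1 else 0)" if "S \<in> ?I" "1 \<notin> T" for S T
    proof -
      have S: "finite S" using that finite_subset[of S "{2..n}"] by auto
      then show ?thesis unfolding E_def using that
        by (subst wedges_eta) (auto simp: strict_sorted_iff)
    qed
    have "w - v = 0"
    proof (rule contraction_determined[of n _ 1])
      have "v \<in> forms n A i" using v \<open>tens n A i \<subseteq> forms n A i\<close> by blast
      then have "w - v \<in> forms n A i" using w form.subspace_diff[OF forms_subspace[OF A]] by blast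
      then show "contraction n (w - v) = 0" by (simp add: forms_def)
      show "1 \<in> {1..n}" using n by simp
      fix T :: "nat set" assume T: "1 \<notin> T"
      have sum_fun: "(\<Sum>x\<in>B. f x) T = (\<Sum>x\<in>B. f x T)" for f :: "'x \<Rightarrow> form" and B
        by (induction B rule: infinite_finite_induct) auto
      have "v T = (\<Sum>S\<in>?I. if T = S then w S else 0)"
        unfolding v_def sum_fun
      proof (rule sum.cong[OF refl])
        fix S assume "S \<in> ?I"
        then show "pscale (w S) (E S) T = (if T = S then w S else 0)" using E[OF _ T] by (simp add: pscale_def)
      qed
      also have "\<dots> = (if T \<in> ?I then w T else 0)" using fin by (simp add: sum.delta)
      also have "\<dots> = w T"
      proof -
        have "T \<in> ?I" if "w T \<noteq> 0"
        proof -
          have "T \<subseteq> {1..n}" "card T = i" using w that by (auto simp: forms_def)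
          moreover have "t \<ge> 2" if "t \<in> T" for t
            using T that \<open>T \<subseteq> {1..n}\<close> by (cases "t = 0 \<or> t = 1") auto
          ultimately show ?thesis by auto
        qed
        then show ?thesis by auto
      qed
      finally show "(w - v) T = 0" by simp
    qed
    then have "w = v" by simp
    then show "w \<in> tens n A i" using v by simp
  qed
qed

section \<open>The Koszul complex of a truncated polynomial ring\<close>

text \<open>Fix \<open>F \<subseteq> {1..n}\<close>.  The truncated polynomial ring has as basis the monomials \<open>\<theta>\<^sup>b\<close> with
\<open>card (supp b \<union> F) < r\<close>; a product with a larger support is zero.  A monomial is represented by its
exponent function \<open>b\<close>, and an element of the Koszul complex by its coordinates at pairs \<open>(S, b)\<close>,
standing for \<open>\<theta>\<^sup>b \<otimes> \<ell>\<^sub>S\<close>.\<close>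

text \<open>The interior product with \<open>e\<^sub>t\<close> on rational coordinates.\<close>

definition contract :: "nat \<Rightarrow> (nat set \<Rightarrow> rat) \<Rightarrow> nat set \<Rightarrow> rat" where
  "contract t v S = (if t \<in> S then 0 else ins_sign S t * v (insert t S))"

text \<open>Left multiplication by \<open>\<ell>\<^sub>g\<close> on rational coordinates.\<close>

definition wedge_basis :: "nat \<Rightarrow> (nat set \<Rightarrow> rat) \<Rightarrow> nat set \<Rightarrow> rat" where
  "wedge_basis g v S = (if g \<in> S then ins_sign (S - {g}) g * v (S - {g}) else 0)"

lemma contract_wedge_basis: "contract t (wedge_basis g v) S = (if t = g then v S else 0) - wedge_basis g (contract t v) S"
proof (cases "t \<in> S")
  case True
  then show ?thesis by (auto simp: contract_def wedge_basis_def insert_absorb ins_sign_square_left)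
next
  case t: False
  show ?thesis
  proof (cases "t = g")
    case True
    then show ?thesis using t by (auto simp: contract_def wedge_basis_def ins_sign_square_left)
  next
    case False
    show ?thesis
    proof (cases "g \<in> S")
      case True
      have "insert t S - {g} = insert t (S - {g})" using False by auto
      then have "ins_sign S t * (ins_sign (insert t S - {g}) g * v (insert t S - {g}))
        = (ins_sign S t * ins_sign (insert t S - {g}) g) * v (insert t (S - {g}))" by simp
      also have "\<dots> = - (ins_sign (S - {g}) g * (ins_sign (S - {g}) t * v (insert t (S - {g}))))"
        using ins_sign_swap[OF t True] by simp
      finally show ?thesis using True False t by (simp add: contract_def wedge_basis_def)
    qed (use False t in \<open>auto simp: contract_def wedge_basis_def\<close>)
  qed
qed

lemma contract_contract: "contract t (contract u v) S = - contract u (contract t v) S"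
proof (cases "t = u \<or> t \<in> S \<or> u \<in> S")
  case False
  have "ins_sign S t * (ins_sign (insert t S) u * v (insert u (insert t S)))
      = (ins_sign S t * ins_sign (insert t S) u) * v (insert u (insert t S))" by simp
  also have "\<dots> = - (ins_sign S u * (ins_sign (insert u S) t * v (insert t (insert u S))))"
    using ins_sign_insert_swap[of t S u] False by (simp add: insert_commute)
  finally show ?thesis using False by (simp add: contract_def)
qed (auto simp: contract_def)

lemma contract_sum: "contract t (\<lambda>U. \<Sum>x\<in>A. f x U) S = (\<Sum>x\<in>A. contract t (f x) S)"
  by (simp add: contract_def sum_distrib_left)

lemma contract_scale: "contract t (\<lambda>U. c * v U) S = c * contract t v S"
  by (simp add: contract_def)

lemma contract_add: "contract t (\<lambda>U. u U + v U) S = contract t u S + contract t v S"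
  by (simp add: contract_def algebra_simps)

lemma contract_diff: "contract t (\<lambda>U. u U - v U) S = contract t u S - contract t v S"
  by (simp add: contract_def algebra_simps)

lemma contract_0: "contract t (\<lambda>U. 0) S = 0"
  by (simp add: contract_def)

lemma wedge_basis_sum: "wedge_basis t (\<lambda>U. \<Sum>x\<in>A. f x U) S = (\<Sum>x\<in>A. wedge_basis t (f x) S)"
  by (simp add: wedge_basis_def sum_distrib_left)

lemma wedge_basis_scale: "wedge_basis t (\<lambda>U. c * v U) S = c * wedge_basis t v S"
  by (simp add: wedge_basis_def)

lemma wedge_basis_0: "wedge_basis t (\<lambda>U. 0) S = 0"
  by (simp add: wedge_basis_def)

lemma contract_determined:
  assumes "\<And>S. (\<Sum>t\<in>{1..n}. contract t v S) = 0" "z \<in> {1..n}" "\<And>S. z \<notin> S \<Longrightarrow> v S = 0"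
  shows "v S = 0"
proof (cases "z \<in> S")
  case True
  define U where "U = S - {z}"
  have S: "S = insert z U" "z \<notin> U" using True by (auto simp: U_def)
  have "contract t v U = 0" if "t \<noteq> z" for t using that assms(3)[of "insert t U"] S by (simp add: contract_def)
  then have "(\<Sum>t\<in>{1..n}. contract t v U) = contract z v U"
    using assms(2) by (subst sum.remove[of _ z]) (auto intro!: sum.neutral)
  then show ?thesis using assms(1)[of U] S by (simp add: contract_def ins_sign_nz)
qed (use assms in simp)

definition supp :: "(nat \<Rightarrow> nat) \<Rightarrow> nat set" where
  "supp b = {t. b t \<noteq> 0}"

definition deg :: "nat \<Rightarrow> (nat \<Rightarrow> nat) \<Rightarrow> nat" where
  "deg n b = (\<Sum>t\<in>{1..n}. b t)"

definition dec :: "(nat \<Rightarrow> nat) \<Rightarrow> nat \<Rightarrow> nat \<Rightarrow> nat" where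
  "dec b t = b(t := b t - 1)"

definition inc :: "(nat \<Rightarrow> nat) \<Rightarrow> nat \<Rightarrow> nat \<Rightarrow> nat" where
  "inc b t = b(t := Suc (b t))"

definition admissible :: "nat \<Rightarrow> nat \<Rightarrow> nat set \<Rightarrow> (nat \<Rightarrow> nat) \<Rightarrow> bool" where
  "admissible n r F b \<longleftrightarrow> supp b \<subseteq> {1..n} \<and> card (supp b \<union> F) < r"

definition admissible_exps :: "nat \<Rightarrow> nat \<Rightarrow> nat set \<Rightarrow> nat \<Rightarrow> (nat \<Rightarrow> nat) set" where
  "admissible_exps n r F k = {b. admissible n r F b \<and> deg n b = k}"

lemma deg_dec: "t \<in> {1..n} \<Longrightarrow> b t \<noteq> 0 \<Longrightarrow> Suc (deg n (dec b t)) = deg n b"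
proof -
  assume t: "t \<in> {1..n}" and b: "b t \<noteq> 0"
  have "(\<Sum>s\<in>{1..n} - {t}. dec b t s) = (\<Sum>s\<in>{1..n} - {t}. b s)"
    by (rule sum.cong) (auto simp: dec_def)
  then show ?thesis using t b unfolding deg_def by (subst (1 2) sum.remove[of _ t]) (auto simp: dec_def)
qed

lemma deg_inc: "t \<in> {1..n} \<Longrightarrow> deg n (inc b t) = Suc (deg n b)"
proof -
  assume t: "t \<in> {1..n}"
  have "(\<Sum>s\<in>{1..n} - {t}. inc b t s) = (\<Sum>s\<in>{1..n} - {t}. b s)"
    by (rule sum.cong) (auto simp: inc_def)
  then show ?thesis using t unfolding deg_def by (subst (1 2) sum.remove[of _ t]) (auto simp: inc_def)
qed

lemma admissible_mono:
  assumes "admissible n r F b" "supp b' \<subseteq> supp b" "F \<subseteq> {1..n}"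
  shows "admissible n r F b'"
proof -
  have "supp b \<union> F \<subseteq> {1..n}" using assms by (auto simp: admissible_def)
  then have "finite (supp b \<union> F)" by (rule finite_subset) simp
  then have "card (supp b' \<union> F) \<le> card (supp b \<union> F)" using assms(2) by (intro card_mono) auto
  then show ?thesis using assms by (auto simp: admissible_def)
qed

lemma supp_dec: "supp (dec b t) \<subseteq> supp b"
  by (auto simp: supp_def dec_def split: if_splits)

lemma supp_inc: "supp (inc b t) = insert t (supp b)"
  by (auto simp: supp_def inc_def)

lemma inc_dec_same: "b t \<noteq> 0 \<Longrightarrow> inc (dec b t) t = b"
  by (auto simp: inc_def dec_def)

lemma dec_inc_same: "dec (inc b t) t = b"
  by (auto simp: inc_def dec_def)

lemma inc_dec_commute: "t \<noteq> g \<Longrightarrow> inc (dec b t) g = dec (inc b g) t"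
  by (auto simp: inc_def dec_def)

lemma dec_commute: "dec (dec b t) u = dec (dec b u) t"
  by (auto simp: dec_def)

lemma finite_admissible_exps: "finite (admissible_exps n r F k)"
proof (rule finite_subset)
  show "admissible_exps n r F k \<subseteq> {f. \<forall>t. (t \<in> {1..n} \<longrightarrow> f t \<in> {..k}) \<and> (t \<notin> {1..n} \<longrightarrow> f t = 0)}"
  proof
    fix b assume b: "b \<in> admissible_exps n r F k"
    have "b t \<le> k" if "t \<in> {1..n}" for t
      using b member_le_sum[of t "{1..n}" b] that by (auto simp: admissible_exps_def deg_def)
    then show "b \<in> {f. \<forall>t. (t \<in> {1..n} \<longrightarrow> f t \<in> {..k}) \<and> (t \<notin> {1..n} \<longrightarrow> f t = 0)}"
      using b by (auto simp: admissible_exps_def admissible_def supp_def)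
  qed
qed (intro finite_set_of_finite_funs; simp)

type_synonym chain = "nat set \<times> (nat \<Rightarrow> nat) \<Rightarrow> rat"

text \<open>The second condition says that the contraction vanishes, so that the exterior factor is
that of the dual lattice space.\<close>

definition skel_chains :: "nat \<Rightarrow> nat \<Rightarrow> nat set \<Rightarrow> nat \<Rightarrow> nat \<Rightarrow> chain set" where
  "skel_chains n r F i k = {w. (\<forall>S b. w (S, b) \<noteq> 0 \<longrightarrow> S \<subseteq> {1..n} \<and> card S = i \<and> b \<in> admissible_exps n r F k)
     \<and> (\<forall>S b. (\<Sum>t\<in>{1..n}. contract t (\<lambda>U. w (U, b)) S) = 0)}"

text \<open>The part of \<open>\<theta>\<^sub>t\<close> times the contraction by \<open>e\<^sub>t\<close> that lands in the monomial \<open>b\<close> comes from the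
monomial \<open>dec b t\<close>.\<close>

definition skel_d :: "nat \<Rightarrow> nat \<Rightarrow> nat set \<Rightarrow> chain \<Rightarrow> chain" where
  "skel_d n r F w = (\<lambda>(S, b). if admissible n r F b then (\<Sum>t\<in>{t\<in>{1..n}. b t \<noteq> 0}. contract t (\<lambda>U. w (U, dec b t)) S) else 0)"

lemma kchainD:
  assumes "w \<in> skel_chains n r F i k"
  shows "w (S, b) \<noteq> 0 \<Longrightarrow> S \<subseteq> {1..n}" "w (S, b) \<noteq> 0 \<Longrightarrow> card S = i" "w (S, b) \<noteq> 0 \<Longrightarrow> b \<in> admissible_exps n r F k"
    "(\<Sum>t\<in>{1..n}. contract t (\<lambda>U. w (U, b)) S) = 0"
  using assms unfolding skel_chains_def by blast+

lemma subspace_skel_chains: "fs.subspace (skel_chains n r F i k)"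
proof (rule fs_subspaceI)
  show "(\<lambda>_. 0) \<in> skel_chains n r F i k" by (simp add: skel_chains_def contract_0)
  show "(\<lambda>x. u x + v x) \<in> skel_chains n r F i k" if u: "u \<in> skel_chains n r F i k" and v: "v \<in> skel_chains n r F i k" for u v
    unfolding skel_chains_def
  proof (intro CollectI conjI allI impI)
    fix S b
    have "(\<Sum>t\<in>{1..n}. contract t (\<lambda>U. u (U, b) + v (U, b)) S)
        = (\<Sum>t\<in>{1..n}. contract t (\<lambda>U. u (U, b)) S) + (\<Sum>t\<in>{1..n}. contract t (\<lambda>U. v (U, b)) S)"
      unfolding contract_add by (rule sum.distrib)
    then show "(\<Sum>t\<in>{1..n}. contract t (\<lambda>U. u (U, b) + v (U, b)) S) = 0"
      unfolding kchainD(4)[OF u] kchainD(4)[OF v] by simp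
    assume "u (S, b) + v (S, b) \<noteq> 0"
    then have "u (S, b) \<noteq> 0 \<or> v (S, b) \<noteq> 0" by auto
    then show "S \<subseteq> {1..n}" "card S = i" "b \<in> admissible_exps n r F k"
      using kchainD(1-3)[OF u, of S b] kchainD(1-3)[OF v, of S b] by blast+
  qed
  show "(\<lambda>x. c * v x) \<in> skel_chains n r F i k" if v: "v \<in> skel_chains n r F i k" for c v
    unfolding skel_chains_def
  proof (intro CollectI conjI allI impI)
    fix S b
    show "(\<Sum>t\<in>{1..n}. contract t (\<lambda>U. c * v (U, b)) S) = 0"
      unfolding contract_scale sum_distrib_left[symmetric] kchainD(4)[OF v] by simp
    assume "c * v (S, b) \<noteq> 0"
    then have "v (S, b) \<noteq> 0" by auto
    then show "S \<subseteq> {1..n}" "card S = i" "b \<in> admissible_exps n r F k"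
      using kchainD(1-3)[OF v, of S b] by blast+
  qed
qed

lemma linear_skel_d: "Vector_Spaces.linear fscale fscale (skel_d n r F)"
proof (rule fs_linearI)
  show "skel_d n r F (u + v) = skel_d n r F u + skel_d n r F v" for u v
  proof
    fix x :: "nat set \<times> (nat \<Rightarrow> nat)"
    obtain S b where x: "x = (S, b)" by (cases x)
    show "skel_d n r F (u + v) x = (skel_d n r F u + skel_d n r F v) x"
      unfolding x skel_d_def plus_fun_def by (simp add: contract_add sum.distrib)
  qed
  show "skel_d n r F (fscale c v) = fscale c (skel_d n r F v)" for c v
  proof
    fix x :: "nat set \<times> (nat \<Rightarrow> nat)"
    obtain S b where x: "x = (S, b)" by (cases x)
    show "skel_d n r F (fscale c v) x = fscale c (skel_d n r F v) x"
      unfolding x skel_d_def fscale_def by (simp add: contract_scale sum_distrib_left)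
  qed
qed

lemma skel_d_contraction:
  assumes "\<And>S b. (\<Sum>t\<in>{1..n}. contract t (\<lambda>U. w (U, b)) S) = 0"
  shows "(\<Sum>u\<in>{1..n}. contract u (\<lambda>U. skel_d n r F w (U, b)) S) = 0"
proof (cases "admissible n r F b")
  case True
  have "(\<Sum>u\<in>{1..n}. contract u (\<lambda>U. skel_d n r F w (U, b)) S)
      = (\<Sum>u\<in>{1..n}. \<Sum>t\<in>{t\<in>{1..n}. b t \<noteq> 0}. contract u (contract t (\<lambda>U. w (U, dec b t))) S)"
    using True by (simp add: skel_d_def contract_sum)
  also have "\<dots> = (\<Sum>t\<in>{t\<in>{1..n}. b t \<noteq> 0}. \<Sum>u\<in>{1..n}. - contract t (contract u (\<lambda>U. w (U, dec b t))) S)"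
    by (subst sum.swap) (intro sum.cong refl contract_contract)
  also have "\<dots> = (\<Sum>t\<in>{t\<in>{1..n}. b t \<noteq> 0}. - contract t (\<lambda>U. \<Sum>u\<in>{1..n}. contract u (\<lambda>U. w (U, dec b t)) U) S)"
    by (simp add: contract_sum sum_negf)
  also have "\<dots> = 0" unfolding assms contract_0 by simp
  finally show ?thesis .
qed (simp add: skel_d_def contract_0)

lemma skel_d_skel_chains:
  assumes w: "w \<in> skel_chains n r F (Suc i) k"
  shows "skel_d n r F w \<in> skel_chains n r F i (Suc k)"
proof -
  have "S \<subseteq> {1..n} \<and> card S = i \<and> b \<in> admissible_exps n r F (Suc k)" if nz: "skel_d n r F w (S, b) \<noteq> 0" for S b
  proof -
    have ok: "admissible n r F b" using nz by (auto simp: skel_d_def split: if_splits)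
    then have "(\<Sum>t\<in>{t\<in>{1..n}. b t \<noteq> 0}. contract t (\<lambda>U. w (U, dec b t)) S) \<noteq> 0" using nz by (simp add: skel_d_def)
    then obtain t where t: "t \<in> {t\<in>{1..n}. b t \<noteq> 0}" "contract t (\<lambda>U. w (U, dec b t)) S \<noteq> 0"
      by (rule sum.not_neutral_contains_not_neutral)
    then have tS: "t \<notin> S" "w (insert t S, dec b t) \<noteq> 0" by (auto simp: contract_def split: if_splits)
    note D = kchainD(1-3)[OF w tS(2)]
    have "finite (insert t S)" using D(1) by (rule finite_subset) simp
    then show ?thesis using D tS(1) t(1) ok deg_dec[of t n b] by (auto simp: admissible_exps_def)
  qed
  then show ?thesis using skel_d_contraction[OF kchainD(4)[OF w]] unfolding skel_chains_def by blast
qed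

text \<open>Multiplications commute and contractions anticommute.\<close>

lemma skel_d_skel_d:
  assumes "F \<subseteq> {1..n}"
  shows "skel_d n r F (skel_d n r F w) = 0"
proof
  fix x :: "nat set \<times> (nat \<Rightarrow> nat)"
  obtain S b where x: "x = (S, b)" by (cases x)
  show "skel_d n r F (skel_d n r F w) x = 0 x"
  proof (cases "admissible n r F b")
    case True
    let ?A = "{t\<in>{1..n}. b t \<noteq> 0}"
    have "skel_d n r F (skel_d n r F w) (S, b) = (\<Sum>t\<in>?A. contract t (\<lambda>U. skel_d n r F w (U, dec b t)) S)"
      using True by (simp add: skel_d_def)
    also have "\<dots> = (\<Sum>t\<in>?A. \<Sum>u\<in>?A - {t}. contract t (contract u (\<lambda>U. w (U, dec (dec b t) u))) S)"
    proof (intro sum.cong refl)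
      fix t assume t: "t \<in> ?A"
      have "admissible n r F (dec b t)" using admissible_mono[OF True supp_dec assms] .
      then have "contract t (\<lambda>U. skel_d n r F w (U, dec b t)) S
         = (\<Sum>u\<in>{u\<in>{1..n}. dec b t u \<noteq> 0}. contract t (contract u (\<lambda>U. w (U, dec (dec b t) u))) S)"
        by (simp add: skel_d_def contract_sum)
      also have "\<dots> = (\<Sum>u\<in>?A - {t}. contract t (contract u (\<lambda>U. w (U, dec (dec b t) u))) S)"
      proof (rule sum.mono_neutral_right)
        show "\<forall>u\<in>{u\<in>{1..n}. dec b t u \<noteq> 0} - (?A - {t}). contract t (contract u (\<lambda>U. w (U, dec (dec b t) u))) S = 0"
          by (auto simp: dec_def contract_def split: if_splits)
      qed (auto simp: dec_def)
      finally show "contract t (\<lambda>U. skel_d n r F w (U, dec b t)) S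
         = (\<Sum>u\<in>?A - {t}. contract t (contract u (\<lambda>U. w (U, dec (dec b t) u))) S)" .
    qed
    also have "\<dots> = 0"
    proof (rule sum_antisymmetric)
      fix t u
      show "contract t (contract u (\<lambda>U. w (U, dec (dec b t) u))) S = - contract u (contract t (\<lambda>U. w (U, dec (dec b u) t))) S"
        unfolding dec_commute[of b t u] by (rule contract_contract)
    qed simp
    finally show ?thesis by (simp add: x)
  qed (simp add: x skel_d_def)
qed

lemma skel_d_0: 
  assumes w: "w \<in> skel_chains n r F 0 k"
  shows "skel_d n r F w = 0"
proof
  fix x :: "nat set \<times> (nat \<Rightarrow> nat)"
  obtain S b where x: "x = (S, b)" by (cases x)
  have "contract t (\<lambda>U. w (U, dec b t)) S = 0" for t
  proof -
    have "w (insert t S, dec b t) = 0"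
    proof (rule ccontr)
      assume nz: "w (insert t S, dec b t) \<noteq> 0"
      have "finite (insert t S)" using kchainD(1)[OF w nz] by (rule finite_subset) simp
      then show False using kchainD(2)[OF w nz] by simp
    qed
    then show ?thesis by (simp add: contract_def)
  qed
  then show "skel_d n r F w x = 0 x" by (simp add: x skel_d_def)
qed

text \<open>An element is determined by its coordinates at sets \<open>S\<close> that avoid a fixed point,
and these are arbitrary.\<close>

lemma fin_dim_skel_chains: "fs.fin_dim (skel_chains n r F i k)"
  and dim_skel_chains: "1 \<le> n \<Longrightarrow> fs.dim (skel_chains n r F i k) = ((n - 1) choose i) * card (admissible_exps n r F k)"
proof -
  let ?X = "{S. S \<subseteq> {1..n} \<and> card S = i} \<times> admissible_exps n r F k"
  have "finite {S. S \<subseteq> {1..n} \<and> card S = i}" by (rule finite_subset[of _ "Pow {1..n}"]) auto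
  then have fX: "finite ?X" using finite_admissible_exps by (rule finite_cartesian_product)
  have "skel_chains n r F i k \<subseteq> supported ?X" 
  proof
    fix w assume w: "w \<in> skel_chains n r F i k"
    have "w (S, b) = 0" if "(S, b) \<notin> ?X" for S b
      using kchainD(1-3)[OF w, of S b] that by blast
    then show "w \<in> supported ?X" unfolding supported_def by (auto simp only: mem_Collect_eq split_paired_All)
  qed
  then show fd: "fs.fin_dim (skel_chains n r F i k)"
    using fs.fin_dim_mono[OF dim_supported(1)[OF fX] subspace_skel_chains] by blast
  assume n: "1 \<le> n"
  let ?Y = "{S. S \<subseteq> {2..n} \<and> card S = i} \<times> admissible_exps n r F k"
  define res :: "chain \<Rightarrow> chain" where "res w = (\<lambda>(S, b). if 1 \<in> S then 0 else w (S, b))" for w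
  have lin: "Vector_Spaces.linear fscale fscale res"
    by (rule fs_linearI) (auto simp: res_def fun_eq_iff fscale_apply)
  have "fs.dim (res ` skel_chains n r F i k) = fs.dim (skel_chains n r F i k)"
  proof (rule fsp.dim_image_inj[OF lin fd])
    fix w assume w: "w \<in> skel_chains n r F i k" and z: "res w = 0"
    have "w (S, b) = 0" for S b
    proof (rule contract_determined[of "\<lambda>U. w (U, b)" n 1])
      show "(\<Sum>t = 1..n. contract t (\<lambda>U. w (U, b)) S) = 0" for S using kchainD(4)[OF w] .
      show "w (S, b) = 0" if "1 \<notin> S" for S using fun_cong[OF z, of "(S, b)"] that by (simp add: res_def)
    qed (use n in simp)
    then show "w = 0" by auto
  qed
  moreover have "res ` skel_chains n r F i k = supported ?Y"
  proof
    show "res ` skel_chains n r F i k \<subseteq> supported ?Y"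
    proof (rule image_subsetI)
      fix w assume w: "w \<in> skel_chains n r F i k"
      have "res w (S, b) = 0" if h: "(S, b) \<notin> ?Y" for S b
      proof (rule ccontr)
        assume nz: "res w (S, b) \<noteq> 0"
        then have w1: "1 \<notin> S" "w (S, b) \<noteq> 0" by (auto simp: res_def split: if_splits)
        note D = kchainD(1-3)[OF w w1(2)]
        have "t \<ge> 2" if "t \<in> S" for t using w1(1) that D(1) by (cases "t = 0 \<or> t = 1") auto
        then have "S \<subseteq> {2..n}" using D(1) by auto
        then show False using h D by blast
      qed
      then show "res w \<in> supported ?Y" unfolding supported_def by (auto simp only: mem_Collect_eq split_paired_All)
    qed
    show "supported ?Y \<subseteq> res ` skel_chains n r F i k"
    proof
      fix v assume v: "v \<in> supported ?Y"
      define w :: chain where "w = (\<lambda>(S, b). \<Sum>t\<in>{1..n}. contract t (wedge_basis 1 (\<lambda>U. v (U, b))) S)"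
      have nz: "S \<subseteq> {2..n} \<and> card S = i \<and> b \<in> admissible_exps n r F k" if "v (S, b) \<noteq> 0" for S b
        using v that by (auto simp: supported_def)
      have "w \<in> skel_chains n r F i k"
        unfolding skel_chains_def
      proof (intro CollectI conjI allI impI)
        fix S b
        show "(\<Sum>u\<in>{1..n}. contract u (\<lambda>U. w (U, b)) S) = 0"
        proof -
          have "(\<Sum>u\<in>{1..n}. contract u (\<lambda>U. w (U, b)) S)
             = (\<Sum>u\<in>{1..n}. \<Sum>t\<in>{1..n}. contract u (contract t (wedge_basis 1 (\<lambda>U. v (U, b)))) S)"
            by (simp add: w_def contract_sum)
          also have "\<dots> = (\<Sum>u\<in>{1..n}. \<Sum>t\<in>{1..n} - {u}. contract u (contract t (wedge_basis 1 (\<lambda>U. v (U, b)))) S)"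
            by (intro sum.cong refl sum.mono_neutral_right) (auto simp: contract_def)
          also have "\<dots> = 0" by (rule sum_antisymmetric[OF _ contract_contract]) simp
          finally show ?thesis .
        qed
        assume "w (S, b) \<noteq> 0"
        then obtain t where t: "t \<in> {1..n}" "contract t (wedge_basis 1 (\<lambda>U. v (U, b))) S \<noteq> 0"
          unfolding w_def by (auto elim: sum.not_neutral_contains_not_neutral)
        then have a: "t \<notin> S" "1 \<in> insert t S" "v (insert t S - {1}, b) \<noteq> 0"
          by (auto simp: contract_def wedge_basis_def split: if_splits)
        note N = nz[OF a(3)]
        have "insert t S - {1} \<subseteq> {2..n}" using N by blast
        then have "finite (insert t S - {1})" by (rule finite_subset) simp
        then have f: "finite S" by simp
        have "card (insert t S) = Suc i" using N card_Suc_Diff1[of "insert t S" 1] a(2) f by simp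
        then show "card S = i" using a(1) f by simp
        show "S \<subseteq> {1..n}" using N t n by auto
        show "b \<in> admissible_exps n r F k" using N by simp
      qed
      moreover have "res w = v"
      proof
        fix x :: "nat set \<times> (nat \<Rightarrow> nat)"
        obtain S b where x: "x = (S, b)" by (cases x)
        show "res w x = v x"
        proof (cases "1 \<in> S")
          case True
          then have "v (S, b) = 0" using nz[of S b] by (cases "v (S, b) = 0") auto
          then show ?thesis using True by (simp add: x res_def)
        next
          case False
          have "w (S, b) = (\<Sum>t\<in>{1..n}. (if t = 1 then v (S, b) else 0) - wedge_basis 1 (contract t (\<lambda>U. v (U, b))) S)"
            by (simp add: w_def contract_wedge_basis)
          also have "\<dots> = v (S, b)" using False n by (simp add: wedge_basis_def sum.delta)
          finally show ?thesis using False by (simp add: x res_def)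
        qed
      qed
      ultimately show "v \<in> res ` skel_chains n r F i k" by blast
    qed
  qed
  moreover have "card ?Y = ((n - 1) choose i) * card (admissible_exps n r F k)"
    using n_subsets[of "{2..n}" i] by (simp add: card_cartesian_product)
  moreover have "finite ?Y"
  proof -
    have "finite {S. S \<subseteq> {2..n} \<and> card S = i}" by (rule finite_subset[of _ "Pow {2..n}"]) auto
    then show ?thesis using finite_admissible_exps by (rule finite_cartesian_product)
  qed
  ultimately show "fs.dim (skel_chains n r F i k) = ((n - 1) choose i) * card (admissible_exps n r F k)"
    using dim_supported(2)[of ?Y] by simp
qed

section \<open>Homotopies of Euler type\<close>

text \<open>The sum over \<open>g \<in> \<Gamma> b\<close> of a weighted derivative by \<open>\<theta>\<^sub>g\<close> followed by multiplication with
\<open>\<ell>\<^sub>g - \<ell>\<^bsub>z b\<^esub>\<close>.  The parameters may depend on the target monomial \<open>b\<close>, so that both vanishing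
results can use it.\<close>

definition homotopy :: "((nat \<Rightarrow> nat) \<Rightarrow> nat set) \<Rightarrow> ((nat \<Rightarrow> nat) \<Rightarrow> nat) \<Rightarrow> ((nat \<Rightarrow> nat) \<Rightarrow> nat \<Rightarrow> rat) \<Rightarrow> chain \<Rightarrow> chain" where
  "homotopy \<Gamma> z \<gamma> w = (\<lambda>(S, b). \<Sum>g\<in>\<Gamma> b. \<gamma> b g * (wedge_basis g (\<lambda>U. w (U, inc b g)) S - wedge_basis (z b) (\<lambda>U. w (U, inc b g)) S))"

lemma linear_homotopy: "Vector_Spaces.linear fscale fscale (homotopy \<Gamma> z \<gamma>)"
proof (rule fs_linearI)
  show "homotopy \<Gamma> z \<gamma> (u + v) = homotopy \<Gamma> z \<gamma> u + homotopy \<Gamma> z \<gamma> v" for u v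
  proof
    fix x :: "nat set \<times> (nat \<Rightarrow> nat)"
    obtain S b where x: "x = (S, b)" by (cases x)
    have "wedge_basis g (\<lambda>U. u (U, c) + v (U, c)) S = wedge_basis g (\<lambda>U. u (U, c)) S + wedge_basis g (\<lambda>U. v (U, c)) S" for g c
      by (simp add: wedge_basis_def algebra_simps)
    then show "homotopy \<Gamma> z \<gamma> (u + v) x = (homotopy \<Gamma> z \<gamma> u + homotopy \<Gamma> z \<gamma> v) x"
      unfolding x homotopy_def plus_fun_def by (simp add: sum.distrib[symmetric] algebra_simps)
  qed
  show "homotopy \<Gamma> z \<gamma> (fscale c v) = fscale c (homotopy \<Gamma> z \<gamma> v)" for c v
  proof
    fix x :: "nat set \<times> (nat \<Rightarrow> nat)"
    obtain S b where x: "x = (S, b)" by (cases x)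
    show "homotopy \<Gamma> z \<gamma> (fscale c v) x = fscale c (homotopy \<Gamma> z \<gamma> v) x"
      unfolding x homotopy_def fscale_def by (simp add: wedge_basis_scale sum_distrib_left algebra_simps)
  qed
qed

lemma homotopy_skel_chains:
  assumes F: "F \<subseteq> {1..n}" and G: "\<And>b. \<Gamma> b \<subseteq> {1..n}" "\<And>b. z b \<in> {1..n}"
    and w: "w \<in> skel_chains n r F i (Suc k)"
  shows "homotopy \<Gamma> z \<gamma> w \<in> skel_chains n r F (Suc i) k"
  unfolding skel_chains_def
proof (intro CollectI conjI allI impI)
  fix S b
  have c0: "(\<Sum>t\<in>{1..n}. contract t (wedge_basis g (\<lambda>U. w (U, c))) S) = w (S, c)" if "g \<in> {1..n}" for g c
  proof -
    have "(\<Sum>t\<in>{1..n}. contract t (wedge_basis g (\<lambda>U. w (U, c))) S)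
       = (\<Sum>t\<in>{1..n}. if t = g then w (S, c) else 0) - (\<Sum>t\<in>{1..n}. wedge_basis g (contract t (\<lambda>U. w (U, c))) S)"
      by (simp only: contract_wedge_basis sum_subtractf)
    also have "(\<Sum>t\<in>{1..n}. wedge_basis g (contract t (\<lambda>U. w (U, c))) S) = 0"
      unfolding wedge_basis_sum[symmetric] kchainD(4)[OF w] wedge_basis_0 ..
    finally show ?thesis using that by (simp add: sum.delta)
  qed
  have "(\<Sum>t\<in>{1..n}. contract t (\<lambda>U. homotopy \<Gamma> z \<gamma> w (U, b)) S)
     = (\<Sum>t\<in>{1..n}. \<Sum>g\<in>\<Gamma> b. \<gamma> b g * (contract t (wedge_basis g (\<lambda>U. w (U, inc b g))) S - contract t (wedge_basis (z b) (\<lambda>U. w (U, inc b g))) S))"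
    unfolding homotopy_def prod.case contract_sum contract_scale contract_diff by (rule refl)
  also have "\<dots> = (\<Sum>g\<in>\<Gamma> b. \<gamma> b g * ((\<Sum>t\<in>{1..n}. contract t (wedge_basis g (\<lambda>U. w (U, inc b g))) S)
       - (\<Sum>t\<in>{1..n}. contract t (wedge_basis (z b) (\<lambda>U. w (U, inc b g))) S)))"
    unfolding sum_subtractf[symmetric] sum_distrib_left by (rule sum.swap)
  also have "\<dots> = 0"
  proof (rule sum.neutral, rule ballI)
    fix g assume "g \<in> \<Gamma> b"
    then have g: "g \<in> {1..n}" using G(1) by blast
    show "\<gamma> b g * ((\<Sum>t\<in>{1..n}. contract t (wedge_basis g (\<lambda>U. w (U, inc b g))) S)
       - (\<Sum>t\<in>{1..n}. contract t (wedge_basis (z b) (\<lambda>U. w (U, inc b g))) S)) = 0"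
      unfolding c0[OF g] c0[OF G(2)] by simp
  qed
  finally show "(\<Sum>t\<in>{1..n}. contract t (\<lambda>U. homotopy \<Gamma> z \<gamma> w (U, b)) S) = 0" .
  assume "homotopy \<Gamma> z \<gamma> w (S, b) \<noteq> 0"
  then have "(\<Sum>g\<in>\<Gamma> b. \<gamma> b g * (wedge_basis g (\<lambda>U. w (U, inc b g)) S - wedge_basis (z b) (\<lambda>U. w (U, inc b g)) S)) \<noteq> 0"
    by (simp add: homotopy_def)
  then obtain g where g: "g \<in> \<Gamma> b" "\<gamma> b g * (wedge_basis g (\<lambda>U. w (U, inc b g)) S - wedge_basis (z b) (\<lambda>U. w (U, inc b g)) S) \<noteq> 0"
    by (rule sum.not_neutral_contains_not_neutral)
  define h where "h = (if wedge_basis g (\<lambda>U. w (U, inc b g)) S = 0 then z b else g)"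
  have "g \<in> {1..n}" "z b \<in> {1..n}" using G(1)[of b] G(2)[of b] g(1) by blast+
  then have h: "h \<in> {1..n}" "wedge_basis h (\<lambda>U. w (U, inc b g)) S \<noteq> 0" using g(2) by (auto simp: h_def)
  then have h2: "h \<in> S" "w (S - {h}, inc b g) \<noteq> 0" by (auto simp: wedge_basis_def split: if_splits)
  note D = kchainD(1-3)[OF w h2(2)]
  show S: "S \<subseteq> {1..n}" using D(1) h(1) by auto
  have "finite S" using S by (rule finite_subset) simp
  then show "card S = Suc i" using D(2) h2(1) card_Suc_Diff1[of S h] by simp
  have gn: "g \<in> {1..n}" using g(1) G(1)[of b] by (rule subsetD[rotated])
  have "admissible n r F b"
  proof (rule admissible_mono[where b = "inc b g"])
    show "admissible n r F (inc b g)" using D(3) by (simp add: admissible_exps_def)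
    show "supp b \<subseteq> supp (inc b g)" by (auto simp: supp_inc)
  qed (rule F)
  then show "b \<in> admissible_exps n r F k" using D(3) deg_inc[OF gn, of b] by (simp add: admissible_exps_def)
qed

text \<open>An Euler-type formula for the differential after the homotopy, applied to a cycle, at the
monomial \<open>b\<close>: the coordinate is multiplied by a number, up to a correction that involves the
reference index \<open>z b\<close>.  The assumptions say that near \<open>b\<close> the weights \<open>\<gamma>\<close> behave like exponents and
that the cycle condition holds at the neighbours of \<open>b\<close>.\<close>

lemma skel_d_homotopy:
  assumes i: "\<And>t U. t \<in> {1..n} \<Longrightarrow> b t \<noteq> 0 \<Longrightarrow> homotopy \<Gamma> z \<gamma> w (U, dec b t)
      = (\<Sum>g\<in>\<Gamma> b. (\<gamma> b g - (if t = g then 1 else 0)) * (wedge_basis g (\<lambda>U. w (U, inc (dec b t) g)) U - wedge_basis (z b) (\<lambda>U. w (U, inc (dec b t) g)) U))"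
    and ii: "\<And>g U. g \<in> \<Gamma> b \<Longrightarrow> (\<Sum>t\<in>{t\<in>{1..n}. inc b g t \<noteq> 0}. contract t (\<lambda>U. w (U, dec (inc b g) t)) U) = 0"
    and iii: "\<And>g. g \<in> \<Gamma> b \<Longrightarrow> b g = 0 \<Longrightarrow> \<gamma> b g = 1"
    and iv: "z b \<notin> S" "z b \<notin> \<Gamma> b" "z b \<in> {1..n}" "\<Gamma> b \<subseteq> {1..n}"
  shows "(\<Sum>t\<in>{t\<in>{1..n}. b t \<noteq> 0}. contract t (\<lambda>U. homotopy \<Gamma> z \<gamma> w (U, dec b t)) S)
     = ((\<Sum>t\<in>\<Gamma> b. \<gamma> b t - 1) + of_nat (card (\<Gamma> b \<inter> S))) * w (S, b)
       - (if b (z b) = 0 then 0 else (\<Sum>g\<in>\<Gamma> b. \<gamma> b g * w (S, inc (dec b (z b)) g)))"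
proof -
  define A where "A = {t\<in>{1..n}. b t \<noteq> 0}"
  define Z where "Z = z b"
  define G where "G = \<Gamma> b"
  define c where "c = \<gamma> b"
  define W where "W x = (\<lambda>U. w (U, x))" for x
  define e where "e t g = (if t = g then 1 else 0 :: rat)" for t g :: nat
  have fA: "finite A" "finite G" using iv(4) by (auto simp: A_def G_def intro: finite_subset)
  have "(\<Sum>t\<in>A. contract t (\<lambda>U. homotopy \<Gamma> z \<gamma> w (U, dec b t)) S)
     = (\<Sum>t\<in>A. contract t (\<lambda>U. \<Sum>g\<in>G. (c g - e t g) * (wedge_basis g (W (inc (dec b t) g)) U - wedge_basis Z (W (inc (dec b t) g)) U)) S)"
  proof (intro sum.cong refl)
    fix t assume "t \<in> A"
    then have tA: "t \<in> {1..n}" "b t \<noteq> 0" by (simp_all add: A_def)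
    have "homotopy \<Gamma> z \<gamma> w (U, dec b t) = (\<Sum>g\<in>G. (c g - e t g) * (wedge_basis g (W (inc (dec b t) g)) U - wedge_basis Z (W (inc (dec b t) g)) U))" for U
      using i[OF tA, of U] unfolding G_def c_def e_def W_def Z_def .
    then show "contract t (\<lambda>U. homotopy \<Gamma> z \<gamma> w (U, dec b t)) S
      = contract t (\<lambda>U. \<Sum>g\<in>G. (c g - e t g) * (wedge_basis g (W (inc (dec b t) g)) U - wedge_basis Z (W (inc (dec b t) g)) U)) S" by simp
  qed
  also have "\<dots> = (\<Sum>t\<in>A. \<Sum>g\<in>G. (c g - e t g) * ((e t g - e t Z) * W (inc (dec b t) g) S - wedge_basis g (contract t (W (inc (dec b t) g))) S))"
  proof -
    have "wedge_basis Z v S = 0" for v using iv(1) by (simp add: wedge_basis_def Z_def)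
    then show ?thesis
      unfolding contract_sum contract_scale contract_diff contract_wedge_basis by (intro sum.cong refl) (auto simp: e_def)
  qed
  also have "\<dots> = (\<Sum>t\<in>A. \<Sum>g\<in>G. (c g - e t g) * e t g * W (inc (dec b t) g) S)
       - (\<Sum>t\<in>A. \<Sum>g\<in>G. (c g - e t g) * e t Z * W (inc (dec b t) g) S)
       - (\<Sum>t\<in>A. \<Sum>g\<in>G. (c g - e t g) * wedge_basis g (contract t (W (inc (dec b t) g))) S)"
    unfolding sum_subtractf[symmetric] by (intro sum.cong refl) (simp add: algebra_simps)
  also have "(\<Sum>t\<in>A. \<Sum>g\<in>G. (c g - e t g) * e t g * W (inc (dec b t) g) S) = (\<Sum>g\<in>G. c g - 1) * W b S"
  proof -
    have "(\<Sum>t\<in>A. \<Sum>g\<in>G. (c g - e t g) * e t g * W (inc (dec b t) g) S)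
       = (\<Sum>g\<in>G. \<Sum>t\<in>A. if t = g then (c g - 1) * W b S else 0)"
      by (subst sum.swap) (intro sum.cong refl, auto simp: e_def A_def inc_dec_same)
    also have "\<dots> = (\<Sum>g\<in>G. if g \<in> A then (c g - 1) * W b S else 0)" using fA by (simp add: sum.delta)
    also have "\<dots> = (\<Sum>g\<in>G. (c g - 1) * W b S)"
      using iii iv(4) by (intro sum.cong refl) (auto simp: A_def G_def c_def)
    finally show ?thesis by (simp add: sum_distrib_right)
  qed
  also have "(\<Sum>t\<in>A. \<Sum>g\<in>G. (c g - e t g) * e t Z * W (inc (dec b t) g) S)
      = (if b Z = 0 then 0 else (\<Sum>g\<in>G. c g * W (inc (dec b Z) g) S))"
  proof -
    have "(\<Sum>t\<in>A. \<Sum>g\<in>G. (c g - e t g) * e t Z * W (inc (dec b t) g) S)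
       = (\<Sum>t\<in>A. if t = Z then (\<Sum>g\<in>G. c g * W (inc (dec b Z) g) S) else 0)"
      using iv(2) by (intro sum.cong refl) (auto simp: e_def G_def Z_def intro!: sum.cong)
    then show ?thesis using fA iv(3) by (simp add: sum.delta A_def Z_def)
  qed
  also have "(\<Sum>t\<in>A. \<Sum>g\<in>G. (c g - e t g) * wedge_basis g (contract t (W (inc (dec b t) g))) S) = - (of_nat (card (G \<inter> S)) * W b S)"
  proof -
    have inner: "(\<Sum>t\<in>A. (c g - e t g) * contract t (W (inc (dec b t) g)) U) = - contract g (W b) U" if g: "g \<in> G" for g U
    proof -
      have gn: "g \<in> {1..n}" using g iv(4) by (auto simp: G_def)
      have set: "{t\<in>{1..n}. inc b g t \<noteq> 0} = insert g (A - {g})" using gn by (auto simp: A_def inc_def)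
      have "0 = (\<Sum>t\<in>insert g (A - {g}). contract t (W (dec (inc b g) t)) U)"
        using ii[of g U] g unfolding set by (simp add: W_def G_def)
      also have "\<dots> = contract g (W b) U + (\<Sum>t\<in>A - {g}. contract t (W (dec (inc b g) t)) U)"
        using fA by (subst sum.insert) (auto simp: dec_inc_same)
      also have "(\<Sum>t\<in>A - {g}. contract t (W (dec (inc b g) t)) U) = (\<Sum>t\<in>A - {g}. contract t (W (inc (dec b t) g)) U)"
        by (intro sum.cong refl) (simp add: inc_dec_commute)
      finally have s: "(\<Sum>t\<in>A - {g}. contract t (W (inc (dec b t) g)) U) = - contract g (W b) U" by simp
      have r: "(\<Sum>t\<in>A - {g}. (c g - e t g) * contract t (W (inc (dec b t) g)) U) = c g * (- contract g (W b) U)"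
        unfolding s[symmetric] sum_distrib_left by (intro sum.cong refl) (auto simp: e_def)
      show ?thesis
      proof (cases "g \<in> A")
        case True
        then have "(\<Sum>t\<in>A. (c g - e t g) * contract t (W (inc (dec b t) g)) U)
            = (c g - 1) * contract g (W b) U + c g * (- contract g (W b) U)"
          using fA r by (subst sum.remove[of _ g]) (auto simp: e_def A_def inc_dec_same)
        then show ?thesis by (simp add: algebra_simps)
      next
        case False
        then have "c g = 1" using iii[of g] g gn by (auto simp: A_def G_def c_def)
        then show ?thesis using r False by simp
      qed
    qed
    have "(\<Sum>t\<in>A. \<Sum>g\<in>G. (c g - e t g) * wedge_basis g (contract t (W (inc (dec b t) g))) S)
       = (\<Sum>g\<in>G. wedge_basis g (\<lambda>U. \<Sum>t\<in>A. (c g - e t g) * contract t (W (inc (dec b t) g)) U) S)"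
      unfolding wedge_basis_sum wedge_basis_scale by (rule sum.swap)
    also have "\<dots> = (\<Sum>g\<in>G. wedge_basis g (\<lambda>U. (-1) * contract g (W b) U) S)"
      by (intro sum.cong refl) (simp add: inner)
    also have "\<dots> = (\<Sum>g\<in>G. if g \<in> S then - W b S else 0)"
      unfolding wedge_basis_scale by (intro sum.cong refl) (auto simp: wedge_basis_def contract_def ins_sign_square_left insert_absorb)
    also have "\<dots> = (\<Sum>g\<in>G \<inter> S. - W b S)"
      by (rule sum.inter_restrict[OF fA(2), symmetric])
    finally show ?thesis by simp
  qed
  finally have fin: "(\<Sum>t\<in>A. contract t (\<lambda>U. homotopy \<Gamma> z \<gamma> w (U, dec b t)) S)
      = ((\<Sum>g\<in>G. c g - 1) + of_nat (card (G \<inter> S))) * W b S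
        - (if b Z = 0 then 0 else (\<Sum>g\<in>G. c g * W (inc (dec b Z) g) S))"
    by (simp only: distrib_right)
  show ?thesis using fin unfolding A_def G_def c_def W_def Z_def .
qed

section \<open>Vanishing of homology\<close>

definition skel_cycles :: "nat \<Rightarrow> nat \<Rightarrow> nat set \<Rightarrow> nat \<Rightarrow> nat \<Rightarrow> chain set" where
  "skel_cycles n r F i k = {w \<in> skel_chains n r F i k. skel_d n r F w = 0}"

definition skel_boundaries :: "nat \<Rightarrow> nat \<Rightarrow> nat set \<Rightarrow> nat \<Rightarrow> nat \<Rightarrow> chain set" where
  "skel_boundaries n r F i k = (if k = 0 then {0} else skel_d n r F ` skel_chains n r F (Suc i) (k - 1))"

definition skel_betti :: "nat \<Rightarrow> nat \<Rightarrow> nat set \<Rightarrow> nat \<Rightarrow> nat \<Rightarrow> int" where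
  "skel_betti n r F i k = int (fs.dim (skel_cycles n r F i k)) - int (fs.dim (skel_boundaries n r F i k))"

lemma fs_fin_dim_0: "fs.fin_dim V \<Longrightarrow> 0 \<in> V"
  using fs.subspace_0 unfolding fs.fin_dim_def by blast

lemma fs_dim_0: "fs.dim {0} = 0"
  by (metis fs.span_empty fs.dim_span_eq_card_independent fs.independent_empty card.empty)

lemma fin_dim_skel_cycles: "fs.fin_dim (skel_cycles n r F i k)"
proof (rule fs.fin_dim_mono[OF fin_dim_skel_chains])
  interpret skel_d: Vector_Spaces.linear fscale fscale "skel_d n r F" by (rule linear_skel_d)
  show "fs.subspace (skel_cycles n r F i k)"
    using subspace_skel_chains[of n r F i k] unfolding skel_cycles_def fs.subspace_def
    by (simp add: skel_d.add skel_d.scale skel_d.zero)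
  show "skel_cycles n r F i k \<subseteq> skel_chains n r F i k" by (auto simp: skel_cycles_def)
qed

lemma fin_dim_skel_boundaries: "fs.fin_dim (skel_boundaries n r F i k)"
proof (cases "k = 0")
  case True
  then show ?thesis using fs.fin_dim_span[of "{}"] by (simp add: skel_boundaries_def)
next
  case False
  then show ?thesis using fsp.fin_dim_image[OF linear_skel_d fin_dim_skel_chains] by (simp add: skel_boundaries_def)
qed

lemma skel_boundaries_subset_skel_cycles: 
  assumes "F \<subseteq> {1..n}"
  shows "skel_boundaries n r F i k \<subseteq> skel_cycles n r F i k"
proof (cases k)
  case 0
  have "0 \<in> skel_cycles n r F i k" by (rule fs_fin_dim_0[OF fin_dim_skel_cycles])
  then show ?thesis using 0 by (simp add: skel_boundaries_def)
next
  case (Suc k')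
  then show ?thesis using skel_d_skel_chains skel_d_skel_d[OF assms] by (auto simp: skel_boundaries_def skel_cycles_def)
qed

text \<open>If the differential after the homotopy is injective on cycles, its image, which consists of
boundaries, has the dimension of the space of cycles.\<close>

lemma skel_betti_eq_0:
  assumes F: "F \<subseteq> {1..n}" and G: "\<And>b. \<Gamma> b \<subseteq> {1..n}" "\<And>b. z b \<in> {1..n}"
    and inj: "\<And>w. w \<in> skel_cycles n r F i k \<Longrightarrow> skel_d n r F (homotopy \<Gamma> z \<gamma> w) = 0 \<Longrightarrow> w = 0"
  shows "skel_betti n r F i k = 0"
proof -
  have "fs.dim (skel_boundaries n r F i k) \<le> fs.dim (skel_cycles n r F i k)"
    using fs.dim_mono_fin[OF fin_dim_skel_cycles _ skel_boundaries_subset_skel_cycles[OF F]] fin_dim_skel_boundaries by (auto simp: fs.fin_dim_def)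
  moreover have "fs.dim (skel_cycles n r F i k) \<le> fs.dim (skel_boundaries n r F i k)"
  proof (cases k)
    case 0
    have "w = 0" if w: "w \<in> skel_cycles n r F i k" for w
    proof (rule inj[OF w])
      have "w (S, inc b g) = 0" if "g \<in> \<Gamma> b" for S b g
      proof (rule ccontr)
        assume nz: "w (S, inc b g) \<noteq> 0"
        have g: "g \<in> {1..n}" using that G(1)[of b] by blast
        have "w \<in> skel_chains n r F i k" using w by (simp add: skel_cycles_def)
        then have "inc b g \<in> admissible_exps n r F k" using kchainD(3)[of w n r F i k S "inc b g"] nz by blast
        then show False using 0 deg_inc[OF g, of b] by (simp add: admissible_exps_def)
      qed
      then have "homotopy \<Gamma> z \<gamma> w = 0"
        unfolding homotopy_def by (intro ext) (auto simp: wedge_basis_def intro!: sum.neutral)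
      then show "skel_d n r F (homotopy \<Gamma> z \<gamma> w) = 0" by (auto simp: skel_d_def contract_0 fun_eq_iff)
    qed
    then have "skel_cycles n r F i k \<subseteq> {0}" by blast
    then have "skel_cycles n r F i k = {0}" using fs_fin_dim_0[OF fin_dim_skel_cycles, of n r F i k] by blast
    then show ?thesis using 0 by (simp add: skel_boundaries_def)
  next
    case (Suc k')
    let ?D = "skel_d n r F \<circ> homotopy \<Gamma> z \<gamma>"
    have lin: "Vector_Spaces.linear fscale fscale ?D"
      by (rule Vector_Spaces.linear_compose[OF linear_homotopy linear_skel_d])
    have "fs.dim (skel_cycles n r F i k) = fs.dim (?D ` skel_cycles n r F i k)"
      using fsp.dim_image_inj[OF lin fin_dim_skel_cycles] inj by simp
    also have "\<dots> \<le> fs.dim (skel_boundaries n r F i k)"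
    proof (rule fs.dim_mono_fin[OF fin_dim_skel_boundaries])
      show "fs.subspace (?D ` skel_cycles n r F i k)"
        using fsp.fin_dim_image[OF lin fin_dim_skel_cycles] by (simp add: fs.fin_dim_def)
      show "?D ` skel_cycles n r F i k \<subseteq> skel_boundaries n r F i k"
        using homotopy_skel_chains[OF F G] Suc by (auto simp: skel_cycles_def skel_boundaries_def)
    qed
    finally show ?thesis .
  qed
  ultimately show ?thesis by (simp add: skel_betti_def)
qed

lemma skel_d_eq_0D:
  assumes "skel_d n r F w = 0" "admissible n r F b"
  shows "(\<Sum>t\<in>{t\<in>{1..n}. b t \<noteq> 0}. contract t (\<lambda>U. w (U, dec b t)) S) = 0"
  using fun_cong[OF assms(1), of "(S, b)"] assms(2) by (simp add: skel_d_def)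

lemma sum_supp:
  assumes "supp b \<subseteq> G" "G \<subseteq> {1..n}"
  shows "(\<Sum>t\<in>G. b t) = deg n b"
  unfolding deg_def using assms by (intro sum.mono_neutral_left) (auto simp: supp_def)

text \<open>The weights \<open>b g + [g \<in> F]\<close> are used on \<open>\<Gamma> b = supp b \<union> F\<close>, which has fewer than \<open>r \<le> n\<close>
elements and so leaves room for the reference index.  At a monomial of a cycle with \<open>card (\<Gamma> b)\<close>
minimal, the homotopy formula has no correction and the factor
\<open>k + card F - card (\<Gamma> b) + card (\<Gamma> b \<inter> S)\<close> is positive since \<open>card (\<Gamma> b) < r \<le> k + card F\<close>.\<close>

lemma skel_betti_high:
  assumes F: "F \<subseteq> {1..n}" and n: "card F < r" "r \<le> n" and k: "r \<le> k + card F"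
  shows "skel_betti n r F i k = 0"
proof -
  define \<Gamma> where "\<Gamma> b = (if admissible n r F b then supp b \<union> F else {})" for b
  define z where "z b = (if admissible n r F b then (SOME t. t \<in> {1..n} - \<Gamma> b) else 1)" for b
  define \<gamma> where "\<gamma> b g = rat_of_nat (b g) + (if g \<in> F then 1 else 0)" for b :: "nat \<Rightarrow> nat" and g
  have G: "\<Gamma> b \<subseteq> {1..n}" for b using F by (auto simp: \<Gamma>_def admissible_def)
  have z: "z b \<in> {1..n} - \<Gamma> b" if "admissible n r F b" for b
  proof -
    have "card (\<Gamma> b) < card {1..n}" using that n by (simp add: \<Gamma>_def admissible_def)
    then have "{1..n} \<noteq> \<Gamma> b" by (metis less_irrefl)
    then have "\<exists>t. t \<in> {1..n} - \<Gamma> b" using G[of b] by blast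
    then have "(SOME t. t \<in> {1..n} - \<Gamma> b) \<in> {1..n} - \<Gamma> b" by (rule someI_ex)
    then show ?thesis using that by (simp add: z_def)
  qed
  have z': "z b \<in> {1..n}" for b using z[of b] n by (cases "admissible n r F b") (auto simp: z_def)
  show ?thesis
  proof (rule skel_betti_eq_0[OF F G z', where \<gamma> = \<gamma>])
    fix w assume w: "w \<in> skel_cycles n r F i k" and dh: "skel_d n r F (homotopy \<Gamma> z \<gamma> w) = 0"
    have wc: "w \<in> skel_chains n r F i k" and dw: "skel_d n r F w = 0" using w by (auto simp: skel_cycles_def)
    show "w = 0"
    proof (rule ccontr)
      assume "w \<noteq> 0"
      then obtain S0 b0 where "w (S0, b0) \<noteq> 0" by (auto simp: fun_eq_iff)
      then have "\<exists>b. \<exists>S. w (S, b) \<noteq> 0" by blast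
      then obtain b where b: "\<exists>S. w (S, b) \<noteq> 0"
        and min: "\<And>b'. (\<exists>S. w (S, b') \<noteq> 0) \<Longrightarrow> card (supp b \<union> F) \<le> card (supp b' \<union> F)"
        using ex_has_least_nat[of "\<lambda>b. \<exists>S. w (S, b) \<noteq> 0" _ "\<lambda>b. card (supp b \<union> F)"] by blast
      have bm: "b \<in> admissible_exps n r F k" using b kchainD(3)[OF wc] by blast
      then have ok: "admissible n r F b" and deg: "deg n b = k" by (auto simp: admissible_exps_def)
      have Gb: "\<Gamma> b = supp b \<union> F" using ok by (simp add: \<Gamma>_def)
      have fG: "finite (\<Gamma> b)" using G finite_subset by blast
      have zb: "z b \<in> {1..n}" "z b \<notin> \<Gamma> b" using z[OF ok] by auto
      \<comment> \<open>By the choice of \<open>b\<close> the cycle vanishes at monomials with a smaller set \<open>\<Gamma>\<close>.\<close>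
      have small: "w (U, c) = 0" if "supp c \<union> F \<subset> \<Gamma> b" for U c
        using min[of c] psubset_card_mono[OF fG that] Gb by (metis leD)
      have "w (S, b) = 0" if zS: "z b \<notin> S" for S
      proof -
        have "0 = (\<Sum>t\<in>{t\<in>{1..n}. b t \<noteq> 0}. contract t (\<lambda>U. homotopy \<Gamma> z \<gamma> w (U, dec b t)) S)"
          using skel_d_eq_0D[OF dh ok] by simp
        also have "\<dots> = ((\<Sum>t\<in>\<Gamma> b. \<gamma> b t - 1) + of_nat (card (\<Gamma> b \<inter> S))) * w (S, b)
           - (if b (z b) = 0 then 0 else (\<Sum>g\<in>\<Gamma> b. \<gamma> b g * w (S, inc (dec b (z b)) g)))"
        proof (rule skel_d_homotopy[where b = b and S = S and w = w and \<Gamma> = \<Gamma> and z = z and \<gamma> = \<gamma> and n = n, OF _ _ _ zS zb(2) zb(1) G])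
          fix t U assume t: "t \<in> {1..n}" "b t \<noteq> 0"
          have okd: "admissible n r F (dec b t)" by (rule admissible_mono[OF ok supp_dec F])
          show "homotopy \<Gamma> z \<gamma> w (U, dec b t)
            = (\<Sum>g\<in>\<Gamma> b. (\<gamma> b g - (if t = g then 1 else 0)) * (wedge_basis g (\<lambda>U. w (U, inc (dec b t) g)) U - wedge_basis (z b) (\<lambda>U. w (U, inc (dec b t) g)) U))"
          proof (cases "t \<in> F \<or> b t \<noteq> 1")
            case True
            then have "supp (dec b t) \<union> F = supp b \<union> F" using t by (auto simp: supp_def dec_def split: if_splits)
            then have GG: "\<Gamma> (dec b t) = \<Gamma> b" using ok okd by (simp add: \<Gamma>_def)
            then have zz: "z (dec b t) = z b" using ok okd by (simp add: z_def)
            have "\<gamma> (dec b t) g = \<gamma> b g - (if t = g then 1 else 0)" for g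
              using t by (auto simp: \<gamma>_def dec_def of_nat_diff)
            then show ?thesis unfolding homotopy_def prod.case GG zz by simp
          next
            case False
            then have "supp (dec b t) \<union> F = \<Gamma> b - {t}" using t by (auto simp: Gb supp_def dec_def split: if_splits)
            \<comment> \<open>Lowering the exponent 1 of \<open>t\<close> removes \<open>t\<close> from \<open>\<Gamma> b\<close>.  Both sides then vanish: the term of
    \<open>t\<close> because its weight is 1, the others because of the smaller set.\<close>
            then have GG: "\<Gamma> (dec b t) = \<Gamma> b - {t}" using okd by (simp add: \<Gamma>_def)
            have tG: "t \<in> \<Gamma> b" using t by (simp add: Gb supp_def)
            have w0: "w (V, inc (dec b t) g) = 0" if "g \<in> \<Gamma> b - {t}" for g V
            proof (rule small)
              have "supp (inc (dec b t) g) \<union> F = \<Gamma> b - {t}"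
                using \<open>supp (dec b t) \<union> F = \<Gamma> b - {t}\<close> that by (auto simp: supp_inc)
              then show "supp (inc (dec b t) g) \<union> F \<subset> \<Gamma> b" using tG by auto
            qed
            have "homotopy \<Gamma> z \<gamma> w (U, dec b t) = 0"
              unfolding homotopy_def prod.case GG using w0 by (intro sum.neutral) (simp add: wedge_basis_def)
            moreover have "(\<Sum>g\<in>\<Gamma> b. (\<gamma> b g - (if t = g then 1 else 0)) * (wedge_basis g (\<lambda>U. w (U, inc (dec b t) g)) U - wedge_basis (z b) (\<lambda>U. w (U, inc (dec b t) g)) U)) = 0"
            proof (rule sum.neutral, rule ballI)
              fix g assume g: "g \<in> \<Gamma> b"
              show "(\<gamma> b g - (if t = g then 1 else 0)) * (wedge_basis g (\<lambda>U. w (U, inc (dec b t) g)) U - wedge_basis (z b) (\<lambda>U. w (U, inc (dec b t) g)) U) = 0"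
              proof (cases "g = t")
                case True
                then show ?thesis using False by (simp add: \<gamma>_def)
              next
                case False
                then show ?thesis using w0[of g] g by (simp add: wedge_basis_def)
              qed
            qed
            ultimately show ?thesis by simp
          qed
        next
          fix g U assume g: "g \<in> \<Gamma> b"
          have "supp (inc b g) \<union> F = supp b \<union> F" using g by (auto simp: Gb supp_inc)
          moreover have "supp (inc b g) \<subseteq> {1..n}" using g G[of b] by (auto simp: Gb supp_inc)
          ultimately have "admissible n r F (inc b g)" using ok by (simp add: admissible_def)
          then show "(\<Sum>t\<in>{t\<in>{1..n}. inc b g t \<noteq> 0}. contract t (\<lambda>U. w (U, dec (inc b g) t)) U) = 0"
            by (rule skel_d_eq_0D[OF dw])
        next
          fix g assume "g \<in> \<Gamma> b" "b g = 0"
          then show "\<gamma> b g = 1" by (auto simp: Gb supp_def \<gamma>_def)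
        qed
        also have "b (z b) = 0" using zb by (auto simp: Gb supp_def)
        finally have e: "((\<Sum>t\<in>\<Gamma> b. \<gamma> b t - 1) + of_nat (card (\<Gamma> b \<inter> S))) * w (S, b) = 0" by simp
        have "(\<Sum>t\<in>\<Gamma> b. \<gamma> b t - 1) = (\<Sum>t\<in>\<Gamma> b. of_nat (b t)) + (\<Sum>t\<in>\<Gamma> b. if t \<in> F then 1 else 0) - of_nat (card (\<Gamma> b))"
          by (simp add: \<gamma>_def sum.distrib sum_subtractf)
        also have "(\<Sum>t\<in>\<Gamma> b. of_nat (b t)) = rat_of_nat k"
          using sum_supp[of b "\<Gamma> b" n] G[of b] deg by (simp add: Gb flip: of_nat_sum)
        also have "(\<Sum>t\<in>\<Gamma> b. if t \<in> F then 1 else 0) = rat_of_nat (card F)"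
        proof -
          have "\<Gamma> b \<inter> F = F" by (auto simp: Gb)
          then show ?thesis using sum.inter_restrict[OF fG, of "\<lambda>_. 1 :: rat" F] by simp
        qed
        also have "rat_of_nat k + rat_of_nat (card F) - of_nat (card (\<Gamma> b)) > 0"
        proof -
          have "card (\<Gamma> b) < k + card F" using ok k by (simp add: admissible_def Gb)
          then have "rat_of_nat (card (\<Gamma> b)) < rat_of_nat (k + card F)" by (simp only: of_nat_less_iff)
          then show ?thesis by simp
        qed
        finally have "(\<Sum>t\<in>\<Gamma> b. \<gamma> b t - 1) + of_nat (card (\<Gamma> b \<inter> S)) > 0" by (simp add: add_pos_nonneg)
        then show ?thesis using e by simp
      qed
      then have "w (S, b) = 0" for S
        using contract_determined[of "\<lambda>U. w (U, b)" n "z b"] kchainD(4)[OF wc] zb(1) by blast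
      then show False using b by blast
    qed
  qed
qed

lemma card_supp_le:
  assumes "supp b \<subseteq> {1..n}"
  shows "card (supp b) \<le> deg n b"
proof -
  have "card (supp b) = (\<Sum>t\<in>supp b. 1)" by simp
  also have "\<dots> \<le> (\<Sum>t\<in>supp b. b t)" by (intro sum_mono) (simp add: supp_def)
  also have "\<dots> = deg n b" by (rule sum_supp[OF order_refl assms])
  finally show ?thesis .
qed

text \<open>In these degrees no monomial is truncated, and the homotopy with derivatives by all
variables except \<open>\<theta>\<^sub>1\<close> applies.  At a monomial of a cycle with the least exponent of \<open>\<theta>\<^sub>1\<close> the
correction disappears, and the factor is at least \<open>i\<close>.\<close>

lemma skel_betti_low:
  assumes F: "F \<subseteq> {1..n}" and n: "1 \<le> n" and k: "Suc k + card F < r" and i: "0 < i"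
  shows "skel_betti n r F i k = 0"
proof -
  define \<Gamma> where "\<Gamma> b = {1..n} - {1}" for b :: "nat \<Rightarrow> nat"
  define z where "z b = (1::nat)" for b :: "nat \<Rightarrow> nat"
  define \<gamma> where "\<gamma> b g = rat_of_nat (b g) + 1" for b :: "nat \<Rightarrow> nat" and g :: nat
  have G: "\<Gamma> b \<subseteq> {1..n}" for b by (auto simp: \<Gamma>_def)
  have z: "z b \<in> {1..n}" "z b \<notin> \<Gamma> b" for b using n by (auto simp: z_def \<Gamma>_def)
  have okI: "admissible n r F b" if "supp b \<subseteq> {1..n}" "deg n b \<le> Suc k" for b
  proof -
    have "card (supp b \<union> F) \<le> card (supp b) + card F" by (rule card_Un_le)
    then show ?thesis using card_supp_le[OF that(1)] that k by (simp add: admissible_def)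
  qed
  show ?thesis
  proof (rule skel_betti_eq_0[OF F G z(1), where \<gamma> = \<gamma>])
    fix w assume w: "w \<in> skel_cycles n r F i k" and dh: "skel_d n r F (homotopy \<Gamma> z \<gamma> w) = 0"
    have wc: "w \<in> skel_chains n r F i k" and dw: "skel_d n r F w = 0" using w by (auto simp: skel_cycles_def)
    have "w (S, b) = 0" if "1 \<notin> S" for S b
    proof (rule ccontr)
      assume "w (S, b) \<noteq> 0"
      then have "\<exists>b S. 1 \<notin> S \<and> w (S, b) \<noteq> 0" using that by blast
      then obtain b where b: "\<exists>S. 1 \<notin> S \<and> w (S, b) \<noteq> 0"
        and min: "\<And>b'. (\<exists>S. 1 \<notin> S \<and> w (S, b') \<noteq> 0) \<Longrightarrow> b 1 \<le> b' 1"
        using ex_has_least_nat[of "\<lambda>b. \<exists>S. 1 \<notin> S \<and> w (S, b) \<noteq> 0" _ "\<lambda>b. b 1"] by blast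
      then obtain S where S: "1 \<notin> S" "w (S, b) \<noteq> 0" by blast
      note D = kchainD(1-3)[OF wc S(2)]
      have bs: "supp b \<subseteq> {1..n}" and ok: "admissible n r F b" and deg: "deg n b = k"
        using D(3) by (auto simp: admissible_exps_def admissible_def)
      have "0 = (\<Sum>t\<in>{t\<in>{1..n}. b t \<noteq> 0}. contract t (\<lambda>U. homotopy \<Gamma> z \<gamma> w (U, dec b t)) S)"
        using skel_d_eq_0D[OF dh ok] by simp
      also have "\<dots> = ((\<Sum>t\<in>\<Gamma> b. \<gamma> b t - 1) + of_nat (card (\<Gamma> b \<inter> S))) * w (S, b)
         - (if b (z b) = 0 then 0 else (\<Sum>g\<in>\<Gamma> b. \<gamma> b g * w (S, inc (dec b (z b)) g)))"
      proof (rule skel_d_homotopy[where b = b and S = S and w = w and \<Gamma> = \<Gamma> and z = z and \<gamma> = \<gamma> and n = n, OF _ _ _ _ z(2) z(1) G])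
        show "z b \<notin> S" using S by (simp add: z_def)
        fix t U assume t: "t \<in> {1..n}" "b t \<noteq> 0"
        have "\<gamma> (dec b t) g = \<gamma> b g - (if t = g then 1 else 0)" for g
          using t by (auto simp: \<gamma>_def dec_def of_nat_diff)
        then show "homotopy \<Gamma> z \<gamma> w (U, dec b t)
            = (\<Sum>g\<in>\<Gamma> b. (\<gamma> b g - (if t = g then 1 else 0)) * (wedge_basis g (\<lambda>U. w (U, inc (dec b t) g)) U - wedge_basis (z b) (\<lambda>U. w (U, inc (dec b t) g)) U))"
          unfolding homotopy_def prod.case by (simp add: \<Gamma>_def z_def)
      next
        fix g U assume "g \<in> \<Gamma> b"
        then have g: "g \<in> {1..n}" using G by blast
        have "admissible n r F (inc b g)"
          using bs g deg_inc[OF g, of b] deg by (intro okI) (auto simp: supp_inc)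
        then show "(\<Sum>t\<in>{t\<in>{1..n}. inc b g t \<noteq> 0}. contract t (\<lambda>U. w (U, dec (inc b g) t)) U) = 0"
          by (rule skel_d_eq_0D[OF dw])
      next
        fix g assume "b g = 0"
        then show "\<gamma> b g = 1" by (simp add: \<gamma>_def)
      qed
      also have "(if b (z b) = 0 then 0 else (\<Sum>g\<in>\<Gamma> b. \<gamma> b g * w (S, inc (dec b (z b)) g))) = 0"
      proof (cases "b 1 = 0")
        case False
        have "w (S, inc (dec b 1) g) = 0" if "g \<in> \<Gamma> b" for g
        proof (rule ccontr)
          assume "w (S, inc (dec b 1) g) \<noteq> 0"
          then have "b 1 \<le> inc (dec b 1) g 1" using min S(1) by blast
          then show False using False that by (auto simp: inc_def dec_def \<Gamma>_def)
        qed
        then show ?thesis by (simp add: z_def)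
      qed (simp add: z_def)
      finally have e: "((\<Sum>t\<in>\<Gamma> b. \<gamma> b t - 1) + of_nat (card (\<Gamma> b \<inter> S))) * w (S, b) = 0" by simp
      have "\<Gamma> b \<inter> S = S" using D(1) S(1) by (auto simp: \<Gamma>_def)
      then have "card (\<Gamma> b \<inter> S) = i" using D(2) by simp
      moreover have "(\<Sum>t\<in>\<Gamma> b. \<gamma> b t - 1) \<ge> 0" by (intro sum_nonneg) (simp add: \<gamma>_def)
      ultimately have "(\<Sum>t\<in>\<Gamma> b. \<gamma> b t - 1) + of_nat (card (\<Gamma> b \<inter> S)) > 0" using i by (simp add: add_nonneg_pos)
      then show False using e S(2) by simp
    qed
    then have "w (S, b) = 0" for S b
      using contract_determined[of "\<lambda>U. w (U, b)" n 1] kchainD(4)[OF wc] n by simp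
    then show "w = 0" by (auto simp: fun_eq_iff)
  qed
qed

section \<open>The remaining Betti numbers from the Euler characteristic\<close>

text \<open>The differential preserves the sum of the two degrees, so along each such strand the
alternating sum of Betti numbers equals that of the dimensions of the chain spaces.\<close>

lemma skel_betti_euler:
  assumes n: "1 \<le> n"
  shows "(\<Sum>i\<le>j. (-1) ^ i * skel_betti n r F i (j - i))
    = (\<Sum>i\<le>j. (-1) ^ i * int (((n - 1) choose i) * card (admissible_exps n r F (j - i))))"
proof -
  define \<rho> where "\<rho> i k = int (fs.dim (skel_d n r F ` skel_chains n r F i k))" for i k
  have b: "skel_betti n r F i k = int (((n - 1) choose i) * card (admissible_exps n r F k)) - \<rho> i k
      - (if k = 0 then 0 else \<rho> (Suc i) (k - 1))" for i k
    using fsp.rank_nullity[OF linear_skel_d[of n r F] fin_dim_skel_chains[of n r F i k]] dim_skel_chains[OF n, of r F i k]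
    by (simp add: skel_betti_def skel_cycles_def skel_boundaries_def \<rho>_def fs_dim_0)
  have r0: "\<rho> 0 k = 0" for k
  proof -
    have "skel_d n r F ` skel_chains n r F 0 k \<subseteq> {0}" using skel_d_0 by blast
    then have "skel_d n r F ` skel_chains n r F 0 k = {0}"
      using fs_fin_dim_0[OF fsp.fin_dim_image[OF linear_skel_d[of n r F] fin_dim_skel_chains[of n r F 0 k]]] by blast
    then show ?thesis by (simp add: \<rho>_def fs_dim_0)
  qed
  have "(\<Sum>i\<le>j. (-1) ^ i * skel_betti n r F i (j - i))
    = (\<Sum>i\<le>j. (-1) ^ i * int (((n - 1) choose i) * card (admissible_exps n r F (j - i))))
      - ((\<Sum>i\<le>j. (-1) ^ i * \<rho> i (j - i)) + (\<Sum>i\<le>j. (-1) ^ i * (if j - i = 0 then 0 else \<rho> (Suc i) (j - i - 1))))"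
    unfolding sum.distrib[symmetric] sum_subtractf[symmetric] b
    by (intro sum.cong refl) (simp add: algebra_simps)
  also have "(\<Sum>i\<le>j. (-1) ^ i * (if j - i = 0 then 0 else \<rho> (Suc i) (j - i - 1)))
      = - (\<Sum>i\<le>j. (-1) ^ i * \<rho> i (j - i))"
  proof (cases j)
    case 0
    then show ?thesis by (simp add: r0)
  next
    case (Suc j')
    have "(\<Sum>i\<le>j. (-1) ^ i * (if j - i = 0 then 0 else \<rho> (Suc i) (j - i - 1)))
       = (\<Sum>i\<le>j'. (-1) ^ i * \<rho> (Suc i) (j' - i))"
      unfolding Suc by (subst sum.atMost_Suc) (auto simp: Suc_diff_le intro!: sum.cong)
    moreover have "(\<Sum>i\<le>j. (-1) ^ i * \<rho> i (j - i)) = - (\<Sum>i\<le>j'. (-1) ^ i * \<rho> (Suc i) (j' - i))"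
      unfolding Suc by (subst sum.atMost_Suc_shift) (simp add: r0 sum_negf)
    ultimately show ?thesis by simp
  qed
  finally show ?thesis by simp
qed

definition comps :: "nat set \<Rightarrow> nat \<Rightarrow> (nat \<Rightarrow> nat) set" where
  "comps G k = {c. supp c \<subseteq> G \<and> (\<Sum>t\<in>G. c t) = k}"

lemma finite_comps:
  assumes "finite G"
  shows "finite (comps G k)"
proof (rule finite_subset)
  show "comps G k \<subseteq> {f. \<forall>t. (t \<in> G \<longrightarrow> f t \<in> {..k}) \<and> (t \<notin> G \<longrightarrow> f t = 0)}"
  proof
    fix c assume c: "c \<in> comps G k"
    have "c t \<le> k" if "t \<in> G" for t
      using c member_le_sum[of t G c] that assms by (auto simp: comps_def)
    then show "c \<in> {f. \<forall>t. (t \<in> G \<longrightarrow> f t \<in> {..k}) \<and> (t \<notin> G \<longrightarrow> f t = 0)}"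
      using c by (auto simp: comps_def supp_def)
  qed
qed (intro finite_set_of_finite_funs assms finite_atMost)

lemma card_comps_insert:
  assumes G: "finite G" "g \<notin> G"
  shows "card (comps (insert g G) k) = (\<Sum>e\<le>k. card (comps G (k - e)))"
proof -
  have "comps (insert g G) k = (\<Union>e\<in>{..k}. (\<lambda>c. c(g := e)) ` comps G (k - e))"
  proof (intro set_eqI iffI)
    fix c assume c: "c \<in> comps (insert g G) k"
    have s: "c g + (\<Sum>t\<in>G. c t) = k" using c G by (simp add: comps_def)
    have "(\<Sum>t\<in>G. (c(g := 0)) t) = (\<Sum>t\<in>G. c t)" using G by (intro sum.cong) auto
    then have "c(g := 0) \<in> comps G (k - c g)" using c s by (auto simp: comps_def supp_def)
    moreover have "c = (c(g := 0))(g := c g)" by auto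
    ultimately show "c \<in> (\<Union>e\<in>{..k}. (\<lambda>c. c(g := e)) ` comps G (k - e))" using s by (intro UN_I[of "c g"] image_eqI) auto
  next
    fix c assume "c \<in> (\<Union>e\<in>{..k}. (\<lambda>c. c(g := e)) ` comps G (k - e))"
    then obtain e d where e: "e \<le> k" "d \<in> comps G (k - e)" "c = d(g := e)" by auto
    have "(\<Sum>t\<in>G. c t) = (\<Sum>t\<in>G. d t)" using G e by (intro sum.cong) auto
    then have "(\<Sum>t\<in>insert g G. c t) = k" using e G by (simp add: comps_def)
    moreover have "supp c \<subseteq> insert g G" using e by (auto simp: comps_def supp_def split: if_splits)
    ultimately show "c \<in> comps (insert g G) k" by (simp add: comps_def)
  qed
  also have "card \<dots> = (\<Sum>e\<le>k. card ((\<lambda>c. c(g := e)) ` comps G (k - e)))"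
  proof (rule card_UN_disjoint)
    show "\<forall>e\<in>{..k}. finite ((\<lambda>c. c(g := e)) ` comps G (k - e))" using finite_comps[OF G(1)] by simp
    show "\<forall>e\<in>{..k}. \<forall>j\<in>{..k}. e \<noteq> j \<longrightarrow> (\<lambda>c. c(g := e)) ` comps G (k - e) \<inter> (\<lambda>c. c(g := j)) ` comps G (k - j) = {}"
    proof (intro ballI impI equals0I)
      fix e j x assume "e \<noteq> j" and x: "x \<in> (\<lambda>c. c(g := e)) ` comps G (k - e) \<inter> (\<lambda>c. c(g := j)) ` comps G (k - j)"
      then obtain c d where c: "x = c(g := e)" and d: "x = d(g := j)" by blast
      have "x g = e" using c by simp
      moreover have "x g = j" using d by simp
      ultimately show False using \<open>e \<noteq> j\<close> by simp
    qed
  qed simp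
  also have "\<dots> = (\<Sum>e\<le>k. card (comps G (k - e)))"
  proof (intro sum.cong refl card_image inj_onI)
    fix e c d assume c: "c \<in> comps G (k - e)" and d: "d \<in> comps G (k - e)" and eq: "c(g := e) = d(g := e)"
    have "c g = 0" "d g = 0" using c d G by (auto simp: comps_def supp_def)
    then have "c t = d t" for t
      using fun_cong[OF eq, of t] by (cases "t = g") auto
    then show "c = d" by auto
  qed
  finally show ?thesis .
qed

text \<open>The series \<open>1 / (1 - x)\<^bsup>card G\<^esup>\<close>.\<close>

definition comps_series :: "nat set \<Rightarrow> real fps" where
  "comps_series G = Abs_fps (\<lambda>k. real (card (comps G k)))"

lemma comps_series: "finite G \<Longrightarrow> (1 - fps_X) ^ card G * comps_series G = 1"
proof (induction G rule: finite_induct)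
  case empty
  have "comps {} k = (if k = 0 then {\<lambda>_. 0} else {})" for k by (auto simp: comps_def supp_def)
  then show ?case by (simp add: comps_series_def fps_eq_iff)
next
  case (insert g G)
  have ring: "a * p * (s * q) = (p * s) * (a * q)" for a p s q :: "real fps" by (simp only: ac_simps)
  have eq: "comps_series (insert g G) = comps_series G * Abs_fps (\<lambda>_. 1)"
  proof (rule fps_ext)
    fix k
    have "fps_nth (comps_series (insert g G)) k = (\<Sum>e\<le>k. real (card (comps G (k - e))))"
      using card_comps_insert[OF insert(1,2)] by (simp add: comps_series_def)
    also have "\<dots> = (\<Sum>e\<le>k. real (card (comps G e)))"
      by (rule sum.reindex_bij_witness[of _ "\<lambda>e. k - e" "\<lambda>e. k - e"]) auto
    finally show "fps_nth (comps_series (insert g G)) k = fps_nth (comps_series G * Abs_fps (\<lambda>_. 1)) k"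
      by (simp add: fps_mult_nth comps_series_def atMost_atLeast0)
  qed
  have X: "(1 - fps_X) * Abs_fps (\<lambda>_. 1) = (1 :: real fps)"
    by (rule fps_ext) (simp add: fps_mult_nth left_diff_distrib fps_X_mult_nth)
  show ?case
    unfolding eq card_insert_disjoint[OF insert(1,2)] power_Suc ring insert.IH X by simp
qed

text \<open>Monomials are sorted by \<open>G = supp b \<union> F\<close>.  The exponents are positive on \<open>G - F\<close> and arbitrary
on \<open>F\<close>.\<close>

lemma card_admissible_exps:
  assumes F: "F \<subseteq> {1..n}"
  shows "card (admissible_exps n r F k) = (\<Sum>G\<in>{G. F \<subseteq> G \<and> G \<subseteq> {1..n} \<and> card G < r}. if card (G - F) \<le> k then card (comps G (k - card (G - F))) else 0)"
proof -
  let ?I = "{G. F \<subseteq> G \<and> G \<subseteq> {1..n} \<and> card G < r}"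
  define B where "B G = {b. supp b \<union> F = G \<and> deg n b = k}" for G
  have fI: "finite ?I" by (rule finite_subset[of _ "Pow {1..n}"]) auto
  have m: "admissible_exps n r F k = (\<Union>G\<in>?I. B G)"
    using F by (auto simp: admissible_exps_def admissible_def B_def)
  have fB: "finite (B G)" if "G \<in> ?I" for G
    by (rule finite_subset[OF _ finite_admissible_exps[of n r F k]]) (use that m in blast)
  have "card (admissible_exps n r F k) = (\<Sum>G\<in>?I. card (B G))"
    unfolding m using fI fB by (intro card_UN_disjoint) (auto simp: B_def)
  also have "\<dots> = (\<Sum>G\<in>?I. if card (G - F) \<le> k then card (comps G (k - card (G - F))) else 0)"
  proof (rule sum.cong[OF refl])
    fix G assume G: "G \<in> ?I"
    then have fG: "finite G" by (auto intro: finite_subset)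
    define u where "u t = (if t \<in> G - F then 1 else 0 :: nat)" for t
    have su: "(\<Sum>t\<in>G. u t) = card (G - F)"
    proof -
      have "(\<Sum>t\<in>G. u t) = (\<Sum>t\<in>G - F. 1)"
        using fG by (intro sum.mono_neutral_cong_right) (auto simp: u_def)
      then show ?thesis by simp
    qed
    have deg: "deg n b = (\<Sum>t\<in>G. b t)" if "supp b \<subseteq> G" for b
      using sum_supp[OF that, of n] G by simp
    have "b t \<ge> u t" if "b \<in> B G" for b t using that by (auto simp: B_def u_def supp_def)
    then have sub: "card (G - F) + (\<Sum>t\<in>G. b t - u t) = k" if "b \<in> B G" for b
    proof -
      have "(\<Sum>t\<in>G. u t) + (\<Sum>t\<in>G. b t - u t) = (\<Sum>t\<in>G. b t)"
        using \<open>\<And>b t. b \<in> B G \<Longrightarrow> u t \<le> b t\<close> that unfolding sum.distrib[symmetric] by (intro sum.cong) auto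
      then show ?thesis using su deg[of b] that by (auto simp: B_def)
    qed
    show "card (B G) = (if card (G - F) \<le> k then card (comps G (k - card (G - F))) else 0)"
    proof (cases "card (G - F) \<le> k")
      case True
      have "bij_betw (\<lambda>b t. b t - u t) (B G) (comps G (k - card (G - F)))"
      proof (rule bij_betw_byWitness[of _ "\<lambda>c t. c t + u t"])
        show "\<forall>b\<in>B G. (\<lambda>t. b t - u t + u t) = b" using \<open>\<And>b t. b \<in> B G \<Longrightarrow> u t \<le> b t\<close> by auto
        show "\<forall>c\<in>comps G (k - card (G - F)). (\<lambda>t. c t + u t - u t) = c" by simp
        show "(\<lambda>b t. b t - u t) ` B G \<subseteq> comps G (k - card (G - F))"
        proof (rule image_subsetI)
          fix b assume b: "b \<in> B G"
          have "supp (\<lambda>t. b t - u t) \<subseteq> G" using b by (auto simp: B_def supp_def)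
          then show "(\<lambda>t. b t - u t) \<in> comps G (k - card (G - F))" using sub[OF b] by (simp add: comps_def)
        qed
        show "(\<lambda>c t. c t + u t) ` comps G (k - card (G - F)) \<subseteq> B G"
        proof (rule image_subsetI)
          fix c assume c: "c \<in> comps G (k - card (G - F))"
          have s: "supp (\<lambda>t. c t + u t) \<subseteq> G" using c by (auto simp: comps_def supp_def u_def split: if_splits)
          have "supp (\<lambda>t. c t + u t) \<union> F = G"
            using s G by (auto simp: supp_def u_def)
          moreover have "deg n (\<lambda>t. c t + u t) = k" unfolding deg[OF s] using c su True by (simp add: sum.distrib comps_def)
          ultimately show "(\<lambda>t. c t + u t) \<in> B G" by (simp add: B_def)
        qed
      qed
      then show ?thesis using True by (simp add: bij_betw_same_card)
    next
      case False
      then have "B G = {}" using sub by fastforce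
      then show ?thesis using False by simp
    qed
  qed
  finally show ?thesis .
qed

lemma sum_subsets_card:
  fixes f :: "nat \<Rightarrow> 'a::comm_semiring_1"
  assumes F: "F \<subseteq> {1..n}"
  shows "(\<Sum>G\<in>{G. F \<subseteq> G \<and> G \<subseteq> {1..n} \<and> card G < r}. f (card (G - F)))
    = (\<Sum>l<r - card F. of_nat ((n - card F) choose l) * f l)"
proof -
  have fF: "finite F" using F finite_subset by blast
  let ?A = "{1..n} - F"
  have cA: "card ?A = n - card F" using F fF by (simp add: card_Diff_subset)
  have "(\<Sum>G\<in>{G. F \<subseteq> G \<and> G \<subseteq> {1..n} \<and> card G < r}. f (card (G - F)))
     = (\<Sum>H\<in>{H. H \<subseteq> ?A \<and> card H < r - card F}. f (card H))"
  proof (rule sum.reindex_bij_witness[of _ "\<lambda>H. F \<union> H" "\<lambda>G. G - F"])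
    fix G assume G: "G \<in> {G. F \<subseteq> G \<and> G \<subseteq> {1..n} \<and> card G < r}"
    then have "finite G" "F \<subseteq> G" by (auto intro: finite_subset)
    then have "card G = card F + card (G - F)" using fF card_mono[of G F] by (simp add: card_Diff_subset)
    then show "G - F \<in> {H. H \<subseteq> ?A \<and> card H < r - card F}" using G by auto
    show "F \<union> (G - F) = G" using G by auto
  next
    fix H assume H: "H \<in> {H. H \<subseteq> ?A \<and> card H < r - card F}"
    then have "H \<subseteq> ?A" by simp
    then have "finite H" by (rule finite_subset) simp
    moreover have "F \<inter> H = {}" using H by auto
    ultimately have "card (F \<union> H) = card F + card H" using fF by (intro card_Un_disjoint)
    then show "F \<union> H \<in> {G. F \<subseteq> G \<and> G \<subseteq> {1..n} \<and> card G < r}" using H F by auto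
    show "F \<union> H - F = H" using H by auto
  qed auto
  also have "{H. H \<subseteq> ?A \<and> card H < r - card F} = (\<Union>l\<in>{..<r - card F}. {H. H \<subseteq> ?A \<and> card H = l})" by auto
  also have "(\<Sum>H\<in>\<dots>. f (card H)) = (\<Sum>l<r - card F. \<Sum>H\<in>{H. H \<subseteq> ?A \<and> card H = l}. f (card H))"
    by (rule sum.UNION_disjoint) (auto intro: finite_subset[of _ "Pow ?A"])
  also have "\<dots> = (\<Sum>l<r - card F. of_nat ((n - card F) choose l) * f l)"
    using n_subsets[of ?A] cA by (intro sum.cong refl) simp
  finally show ?thesis .
qed

lemma one_minus_X_power_nth: "fps_nth ((1 - fps_X) ^ m :: real fps) k = (-1) ^ k * real (m choose k)"
proof (induction m arbitrary: k)
  case (Suc m)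
  have "(1 - fps_X) ^ Suc m = (1 - fps_X) ^ m - fps_X * (1 - fps_X :: real fps) ^ m" by (simp add: left_diff_distrib)
  then show ?case by (cases k) (simp_all add: Suc algebra_simps)
qed (simp add: binomial_eq_0)

text \<open>The left-hand side is a coefficient of \<open>(1 - x)\<^bsup>n-1\<^esup>\<close> times the generating function of
the monomials, which by \<open>card_admissible_exps\<close> is a sum of terms \<open>x\<^sup>l / (1 - x)\<^bsup>card F + l\<^esup>\<close>.\<close>

lemma euler_coefficients:
  assumes F: "F \<subseteq> {1..n}" and n: "r \<le> n"
  shows "(\<Sum>i\<le>j. (-1) ^ i * real (((n - 1) choose i) * card (admissible_exps n r F (j - i))))
    = (\<Sum>l<r - card F. if l \<le> j then real ((n - card F) choose l) * ((-1) ^ (j - l) * real ((n - card F - 1 - l) choose (j - l))) else 0)"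
proof -
  let ?I = "{G. F \<subseteq> G \<and> G \<subseteq> {1..n} \<and> card G < r}"
  define HS where "HS = Abs_fps (\<lambda>k. real (card (admissible_exps n r F k)))"
  have "(\<Sum>i\<le>j. (-1) ^ i * real (((n - 1) choose i) * card (admissible_exps n r F (j - i))))
     = fps_nth ((1 - fps_X) ^ (n - 1) * HS) j"
    by (simp add: fps_mult_nth one_minus_X_power_nth HS_def atMost_atLeast0 mult_ac)
  also have "HS = (\<Sum>G\<in>?I. fps_X ^ card (G - F) * comps_series G)"
  proof (rule fps_ext)
    fix k
    show "fps_nth HS k = fps_nth (\<Sum>G\<in>?I. fps_X ^ card (G - F) * comps_series G) k"
      unfolding HS_def fps_sum_nth fps_X_power_mult_nth comps_series_def
      by (simp add: card_admissible_exps[OF F] not_less cong: if_cong) (auto intro!: sum.cong)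
  qed
  also have "(1 - fps_X) ^ (n - 1) * (\<Sum>G\<in>?I. fps_X ^ card (G - F) * comps_series G)
     = (\<Sum>G\<in>?I. fps_X ^ card (G - F) * (1 - fps_X) ^ (n - card F - 1 - card (G - F)))"
    unfolding sum_distrib_left
  proof (rule sum.cong[OF refl])
    fix G assume G: "G \<in> ?I"
    then have fG: "finite G" "finite F" using F by (auto intro: finite_subset)
    have cG: "card G = card F + card (G - F)" using G fG card_mono[of G F] by (simp add: card_Diff_subset)
    have "n - 1 = (n - card F - 1 - card (G - F)) + card G" using G n cG by auto
    then have "(1 - fps_X) ^ (n - 1) * (fps_X ^ card (G - F) * comps_series G)
       = fps_X ^ card (G - F) * (1 - fps_X) ^ (n - card F - 1 - card (G - F)) * ((1 - fps_X) ^ card G * comps_series G)"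
      by (simp add: power_add mult_ac)
    then show "(1 - fps_X) ^ (n - 1) * (fps_X ^ card (G - F) * comps_series G)
      = fps_X ^ card (G - F) * (1 - fps_X) ^ (n - card F - 1 - card (G - F))"
      using comps_series[OF fG(1)] by simp
  qed
  also have "\<dots> = (\<Sum>l<r - card F. of_nat ((n - card F) choose l) * (fps_X ^ l * (1 - fps_X) ^ (n - card F - 1 - l)))"
    by (rule sum_subsets_card[OF F, where f = "\<lambda>l. fps_X ^ l * (1 - fps_X) ^ (n - card F - 1 - l)"])
  also have "fps_nth \<dots> j = (\<Sum>l<r - card F. if l \<le> j then real ((n - card F) choose l) * ((-1) ^ (j - l) * real ((n - card F - 1 - l) choose (j - l))) else 0)"
    unfolding fps_sum_nth fps_of_nat[symmetric] fps_mult_left_const_nth fps_X_power_mult_nth one_minus_X_power_nth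
    by (intro sum.cong refl) auto
  finally show ?thesis .
qed

text \<open>By \<open>skel_betti_low\<close> and \<open>skel_betti_high\<close>, at most one Betti number with \<open>i > 0\<close> and at most
one with \<open>i = 0\<close> survive in a strand, and never both; the Euler characteristic gives its value.\<close>

theorem skel_betti_formula:
  assumes F: "F \<subseteq> {1..n}" and n: "card F < r" "r \<le> n"
  shows "real_of_int (skel_betti n r F i k)
    = (if i = 0 then (if k < r - card F then 1 else 0)
       else if Suc k = r - card F then betti_link i (r - card F) (n - card F) else 0)"
proof -
  define \<rho> where "\<rho> = r - card F"
  define \<nu> where "\<nu> = n - card F"
  have n1: "1 \<le> n" using n by simp
  have \<rho>: "0 < \<rho>" "\<rho> \<le> \<nu>" using n by (auto simp: \<rho>_def \<nu>_def)
  have z: "skel_betti n r F i k = 0" if "\<rho> \<le> k \<or> (0 < i \<and> Suc k \<noteq> \<rho>)" for i k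
  proof (cases "\<rho> \<le> k")
    case True
    then show ?thesis using n by (intro skel_betti_high[OF F]) (auto simp: \<rho>_def)
  next
    case False
    then show ?thesis using that by (intro skel_betti_low[OF F n1]) (auto simp: \<rho>_def)
  qed
  have E: "(\<Sum>i\<le>j. (-1) ^ i * real_of_int (skel_betti n r F i (j - i)))
     = (\<Sum>l<\<rho>. if l \<le> j then real (\<nu> choose l) * ((-1) ^ (j - l) * real ((\<nu> - 1 - l) choose (j - l))) else 0)" for j
  proof -
    have "(\<Sum>i\<le>j. (-1) ^ i * real_of_int (skel_betti n r F i (j - i))) = real_of_int (\<Sum>i\<le>j. (-1) ^ i * skel_betti n r F i (j - i))"
      by simp
    also have "\<dots> = (\<Sum>i\<le>j. (-1) ^ i * real (((n - 1) choose i) * card (admissible_exps n r F (j - i))))"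
      unfolding skel_betti_euler[OF n1] by simp
    finally show ?thesis unfolding euler_coefficients[OF F n(2)] \<rho>_def \<nu>_def .
  qed
  show ?thesis
  proof (cases "\<rho> \<le> k \<or> (0 < i \<and> Suc k \<noteq> \<rho>)")
    case True
    then show ?thesis using z[OF True] by (auto simp: \<rho>_def)
  next
    case k: False
    show ?thesis
    proof (cases "i = 0")
      case True
      have kr: "k < \<rho>" using k by simp
      have z': "skel_betti n r F i' (k - i') = 0" if "0 < i'" "i' \<le> k" for i'
        using that kr by (intro z) auto
      have "(\<Sum>i\<le>k. (-1) ^ i * real_of_int (skel_betti n r F i (k - i))) = (\<Sum>i\<le>k. if i = 0 then real_of_int (skel_betti n r F 0 k) else 0)"
        using z' by (intro sum.cong refl) auto
      then have "real_of_int (skel_betti n r F 0 k) = (\<Sum>l<\<rho>. if l \<le> k then real (\<nu> choose l) * ((-1) ^ (k - l) * real ((\<nu> - 1 - l) choose (k - l))) else 0)"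
        unfolding E by simp
      also have "\<dots> = (\<Sum>l\<le>k. real (\<nu> choose l) * ((-1) ^ (k - l) * real ((\<nu> - 1 - l) choose (k - l))))"
        using kr by (intro sum.mono_neutral_cong_right) auto
      also have "\<dots> = (\<Sum>q\<le>k. (-1) ^ q * real ((\<nu> choose (k - q)) * (((\<nu> - 1 - k) + q) choose q)))"
        using kr \<rho> by (intro sum.reindex_bij_witness[of _ "\<lambda>q. k - q" "\<lambda>l. k - l"]) auto
      also have "\<dots> = real ((\<nu> - Suc (\<nu> - 1 - k)) choose k)"
        using kr \<rho> by (intro sum_choose_alternating) auto
      also have "\<nu> - Suc (\<nu> - 1 - k) = k" using kr \<rho> by auto
      finally show ?thesis using True kr by (simp add: \<rho>_def)
    next
      case False
      then have kr: "Suc k = \<rho>" using k by simp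
      have "(\<Sum>i'\<le>i + k. (-1) ^ i' * real_of_int (skel_betti n r F i' (i + k - i')))
        = (\<Sum>i'\<le>i + k. if i' = i then (-1) ^ i * real_of_int (skel_betti n r F i k) else 0)"
      proof (rule sum.cong[OF refl])
        fix i' assume i': "i' \<in> {..i + k}"
        have "skel_betti n r F i' (i + k - i') = 0" if "i' \<noteq> i"
          using that i' kr False by (intro z) auto
        then show "(-1) ^ i' * real_of_int (skel_betti n r F i' (i + k - i')) = (if i' = i then (-1) ^ i * real_of_int (skel_betti n r F i k) else 0)"
          by auto
      qed
      then have "(-1) ^ i * real_of_int (skel_betti n r F i k) = (\<Sum>l<\<rho>. if l \<le> i + k then real (\<nu> choose l) * ((-1) ^ (i + k - l) * real ((\<nu> - 1 - l) choose (i + k - l))) else 0)"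
        unfolding E by simp
      then have "(-1) ^ i * ((-1) ^ i * real_of_int (skel_betti n r F i k)) = (\<Sum>l<\<rho>. (-1) ^ i * (if l \<le> i + k then real (\<nu> choose l) * ((-1) ^ (i + k - l) * real ((\<nu> - 1 - l) choose (i + k - l))) else 0))"
        by (simp only: sum_distrib_left)
      also have "\<dots> = betti_link i \<rho> \<nu>"
        unfolding betti_link_def
      proof (rule sum.cong[OF refl])
        fix l assume l: "l \<in> {..<\<rho>}"
        have e: "i + \<rho> - 1 - l = i + k - l" using kr by simp
        have "i + (i + k - l) = (\<rho> - 1 - l) + 2 * i" using kr l by auto
        then have "(-1::real) ^ (i + (i + k - l)) = (-1) ^ (\<rho> - 1 - l)" by (simp only: power_add power_mult) simp
        then have "(-1) ^ i * (-1) ^ (i + k - l) = (-1::real) ^ (\<rho> - 1 - l)" by (simp only: power_add)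
        moreover have "l \<le> i + k" using l kr by auto
        ultimately show "(-1) ^ i * (if l \<le> i + k then real (\<nu> choose l) * ((-1) ^ (i + k - l) * real ((\<nu> - 1 - l) choose (i + k - l))) else 0)
          = (-1) ^ (\<rho> - 1 - l) * real ((\<nu> choose l) * ((\<nu> - 1 - l) choose (i + \<rho> - 1 - l)))"
          unfolding e by (simp add: mult_ac)
      qed
      finally have "real_of_int (skel_betti n r F i k) = betti_link i \<rho> \<nu>"
        by (simp flip: mult.assoc power_mult_distrib)
      then show ?thesis using False kr by (simp add: \<rho>_def \<nu>_def)
    qed
  qed
qed

section \<open>The Stanley--Reisner ideal in terms of monomials\<close>

abbreviation keys where "keys \<equiv> Poly_Mapping.keys"
abbreviation lookup where "lookup \<equiv> Poly_Mapping.lookup"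
abbreviation single where "single \<equiv> Poly_Mapping.single"

definition top_set :: "monomial \<Rightarrow> nat set" where
  "top_set a = \<Union>(keys a)"

definition chain_mon :: "monomial \<Rightarrow> bool" where
  "chain_mon a \<longleftrightarrow> (\<forall>F\<in>keys a. \<forall>G\<in>keys a. F \<subseteq> G \<or> G \<subseteq> F)"

lemma keys_add_nat: "keys (a + b) = keys a \<union> keys b" for a b :: monomial
  by (auto simp: in_keys_iff lookup_add)

lemma top_set_in_keys:
  assumes "chain_mon a" "keys a \<noteq> {}"
  shows "top_set a \<in> keys a"
proof -
  have "subset.chain UNIV (keys a)" using assms(1) by (auto simp: chain_mon_def subset_chain_def)
  then show ?thesis unfolding top_set_def by (intro Union_in_chain assms(2)) auto
qed

lemma keys_subset_top_set: "F \<in> keys a \<Longrightarrow> F \<subseteq> top_set a"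
  by (auto simp: top_set_def)

lemma flats_card: "F \<in> flats r n \<Longrightarrow> card F \<le> r - 1" "F \<in> flats r n \<Longrightarrow> F \<subseteq> {1..n}" "F \<in> flats r n \<Longrightarrow> F \<noteq> {}"
  by (auto simp: flats_def)

lemma card_top_set_less:
  assumes "chain_mon a" "keys a \<subseteq> flats r n" "1 \<le> r"
  shows "card (top_set a) < r"
proof (cases "keys a = {}")
  case True
  then show ?thesis using assms(3) by (simp add: top_set_def)
next
  case False
  then have "top_set a \<in> flats r n" using top_set_in_keys assms by blast
  then show ?thesis using flats_card(1) assms(3) by fastforce
qed

lemma top_set_subset: "keys a \<subseteq> flats r n \<Longrightarrow> top_set a \<subseteq> {1..n}"
  by (auto simp: top_set_def flats_def)

lemma poly_mapping_sum_single: "p = (\<Sum>a\<in>keys p. single a (lookup p a))" for p :: flat_poly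
  by (rule poly_mapping_eqI) (auto simp: lookup_sum lookup_single when_def in_keys_iff)

lemma keys_mult_single_subset: "c \<in> keys (single a x * p) \<Longrightarrow> \<exists>b\<in>keys p. c = a + b" for p :: flat_poly
  using keys_mult[of "single a x" p] by (auto split: if_splits)

lemma sr_ideal_zero_coeff:
  assumes "p \<in> sr_ideal r n" "a \<in> keys p"
  shows "\<not> chain_mon a"
  using assms
proof (induction rule: sr_ideal.induct)
  case (add p q)
  then show ?case using Poly_Mapping.keys_add[of p q] by blast
next
  case (gen F G q)
  have "xvar F * xvar G = single (single F 1 + single G 1) 1" by (simp add: xvar_def mult_single)
  then obtain b where "a = (single F 1 + single G 1) + b"
    using gen.prems keys_mult_single_subset[of a "single F 1 + single G 1" 1 q] by (auto simp: mult.commute)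
  then have "F \<in> keys a" "G \<in> keys a" by (auto simp: keys_add_nat)
  then show ?case using gen by (auto simp: chain_mon_def)
qed simp

lemma sr_ideal_scale: "p \<in> sr_ideal r n \<Longrightarrow> single 0 c * p \<in> sr_ideal r n"
  by (rule sr_ideal_mult) (auto simp: poly_ring_def)

lemma sr_ideal_uminus: "p \<in> sr_ideal r n \<Longrightarrow> - p \<in> sr_ideal r n"
  using sr_ideal_scale[of p r n "-1"] by (simp add: single_uminus)

lemma sr_ideal_sum: "(\<And>x. x \<in> A \<Longrightarrow> f x \<in> sr_ideal r n) \<Longrightarrow> (\<Sum>x\<in>A. f x) \<in> sr_ideal r n"
  by (induction A rule: infinite_finite_induct) (auto intro: sr_ideal.zero sr_ideal.add)

lemma nonchain_in_sr_ideal: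
  assumes a: "keys a \<subseteq> flats r n" and nc: "\<not> chain_mon a"
  shows "single a c \<in> sr_ideal r n"
proof -
  obtain F G where FG: "F \<in> keys a" "G \<in> keys a" "\<not> F \<subseteq> G" "\<not> G \<subseteq> F" using nc by (auto simp: chain_mon_def)
  define b where "b = a - (single F 1 + single G 1)"
  have ab: "a = b + (single F 1 + single G 1)"
  proof (rule poly_mapping_eqI)
    fix H
    have "lookup a F \<noteq> 0" "lookup a G \<noteq> 0" "F \<noteq> G" using FG by (auto simp: in_keys_iff)
    then show "lookup a H = lookup (b + (single F 1 + single G 1)) H"
      by (auto simp: b_def lookup_add lookup_minus lookup_single when_def)
  qed
  then have "single a c = single b c * (xvar F * xvar G)" by (simp add: xvar_def mult_single)
  moreover have "keys b \<subseteq> keys a" unfolding ab keys_add_nat by blast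
  then have "single b c \<in> poly_ring r n" using a by (auto simp: poly_ring_def)
  ultimately show ?thesis using FG a by (simp add: sr_ideal.gen subset_iff)
qed

text \<open>Together with \<open>sr_ideal_zero_coeff\<close> this identifies the ideal with the span of the monomials
that are not supported on a chain.\<close>

lemma sr_idealI:
  assumes "p \<in> poly_ring r n" "\<And>a. a \<in> keys p \<Longrightarrow> \<not> chain_mon a"
  shows "p \<in> sr_ideal r n"
  by (subst poly_mapping_sum_single) (use assms in \<open>auto intro!: sr_ideal_sum nonchain_in_sr_ideal simp: poly_ring_def\<close>)

definition all_keys :: "(monomial \<Rightarrow> bool) \<Rightarrow> flat_poly \<Rightarrow> bool" where
  "all_keys P p \<longleftrightarrow> (\<forall>c\<in>keys p. P c)"

lemma all_keys_mult:
  assumes "all_keys P p" "all_keys Q q" "\<And>a b. P a \<Longrightarrow> Q b \<Longrightarrow> R (a + b)"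
  shows "all_keys R (p * q)"
  using assms keys_mult[of p q] unfolding all_keys_def by blast

section \<open>The linear forms in the image of the Koszul differential\<close>

definition theta_var :: "nat \<Rightarrow> nat \<Rightarrow> nat \<Rightarrow> flat_poly" where
  "theta_var r n t = (\<Sum>F | F \<in> flats r n \<and> t \<in> F. xvar F)"

definition theta_mon :: "nat \<Rightarrow> nat \<Rightarrow> (nat \<Rightarrow> nat) \<Rightarrow> flat_poly" where
  "theta_mon r n b = (\<Prod>t\<in>{1..n}. theta_var r n t ^ b t)"

text \<open>The product \<open>a \<theta>\<^sup>b\<close>.\<close>

definition fy_elem :: "nat \<Rightarrow> nat \<Rightarrow> monomial \<times> (nat \<Rightarrow> nat) \<Rightarrow> flat_poly" where
  "fy_elem r n = (\<lambda>(a, b). single a 1 * theta_mon r n b)"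

lemma keys_sum_xvar: "finite A \<Longrightarrow> c \<in> keys (\<Sum>F\<in>A. xvar F) \<Longrightarrow> \<exists>F\<in>A. c = single F 1"
proof (induction A rule: finite_induct)
  case (insert G A)
  have "keys (xvar G + (\<Sum>F\<in>A. xvar F)) \<subseteq> keys (xvar G) \<union> keys (\<Sum>F\<in>A. xvar F)"
    by (rule Poly_Mapping.keys_add)
  then have "c \<in> keys (xvar G) \<or> c \<in> keys (\<Sum>F\<in>A. xvar F)" using insert.prems insert.hyps by auto
  then show ?case using insert.IH by (auto simp: xvar_def split: if_splits)
qed simp

lemma keys_theta_var: "c \<in> keys (theta_var r n t) \<Longrightarrow> \<exists>F\<in>flats r n. t \<in> F \<and> c = single F 1"
  using keys_sum_xvar[of "{F. F \<in> flats r n \<and> t \<in> F}" c] finite_flats[of r n] by (auto simp: theta_var_def)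

lemma poly_ring_0: "0 \<in> poly_ring r n"
  by (simp add: poly_ring_def)

lemma sum_xvar_poly_ring: "A \<subseteq> flats r n \<Longrightarrow> (\<Sum>F\<in>A. xvar F) \<in> poly_ring r n"
  by (induction A rule: infinite_finite_induct) (simp_all add: poly_ring_add xvar_poly_ring poly_ring_0)

lemma theta_var_poly_ring: "theta_var r n t \<in> poly_ring r n"
  unfolding theta_var_def by (rule sum_xvar_poly_ring) auto

lemma poly_ring_1: "1 \<in> poly_ring r n"
  by (simp add: poly_ring_def)

lemma poly_ring_power: "p \<in> poly_ring r n \<Longrightarrow> p ^ k \<in> poly_ring r n"
  by (induction k) (auto simp: poly_ring_1 poly_ring_mult)

lemma poly_ring_prod: "(\<And>x. x \<in> A \<Longrightarrow> f x \<in> poly_ring r n) \<Longrightarrow> (\<Prod>x\<in>A. f x) \<in> poly_ring r n"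
  by (induction A rule: infinite_finite_induct) (auto simp: poly_ring_1 poly_ring_mult)

lemma poly_ring_single: "keys a \<subseteq> flats r n \<Longrightarrow> single a c \<in> poly_ring r n"
  by (auto simp: poly_ring_def)

lemma theta_mon_poly_ring: "theta_mon r n b \<in> poly_ring r n"
  unfolding theta_mon_def by (intro poly_ring_prod poly_ring_power theta_var_poly_ring)

lemma homogeneous_1: "1 \<in> homogeneous 0"
  by (auto simp: homogeneous_def mdeg_def)

lemma homogeneous_power: "p \<in> homogeneous k \<Longrightarrow> p ^ l \<in> homogeneous (l * k)"
  by (induction l) (auto simp: homogeneous_1 homogeneous_mult)

lemma homogeneous_prod:
  "finite A \<Longrightarrow> (\<And>x. x \<in> A \<Longrightarrow> f x \<in> homogeneous (d x)) \<Longrightarrow> (\<Prod>x\<in>A. f x) \<in> homogeneous (\<Sum>x\<in>A. d x)"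
  by (induction A rule: finite_induct) (auto simp: homogeneous_1 homogeneous_mult)

lemma homogeneous_add: "p \<in> homogeneous k \<Longrightarrow> q \<in> homogeneous k \<Longrightarrow> p + q \<in> homogeneous k"
  using Poly_Mapping.keys_add[of p q] by (auto simp: homogeneous_def)

lemma homogeneous_single: "mdeg a = k \<Longrightarrow> single a c \<in> homogeneous k"
  by (auto simp: homogeneous_def)

lemma mdeg_single: "mdeg (single F e) = e"
  by (cases "e = 0") (simp_all add: mdeg_def)

lemma theta_var_homogeneous: "theta_var r n t \<in> homogeneous 1"
  using keys_theta_var[of _ r n t] by (fastforce simp: homogeneous_def mdeg_single)

lemma theta_mon_homogeneous: "theta_mon r n b \<in> homogeneous (deg n b)"
  unfolding theta_mon_def deg_def using homogeneous_power[OF theta_var_homogeneous]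
  by (intro homogeneous_prod) auto

lemma fy_elem_homogeneous: "mdeg a + deg n b = k \<Longrightarrow> fy_elem r n (a, b) \<in> homogeneous k"
  unfolding fy_elem_def using homogeneous_mult[OF homogeneous_single[OF refl] theta_mon_homogeneous] by auto

lemma fy_elem_poly_ring: "keys a \<subseteq> flats r n \<Longrightarrow> fy_elem r n (a, b) \<in> poly_ring r n"
  unfolding fy_elem_def by (auto intro: poly_ring_mult poly_ring_single theta_mon_poly_ring)

lemma theta_var_theta_mon: "t \<in> {1..n} \<Longrightarrow> theta_var r n t * theta_mon r n b = theta_mon r n (inc b t)"
proof -
  assume t: "t \<in> {1..n}"
  have "(\<Prod>s\<in>{1..n} - {t}. theta_var r n s ^ inc b t s) = (\<Prod>s\<in>{1..n} - {t}. theta_var r n s ^ b s)"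
    by (rule prod.cong) (auto simp: inc_def)
  moreover have "theta_mon r n (inc b t) = theta_var r n t ^ inc b t t * (\<Prod>s\<in>{1..n} - {t}. theta_var r n s ^ inc b t s)"
    unfolding theta_mon_def using t by (intro prod.remove) auto
  moreover have "theta_mon r n b = theta_var r n t ^ b t * (\<Prod>s\<in>{1..n} - {t}. theta_var r n s ^ b s)"
    unfolding theta_mon_def using t by (intro prod.remove) auto
  ultimately show ?thesis by (simp add: inc_def mult.assoc)
qed

lemma theta_var_fy_elem: "t \<in> {1..n} \<Longrightarrow> theta_var r n t * fy_elem r n (a, b) = fy_elem r n (a, inc b t)"
  unfolding fy_elem_def using theta_var_theta_mon[of t n r b] by (simp add: mult.left_commute)

lemma theta_mon_0: "theta_mon r n (\<lambda>_. 0) = 1"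
  by (simp add: theta_mon_def)

lemma theta_mon_covers:
  assumes "supp b \<subseteq> {1..n}"
  shows "all_keys (\<lambda>c. supp b \<subseteq> top_set c) (theta_mon r n b)"
proof -
  have one: "all_keys (\<lambda>c. {} \<subseteq> top_set c) p" for p by (auto simp: all_keys_def)
  have add: "U \<subseteq> top_set c \<Longrightarrow> V \<subseteq> top_set d \<Longrightarrow> U \<union> V \<subseteq> top_set (c + d)" for U V c d
    by (auto simp: top_set_def keys_add_nat)
  have pow: "all_keys (\<lambda>c. (if k = 0 then {} else {t}) \<subseteq> top_set c) (theta_var r n t ^ k)" for t k
  proof (cases k)
    case (Suc l)
    have "all_keys (\<lambda>c. {t} \<subseteq> top_set c) (theta_var r n t)"
      using keys_theta_var[of _ r n t] by (fastforce simp: all_keys_def top_set_def)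
    then have "all_keys (\<lambda>c. {t} \<subseteq> top_set c) (theta_var r n t * theta_var r n t ^ l)"
      by (rule all_keys_mult[OF _ one]) (auto simp: top_set_def keys_add_nat)
    then show ?thesis using Suc by simp
  qed (auto simp: all_keys_def)
  have "all_keys (\<lambda>c. (\<Union>t\<in>A. if b t = 0 then {} else {t}) \<subseteq> top_set c) (\<Prod>t\<in>A. theta_var r n t ^ b t)" if "finite A" for A
    using that
  proof (induction A rule: finite_induct)
    case (insert s A)
    have "all_keys (\<lambda>c. (if b s = 0 then {} else {s}) \<union> (\<Union>t\<in>A. if b t = 0 then {} else {t}) \<subseteq> top_set c)
        (theta_var r n s ^ b s * (\<Prod>t\<in>A. theta_var r n t ^ b t))"
      by (rule all_keys_mult[OF pow insert.IH]) (rule add)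
    then show ?case using insert.hyps by (auto simp: all_keys_def)
  qed (auto simp: all_keys_def)
  from this[of "{1..n}"] show ?thesis
    unfolding theta_mon_def all_keys_def using assms by (force simp: supp_def)
qed

text \<open>In every monomial of the product the sets cover \<open>supp b\<close> and the sets of \<open>a\<close>.  A chain
of flats would do this with a single flat, whose size is below \<open>r\<close>.\<close>

lemma fy_elem_in_sr_ideal:
  assumes a: "keys a \<subseteq> flats r n" and b: "supp b \<subseteq> {1..n}" and r: "1 \<le> r" and c: "r \<le> card (supp b \<union> top_set a)"
  shows "fy_elem r n (a, b) \<in> sr_ideal r n"
proof (rule sr_idealI)
  show P: "fy_elem r n (a, b) \<in> poly_ring r n" using fy_elem_poly_ring[OF a] .
  fix d assume d: "d \<in> keys (fy_elem r n (a, b))"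
  show "\<not> chain_mon d"
  proof
    assume ch: "chain_mon d"
    obtain e where e: "e \<in> keys (theta_mon r n b)" "d = a + e"
      using d keys_mult_single_subset[of d a 1 "theta_mon r n b"] by (auto simp: fy_elem_def)
    have "supp b \<subseteq> top_set e" using theta_mon_covers[OF b] e(1) by (auto simp: all_keys_def)
    then have sub: "supp b \<union> top_set a \<subseteq> top_set d" using e(2) by (auto simp: top_set_def keys_add_nat)
    have skel_d: "keys d \<subseteq> flats r n" using P d by (auto simp: poly_ring_def)
    have "finite (top_set d)" using top_set_subset[OF skel_d] by (rule finite_subset) simp
    then have "card (supp b \<union> top_set a) \<le> card (top_set d)" using sub by (rule card_mono)
    then show False using card_top_set_less[OF ch skel_d r] c by simp
  qed
qed

text \<open>Every factor is minus the sum of the variables of flats \<open>H\<close> that contain \<open>t\<close> but not \<open>G\<close>.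
If a monomial of the product were supported on a chain, the largest among \<open>F\<close> and the chosen sets
\<open>H\<close> would cover \<open>G\<close>, yet none of these sets contains \<open>G\<close>.\<close>

lemma relation_in_sr_ideal:
  assumes a: "keys a \<subseteq> flats r n" and F: "F = {} \<or> F \<in> keys a" "F \<subset> G" and G: "G \<in> flats r n"
  shows "single a 1 * (\<Prod>t\<in>G - F. (\<Sum>H | H \<in> flats r n \<and> G \<subseteq> H. xvar H) - theta_var r n t) \<in> sr_ideal r n"
proof -
  let ?s = "\<Sum>H | H \<in> flats r n \<and> G \<subseteq> H. xvar H"
  let ?u = "\<lambda>t. \<Sum>H | H \<in> flats r n \<and> t \<in> H \<and> \<not> G \<subseteq> H. xvar H"
  have eq: "?s - theta_var r n t = - ?u t" if "t \<in> G" for t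
  proof -
    have "{H. H \<in> flats r n \<and> t \<in> H} = {H. H \<in> flats r n \<and> G \<subseteq> H} \<union> {H. H \<in> flats r n \<and> t \<in> H \<and> \<not> G \<subseteq> H}"
      using that by auto
    then have "theta_var r n t = ?s + ?u t"
      unfolding theta_var_def using finite_flats[of r n] by (simp only:) (subst sum.union_disjoint, auto)
    then show ?thesis by simp
  qed
  define P where "P T c \<longleftrightarrow> (\<forall>t\<in>T. \<exists>H\<in>keys c. t \<in> H \<and> \<not> G \<subseteq> H)" for T and c :: monomial
  have fG: "finite G" using G by (auto simp: flats_def intro: finite_subset)
  have Pu: "all_keys (P {t}) (- ?u t)" for t
  proof -
    have "\<exists>H\<in>{H. H \<in> flats r n \<and> t \<in> H \<and> \<not> G \<subseteq> H}. c = single H 1" if "c \<in> keys (?u t)" for c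
      using that finite_flats[of r n] by (intro keys_sum_xvar) auto
    then show ?thesis by (fastforce simp: all_keys_def P_def)
  qed
  have Pp: "all_keys (P T) (\<Prod>t\<in>T. - ?u t)" if "finite T" for T
    using that
  proof (induction T rule: finite_induct)
    case empty
    then show ?case by (simp add: all_keys_def P_def)
  next
    case (insert t T)
    have "all_keys (P (insert t T)) (- ?u t * (\<Prod>t\<in>T. - ?u t))"
      by (rule all_keys_mult[OF Pu insert.IH]) (auto simp: P_def keys_add_nat)
    then show ?case using insert.hyps by simp
  qed
  have "(\<Prod>t\<in>G - F. ?s - theta_var r n t) = (\<Prod>t\<in>G - F. - ?u t)" using eq by (intro prod.cong) auto
  moreover have "single a 1 * (\<Prod>t\<in>G - F. - ?u t) \<in> sr_ideal r n"
  proof (rule sr_idealI)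
    have "- ?u t \<in> poly_ring r n" for t
      using poly_ring_mult[OF poly_ring_single[of 0 r n "-1"] sum_xvar_poly_ring[of "{H. H \<in> flats r n \<and> t \<in> H \<and> \<not> G \<subseteq> H}" r n]]
      by (simp add: single_uminus subset_iff)
    then show PR: "single a 1 * (\<Prod>t\<in>G - F. - ?u t) \<in> poly_ring r n"
      using a by (intro poly_ring_mult poly_ring_single poly_ring_prod)
    fix d assume d: "d \<in> keys (single a 1 * (\<Prod>t\<in>G - F. - ?u t))"
    show "\<not> chain_mon d"
    proof
      assume ch: "chain_mon d"
      obtain e where e: "e \<in> keys (\<Prod>t\<in>G - F. - ?u t)" "d = a + e" using keys_mult_single_subset[OF d] by blast
      have Pe: "P (G - F) e" using Pp[of "G - F"] fG e(1) by (auto simp: all_keys_def)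
      define K where "K = {H \<in> keys d. H = F \<or> \<not> G \<subseteq> H}"
      have K: "\<not> G \<subseteq> H" if "H \<in> K" for H using that F(2) by (auto simp: K_def)
      have cov: "G \<subseteq> \<Union>K"
      proof
        fix t assume t: "t \<in> G"
        show "t \<in> \<Union>K"
        proof (cases "t \<in> F")
          case True
          then have "F \<in> keys d" using F(1) e(2) by (auto simp: keys_add_nat)
          then show ?thesis using True by (auto simp: K_def)
        next
          case False
          then obtain H where "H \<in> keys e" "t \<in> H" "\<not> G \<subseteq> H" using Pe t by (auto simp: P_def)
          then show ?thesis using e(2) by (auto simp: K_def keys_add_nat)
        qed
      qed
      have "K \<noteq> {}" using cov flats_card(3)[OF G] by auto
      moreover have "finite K" by (simp add: K_def)
      moreover have "subset.chain UNIV K" using ch by (auto simp: chain_mon_def subset_chain_def K_def)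
      ultimately have "\<Union>K \<in> K" by (intro Union_in_chain)
      then show False using K cov by blast
    qed
  qed
  ultimately show ?thesis by simp
qed

section \<open>Products with Feichtner--Yuzvinsky monomials span\<close>

text \<open>The exponent of \<open>G\<close> stays below the number of elements that \<open>G\<close> adds to any smaller set of the
monomial; by monotonicity this amounts to the condition for the predecessor of \<open>G\<close>.\<close>

definition fy_mon :: "monomial \<Rightarrow> bool" where
  "fy_mon a \<longleftrightarrow> chain_mon a \<and> {} \<notin> keys a \<and>
     (\<forall>G\<in>keys a. \<forall>F\<in>insert {} (keys a). F \<subset> G \<longrightarrow> lookup a G < card (G - F))"

definition fy_index :: "nat \<Rightarrow> nat \<Rightarrow> nat \<Rightarrow> (monomial \<times> (nat \<Rightarrow> nat)) set" where
  "fy_index r n k = {(a, b). fy_mon a \<and> keys a \<subseteq> flats r n \<and> admissible n r (top_set a) b \<and> mdeg a + deg n b = k}"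

text \<open>The span of the products indexed by \<open>fy_index\<close>, together with the ideal.\<close>

inductive_set fy_span :: "nat \<Rightarrow> nat \<Rightarrow> nat \<Rightarrow> flat_poly set" for r n k where
  ideal: "y \<in> sr_ideal r n \<Longrightarrow> y \<in> fy_span r n k"
| base: "x \<in> fy_index r n k \<Longrightarrow> single 0 c * fy_elem r n x \<in> fy_span r n k"
| add: "p \<in> fy_span r n k \<Longrightarrow> q \<in> fy_span r n k \<Longrightarrow> p + q \<in> fy_span r n k"

lemma fy_span_scale: "p \<in> fy_span r n k \<Longrightarrow> single 0 c * p \<in> fy_span r n k"
proof (induction rule: fy_span.induct)
  case (ideal y)
  then show ?case by (intro fy_span.ideal sr_ideal_scale)
next
  case (base x d)
  then show ?case using fy_span.base[of x r n k "c * d"] by (simp add: mult_single flip: mult.assoc)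
next
  case (add p q)
  then show ?case by (simp add: distrib_left fy_span.add)
qed

lemma fy_span_theta_var:
  assumes r: "1 \<le> r" and t: "t \<in> {1..n}"
  shows "p \<in> fy_span r n k \<Longrightarrow> theta_var r n t * p \<in> fy_span r n (Suc k)"
proof (induction rule: fy_span.induct)
  case (ideal y)
  then show ?case by (intro fy_span.ideal sr_ideal_mult theta_var_poly_ring)
next
  case (base x c)
  obtain a b where x: "x = (a, b)" by (cases x)
  have X: "fy_mon a" "keys a \<subseteq> flats r n" "admissible n r (top_set a) b" "mdeg a + deg n b = k"
    using base by (auto simp: x fy_index_def)
  have bs: "supp (inc b t) \<subseteq> {1..n}" using X(3) t by (auto simp: admissible_def supp_inc)
  have eq: "theta_var r n t * (single 0 c * fy_elem r n x) = single 0 c * fy_elem r n (a, inc b t)"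
    using theta_var_fy_elem[OF t, of r a b] by (simp add: x mult.left_commute)
  show ?case
  proof (cases "card (supp (inc b t) \<union> top_set a) < r")
    case True
    then have "(a, inc b t) \<in> fy_index r n (Suc k)"
      using X bs deg_inc[OF t, of b] by (simp add: fy_index_def admissible_def)
    then show ?thesis unfolding eq by (rule fy_span.base)
  next
    case False
    then have "fy_elem r n (a, inc b t) \<in> sr_ideal r n" using fy_elem_in_sr_ideal[OF X(2) bs r] by simp
    then show ?thesis unfolding eq by (intro fy_span.ideal sr_ideal_scale)
  qed
next
  case (add p q)
  then show ?case by (simp add: distrib_left fy_span.add)
qed

lemma fy_span_theta_mon:
  assumes r: "1 \<le> r" and p: "p \<in> fy_span r n k"
  shows "theta_mon r n b * p \<in> fy_span r n (k + deg n b)"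
proof -
  have pow: "theta_var r n t ^ m * q \<in> fy_span r n (k + m)" if "t \<in> {1..n}" "q \<in> fy_span r n k" for t m q k
    using that(2)
  proof (induction m)
    case (Suc m)
    then have "theta_var r n t * (theta_var r n t ^ m * q) \<in> fy_span r n (Suc (k + m))" using fy_span_theta_var[OF r that(1)] by blast
    then show ?case by (simp add: mult.assoc)
  qed simp
  have "(\<Prod>t\<in>A. theta_var r n t ^ b t) * p \<in> fy_span r n (k + (\<Sum>t\<in>A. b t))" if "A \<subseteq> {1..n}" "finite A" for A
    using that(2,1)
  proof (induction A rule: finite_induct)
    case (insert s A)
    then have "theta_var r n s ^ b s * ((\<Prod>t\<in>A. theta_var r n t ^ b t) * p) \<in> fy_span r n ((k + (\<Sum>t\<in>A. b t)) + b s)"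
      by (intro pow) auto
    then show ?case using insert.hyps by (simp add: mult.assoc add_ac)
  qed (use p in simp)
  from this[of "{1..n}"] show ?thesis by (simp add: theta_mon_def deg_def)
qed

text \<open>Small sets weigh more.  With this weight the pure power of \<open>x\<^sub>G\<close> is the leading term of the
relation \<open>relation_in_sr_ideal\<close>; the forms \<open>\<theta>\<^sub>t\<close> count as scalars of weight 0.\<close>

definition weight :: "nat \<Rightarrow> monomial \<Rightarrow> nat" where
  "weight n a = (\<Sum>F\<in>keys a. lookup a F * (n + 1 - card F))"

lemma weight_superset: "finite A \<Longrightarrow> keys a \<subseteq> A \<Longrightarrow> weight n a = (\<Sum>F\<in>A. lookup a F * (n + 1 - card F))"
  unfolding weight_def by (rule sum.mono_neutral_left) (auto simp: in_keys_iff)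

lemma weight_add: "weight n (a + b) = weight n a + weight n b"
  using weight_superset[of "keys a \<union> keys b" "a + b" n] weight_superset[of "keys a \<union> keys b" a n]
    weight_superset[of "keys a \<union> keys b" b n]
  by (simp add: keys_add_nat lookup_add sum.distrib algebra_simps)

lemma weight_single: "weight n (single F e) = e * (n + 1 - card F)"
  by (cases "e = 0") (simp_all add: weight_def)

inductive_set lower_terms :: "nat \<Rightarrow> nat \<Rightarrow> nat \<Rightarrow> nat \<Rightarrow> flat_poly set" for r n N k where
  zero: "0 \<in> lower_terms r n N k"
| base: "weight n a < N \<Longrightarrow> keys a \<subseteq> flats r n \<Longrightarrow> mdeg a + deg n b = k \<Longrightarrow>
    single 0 c * fy_elem r n (a, b) \<in> lower_terms r n N k"
| add: "p \<in> lower_terms r n N k \<Longrightarrow> q \<in> lower_terms r n N k \<Longrightarrow> p + q \<in> lower_terms r n N k"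

lemma lower_terms_mono: "p \<in> lower_terms r n N k \<Longrightarrow> N \<le> N' \<Longrightarrow> p \<in> lower_terms r n N' k"
  by (induction rule: lower_terms.induct) (auto intro: lower_terms.intros)

lemma lower_terms_scale: "p \<in> lower_terms r n N k \<Longrightarrow> single 0 c * p \<in> lower_terms r n N k"
proof (induction rule: lower_terms.induct)
  case (base a b d)
  then show ?case using lower_terms.base[of n a N r b k "c * d"] by (simp add: mult_single flip: mult.assoc)
qed (auto simp: distrib_left intro: lower_terms.intros)

lemma lower_terms_uminus: "p \<in> lower_terms r n N k \<Longrightarrow> - p \<in> lower_terms r n N k"
  using lower_terms_scale[of p r n N k "-1"] by (simp add: single_uminus)

lemma lower_terms_xvar:
  assumes H: "H \<in> flats r n"
  shows "p \<in> lower_terms r n N k \<Longrightarrow> xvar H * p \<in> lower_terms r n (N + (n + 1 - card H)) (Suc k)"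
proof (induction rule: lower_terms.induct)
  case (base a b c)
  have "xvar H * (single 0 c * fy_elem r n (a, b)) = single 0 c * fy_elem r n (single H 1 + a, b)"
    by (simp add: fy_elem_def xvar_def mult.left_commute[of "single (single H (Suc 0)) 1"] mult_single flip: mult.assoc)
  moreover have "weight n (single H 1 + a) < N + (n + 1 - card H)" using base by (simp add: weight_add weight_single)
  moreover have "keys (single H 1 + a) \<subseteq> flats r n" using base H by (simp add: keys_add_nat)
  moreover have "mdeg (single H 1 + a) + deg n b = Suc k" using base by (simp add: mdeg_add mdeg_single)
  ultimately show ?case using lower_terms.base by metis
qed (auto simp: distrib_left intro: lower_terms.intros)

lemma lower_terms_theta_var:
  assumes t: "t \<in> {1..n}"
  shows "p \<in> lower_terms r n N k \<Longrightarrow> theta_var r n t * p \<in> lower_terms r n N (Suc k)"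
proof (induction rule: lower_terms.induct)
  case (base a b c)
  have "theta_var r n t * (single 0 c * fy_elem r n (a, b)) = single 0 c * fy_elem r n (a, inc b t)"
    using theta_var_fy_elem[OF t, of r a b] by (simp add: mult.left_commute)
  then show ?case using lower_terms.base[of n a N r "inc b t" "Suc k" c] base deg_inc[OF t, of b] by simp
qed (auto simp: distrib_left intro: lower_terms.intros)

lemma lower_terms_sum: "(\<And>x. x \<in> A \<Longrightarrow> f x \<in> lower_terms r n N k) \<Longrightarrow> (\<Sum>x\<in>A. f x) \<in> lower_terms r n N k"
  by (induction A rule: infinite_finite_induct) (auto intro: lower_terms.intros)

lemma lower_terms_single: "weight n a < N \<Longrightarrow> keys a \<subseteq> flats r n \<Longrightarrow> mdeg a = k \<Longrightarrow> single a 1 \<in> lower_terms r n N k"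
  using lower_terms.base[of n a N r "\<lambda>_. 0" k 1] by (simp add: fy_elem_def theta_mon_0 deg_def)

text \<open>Expanding the product, the choice of \<open>x\<^sub>G\<close> in every factor gives the stated monomial.
Choosing a variable of a larger flat or \<open>\<theta>\<^sub>t\<close> instead lowers the weight.\<close>

lemma product_leading_term:
  assumes m: "keys m \<subseteq> flats r n" and G: "G \<in> flats r n" and D: "finite D" "D \<subseteq> G"
  shows "single m 1 * (\<Prod>t\<in>D. (\<Sum>H | H \<in> flats r n \<and> G \<subseteq> H. xvar H) - theta_var r n t)
      - single (m + single G (card D)) 1 \<in> lower_terms r n (weight n m + card D * (n + 1 - card G)) (mdeg m + card D)"
  using D
proof (induction D rule: finite_induct)
  case empty
  then show ?case by (simp add: lower_terms.zero)
next
  case (insert t D)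
  let ?q = "n + 1 - card G"
  define P where "P = single m 1 * (\<Prod>t\<in>D. (\<Sum>H | H \<in> flats r n \<and> G \<subseteq> H. xvar H) - theta_var r n t)"
  define L where "L d = single (m + single G d) (1::rat)" for d
  define N where "N = weight n m + card D * ?q"
  define s where "s = (\<Sum>H | H \<in> flats r n \<and> G \<subset> H. xvar H)"
  have fl: "finite (flats r n)" by (rule finite_flats)
  have G1: "G \<subseteq> {1..n}" using G by (simp add: flats_def)
  have q: "0 < ?q" using card_mono[OF _ G1] by simp
  have t: "t \<in> {1..n}" using insert.prems G1 by blast
  have e: "P - L (card D) \<in> lower_terms r n N (mdeg m + card D)"
    using insert unfolding P_def L_def N_def by simp
  have split: "(\<Sum>H | H \<in> flats r n \<and> G \<subseteq> H. xvar H) = xvar G + s"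
  proof -
    have "{H. H \<in> flats r n \<and> G \<subseteq> H} = insert G {H. H \<in> flats r n \<and> G \<subset> H}" using G by auto
    then show ?thesis unfolding s_def using fl by simp
  qed
  have eqn: "single m 1 * (\<Prod>t\<in>insert t D. (\<Sum>H | H \<in> flats r n \<and> G \<subseteq> H. xvar H) - theta_var r n t)
      = (xvar G + s - theta_var r n t) * P"
    unfolding split P_def using insert.hyps by (simp add: mult.left_commute)
  have xL: "xvar G * L d = L (Suc d)" for d
    by (simp add: xvar_def L_def mult_single add.left_commute flip: single_add)
  have "(xvar G + s - theta_var r n t) * P - L (Suc (card D))
      = xvar G * (P - L (card D)) + s * (P - L (card D)) + (- (theta_var r n t * (P - L (card D))))
        + s * L (card D) + (- (theta_var r n t * L (card D)))"
    by (simp add: algebra_simps xL[symmetric])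
  moreover have "\<dots> \<in> lower_terms r n (N + ?q) (Suc (mdeg m + card D))"
  proof -
    have xs: "s * p \<in> lower_terms r n (M + ?q - 1) (Suc k)" if "p \<in> lower_terms r n M k" for p M k
      unfolding s_def sum_distrib_right
    proof (rule lower_terms_sum)
      fix H assume H: "H \<in> {H. H \<in> flats r n \<and> G \<subset> H}"
      then have "finite H" by (auto simp: flats_def intro: finite_subset)
      then have "card G < card H" using H by (auto intro: psubset_card_mono)
      then have "M + (n + 1 - card H) \<le> M + ?q - 1" using q by simp
      then show "xvar H * p \<in> lower_terms r n (M + ?q - 1) (Suc k)" using H lower_terms_xvar[OF _ that] lower_terms_mono by blast
    qed
    have Lq: "L (card D) \<in> lower_terms r n (Suc N) (mdeg m + card D)"
      unfolding L_def using m G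
      by (intro lower_terms_single) (auto simp: N_def weight_add weight_single mdeg_add mdeg_single keys_add_nat split: if_splits)
    have 1: "xvar G * (P - L (card D)) \<in> lower_terms r n (N + ?q) (Suc (mdeg m + card D))"
      using lower_terms_xvar[OF G e] .
    have 2: "s * (P - L (card D)) \<in> lower_terms r n (N + ?q) (Suc (mdeg m + card D))"
      using xs[OF e] by (rule lower_terms_mono) simp
    have 3: "- (theta_var r n t * (P - L (card D))) \<in> lower_terms r n (N + ?q) (Suc (mdeg m + card D))"
      by (rule lower_terms_uminus, rule lower_terms_mono[OF lower_terms_theta_var[OF t e]]) simp
    have 4: "s * L (card D) \<in> lower_terms r n (N + ?q) (Suc (mdeg m + card D))"
      using xs[OF Lq] by (rule lower_terms_mono) simp
    have 5: "- (theta_var r n t * L (card D)) \<in> lower_terms r n (N + ?q) (Suc (mdeg m + card D))"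
      by (rule lower_terms_uminus, rule lower_terms_mono[OF lower_terms_theta_var[OF t Lq]]) (use q in simp)
    show ?thesis by (intro lower_terms.add 1 2 3 4 5)
  qed
  ultimately have "(xvar G + s - theta_var r n t) * P - L (Suc (card D)) \<in> lower_terms r n (N + ?q) (Suc (mdeg m + card D))"
    by (simp only:)
  moreover have "N + ?q = weight n m + Suc (card D) * ?q" by (simp add: N_def)
  ultimately show ?case unfolding eqn card_insert_disjoint[OF insert.hyps] by (simp only: L_def add_Suc_right)
qed

lemma lower_terms_subset_fy_span:
  assumes r: "1 \<le> r" and IH: "\<And>a. weight n a < N \<Longrightarrow> keys a \<subseteq> flats r n \<Longrightarrow> single a 1 \<in> fy_span r n (mdeg a)"
  shows "p \<in> lower_terms r n N k \<Longrightarrow> p \<in> fy_span r n k"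
proof (induction rule: lower_terms.induct)
  case zero
  then show ?case by (intro fy_span.ideal sr_ideal.zero)
next
  case (base a b c)
  have "theta_mon r n b * single a 1 \<in> fy_span r n (mdeg a + deg n b)" using fy_span_theta_mon[OF r IH] base by blast
  then show ?case using base fy_span_scale by (simp add: fy_elem_def mult.commute[of "single a 1"])
next
  case (add p q)
  then show ?case by (rule_tac fy_span.add)
qed

text \<open>Induction on the weight.  A chain monomial that violates the bound for \<open>F \<subset> G\<close> is divisible
by the leading term of the relation for \<open>F\<close> and \<open>G\<close>, which replaces it by terms of lower weight.\<close>

lemma single_in_fy_span:
  assumes r: "1 \<le> r"
  shows "keys a \<subseteq> flats r n \<Longrightarrow> single a 1 \<in> fy_span r n (mdeg a)"
proof (induction "weight n a" arbitrary: a rule: less_induct)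
  case less
  show ?case
  proof (cases "chain_mon a")
    case False
    then show ?thesis using less.prems by (intro fy_span.ideal nonchain_in_sr_ideal)
  next
    case ch: True
    have ne: "{} \<notin> keys a" using less.prems by (auto simp: flats_def)
    show ?thesis
    proof (cases "fy_mon a")
      case True
      have "admissible n r (top_set a) (\<lambda>_. 0)" using card_top_set_less[OF ch less.prems r] by (simp add: admissible_def supp_def)
      then have "(a, \<lambda>_. 0) \<in> fy_index r n (mdeg a)" using True less.prems by (simp add: fy_index_def deg_def)
      from fy_span.base[OF this, of 1] show ?thesis by (simp add: fy_elem_def theta_mon_0)
    next
      case False
      then obtain G F where G: "G \<in> keys a" and F: "F \<in> insert {} (keys a)" "F \<subset> G" and le: "card (G - F) \<le> lookup a G"
        using ch ne unfolding fy_mon_def not_less[symmetric] by blast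
      \<comment> \<open>The relation is multiplied by what remains of \<open>a\<close> besides its leading term.\<close>
      define m where "m = a - single G (card (G - F))"
      have am: "a = m + single G (card (G - F))"
      proof (rule poly_mapping_eqI)
        fix H
        show "lookup a H = lookup (m + single G (card (G - F))) H"
          using le by (auto simp: m_def lookup_add lookup_minus lookup_single when_def)
      qed
      have Gf: "G \<in> flats r n" using G less.prems by blast
      have fG: "finite G" using Gf by (auto simp: flats_def intro: finite_subset)
      have km: "keys m \<subseteq> flats r n"
        using less.prems unfolding am keys_add_nat by blast
      have Fm: "F = {} \<or> F \<in> keys m"
        using F by (auto simp: m_def in_keys_iff lookup_minus lookup_single when_def)
      let ?p = "single m 1 * (\<Prod>t\<in>G - F. (\<Sum>H | H \<in> flats r n \<and> G \<subseteq> H. xvar H) - theta_var r n t)"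
      have I: "?p \<in> sr_ideal r n" by (rule relation_in_sr_ideal[OF km Fm F(2) Gf])
      have "?p - single a 1 \<in> lower_terms r n (weight n a) (mdeg a)"
      proof -
        have "weight n a = weight n m + card (G - F) * (n + 1 - card G)" "mdeg a = mdeg m + card (G - F)"
          by (subst am, simp add: weight_add weight_single) (subst am, simp add: mdeg_add mdeg_single)
        then show ?thesis using product_leading_term[OF km Gf, of "G - F"] fG am by simp
      qed
      then have "?p - single a 1 \<in> fy_span r n (mdeg a)"
        using lower_terms_subset_fy_span[OF r] less.hyps by blast
      then have "single 0 (-1) * (?p - single a 1) \<in> fy_span r n (mdeg a)" by (rule fy_span_scale)
      from fy_span.add[OF fy_span.ideal[OF I] this]
      have "?p + single 0 (-1) * (?p - single a 1) \<in> fy_span r n (mdeg a)" .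
      then show ?thesis by (simp add: single_uminus)
    qed
  qed
qed

section \<open>Independence by counting\<close>

definition fy_pairs :: "nat set \<Rightarrow> nat \<Rightarrow> (monomial \<times> (nat \<Rightarrow> nat)) set" where
  "fy_pairs G k = {(a, b). fy_mon a \<and> top_set a \<union> supp b = G \<and> mdeg a + (\<Sum>t\<in>G. b t) = k}"

definition top_chains :: "nat set \<Rightarrow> nat \<Rightarrow> monomial set" where
  "top_chains G k = {a. chain_mon a \<and> {} \<notin> keys a \<and> top_set a = G \<and> mdeg a = k}"

lemma finite_monomials_on:
  assumes "finite S"
  shows "finite {a :: monomial. keys a \<subseteq> S \<and> mdeg a = k}" (is "finite ?M")
proof (rule finite_imageD)
  have "lookup a F \<le> k" if "a \<in> ?M" for a F
  proof (cases "F \<in> keys a")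
    case True
    have "lookup a F \<le> mdeg a" unfolding mdeg_def by (rule member_le_sum) (use True in auto)
    with that show ?thesis by simp
  qed (simp add: in_keys_iff)
  then have "lookup ` ?M \<subseteq> {f. \<forall>F. (F \<in> S \<longrightarrow> f F \<in> {..k}) \<and> (F \<notin> S \<longrightarrow> f F = 0)}"
    by (auto simp: in_keys_iff)
  then show "finite (lookup ` ?M)"
    by (rule finite_subset) (intro finite_set_of_finite_funs assms finite_atMost)
  show "inj_on lookup ?M" by (rule inj_onI) (simp only: Poly_Mapping.lookup_inject)
qed

lemma finite_chains: "finite G \<Longrightarrow> finite (top_chains G k)"
  by (rule finite_subset[OF _ finite_monomials_on[of "Pow G" k]]) (auto simp: top_chains_def top_set_def)

lemma finite_bounded_funs:
  assumes "finite G"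
  shows "finite {b :: nat \<Rightarrow> nat. supp b \<subseteq> G \<and> (\<Sum>t\<in>G. b t) \<le> k}"
proof (rule finite_subset)
  show "{b. supp b \<subseteq> G \<and> (\<Sum>t\<in>G. b t) \<le> k} \<subseteq> {f. \<forall>t. (t \<in> G \<longrightarrow> f t \<in> {..k}) \<and> (t \<notin> G \<longrightarrow> f t = 0)}"
  proof
    fix b assume b: "b \<in> {b. supp b \<subseteq> G \<and> (\<Sum>t\<in>G. b t) \<le> k}"
    have "b t \<le> k" if "t \<in> G" for t using member_le_sum[of t G b] that assms b by auto
    then show "b \<in> {f. \<forall>t. (t \<in> G \<longrightarrow> f t \<in> {..k}) \<and> (t \<notin> G \<longrightarrow> f t = 0)}"
      using b by (auto simp: supp_def)
  qed
qed (intro finite_set_of_finite_funs assms finite_atMost)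

lemma finite_fy_pairs:
  assumes "finite G"
  shows "finite (fy_pairs G k)"
proof (rule finite_subset)
  show "fy_pairs G k \<subseteq> (\<Union>j\<in>{..k}. {a. keys a \<subseteq> Pow G \<and> mdeg a = j}) \<times> {b. supp b \<subseteq> G \<and> (\<Sum>t\<in>G. b t) \<le> k}"
    by (auto simp: fy_pairs_def top_set_def)
  show "finite ((\<Union>j\<in>{..k}. {a :: monomial. keys a \<subseteq> Pow G \<and> mdeg a = j}) \<times> {b. supp b \<subseteq> G \<and> (\<Sum>t\<in>G. b t) \<le> k})"
    using assms by (intro finite_cartesian_product finite_UN_I finite_monomials_on finite_bounded_funs) auto
qed

lemma chain_mon_add_top:
  assumes "chain_mon a" "top_set a \<subseteq> G"
  shows "chain_mon (a + single G e)"
  using assms unfolding chain_mon_def keys_add_nat by (auto simp: top_set_def split: if_splits)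

text \<open>Multiplication by \<open>x\<^sub>G\<close> embeds the chain monomials with union inside \<open>G\<close> into those
with union \<open>G\<close>.\<close>

lemma card_chains_step:
  assumes G: "finite G" "G \<noteq> {}"
  shows "(\<Sum>H\<in>Pow G. card (top_chains H k)) \<le> card (top_chains G (Suc k))"
proof -
  have fin: "finite (top_chains H k)" if "H \<in> Pow G" for H
    using that G finite_chains finite_subset by blast
  have "(\<Sum>H\<in>Pow G. card (top_chains H k)) = card (\<Union>H\<in>Pow G. top_chains H k)"
    using G fin by (subst card_UN_disjoint) (auto simp: top_chains_def)
  also have "\<dots> \<le> card (top_chains G (Suc k))"
  proof (rule card_inj_on_le[where f = "\<lambda>a. a + single G 1"])
    show "inj_on (\<lambda>a. a + single G 1) (\<Union>H\<in>Pow G. top_chains H k)" by (auto simp: inj_on_def)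
    show "(\<lambda>a. a + single G 1) ` (\<Union>H\<in>Pow G. top_chains H k) \<subseteq> top_chains G (Suc k)"
    proof (rule image_subsetI)
      fix a assume "a \<in> (\<Union>H\<in>Pow G. top_chains H k)"
      then have a: "chain_mon a" "{} \<notin> keys a" "top_set a \<subseteq> G" "mdeg a = k" by (auto simp: top_chains_def)
      have "top_set (a + single G 1) = G" using a(3) by (auto simp: top_set_def keys_add_nat)
      then show "a + single G 1 \<in> top_chains G (Suc k)"
        using chain_mon_add_top[OF a(1,3)] a G by (auto simp: top_chains_def keys_add_nat mdeg_add mdeg_single)
    qed
    show "finite (top_chains G (Suc k))" using G finite_chains by blast
  qed
  finally show ?thesis .
qed

text \<open>Lowers the degree by one, as the inverse of the step in \<open>card_chains_step\<close> does.  If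
\<open>top_set a\<close> is smaller than \<open>G\<close>, every element of \<open>G - top_set a\<close> has a positive exponent in \<open>b\<close>; these
exponents are lowered and recorded, up to one, as an exponent of \<open>G\<close>.\<close>

definition shift_pair :: "nat set \<Rightarrow> monomial \<times> (nat \<Rightarrow> nat) \<Rightarrow> monomial \<times> (nat \<Rightarrow> nat)" where
  "shift_pair G = (\<lambda>(a, b). if top_set a = G then (a - single G 1, b)
     else (a + single G (card (G - top_set a) - 1), \<lambda>t. b t - (if t \<in> G - top_set a then 1 else 0)))"

lemma shift_pair_top: "top_set a = G \<Longrightarrow> shift_pair G (a, b) = (a - single G 1, b)"
  and shift_pair_low: "top_set a \<subset> G \<Longrightarrow> shift_pair G (a, b) =
    (a + single G (card (G - top_set a) - 1), \<lambda>t. b t - (if t \<in> G - top_set a then 1 else 0))"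
  by (auto simp: shift_pair_def)

lemma fy_mon_mono:
  assumes "fy_mon a" "\<And>F. lookup a' F \<le> lookup a F"
  shows "fy_mon a'"
proof -
  have k: "keys a' \<subseteq> keys a"
  proof
    fix F assume "F \<in> keys a'"
    then show "F \<in> keys a" using assms(2)[of F] by (simp add: in_keys_iff)
  qed
  have "lookup a' G < card (G - F)" if "G \<in> keys a'" "F \<in> insert {} (keys a')" "F \<subset> G" for G F
  proof -
    have "G \<in> keys a" "F \<in> insert {} (keys a)" using that(1,2) k by auto
    then have "lookup a G < card (G - F)" using assms(1) that(3) by (auto simp: fy_mon_def)
    then show ?thesis using assms(2)[of G] by simp
  qed
  moreover have "chain_mon a'"
    unfolding chain_mon_def
  proof (intro ballI)
    fix F G assume "F \<in> keys a'" "G \<in> keys a'"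
    then have "F \<in> keys a" "G \<in> keys a" using k by auto
    then show "F \<subseteq> G \<or> G \<subseteq> F" using assms(1) unfolding fy_mon_def chain_mon_def by blast
  qed
  moreover have "{} \<notin> keys a'" using assms(1) k by (auto simp: fy_mon_def)
  ultimately show ?thesis by (simp add: fy_mon_def)
qed

text \<open>Any smaller set of the monomial lies in \<open>top_set a\<close>, so the bound for the new top \<open>G\<close> is
strictest at \<open>top_set a\<close>.\<close>

lemma fy_mon_add_top:
  assumes fy: "fy_mon a" and G: "finite G" "top_set a \<subset> G" and e: "e < card (G - top_set a)"
  shows "fy_mon (a + single G e)"
  unfolding fy_mon_def
proof (intro conjI ballI impI)
  have k: "keys (a + single G e) \<subseteq> insert G (keys a)" by (auto simp: keys_add_nat split: if_splits)
  have G0: "G \<notin> keys a" using keys_subset_top_set[of G a] G by auto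
  show "chain_mon (a + single G e)" using fy G by (intro chain_mon_add_top) (auto simp: fy_mon_def)
  show "{} \<notin> keys (a + single G e)" using fy G k by (auto simp: fy_mon_def)
  fix H K assume H: "H \<in> keys (a + single G e)" and K: "K \<in> insert {} (keys (a + single G e))" and KH: "K \<subset> H"
  show "lookup (a + single G e) H < card (H - K)"
  proof (cases "H = G")
    case True
    have "K \<subseteq> top_set a" using K KH True k keys_subset_top_set[of K a] by auto
    then have "card (G - top_set a) \<le> card (G - K)" using G by (intro card_mono) auto
    moreover have "lookup (a + single G e) G = e" using G0 by (simp add: lookup_add in_keys_iff)
    ultimately show ?thesis using e True by simp
  next
    case False
    then have Ha: "H \<in> keys a" using H k by auto
    then have "H \<subseteq> top_set a" by (rule keys_subset_top_set)
    then have "K \<noteq> G" using KH G by auto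
    then have "K \<in> insert {} (keys a)" using K k by auto
    then have "lookup a H < card (H - K)" using fy Ha KH unfolding fy_mon_def by blast
    then show ?thesis using False by (simp add: lookup_add lookup_single)
  qed
qed

lemma shift_pair_in_fy_pairs:
  assumes G: "finite G" "G \<noteq> {}" and x: "x \<in> fy_pairs G (Suc k)"
  shows "shift_pair G x \<in> (\<Union>H\<in>Pow G. fy_pairs H k)"
proof -
  obtain a b where ab: "x = (a, b)" by (cases x)
  have fy: "fy_mon a" and U: "top_set a \<union> supp b = G" and deg: "mdeg a + (\<Sum>t\<in>G. b t) = Suc k"
    using x by (auto simp: ab fy_pairs_def)
  have ch: "chain_mon a" and ne: "{} \<notin> keys a" using fy by (auto simp: fy_mon_def)
  have mem: "(a', b') \<in> (\<Union>H\<in>Pow G. fy_pairs H k)"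
    if "fy_mon a'" "top_set a' \<subseteq> G" "supp b' \<subseteq> G" "mdeg a' + (\<Sum>t\<in>G. b' t) = k" for a' b'
  proof -
    let ?H = "top_set a' \<union> supp b'"
    have "(\<Sum>t\<in>?H. b' t) = (\<Sum>t\<in>G. b' t)"
      using that G by (intro sum.mono_neutral_left) (auto simp: supp_def)
    then have "(a', b') \<in> fy_pairs ?H k" using that by (simp add: fy_pairs_def)
    moreover have "?H \<in> Pow G" using that(2,3) by simp
    ultimately show ?thesis by (rule_tac UN_I)
  qed
  show ?thesis
  proof (cases "top_set a = G")
    case True
    have Gk: "G \<in> keys a"
    proof -
      have "keys a \<noteq> {}" using True G by (auto simp: top_set_def)
      then show ?thesis using top_set_in_keys[OF ch] True by simp
    qed
    define a' where "a' = a - single G 1"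
    have a: "a = a' + single G 1"
    proof (rule poly_mapping_eqI)
      fix H
      have "lookup a G \<noteq> 0" using Gk by (simp add: in_keys_iff)
      then show "lookup a H = lookup (a' + single G 1) H"
        by (auto simp: a'_def lookup_add lookup_minus lookup_single when_def)
    qed
    have "fy_mon a'" by (rule fy_mon_mono[OF fy]) (simp add: a'_def lookup_minus)
    moreover have "top_set a' \<subseteq> G"
    proof -
      have "top_set a' \<subseteq> top_set a" by (subst a) (auto simp: top_set_def keys_add_nat)
      then show ?thesis using True by simp
    qed
    moreover have "mdeg a = Suc (mdeg a')" by (subst a) (simp add: mdeg_add mdeg_single)
    ultimately have "(a', b) \<in> (\<Union>H\<in>Pow G. fy_pairs H k)" using U deg by (intro mem) auto
    then show ?thesis using True by (simp add: ab shift_pair_def a'_def)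
  next
    case False
    define F where "F = top_set a"
    have FG: "F \<subset> G" using False U by (auto simp: F_def)
    define e where "e = card (G - F) - 1"
    define a' where "a' = a + single G e"
    define u where "u t = (if t \<in> G - F then 1 else 0 :: nat)" for t
    have c: "0 < card (G - F)" using FG G by (auto simp: card_gt_0_iff)
    have G0: "G \<notin> keys a" using keys_subset_top_set[of G a] FG by (auto simp: F_def)
    have "fy_mon a'"
      unfolding a'_def using fy FG G c by (intro fy_mon_add_top) (simp_all add: F_def e_def)
    moreover have "top_set a' \<subseteq> G" using FG by (auto simp: a'_def F_def top_set_def keys_add_nat split: if_splits)
    moreover have "supp (\<lambda>t. b t - u t) \<subseteq> G" using U by (auto simp: supp_def)
    moreover have "mdeg a' + (\<Sum>t\<in>G. b t - u t) = k"
    proof -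
      have le: "u t \<le> b t" for t using U by (auto simp: u_def F_def supp_def)
      have "(\<Sum>t\<in>G. u t) = (\<Sum>t\<in>G - F. 1)"
        using G by (intro sum.mono_neutral_cong_right) (auto simp: u_def)
      then have su: "(\<Sum>t\<in>G. u t) = card (G - F)" by simp
      have "(\<Sum>t\<in>G. u t) + (\<Sum>t\<in>G. b t - u t) = (\<Sum>t\<in>G. b t)"
        using le unfolding sum.distrib[symmetric] by (intro sum.cong) auto
      moreover have "mdeg a' = mdeg a + e" by (simp add: a'_def mdeg_add mdeg_single)
      ultimately show ?thesis using deg c su by (simp add: e_def)
    qed
    ultimately have "(a', \<lambda>t. b t - u t) \<in> (\<Union>H\<in>Pow G. fy_pairs H k)" by (rule mem)
    then show ?thesis using False by (simp add: ab shift_pair_def a'_def e_def u_def F_def)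
  qed
qed

text \<open>The two cases of the definition cannot collide, since the second would produce an exponent
of \<open>G\<close> that is too large for a Feichtner--Yuzvinsky monomial before the shift.\<close>

lemma shift_pair_inj:
  assumes G: "finite G" "G \<noteq> {}"
  shows "inj_on (shift_pair G) (fy_pairs G (Suc k))"
proof (rule inj_onI)
  have case_top: "G \<in> keys a" if "fy_mon a" "top_set a = G" for a
  proof -
    have "keys a \<noteq> {}" using that G by (auto simp: top_set_def)
    then show ?thesis using top_set_in_keys[of a] that by (simp add: fy_mon_def)
  qed
  have case_low: "lookup a G = 0" if "top_set a \<subset> G" for a
    using keys_subset_top_set[of G a] that by (auto simp: in_keys_iff)
  have mixed: False if a: "fy_mon a" "top_set a = G" and b: "fy_mon c" "top_set c \<subset> G"
    and eq: "a - single G 1 = c + single G (card (G - top_set c) - 1)" for a c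
  proof -
    have l: "lookup (a - single G 1) H = lookup (c + single G (card (G - top_set c) - 1)) H" for H using eq by simp
    have same: "lookup a H = lookup c H" if "H \<noteq> G" for H
      using l[of H] that by (simp add: lookup_add lookup_minus lookup_single)
    have Ga: "G \<in> keys a" using case_top[OF a] .
    have c0: "0 < card (G - top_set c)" using b(2) G by (auto simp: card_gt_0_iff)
    have "lookup a G - 1 = card (G - top_set c) - 1"
      using l[of G] case_low[OF b(2)] by (simp add: lookup_add lookup_minus lookup_single)
    then have la: "lookup a G = card (G - top_set c)" using Ga c0 by (auto simp: in_keys_iff)
    have "top_set c \<in> insert {} (keys a)"
    proof (cases "keys c = {}")
      case True
      then show ?thesis by (simp add: top_set_def)
    next
      case False
      then have "top_set c \<in> keys c" using top_set_in_keys b(1) by (auto simp: fy_mon_def)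
      then show ?thesis using same[of "top_set c"] b(2) by (auto simp: in_keys_iff)
    qed
    then have "lookup a G < card (G - top_set c)" using a(1) Ga b(2) unfolding fy_mon_def by blast
    then show False using la by simp
  qed
  fix x y assume x: "x \<in> fy_pairs G (Suc k)" and y: "y \<in> fy_pairs G (Suc k)" and eq: "shift_pair G x = shift_pair G y"
  obtain a b c d where ab: "x = (a, b)" and cd: "y = (c, d)" by (cases x, cases y)
  have A: "fy_mon a" "top_set a \<union> supp b = G" and C: "fy_mon c" "top_set c \<union> supp d = G"
    using x y by (auto simp: ab cd fy_pairs_def)
  consider "top_set a = G" "top_set c = G" | "top_set a = G" "top_set c \<subset> G" | "top_set a \<subset> G" "top_set c = G"
    | "top_set a \<subset> G" "top_set c \<subset> G" using A(2) C(2) by blast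
  then show "x = y"
  proof cases
    case 1
    then have e: "a - single G 1 = c - single G 1" and bd: "b = d" using eq unfolding ab cd shift_pair_top[OF 1(1)] shift_pair_top[OF 1(2)] by simp_all
    have "lookup a G \<noteq> 0" "lookup c G \<noteq> 0" using case_top A(1) C(1) 1 by (auto simp: in_keys_iff)
    moreover have l: "lookup (a - single G 1) H = lookup (c - single G 1) H" for H using e by simp
    ultimately have "lookup a H = lookup c H" for H
      using l[of H] by (cases "H = G") (simp_all add: lookup_minus lookup_single)
    then have "a = c" by (rule poly_mapping_eqI)
    then show ?thesis using bd by (simp add: ab cd)
  next
    case 2
    then have "a - single G 1 = c + single G (card (G - top_set c) - 1)"
      using eq unfolding ab cd shift_pair_top[OF 2(1)] shift_pair_low[OF 2(2)] by (simp only: prod.inject)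
    then show ?thesis using mixed A(1) C(1) 2 by blast
  next
    case 3
    then have "c - single G 1 = a + single G (card (G - top_set a) - 1)"
      using eq[symmetric] unfolding ab cd shift_pair_top[OF 3(2)] shift_pair_low[OF 3(1)] by (simp only: prod.inject)
    then show ?thesis using mixed A(1) C(1) 3 by blast
  next
    case 4
    then have e: "a + single G (card (G - top_set a) - 1) = c + single G (card (G - top_set c) - 1)"
      and bd: "(\<lambda>t. b t - (if t \<in> G - top_set a then 1 else 0)) = (\<lambda>t. d t - (if t \<in> G - top_set c then 1 else 0))"
      using eq unfolding ab cd shift_pair_low[OF 4(1)] shift_pair_low[OF 4(2)] by simp_all
    have l: "lookup (a + single G (card (G - top_set a) - 1)) H = lookup (c + single G (card (G - top_set c) - 1)) H" for H
      using e by simp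
    have "lookup a H = lookup c H" for H
      using l[of H] case_low 4 by (cases "H = G") (simp_all add: lookup_add lookup_single)
    then have ac: "a = c" by (rule poly_mapping_eqI)
    have "b t = d t" for t
    proof -
      have "t \<in> G - top_set a \<Longrightarrow> b t \<noteq> 0 \<and> d t \<noteq> 0" using A(2) C(2) ac by (auto simp: supp_def)
      then show ?thesis using fun_cong[OF bd, of t] ac by (auto split: if_splits)
    qed
    then show ?thesis using ac by (auto simp: ab cd)
  qed
qed

lemma mdeg_eq_0: "mdeg a = 0 \<Longrightarrow> a = 0"
proof -
  assume "mdeg a = 0"
  then have "lookup a F = lookup 0 F" for F by (cases "F \<in> keys a") (auto simp: mdeg_def in_keys_iff)
  then show ?thesis by (rule poly_mapping_eqI)
qed

text \<open>Induction on the degree: \<open>shift_pair\<close> bounds the left-hand side, and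
\<open>card_chains_step\<close> bounds the right-hand side, by sums over the subsets of \<open>G\<close>.\<close>

lemma card_fy_pairs_le: "finite G \<Longrightarrow> card (fy_pairs G k) \<le> card (top_chains G k)"
proof (induction k arbitrary: G)
  case 0
  have "a = 0 \<and> b = (\<lambda>_. 0) \<and> G = {}" if "(a, b) \<in> fy_pairs G 0" for a b
  proof -
    have p: "top_set a \<union> supp b = G" "mdeg a = 0" "(\<Sum>t\<in>G. b t) = 0" using that by (auto simp: fy_pairs_def)
    have a: "a = 0" using mdeg_eq_0 p by blast
    have "b t = 0" for t using p 0 by (cases "t \<in> G") (auto simp: supp_def)
    then show ?thesis using p a by (auto simp: top_set_def supp_def)
  qed
  then have sub: "fy_pairs G 0 \<subseteq> (if G = {} then {(0, \<lambda>_. 0)} else {})" by auto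
  show ?case
  proof (cases "G = {}")
    case True
    have "0 \<in> top_chains G 0" using True by (simp add: top_chains_def chain_mon_def top_set_def mdeg_def)
    then have "0 < card (top_chains G 0)" using finite_chains[OF 0] by (auto simp: card_gt_0_iff)
    moreover have "card (fy_pairs G 0) \<le> card {(0 :: monomial, \<lambda>_ :: nat. 0 :: nat)}" using sub True by (intro card_mono) auto
    ultimately show ?thesis by simp
  qed (use sub in simp)
next
  case (Suc k)
  show ?case
  proof (cases "G = {}")
    case True
    have "fy_pairs G (Suc k) = {}"
    proof (rule ccontr)
      assume "fy_pairs G (Suc k) \<noteq> {}"
      then obtain a b where a: "fy_mon a" "top_set a = {}" "mdeg a = Suc k" using True by (auto simp: fy_pairs_def)
      have "keys a = {}"
      proof (rule ccontr)
        assume "keys a \<noteq> {}"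
        then have "top_set a \<in> keys a" using a(1) by (intro top_set_in_keys) (simp_all add: fy_mon_def)
        then show False using a by (simp add: fy_mon_def)
      qed
      then show False using \<open>mdeg a = Suc k\<close> by (simp add: mdeg_def)
    qed
    then show ?thesis by simp
  next
    case False
    have fin: "finite (fy_pairs H k)" if "H \<in> Pow G" for H
      using that Suc.prems finite_fy_pairs finite_subset by blast
    have "card (fy_pairs G (Suc k)) \<le> card (\<Union>H\<in>Pow G. fy_pairs H k)"
    proof (rule card_inj_on_le[OF shift_pair_inj[OF Suc.prems False]])
      show "shift_pair G ` fy_pairs G (Suc k) \<subseteq> (\<Union>H\<in>Pow G. fy_pairs H k)"
        using shift_pair_in_fy_pairs[OF Suc.prems False] by blast
      show "finite (\<Union>H\<in>Pow G. fy_pairs H k)" using Suc.prems fin by blast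
    qed
    also have "\<dots> \<le> (\<Sum>H\<in>Pow G. card (fy_pairs H k))" using Suc.prems by (intro card_UN_le) simp
    also have "\<dots> \<le> (\<Sum>H\<in>Pow G. card (top_chains H k))"
      using Suc.prems finite_subset by (intro sum_mono Suc.IH) auto
    also have "\<dots> \<le> card (top_chains G (Suc k))" by (rule card_chains_step[OF Suc.prems False])
    finally show ?thesis .
  qed
qed

definition chain_mons :: "nat \<Rightarrow> nat \<Rightarrow> nat \<Rightarrow> monomial set" where
  "chain_mons r n k = {a. keys a \<subseteq> flats r n \<and> chain_mon a \<and> mdeg a = k}"

lemma finite_chain_mons: "finite (chain_mons r n k)"
  by (rule finite_subset[OF _ finite_monomials_on[OF finite_flats, of r n k]]) (auto simp: chain_mons_def)

lemma keys_flatsI: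
  assumes "top_set a \<subseteq> {1..n}" "card (top_set a) < r" "{} \<notin> keys a"
  shows "keys a \<subseteq> flats r n"
proof
  fix F assume F: "F \<in> keys a"
  have "finite (top_set a)" using assms(1) by (rule finite_subset) simp
  then have "card F \<le> card (top_set a)" using keys_subset_top_set[OF F] by (rule card_mono)
  then show "F \<in> flats r n" using F assms keys_subset_top_set[OF F] by (auto simp: flats_def)
qed

lemma fy_index_eq: "fy_index r n k = (\<Union>G\<in>{G. G \<subseteq> {1..n} \<and> card G < r}. fy_pairs G k)"
proof (intro set_eqI iffI)
  fix x assume x: "x \<in> fy_index r n k"
  obtain a b where ab: "x = (a, b)" by (cases x)
  let ?G = "top_set a \<union> supp b"
  have X: "fy_mon a" "keys a \<subseteq> flats r n" "admissible n r (top_set a) b" "mdeg a + deg n b = k"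
    using x by (auto simp: ab fy_index_def)
  have "?G \<subseteq> {1..n}" using X(3) top_set_subset[OF X(2)] by (auto simp: admissible_def)
  moreover have "card ?G < r" using X(3) by (simp add: admissible_def Un_commute)
  moreover have "deg n b = (\<Sum>t\<in>?G. b t)" using sum_supp[of b ?G n] calculation by simp
  ultimately show "x \<in> (\<Union>G\<in>{G. G \<subseteq> {1..n} \<and> card G < r}. fy_pairs G k)"
    using X by (auto simp: ab fy_pairs_def)
next
  fix x assume "x \<in> (\<Union>G\<in>{G. G \<subseteq> {1..n} \<and> card G < r}. fy_pairs G k)"
  then obtain G where G: "G \<subseteq> {1..n}" "card G < r" "x \<in> fy_pairs G k" by auto
  obtain a b where ab: "x = (a, b)" by (cases x)
  have P: "fy_mon a" "top_set a \<union> supp b = G" "mdeg a + (\<Sum>t\<in>G. b t) = k" using G(3) by (auto simp: ab fy_pairs_def)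
  have fG: "finite G" using G(1) by (rule finite_subset) simp
  have "card (top_set a) \<le> card G" using P(2) fG by (intro card_mono) auto
  then have "keys a \<subseteq> flats r n" using P G by (intro keys_flatsI) (auto simp: fy_mon_def)
  moreover have "deg n b = (\<Sum>t\<in>G. b t)" using sum_supp[of b G n] P(2) G(1) by auto
  ultimately show "x \<in> fy_index r n k" using P G by (auto simp: ab fy_index_def admissible_def Un_commute)
qed

lemma finite_fy_index: "finite (fy_index r n k)"
  unfolding fy_index_eq
proof (rule finite_UN_I)
  show "finite {G. G \<subseteq> {1..n} \<and> card G < r}" by (rule finite_subset[of _ "Pow {1..n}"]) auto
  fix G assume "G \<in> {G. G \<subseteq> {1..n} \<and> card G < r}"
  then have "G \<subseteq> {1..n}" by simp
  then have "finite G" by (rule finite_subset) simp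
  then show "finite (fy_pairs G k)" by (rule finite_fy_pairs)
qed

lemma card_fy_index_le:
  assumes r: "1 \<le> r"
  shows "card (fy_index r n k) \<le> card (chain_mons r n k)"
proof -
  let ?I = "{G. G \<subseteq> {1..n} \<and> card G < r}"
  have fI: "finite ?I" by (rule finite_subset[of _ "Pow {1..n}"]) auto
  have fG: "finite G" if "G \<in> ?I" for G
  proof -
    have "G \<subseteq> {1..n}" using that by simp
    then show ?thesis by (rule finite_subset) simp
  qed
  have "card (fy_index r n k) \<le> (\<Sum>G\<in>?I. card (fy_pairs G k))" unfolding fy_index_eq by (rule card_UN_le[OF fI])
  also have "\<dots> \<le> (\<Sum>G\<in>?I. card (top_chains G k))" using fG by (intro sum_mono card_fy_pairs_le)
  also have "\<dots> = card (\<Union>G\<in>?I. top_chains G k)"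
  proof (rule card_UN_disjoint[symmetric, OF fI])
    show "\<forall>G\<in>?I. finite (top_chains G k)" by (intro ballI finite_chains fG)
    show "\<forall>G\<in>?I. \<forall>H\<in>?I. G \<noteq> H \<longrightarrow> top_chains G k \<inter> top_chains H k = {}"
      by (auto simp: top_chains_def)
  qed
  also have "(\<Union>G\<in>?I. top_chains G k) = chain_mons r n k"
  proof (intro set_eqI iffI)
    fix a assume "a \<in> (\<Union>G\<in>?I. top_chains G k)"
    then show "a \<in> chain_mons r n k" using keys_flatsI[of a n r] by (auto simp: top_chains_def chain_mons_def)
  next
    fix a assume a: "a \<in> chain_mons r n k"
    then have "top_set a \<in> ?I" using top_set_subset[of a r n] card_top_set_less[of a r n] r by (auto simp: chain_mons_def)
    moreover have "a \<in> top_chains (top_set a) k" using a by (auto simp: top_chains_def chain_mons_def flats_def)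
    ultimately show "a \<in> (\<Union>G\<in>?I. top_chains G k)" by blast
  qed
  finally show ?thesis .
qed

definition fy_comb :: "nat \<Rightarrow> nat \<Rightarrow> nat \<Rightarrow> (monomial \<times> (nat \<Rightarrow> nat) \<Rightarrow> rat) \<Rightarrow> flat_poly" where
  "fy_comb r n k c = (\<Sum>x\<in>fy_index r n k. single 0 (c x) * fy_elem r n x)"

lemma fy_comb_add: "fy_comb r n k (\<lambda>x. c x + d x) = fy_comb r n k c + fy_comb r n k d"
  by (simp add: fy_comb_def single_add distrib_right sum.distrib)

lemma fy_comb_scale: "fy_comb r n k (\<lambda>x. u * c x) = single 0 u * fy_comb r n k c"
proof -
  have s: "single (0 :: monomial) (u * v) = single 0 u * single 0 v" for v by (simp add: mult_single)
  show ?thesis unfolding fy_comb_def s sum_distrib_left by (simp add: mult.assoc)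
qed

lemma fy_comb_0: "fy_comb r n k (\<lambda>_. 0) = 0"
  by (simp add: fy_comb_def)

lemma fy_comb_in: "fy_comb r n k c \<in> poly_ring r n \<inter> homogeneous k"
proof -
  have "single 0 (c x) * fy_elem r n x \<in> poly_ring r n \<and> single 0 (c x) * fy_elem r n x \<in> homogeneous k" if "x \<in> fy_index r n k" for x
  proof -
    obtain a b where x: "x = (a, b)" by (cases x)
    have "fy_elem r n x \<in> poly_ring r n" "fy_elem r n x \<in> homogeneous k"
      using that fy_elem_poly_ring[of a r n b] fy_elem_homogeneous[of a n b k r] by (auto simp: x fy_index_def)
    then show ?thesis
      using poly_ring_mult[OF poly_ring_single[of 0 r n]] homogeneous_mult[OF homogeneous_single[of 0 0]]
      by (fastforce simp: mdeg_def)
  qed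
  then have "A \<subseteq> fy_index r n k \<Longrightarrow> (\<Sum>x\<in>A. single 0 (c x) * fy_elem r n x) \<in> poly_ring r n \<inter> homogeneous k" for A
  proof (induction A rule: infinite_finite_induct)
    case (insert x A)
    then show ?case by (simp add: poly_ring_add homogeneous_add)
  qed (simp_all add: poly_ring_0 homogeneous_def)
  then show ?thesis unfolding fy_comb_def by blast
qed

lemma fy_span_fy_comb: "p \<in> fy_span r n k \<Longrightarrow> \<exists>c\<in>supported (fy_index r n k). p - fy_comb r n k c \<in> sr_ideal r n"
proof (induction rule: fy_span.induct)
  case (ideal y)
  then show ?case
    by (intro bexI[of _ "\<lambda>_. 0"]) (simp_all add: fy_comb_0 supported_def)
next
  case (base x c)
  have "fy_comb r n k (\<lambda>y. if y = x then c else 0) = (\<Sum>y\<in>fy_index r n k. if y = x then single 0 c * fy_elem r n x else 0)"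
    unfolding fy_comb_def by (intro sum.cong) auto
  also have "\<dots> = single 0 c * fy_elem r n x" using base finite_fy_index by simp
  finally show ?case using base
    by (intro bexI[of _ "\<lambda>y. if y = x then c else 0"]) (auto simp: supported_def sr_ideal.zero)
next
  case (add p q)
  then obtain c d where c: "c \<in> supported (fy_index r n k)" "p - fy_comb r n k c \<in> sr_ideal r n"
    and d: "d \<in> supported (fy_index r n k)" "q - fy_comb r n k d \<in> sr_ideal r n" by auto
  have "p + q - fy_comb r n k (\<lambda>x. c x + d x) \<in> sr_ideal r n"
    using sr_ideal.add[OF c(2) d(2)] by (simp add: fy_comb_add algebra_simps)
  moreover have "(\<lambda>x. c x + d x) \<in> supported (fy_index r n k)" using c d by (simp add: supported_def)
  ultimately show ?case by blast
qed

lemma fy_spanning: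
  assumes r: "1 \<le> r" and p: "p \<in> poly_ring r n \<inter> homogeneous k"
  shows "\<exists>c\<in>supported (fy_index r n k). p - fy_comb r n k c \<in> sr_ideal r n"
proof (rule fy_span_fy_comb)
  have 1: "single a (lookup p a) \<in> fy_span r n k" if a: "a \<in> keys p" for a
  proof -
    have "keys a \<subseteq> flats r n" "mdeg a = k" using a p by (auto simp: poly_ring_def homogeneous_def)
    then have "single a 1 \<in> fy_span r n k" using single_in_fy_span[OF r] by blast
    then have "single 0 (lookup p a) * single a 1 \<in> fy_span r n k" by (rule fy_span_scale)
    then show ?thesis by (simp add: mult_single)
  qed
  have "A \<subseteq> keys p \<Longrightarrow> (\<Sum>a\<in>A. single a (lookup p a)) \<in> fy_span r n k" for A
  proof (induction A rule: infinite_finite_induct)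
    case (insert a A)
    then have "single a (lookup p a) \<in> fy_span r n k" "(\<Sum>a\<in>A. single a (lookup p a)) \<in> fy_span r n k" using 1 by auto
    then have "single a (lookup p a) + (\<Sum>a\<in>A. single a (lookup p a)) \<in> fy_span r n k" by (rule fy_span.add)
    then show ?case using insert.hyps by simp
  qed (simp_all add: fy_span.ideal sr_ideal.zero)
  then have "(\<Sum>a\<in>keys p. single a (lookup p a)) \<in> fy_span r n k" by blast
  then show "p \<in> fy_span r n k" using poly_mapping_sum_single[of p] by simp
qed

text \<open>The chain monomials are a basis modulo the ideal.  The products span, and by
\<open>card_fy_index_le\<close> there are not more of them than chain monomials; hence by rank and nullity there
is no relation.\<close>

lemma fy_independent:
  assumes r: "1 \<le> r" and c: "c \<in> supported (fy_index r n k)" and z: "fy_comb r n k c \<in> sr_ideal r n"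
  shows "c = 0"
proof -
  define f where "f c = (\<lambda>m. if m \<in> chain_mons r n k then lookup (fy_comb r n k c) m else 0)" for c
  have lin: "Vector_Spaces.linear fscale fscale f"
  proof (rule fs_linearI)
    show "f (u + v) = f u + f v" for u v
      by (simp add: f_def fun_eq_iff plus_fun_def fy_comb_add lookup_add)
    have "lookup (single 0 c * p) m = c * lookup p m" for c :: rat and p :: flat_poly and m
      by (simp add: map.rep_eq when_def flip: mult_map_scale_conv_mult)
    then show "f (fscale c v) = fscale c (f v)" for c v
      by (simp add: f_def fun_eq_iff fscale_def fy_comb_scale)
  qed
  have img: "f ` supported (fy_index r n k) = supported (chain_mons r n k)"
  proof
    show "f ` supported (fy_index r n k) \<subseteq> supported (chain_mons r n k)" by (auto simp: f_def supported_def)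
    show "supported (chain_mons r n k) \<subseteq> f ` supported (fy_index r n k)"
    proof
      fix g assume g: "g \<in> supported (chain_mons r n k)"
      define p where "p = (\<Sum>m\<in>chain_mons r n k. single m (g m))"
      have lp: "lookup p m = g m" for m
        using g finite_chain_mons[of r n k] by (auto simp: p_def lookup_sum lookup_single when_def supported_def)
      then have "keys p \<subseteq> chain_mons r n k" using g by (auto simp: in_keys_iff supported_def)
      then have "p \<in> poly_ring r n \<inter> homogeneous k" by (auto simp: poly_ring_def homogeneous_def chain_mons_def)
      then obtain d where d: "d \<in> supported (fy_index r n k)" "p - fy_comb r n k d \<in> sr_ideal r n" using fy_spanning[OF r] by blast
      have "f d m = g m" for m
      proof (cases "m \<in> chain_mons r n k")
        case True
        then have "m \<notin> keys (p - fy_comb r n k d)" using sr_ideal_zero_coeff[OF d(2)] by (auto simp: chain_mons_def)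
        then have "lookup p m = lookup (fy_comb r n k d) m" by (simp add: in_keys_iff lookup_minus)
        then show ?thesis using True lp by (simp add: f_def)
      qed (use g in \<open>simp add: f_def supported_def\<close>)
      then have "g = f d" by auto
      then show "g \<in> f ` supported (fy_index r n k)" using d(1) by blast
    qed
  qed
  have fin: "fs.fin_dim (supported (fy_index r n k))" using finite_fy_index by (rule dim_supported)
  define K where "K = {v \<in> supported (fy_index r n k). f v = 0}"
  interpret f: Vector_Spaces.linear fscale fscale f by (rule lin)
  have finK: "fs.fin_dim K"
  proof (rule fs.fin_dim_mono[OF fin])
    show "fs.subspace K" using subspace_supported[of "fy_index r n k"]
      unfolding K_def fs.subspace_def by (simp add: f.add f.scale f.zero)
  qed (auto simp: K_def)
  have "card (fy_index r n k) = fs.dim K + card (chain_mons r n k)"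
    using fsp.rank_nullity[OF lin fin] dim_supported(2)[OF finite_fy_index[of r n k]]
      dim_supported(2)[OF finite_chain_mons[of r n k]] by (simp add: img K_def)
  then have "fs.dim K = 0" using card_fy_index_le[OF r, of n k] by simp
  moreover have "c \<in> K"
  proof -
    have "f c = 0" using sr_ideal_zero_coeff[OF z] by (auto simp: f_def fun_eq_iff chain_mons_def in_keys_iff)
    then show ?thesis using c by (simp add: K_def)
  qed
  ultimately show ?thesis
  proof -
    obtain B where B: "finite B" "B \<subseteq> K" "fs.span B = K" "card B = fs.dim K" using fs.fin_dim_basis[OF finK] .
    then have "K = {0}" using \<open>fs.dim K = 0\<close> by (auto simp: fs.span_empty)
    then show ?thesis using \<open>c \<in> K\<close> by simp
  qed
qed

section \<open>Splitting of the Koszul complex\<close>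

text \<open>The coefficient spaces of \<open>K_num\<close> and \<open>K_den\<close>.\<close>

definition num_part where "num_part r n k = poly_ring r n \<inter> homogeneous k"
definition den_part where "den_part r n k = sr_ideal r n \<inter> homogeneous k"

lemma homogeneous_scale: "p \<in> homogeneous k \<Longrightarrow> single 0 c * p \<in> homogeneous k"
  using homogeneous_mult[OF homogeneous_single[of 0 0 c], of p k] by (simp add: mdeg_def)

lemma poly_ring_scale: "p \<in> poly_ring r n \<Longrightarrow> single 0 c * p \<in> poly_ring r n"
  by (rule poly_ring_mult) (simp_all add: poly_ring_single)

lemma coeff_space_num: "coeff_space (num_part r n k)"
  by (auto simp: coeff_space_def num_part_def poly_ring_0 homogeneous_add poly_ring_add homogeneous_scale poly_ring_scale)
    (simp add: homogeneous_def)

lemma coeff_space_den: "coeff_space (den_part r n k)"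
  by (auto simp: coeff_space_def den_part_def sr_ideal.zero sr_ideal.add homogeneous_add homogeneous_scale sr_ideal_scale)
    (simp add: homogeneous_def)

lemma K_num_forms: "1 \<le> n \<Longrightarrow> K_num r n i (i + k) = forms n (num_part r n k) i"
  by (simp add: K_num_def num_part_def[symmetric] tens_eq_forms[OF coeff_space_num])

lemma K_den_forms: "1 \<le> n \<Longrightarrow> K_den r n i (i + k) = forms n (den_part r n k) i"
  by (simp add: K_den_def den_part_def[symmetric] tens_eq_forms[OF coeff_space_den])

lemma forms_denI:
  assumes "u \<in> forms n (num_part r n k) i" "\<And>S. u S \<in> sr_ideal r n"
  shows "u \<in> forms n (den_part r n k) i"
  using assms by (simp add: forms_def num_part_def den_part_def)

lemma forms_denD: "u \<in> forms n (den_part r n k) i \<Longrightarrow> u S \<in> sr_ideal r n"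
  by (simp add: forms_def den_part_def)

lemma fy_comb_cong: "(\<And>x. x \<in> fy_index r n k \<Longrightarrow> c x = d x) \<Longrightarrow> fy_comb r n k c = fy_comb r n k d"
  unfolding fy_comb_def by (intro sum.cong) auto

lemma fy_comb_sum: "fy_comb r n k (\<lambda>x. \<Sum>t\<in>A. c t x) = (\<Sum>t\<in>A. fy_comb r n k (c t))"
  by (induction A rule: infinite_finite_induct) (simp_all add: fy_comb_0 fy_comb_add)

lemma fy_comb_contraction:
  "fy_comb r n k (\<lambda>x. \<Sum>t\<in>{1..n}. contract t (\<lambda>U. v U x) S) = (\<Sum>t\<in>{1..n} - S. sgn_ins S t * fy_comb r n k (v (insert t S)))"
proof -
  have "(\<Sum>t\<in>{1..n}. contract t (\<lambda>U. v U x) S) = (\<Sum>t\<in>{1..n} - S. ins_sign S t * v (insert t S) x)" for x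
    by (rule sum.mono_neutral_cong_right) (auto simp: contract_def)
  then show ?thesis by (simp add: fy_comb_sum fy_comb_scale sgn_ins_ins_sign)
qed

text \<open>The form with coefficients \<open>\<Sum> w (a, S, b) a \<theta>\<^sup>b\<close>.\<close>

definition to_form :: "nat \<Rightarrow> nat \<Rightarrow> nat \<Rightarrow> (monomial \<times> nat set \<times> (nat \<Rightarrow> nat) \<Rightarrow> rat) \<Rightarrow> form" where
  "to_form r n k w = (\<lambda>S. fy_comb r n k (\<lambda>(a, b). w (a, S, b)))"

definition fy_mons :: "nat \<Rightarrow> nat \<Rightarrow> nat \<Rightarrow> monomial set" where
  "fy_mons r n k = {a. fy_mon a \<and> keys a \<subseteq> flats r n \<and> mdeg a \<le> k}"

lemma finite_fy_mons: "finite (fy_mons r n k)"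
proof (rule finite_subset)
  show "fy_mons r n k \<subseteq> (\<Union>j\<in>{..k}. chain_mons r n j)" by (auto simp: fy_mons_def chain_mons_def fy_mon_def)
qed (simp add: finite_chain_mons)

text \<open>The direct sum, over Feichtner--Yuzvinsky monomials \<open>a\<close>, of the Koszul complexes of the
truncated polynomial rings for \<open>F = top_set a\<close>, in degrees lowered by that of \<open>a\<close>.\<close>

abbreviation total_chains where
  "total_chains r n i k \<equiv> family (fy_mons r n k) (\<lambda>a. skel_chains n r (top_set a) i (k - mdeg a))"

definition total_d where
  "total_d n r w = (\<lambda>(a, x). skel_d n r (top_set a) (\<lambda>x. w (a, x)) x)"

lemma total_chains_supported:
  assumes w: "w \<in> total_chains r n i k"
  shows "(\<lambda>(a, b). w (a, S, b)) \<in> supported (fy_index r n k)"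
    and "w (a, S, b) \<noteq> 0 \<Longrightarrow> S \<subseteq> {1..n} \<and> card S = i"
    and "(\<Sum>t\<in>{1..n}. contract t (\<lambda>U. w (a, U, b)) S) = 0"
proof -
  have *: "(a, b) \<in> fy_index r n k \<and> S \<subseteq> {1..n} \<and> card S = i" if nz: "w (a, S, b) \<noteq> 0" for a b S
  proof -
    have a: "a \<in> fy_mons r n k" using w nz unfolding family_def by blast
    then have "(\<lambda>x. w (a, x)) \<in> skel_chains n r (top_set a) i (k - mdeg a)" using w by (simp add: family_def)
    note D = kchainD(1-3)[OF this, of S b]
    have "b \<in> admissible_exps n r (top_set a) (k - mdeg a)" "S \<subseteq> {1..n}" "card S = i" using D nz by auto
    then show ?thesis using a by (simp add: admissible_exps_def fy_index_def fy_mons_def)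
  qed
  show "(\<lambda>(a, b). w (a, S, b)) \<in> supported (fy_index r n k)" using * by (auto simp: supported_def)
  show "w (a, S, b) \<noteq> 0 \<Longrightarrow> S \<subseteq> {1..n} \<and> card S = i" using * by blast
  show "(\<Sum>t\<in>{1..n}. contract t (\<lambda>U. w (a, U, b)) S) = 0"
  proof (cases "a \<in> fy_mons r n k")
    case True
    then have "(\<lambda>x. w (a, x)) \<in> skel_chains n r (top_set a) i (k - mdeg a)" using w by (simp add: family_def)
    then show ?thesis using kchainD(4) by fastforce
  next
    case False
    then show ?thesis using w by (simp add: family_def contract_0)
  qed
qed

lemma total_chainsI:
  assumes "\<And>a S b. w (a, S, b) \<noteq> 0 \<Longrightarrow> (a, b) \<in> fy_index r n k \<and> S \<subseteq> {1..n} \<and> card S = i"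
    and "\<And>a S b. (\<Sum>t\<in>{1..n}. contract t (\<lambda>U. w (a, U, b)) S) = 0"
  shows "w \<in> total_chains r n i k"
  unfolding family_def skel_chains_def
proof (intro CollectI conjI ballI allI impI)
  fix a S b assume "w (a, S, b) \<noteq> 0"
  then show "S \<subseteq> {1..n}" "card S = i" "b \<in> admissible_exps n r (top_set a) (k - mdeg a)"
    using assms(1)[of a S b] by (auto simp: fy_index_def admissible_exps_def)
next
  fix a x assume a: "a \<notin> fy_mons r n k"
  show "w (a, x) = 0"
  proof (rule ccontr)
    assume "w (a, x) \<noteq> 0"
    then have "(a, snd x) \<in> fy_index r n k" using assms(1)[of a "fst x" "snd x"] by simp
    then show False using a by (simp add: fy_index_def fy_mons_def)
  qed
qed (rule assms(2))

lemma to_form_forms: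
  assumes w: "w \<in> total_chains r n i k"
  shows "to_form r n k w \<in> forms n (num_part r n k) i"
  unfolding forms_def
proof (intro CollectI conjI allI impI)
  fix S
  show "to_form r n k w S \<in> num_part r n k" unfolding to_form_def num_part_def by (rule fy_comb_in)
  assume nz: "to_form r n k w S \<noteq> 0"
  have "\<exists>a b. w (a, S, b) \<noteq> 0"
  proof (rule ccontr)
    assume "\<not> ?thesis"
    then have "(\<lambda>(a, b). w (a, S, b)) = (\<lambda>_. 0)" by auto
    then show False using nz by (simp add: to_form_def fy_comb_0)
  qed
  then show "S \<subseteq> {1..n}" "card S = i" using total_chains_supported(2)[OF w] by blast+
next
  show "contraction n (to_form r n k w) = 0"
  proof
    fix S
    have "contraction n (to_form r n k w) S = fy_comb r n k (\<lambda>x. \<Sum>t\<in>{1..n}. contract t (\<lambda>U. case x of (a, b) \<Rightarrow> w (a, U, b)) S)"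
      unfolding fy_comb_contraction contraction_def to_form_def ..
    also have "\<dots> = fy_comb r n k (\<lambda>_. 0)"
      using total_chains_supported(3)[OF w] by (intro fy_comb_cong) auto
    finally show "contraction n (to_form r n k w) S = 0 S" by (simp add: fy_comb_0)
  qed
qed

lemma to_form_injective:
  assumes r: "1 \<le> r" and w: "w \<in> total_chains r n i k" and z: "\<And>S. to_form r n k w S \<in> sr_ideal r n"
  shows "w = 0"
proof
  fix y :: "monomial \<times> nat set \<times> (nat \<Rightarrow> nat)"
  obtain a S b where y: "y = (a, S, b)" by (cases y)
  have "(\<lambda>(a, b). w (a, S, b)) = 0"
    using fy_independent[OF r total_chains_supported(1)[OF w] z[of S, unfolded to_form_def]] .
  then have "(\<lambda>(a, b). w (a, S, b)) (a, b) = 0 (a, b)" by (rule fun_cong)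
  then show "w y = 0 y" by (simp add: y)
qed

lemma to_form_add: "to_form r n k (u + v) = to_form r n k u + to_form r n k v"
proof
  fix S
  have "(\<lambda>(a, b). (u + v) (a, S, b)) = (\<lambda>x. (case x of (a, b) \<Rightarrow> u (a, S, b)) + (case x of (a, b) \<Rightarrow> v (a, S, b)))"
    by auto
  then show "to_form r n k (u + v) S = (to_form r n k u + to_form r n k v) S" by (simp add: to_form_def fy_comb_add)
qed

lemma to_form_scale: "to_form r n k (fscale c v) = rscale c (to_form r n k v)"
proof
  fix S
  have "(\<lambda>(a, b). fscale c v (a, S, b)) = (\<lambda>x. c * (case x of (a, b) \<Rightarrow> v (a, S, b)))"
    by (auto simp: fscale_def)
  then show "to_form r n k (fscale c v) S = rscale c (to_form r n k v) S" by (simp add: to_form_def fy_comb_scale rscale_def)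
qed

text \<open>The coefficients of \<open>u\<close> are expanded in the products \<open>a \<theta>\<^sup>b\<close> one set \<open>S\<close> at a time.  By
independence the contraction vanishes on the expansions as it does on \<open>u\<close>.\<close>

lemma to_form_surjective:
  assumes r: "1 \<le> r" and u: "u \<in> forms n (num_part r n k) i"
  shows "\<exists>w\<in>total_chains r n i k. u - to_form r n k w \<in> forms n (den_part r n k) i"
proof -
  have "\<exists>c. c \<in> supported (fy_index r n k) \<and> u S - fy_comb r n k c \<in> sr_ideal r n \<and> (u S = 0 \<longrightarrow> c = 0)" for S
  proof (cases "u S = 0")
    case True
    then show ?thesis by (intro exI[of _ 0]) (simp add: supported_def zero_fun_def fy_comb_0 sr_ideal.zero)
  next
    case False
    have "u S \<in> poly_ring r n \<inter> homogeneous k" using u by (simp add: forms_def num_part_def)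
    from fy_spanning[OF r this] show ?thesis using False by blast
  qed
  then obtain c where c: "\<And>S. c S \<in> supported (fy_index r n k)" "\<And>S. u S - fy_comb r n k (c S) \<in> sr_ideal r n"
    "\<And>S. u S = 0 \<Longrightarrow> c S = 0" by metis
  define w where "w = (\<lambda>(a, S, b). c S (a, b))"
  have Pw: "to_form r n k w S = fy_comb r n k (c S)" for S by (simp add: to_form_def w_def)
  have contr: "(\<lambda>x. \<Sum>t\<in>{1..n}. contract t (\<lambda>U. c U x) S) = 0" for S
  proof (rule fy_independent[OF r])
    show "(\<lambda>x. \<Sum>t\<in>{1..n}. contract t (\<lambda>U. c U x) S) \<in> supported (fy_index r n k)"
      using c(1) by (auto simp: supported_def contract_def intro!: sum.neutral)
    have "contraction n u S = 0" using u by (simp add: forms_def)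
    then have "(\<Sum>t\<in>{1..n} - S. sgn_ins S t * u (insert t S)) = 0" by (simp add: contraction_def)
    then have "fy_comb r n k (\<lambda>x. \<Sum>t\<in>{1..n}. contract t (\<lambda>U. c U x) S)
        = - (\<Sum>t\<in>{1..n} - S. single 0 (ins_sign S t) * (u (insert t S) - fy_comb r n k (c (insert t S))))"
      unfolding fy_comb_contraction sgn_ins_ins_sign right_diff_distrib sum_subtractf by simp
    also have "\<dots> \<in> sr_ideal r n"
      by (intro sr_ideal_uminus sr_ideal_sum sr_ideal_scale c(2))
    finally show "fy_comb r n k (\<lambda>x. \<Sum>t\<in>{1..n}. contract t (\<lambda>U. c U x) S) \<in> sr_ideal r n" .
  qed
  have w: "w \<in> total_chains r n i k"
  proof (rule total_chainsI)
    fix a S b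
    show "(a, b) \<in> fy_index r n k \<and> S \<subseteq> {1..n} \<and> card S = i" if nz: "w (a, S, b) \<noteq> 0"
    proof -
      have n0: "c S (a, b) \<noteq> 0" using nz by (simp add: w_def)
      then have "(a, b) \<in> fy_index r n k" using c(1)[of S] unfolding supported_def by blast
      moreover have "u S \<noteq> 0" using n0 c(3)[of S] by auto
      ultimately show ?thesis using u unfolding forms_def by blast
    qed
    show "(\<Sum>t\<in>{1..n}. contract t (\<lambda>U. w (a, U, b)) S) = 0"
      using fun_cong[OF contr[of S], of "(a, b)"] by (simp add: w_def)
  qed
  moreover have "u - to_form r n k w \<in> forms n (den_part r n k) i"
  proof (rule forms_denI)
    show "u - to_form r n k w \<in> forms n (num_part r n k) i"
      using u to_form_forms[OF w] by (intro form.subspace_diff forms_subspace coeff_space_num)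
    show "(u - to_form r n k w) S \<in> sr_ideal r n" for S using c(2)[of S] by (simp add: Pw)
  qed
  ultimately show ?thesis by blast
qed

definition shift_exp :: "nat \<Rightarrow> (monomial \<times> (nat \<Rightarrow> nat) \<Rightarrow> rat) \<Rightarrow> monomial \<times> (nat \<Rightarrow> nat) \<Rightarrow> rat" where
  "shift_exp t c = (\<lambda>(a, b). if b t \<noteq> 0 then c (a, dec b t) else 0)"

lemma theta_var_fy_comb:
  assumes r: "1 \<le> r" and t: "t \<in> {1..n}"
  shows "theta_var r n t * fy_comb r n k c - fy_comb r n (Suc k) (\<lambda>x. if x \<in> (\<lambda>(a, b). (a, inc b t)) ` fy_index r n k then shift_exp t c x else 0) \<in> sr_ideal r n"
proof -
  define h where "h = (\<lambda>(a :: monomial, b). (a, inc b t))"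
  define X where "X = {x \<in> fy_index r n k. h x \<in> fy_index r n (Suc k)}"
  have fX: "finite (fy_index r n k)" by (rule finite_fy_index)
  have fy_elem: "theta_var r n t * fy_elem r n x = fy_elem r n (h x)" for x
    using theta_var_fy_elem[OF t] by (cases x) (simp add: h_def)
  have ideal: "fy_elem r n (h x) \<in> sr_ideal r n" if x: "x \<in> fy_index r n k - X" for x
  proof -
    obtain a b where ab: "x = (a, b)" by (cases x)
    have I: "fy_mon a" "keys a \<subseteq> flats r n" "admissible n r (top_set a) b" "mdeg a + deg n b = k" "(a, inc b t) \<notin> fy_index r n (Suc k)"
      using x by (auto simp: X_def ab h_def fy_index_def)
    have bs: "supp (inc b t) \<subseteq> {1..n}" using I(3) t by (auto simp: admissible_def supp_inc)
    have "\<not> admissible n r (top_set a) (inc b t)" using I deg_inc[OF t, of b] by (simp add: fy_index_def)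
    then have "r \<le> card (supp (inc b t) \<union> top_set a)" using bs by (simp add: admissible_def)
    then show ?thesis using fy_elem_in_sr_ideal[OF I(2) bs r] by (simp add: ab h_def)
  qed
  have inj: "inj_on h X" unfolding h_def inj_on_def by (auto, metis dec_inc_same)
  have "fy_comb r n (Suc k) (\<lambda>x. if x \<in> h ` fy_index r n k then shift_exp t c x else 0)
      = (\<Sum>y\<in>h ` X. single 0 (shift_exp t c y) * fy_elem r n y)"
    unfolding fy_comb_def using finite_fy_index by (intro sum.mono_neutral_cong_right) (auto simp: X_def)
  also have "\<dots> = (\<Sum>x\<in>X. single 0 (shift_exp t c (h x)) * fy_elem r n (h x))"
    by (simp add: sum.reindex[OF inj])
  also have "\<dots> = (\<Sum>x\<in>X. single 0 (c x) * fy_elem r n (h x))"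
  proof (intro sum.cong refl)
    fix x :: "monomial \<times> (nat \<Rightarrow> nat)"
    have "shift_exp t c (h x) = c x" by (cases x) (simp add: shift_exp_def h_def dec_inc_same, simp add: inc_def)
    then show "single 0 (shift_exp t c (h x)) * fy_elem r n (h x) = single 0 (c x) * fy_elem r n (h x)" by simp
  qed
  finally have 1: "fy_comb r n (Suc k) (\<lambda>x. if x \<in> h ` fy_index r n k then shift_exp t c x else 0)
      = (\<Sum>x\<in>X. single 0 (c x) * fy_elem r n (h x))" .
  have "theta_var r n t * fy_comb r n k c = (\<Sum>x\<in>fy_index r n k. single 0 (c x) * fy_elem r n (h x))"
    unfolding fy_comb_def sum_distrib_left fy_elem[symmetric] by (simp add: mult.left_commute)
  also have "\<dots> = (\<Sum>x\<in>X. single 0 (c x) * fy_elem r n (h x)) + (\<Sum>x\<in>fy_index r n k - X. single 0 (c x) * fy_elem r n (h x))"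
    using fX by (subst sum.subset_diff[of X]) (auto simp: X_def add.commute)
  finally show ?thesis
    unfolding h_def[symmetric] 1 using ideal by (auto intro!: sr_ideal_sum sr_ideal_scale)
qed

text \<open>Multiplication by \<open>\<theta>\<^sub>t\<close> raises the exponent of \<open>t\<close>; the products that leave the
index set are in the ideal by \<open>fy_elem_in_sr_ideal\<close>.\<close>

lemma theta_var_fy_comb_supported:
  assumes r: "1 \<le> r" and t: "t \<in> {1..n}" and c: "c \<in> supported (fy_index r n k)"
  shows "theta_var r n t * fy_comb r n k c - fy_comb r n (Suc k) (shift_exp t c) \<in> sr_ideal r n"
proof -
  have "shift_exp t c x = 0" if "x \<notin> (\<lambda>(a, b). (a, inc b t)) ` fy_index r n k" for x
  proof (rule ccontr)
    obtain a b where ab: "x = (a, b)" by (cases x)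
    assume nz: "shift_exp t c x \<noteq> 0"
    then have b: "b t \<noteq> 0" and "c (a, dec b t) \<noteq> 0" by (auto simp: shift_exp_def ab split: if_splits)
    then have "(a, dec b t) \<in> fy_index r n k" using c unfolding supported_def by blast
    then have "(\<lambda>(a, b). (a, inc b t)) (a, dec b t) \<in> (\<lambda>(a, b). (a, inc b t)) ` fy_index r n k" by (rule imageI)
    then show False using that b by (simp add: ab inc_dec_same)
  qed
  then have "fy_comb r n (Suc k) (\<lambda>x. if x \<in> (\<lambda>(a, b). (a, inc b t)) ` fy_index r n k then shift_exp t c x else 0)
      = fy_comb r n (Suc k) (shift_exp t c)"
    by (intro fy_comb_cong) (simp only: if_cancel split: if_split, simp)
  then show ?thesis using theta_var_fy_comb[OF r t, of k c] by (simp only:)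
qed

text \<open>The map \<open>to_form\<close> commutes with the differentials up to the ideal.\<close>

lemma koszul_d_to_form:
  assumes r: "1 \<le> r" and w: "w \<in> total_chains r n i k"
  shows "koszul_d r n (to_form r n k w) S - to_form r n (Suc k) (total_d n r w) S \<in> sr_ideal r n"
proof -
  define c where "c t = (\<lambda>(a, b). w (a, insert t S, b))" for t
  have "to_form r n (Suc k) (total_d n r w) S = fy_comb r n (Suc k) (\<lambda>x. \<Sum>t\<in>{1..n} - S. ins_sign S t * shift_exp t (c t) x)"
    unfolding to_form_def
  proof (rule fy_comb_cong)
    fix x assume x: "x \<in> fy_index r n (Suc k)"
    obtain a b where ab: "x = (a, b)" by (cases x)
    have "admissible n r (top_set a) b" using x by (simp add: ab fy_index_def)
    then have "(case x of (a, b) \<Rightarrow> total_d n r w (a, S, b)) = (\<Sum>t\<in>{t\<in>{1..n}. b t \<noteq> 0}. contract t (\<lambda>U. w (a, U, dec b t)) S)"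
      by (simp add: ab total_d_def skel_d_def)
    also have "\<dots> = (\<Sum>t\<in>{1..n}. if t \<in> S then 0 else ins_sign S t * shift_exp t (c t) x)"
      by (rule sum.mono_neutral_cong_left) (auto simp: contract_def shift_exp_def ab c_def)
    also have "\<dots> = (\<Sum>t\<in>{1..n} - S. ins_sign S t * shift_exp t (c t) x)"
      by (rule sum.mono_neutral_cong_right) auto
    finally show "(case x of (a, b) \<Rightarrow> total_d n r w (a, S, b)) = (\<Sum>t\<in>{1..n} - S. ins_sign S t * shift_exp t (c t) x)" .
  qed
  also have "\<dots> = (\<Sum>t\<in>{1..n} - S. single 0 (ins_sign S t) * fy_comb r n (Suc k) (shift_exp t (c t)))"
    by (simp add: fy_comb_sum fy_comb_scale)
  finally have 1: "to_form r n (Suc k) (total_d n r w) S = \<dots>" .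
  have "koszul_d r n (to_form r n k w) S = (\<Sum>t\<in>{1..n} - S. single 0 (ins_sign S t) * (theta_var r n t * fy_comb r n k (c t)))"
    unfolding koszul_d_def theta_var_def[symmetric] sgn_ins_ins_sign to_form_def c_def by (simp only: mult.assoc)
  then have "koszul_d r n (to_form r n k w) S - to_form r n (Suc k) (total_d n r w) S
      = (\<Sum>t\<in>{1..n} - S. single 0 (ins_sign S t) * (theta_var r n t * fy_comb r n k (c t) - fy_comb r n (Suc k) (shift_exp t (c t))))"
    unfolding 1 by (simp add: right_diff_distrib sum_subtractf)
  also have "\<dots> \<in> sr_ideal r n"
    using total_chains_supported(1)[OF w] by (intro sr_ideal_sum sr_ideal_scale theta_var_fy_comb_supported r) (auto simp: c_def)
  finally show ?thesis .
qed

lemma total_d_total_chains: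
  assumes w: "w \<in> total_chains r n (Suc i) k"
  shows "total_d n r w \<in> total_chains r n i (Suc k)"
  unfolding family_def
proof (intro CollectI conjI ballI allI impI)
  interpret skel_d: Vector_Spaces.linear fscale fscale "skel_d n r F" for F by (rule linear_skel_d)
  have zero: "(\<lambda>x. total_d n r w (a, x)) = 0" if "a \<notin> fy_mons r n k" for a
  proof -
    have "(\<lambda>x. w (a, x)) = 0" using w that by (auto simp: family_def)
    then show ?thesis by (simp add: total_d_def skel_d.zero) (simp add: zero_fun_def)
  qed
  fix a
  show "total_d n r w (a, x) = 0" if "a \<notin> fy_mons r n (Suc k)" for x
  proof -
    have "a \<notin> fy_mons r n k" using that by (auto simp: fy_mons_def)
    then show ?thesis using fun_cong[OF zero, of a x] by simp
  qed
  assume a: "a \<in> fy_mons r n (Suc k)"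
  show "(\<lambda>x. total_d n r w (a, x)) \<in> skel_chains n r (top_set a) i (Suc k - mdeg a)"
  proof (cases "a \<in> fy_mons r n k")
    case True
    then have "(\<lambda>x. w (a, x)) \<in> skel_chains n r (top_set a) (Suc i) (k - mdeg a)" using w by (simp add: family_def)
    then have "skel_d n r (top_set a) (\<lambda>x. w (a, x)) \<in> skel_chains n r (top_set a) i (Suc (k - mdeg a))" by (rule skel_d_skel_chains)
    moreover have "Suc (k - mdeg a) = Suc k - mdeg a" using True by (auto simp: fy_mons_def)
    ultimately show ?thesis by (simp add: total_d_def)
  next
    case False
    show ?thesis unfolding zero[OF False] by (rule fs.subspace_0[OF subspace_skel_chains])
  qed
qed

abbreviation total_cycles where
  "total_cycles r n i k \<equiv> family (fy_mons r n k) (\<lambda>a. skel_cycles n r (top_set a) i (k - mdeg a))"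

abbreviation total_boundaries where
  "total_boundaries r n i k \<equiv> family (fy_mons r n k) (\<lambda>a. skel_boundaries n r (top_set a) i (k - mdeg a))"

lemma total_cycles_iff: "w \<in> total_cycles r n i k \<longleftrightarrow> w \<in> total_chains r n i k \<and> total_d n r w = 0"
proof -
  interpret skel_d: Vector_Spaces.linear fscale fscale "skel_d n r F" for F by (rule linear_skel_d)
  have "total_d n r w = 0 \<longleftrightarrow> (\<forall>a. skel_d n r (top_set a) (\<lambda>x. w (a, x)) = 0)"
    by (auto simp: total_d_def fun_eq_iff)
  moreover have "skel_d n r (top_set a) (\<lambda>x. w (a, x)) = 0" if "\<forall>x. w (a, x) = 0" for a
  proof -
    have "(\<lambda>x. w (a, x)) = 0" using that by auto
    then show ?thesis by (simp add: skel_d.zero)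
  qed
  ultimately show ?thesis unfolding family_def skel_cycles_def by blast
qed

lemma total_boundaries_0: "total_boundaries r n i 0 = {0}"
  by (auto simp: family_def skel_boundaries_def fun_eq_iff) metis

text \<open>In the summands with \<open>mdeg a = Suc k\<close> the boundaries are zero, which is why the index
set may shrink to degree \<open>k\<close>.\<close>

lemma total_boundaries_Suc: "total_boundaries r n i (Suc k) = total_d n r ` total_chains r n (Suc i) k"
proof (intro set_eqI iffI)
  interpret skel_d: Vector_Spaces.linear fscale fscale "skel_d n r F" for F by (rule linear_skel_d)
  fix w :: "monomial \<times> nat set \<times> (nat \<Rightarrow> nat) \<Rightarrow> rat"
  {
    assume w: "w \<in> total_boundaries r n i (Suc k)"
    have "\<exists>y. y \<in> skel_chains n r (top_set a) (Suc i) (k - mdeg a) \<and> (\<lambda>x. w (a, x)) = skel_d n r (top_set a) y" if a: "a \<in> fy_mons r n k" for a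
    proof -
      have "a \<in> fy_mons r n (Suc k)" "Suc k - mdeg a = Suc (k - mdeg a)" using a by (auto simp: fy_mons_def)
      then have "(\<lambda>x. w (a, x)) \<in> skel_boundaries n r (top_set a) i (Suc (k - mdeg a))" using w unfolding family_def by fastforce
      then show ?thesis by (auto simp: skel_boundaries_def)
    qed
    then obtain y where y: "\<And>a. a \<in> fy_mons r n k \<Longrightarrow> y a \<in> skel_chains n r (top_set a) (Suc i) (k - mdeg a)"
      "\<And>a. a \<in> fy_mons r n k \<Longrightarrow> (\<lambda>x. w (a, x)) = skel_d n r (top_set a) (y a)" by metis
    define v where "v = (\<lambda>(a, x). if a \<in> fy_mons r n k then y a x else 0)"
    have v: "v \<in> total_chains r n (Suc i) k" using y(1) by (auto simp: family_def v_def)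
    have "total_d n r v (a, x) = w (a, x)" for a x
    proof (cases "a \<in> fy_mons r n k")
      case True
      then show ?thesis using fun_cong[OF y(2)[OF True], of x] by (simp add: total_d_def v_def)
    next
      case False
      have "(\<lambda>x. v (a, x)) = 0" using False by (auto simp: v_def)
      then have "total_d n r v (a, x) = 0" by (simp add: total_d_def skel_d.zero)
      moreover have "w (a, x) = 0"
      proof (cases "a \<in> fy_mons r n (Suc k)")
        case True
        then have "mdeg a = Suc k" using False by (auto simp: fy_mons_def)
        moreover have "(\<lambda>x. w (a, x)) \<in> skel_boundaries n r (top_set a) i (Suc k - mdeg a)" using w True by (simp add: family_def)
        ultimately have "(\<lambda>x. w (a, x)) = 0" by (simp add: skel_boundaries_def)
        then have "(\<lambda>x. w (a, x)) x = 0 x" by (rule fun_cong)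
        then show ?thesis by simp
      qed (use w in \<open>cases x; simp add: family_def\<close>)
      ultimately show ?thesis by simp
    qed
    then have "w = total_d n r v" by (auto simp: fun_eq_iff)
    then show "w \<in> total_d n r ` total_chains r n (Suc i) k" using v by blast
  next
    assume "w \<in> total_d n r ` total_chains r n (Suc i) k"
    then obtain v where v: "v \<in> total_chains r n (Suc i) k" and wv: "w = total_d n r v" by blast
    have T: "w \<in> total_chains r n i (Suc k)" using total_d_total_chains[OF v] wv by simp
    show "w \<in> total_boundaries r n i (Suc k)"
      unfolding family_def
    proof (intro CollectI conjI ballI allI impI)
      fix a assume a: "a \<in> fy_mons r n (Suc k)"
      have eq: "(\<lambda>x. w (a, x)) = skel_d n r (top_set a) (\<lambda>x. v (a, x))" by (simp add: wv total_d_def)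
      show "(\<lambda>x. w (a, x)) \<in> skel_boundaries n r (top_set a) i (Suc k - mdeg a)"
      proof (cases "a \<in> fy_mons r n k")
        case True
        then have "(\<lambda>x. v (a, x)) \<in> skel_chains n r (top_set a) (Suc i) (k - mdeg a)" using v by (simp add: family_def)
        moreover have "Suc k - mdeg a = Suc (k - mdeg a)" using True by (auto simp: fy_mons_def)
        ultimately show ?thesis unfolding eq by (simp add: skel_boundaries_def)
      next
        case False
        then have "(\<lambda>x. v (a, x)) = 0" using v by (auto simp: family_def)
        then have "(\<lambda>x. w (a, x)) = 0" unfolding eq by (simp add: skel_d.zero)
        then show ?thesis using fs_fin_dim_0[OF fin_dim_skel_boundaries] by simp
      qed
    qed (use T in \<open>force simp: family_def\<close>)
  }
qed

lemma total_boundaries_subset_total_cycles: "total_boundaries r n i k \<subseteq> total_cycles r n i k"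
proof
  fix w assume w: "w \<in> total_boundaries r n i k"
  show "w \<in> total_cycles r n i k"
    unfolding family_def
  proof (intro CollectI conjI ballI)
    fix a assume a: "a \<in> fy_mons r n k"
    then have "top_set a \<subseteq> {1..n}" using top_set_subset by (auto simp: fy_mons_def)
    then show "(\<lambda>x. w (a, x)) \<in> skel_cycles n r (top_set a) i (k - mdeg a)"
      using w a skel_boundaries_subset_skel_cycles unfolding family_def by blast
  qed (use w in \<open>force simp: family_def\<close>)
qed

global_interpretation ffp: vector_space_pair fscale rscale
  by unfold_locales

lemma linear_to_form: "Vector_Spaces.linear fscale rscale (to_form r n k)"
  by unfold_locales (simp_all add: to_form_add to_form_scale)

lemma fin_dim_K_den: "form.fin_dim (K_den r n i j)"
proof -
  obtain B where B: "finite B" "K_num r n i j \<subseteq> form.span B" using K_num_finite_dim[of r n i j] by blast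
  have "K_den r n i j \<subseteq> form.span B" using K_den_subset_K_num[of r n i j] B(2) by (rule subset_trans)
  then show ?thesis unfolding form.fin_dim_def using K_den_subspace[of r n i j] B(1) by (intro conjI exI)
qed

text \<open>Modulo \<open>K_den\<close> the map \<open>to_form\<close> is injective.\<close>

lemma dim_to_form_plus_den:
  assumes r: "1 \<le> r" and n: "1 \<le> n" and W: "fs.fin_dim W" "W \<subseteq> total_chains r n i k"
  shows "form.dim {u + v | u v. u \<in> to_form r n k ` W \<and> v \<in> K_den r n i (i + k)} = fs.dim W + form.dim (K_den r n i (i + k))"
proof -
  have inj: "w = 0" if "w \<in> W" "to_form r n k w \<in> K_den r n i (i + k)" for w
  proof (rule to_form_injective[OF r])
    show "w \<in> total_chains r n i k" using that W by blast
    show "to_form r n k w S \<in> sr_ideal r n" for S using that(2) unfolding K_den_forms[OF n] by (rule forms_denD)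
  qed
  interpret P: Vector_Spaces.linear fscale rscale "to_form r n k" by (rule linear_to_form)
  have z: "0 \<in> K_den r n i (i + k)" by (rule form.subspace_0[OF K_den_subspace])
  have f: "form.fin_dim (to_form r n k ` W)" by (rule ffp.fin_dim_image[OF linear_to_form W(1)])
  have "form.dim (to_form r n k ` W) = fs.dim W"
  proof (rule ffp.dim_image_inj[OF linear_to_form W(1)])
    fix v assume "v \<in> W" "to_form r n k v = 0"
    then have "to_form r n k v \<in> K_den r n i (i + k)" using z by simp
    with \<open>v \<in> W\<close> show "v = 0" by (rule inj)
  qed
  moreover have "to_form r n k ` W \<inter> K_den r n i (i + k) = {0}"
  proof
    show "to_form r n k ` W \<inter> K_den r n i (i + k) \<subseteq> {0}"
    proof
      fix u assume "u \<in> to_form r n k ` W \<inter> K_den r n i (i + k)"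
      then obtain w where "w \<in> W" "u = to_form r n k w" "to_form r n k w \<in> K_den r n i (i + k)" by blast
      then show "u \<in> {0}" using inj[of w] P.zero by simp
    qed
    have "0 \<in> W" using fs_fin_dim_0[OF W(1)] .
    then have "0 \<in> to_form r n k ` W" using P.zero by (metis imageI)
    then show "{0} \<subseteq> to_form r n k ` W \<inter> K_den r n i (i + k)" using z by simp
  qed
  ultimately show ?thesis using form.dim_direct_sum[OF f fin_dim_K_den] by simp
qed

lemma K_num_decompose:
  assumes r: "1 \<le> r" and n: "1 \<le> n" and u: "u \<in> K_num r n i (i + k)"
  obtains w v where "w \<in> total_chains r n i k" "v \<in> K_den r n i (i + k)" "u = to_form r n k w + v"
proof -
  obtain w where "w \<in> total_chains r n i k" "u - to_form r n k w \<in> K_den r n i (i + k)"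
    using to_form_surjective[OF r] u unfolding K_num_forms[OF n] K_den_forms[OF n] by blast
  then show ?thesis using that[of w "u - to_form r n k w"] by simp
qed

lemma to_form_K_num: "1 \<le> n \<Longrightarrow> w \<in> total_chains r n i k \<Longrightarrow> to_form r n k w \<in> K_num r n i (i + k)"
  by (simp add: K_num_forms to_form_forms)

lemma koszul_d_to_form_den:
  assumes r: "1 \<le> r" and n: "1 \<le> n" and w: "w \<in> total_chains r n (Suc i) k"
  shows "koszul_d r n (to_form r n k w) - to_form r n (Suc k) (total_d n r w) \<in> K_den r n i (i + Suc k)"
  unfolding K_den_forms[OF n]
proof (rule forms_denI)
  have "koszul_d r n (to_form r n k w) \<in> K_num r n i (i + Suc k)"
    using koszul_d_num[of "to_form r n k w" r n i "Suc i + k"] to_form_K_num[OF n w] by simp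
  moreover have "to_form r n (Suc k) (total_d n r w) \<in> K_num r n i (i + Suc k)"
    by (rule to_form_K_num[OF n total_d_total_chains[OF w]])
  ultimately show "koszul_d r n (to_form r n k w) - to_form r n (Suc k) (total_d n r w) \<in> forms n (num_part r n (Suc k)) i"
    unfolding K_num_forms[OF n] by (intro form.subspace_diff forms_subspace coeff_space_num)
  show "(koszul_d r n (to_form r n k w) - to_form r n (Suc k) (total_d n r w)) S \<in> sr_ideal r n" for S
    using koszul_d_to_form[OF r w] by simp
qed

lemma total_d_0_degree:
  assumes "w \<in> total_chains r n 0 k"
  shows "total_d n r w = 0"
proof
  interpret skel_d: Vector_Spaces.linear fscale fscale "skel_d n r F" for F by (rule linear_skel_d)
  fix y :: "monomial \<times> nat set \<times> (nat \<Rightarrow> nat)"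
  obtain a x where y: "y = (a, x)" by (cases y)
  have "skel_d n r (top_set a) (\<lambda>x. w (a, x)) = 0"
  proof (cases "a \<in> fy_mons r n k")
    case True
    then have "(\<lambda>x. w (a, x)) \<in> skel_chains n r (top_set a) 0 (k - mdeg a)" using assms by (simp add: family_def)
    then show ?thesis by (rule skel_d_0)
  next
    case False
    then have "(\<lambda>x. w (a, x)) = 0" using assms by (auto simp: family_def)
    then show ?thesis by (simp add: skel_d.zero)
  qed
  then show "total_d n r w y = 0 y" by (simp add: total_d_def y)
qed

lemma koszul_cycles_eq:
  assumes r: "1 \<le> r" and n: "1 \<le> n"
  shows "koszul_cycles r n i (i + k) = {u + v | u v. u \<in> to_form r n k ` total_cycles r n i k \<and> v \<in> K_den r n i (i + k)}"
proof (intro set_eqI iffI)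
  let ?K = "K_den r n (i - 1) (i + k)"
  have cycle_iff: "koszul_d r n (to_form r n k w) \<in> ?K \<longleftrightarrow> total_d n r w = 0" if w: "w \<in> total_chains r n i k" for w
  proof (cases i)
    case 0
    have "koszul_d r n (to_form r n k w) = 0"
      using to_form_K_num[OF n w] koszul_d_tens_0 by (simp add: K_num_def 0)
    then show ?thesis using total_d_0_degree w form.subspace_0[OF K_den_subspace] by (simp add: 0)
  next
    case (Suc i')
    have K: "?K = K_den r n i' (i' + Suc k)" using Suc by simp
    have T: "total_d n r w \<in> total_chains r n i' (Suc k)" using total_d_total_chains w Suc by simp
    have d: "koszul_d r n (to_form r n k w) - to_form r n (Suc k) (total_d n r w) \<in> ?K"
      unfolding K using koszul_d_to_form_den[OF r n] w Suc by simp
    show ?thesis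
    proof
      assume "koszul_d r n (to_form r n k w) \<in> ?K"
      then have "koszul_d r n (to_form r n k w) - (koszul_d r n (to_form r n k w) - to_form r n (Suc k) (total_d n r w)) \<in> ?K"
        using d by (rule form.subspace_diff[OF K_den_subspace])
      then have P: "to_form r n (Suc k) (total_d n r w) \<in> K_den r n i' (i' + Suc k)" unfolding K by simp
      show "total_d n r w = 0"
      proof (rule to_form_injective[OF r T])
        show "to_form r n (Suc k) (total_d n r w) S \<in> sr_ideal r n" for S
          using P unfolding K_den_forms[OF n] by (rule forms_denD)
      qed
    next
      interpret P: Vector_Spaces.linear fscale rscale "to_form r n (Suc k)" by (rule linear_to_form)
      assume "total_d n r w = 0"
      then show "koszul_d r n (to_form r n k w) \<in> ?K" using d by (simp add: P.zero)
    qed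
  qed
  fix z
  {
    assume z: "z \<in> koszul_cycles r n i (i + k)"
    then have "z \<in> K_num r n i (i + k)" by (simp add: koszul_cycles_def)
    then obtain w v where w: "w \<in> total_chains r n i k" and v: "v \<in> K_den r n i (i + k)" and zv: "z = to_form r n k w + v"
      by (rule K_num_decompose[OF r n])
    have "koszul_d r n z - koszul_d r n v \<in> ?K"
      using z koszul_d_den[OF v] by (intro form.subspace_diff K_den_subspace) (simp add: koszul_cycles_def)
    then have "koszul_d r n (to_form r n k w) \<in> ?K" by (simp add: zv koszul_d_add)
    then have "total_d n r w = 0" using cycle_iff[OF w] by (simp only:)
    then have "w \<in> total_cycles r n i k" using w by (simp only: total_cycles_iff)
    then show "z \<in> {u + v | u v. u \<in> to_form r n k ` total_cycles r n i k \<and> v \<in> K_den r n i (i + k)}" using v zv by blast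
  next
    assume "z \<in> {u + v | u v. u \<in> to_form r n k ` total_cycles r n i k \<and> v \<in> K_den r n i (i + k)}"
    then obtain w v where w: "w \<in> total_cycles r n i k" and v: "v \<in> K_den r n i (i + k)" and zv: "z = to_form r n k w + v" by blast
    have w': "w \<in> total_chains r n i k" "total_d n r w = 0" using w by (simp_all add: total_cycles_iff)
    have "v \<in> K_num r n i (i + k)" using v K_den_subset_K_num by blast
    then have "z \<in> K_num r n i (i + k)" unfolding zv
      using to_form_K_num[OF n w'(1)] by (intro form.subspace_add K_num_subspace)
    moreover have "koszul_d r n z \<in> ?K" unfolding zv koszul_d_add
      using cycle_iff[OF w'(1)] w'(2) koszul_d_den[OF v] by (intro form.subspace_add K_den_subspace) auto
    ultimately show "z \<in> koszul_cycles r n i (i + k)" by (simp add: koszul_cycles_def)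
  }
qed

lemma koszul_boundaries_eq:
  assumes r: "1 \<le> r" and n: "1 \<le> n"
  shows "koszul_boundaries r n i (i + k) = {u + v | u v. u \<in> to_form r n k ` total_boundaries r n i k \<and> v \<in> K_den r n i (i + k)}"
proof (cases k)
  case 0
  interpret P: Vector_Spaces.linear fscale rscale "to_form r n k" by (rule linear_to_form)
  have "koszul_boundaries r n i (i + k) = K_den r n i (i + k)"
    by (simp add: koszul_boundaries_def K_num_def 0 koszul_d_zero)
  moreover have "to_form r n k ` total_boundaries r n i k = {0}" using total_boundaries_0[of r n i] P.zero unfolding 0 by (simp only: image_insert image_empty)
  ultimately show ?thesis by auto
next
  case (Suc k')
  let ?K = "K_den r n i (i + Suc k')"
  have "z \<in> koszul_boundaries r n i (i + k) \<longleftrightarrow> (\<exists>w\<in>total_chains r n (Suc i) k'. \<exists>v\<in>?K. z = to_form r n (Suc k') (total_d n r w) + v)" for z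
  proof
    assume "z \<in> koszul_boundaries r n i (i + k)"
    then obtain u v where u: "u \<in> K_num r n (Suc i) (Suc i + k')" and v: "v \<in> ?K" and z: "z = koszul_d r n u + v"
      by (auto simp: koszul_boundaries_def Suc)
    obtain w v' where w: "w \<in> total_chains r n (Suc i) k'" and v': "v' \<in> K_den r n (Suc i) (Suc i + k')" and uw: "u = to_form r n k' w + v'"
      using K_num_decompose[OF r n u] .
    let ?e = "koszul_d r n (to_form r n k' w) - to_form r n (Suc k') (total_d n r w)"
    have "koszul_d r n v' \<in> ?K" using koszul_d_den[OF v'] by simp
    then have "?e + (koszul_d r n v' + v) \<in> ?K"
      using koszul_d_to_form_den[OF r n w] v by (intro form.subspace_add K_den_subspace)
    moreover have "z = to_form r n (Suc k') (total_d n r w) + (?e + (koszul_d r n v' + v))"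
      by (simp add: z uw koszul_d_add)
    ultimately show "\<exists>w\<in>total_chains r n (Suc i) k'. \<exists>v\<in>?K. z = to_form r n (Suc k') (total_d n r w) + v" using w by blast
  next
    assume "\<exists>w\<in>total_chains r n (Suc i) k'. \<exists>v\<in>?K. z = to_form r n (Suc k') (total_d n r w) + v"
    then obtain w v where w: "w \<in> total_chains r n (Suc i) k'" and v: "v \<in> ?K" and z: "z = to_form r n (Suc k') (total_d n r w) + v" by blast
    let ?e = "koszul_d r n (to_form r n k' w) - to_form r n (Suc k') (total_d n r w)"
    have "v - ?e \<in> ?K" using v koszul_d_to_form_den[OF r n w] by (rule form.subspace_diff[OF K_den_subspace])
    moreover have "z = koszul_d r n (to_form r n k' w) + (v - ?e)" by (simp add: z)
    moreover have "to_form r n k' w \<in> K_num r n (i + 1) (i + Suc k')" using to_form_K_num[OF n w] by simp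
    ultimately show "z \<in> koszul_boundaries r n i (i + k)" unfolding koszul_boundaries_def Suc by blast
  qed
  then show ?thesis unfolding Suc total_boundaries_Suc by (intro set_eqI) (auto simp: Suc)
qed

text \<open>Cycles and boundaries are the images of those of the direct sum, enlarged by the same
\<open>K_den\<close>, whose dimension cancels in the difference.\<close>

theorem koszul_betti_eq_sum:
  assumes r: "1 \<le> r" "1 \<le> n"
  shows "int (koszul_betti r n i (i + k)) = (\<Sum>a\<in>fy_mons r n k. skel_betti n r (top_set a) i (k - mdeg a))"
proof -
  have Z: "fs.fin_dim (total_cycles r n i k) \<and> fs.dim (total_cycles r n i k) = (\<Sum>a\<in>fy_mons r n k. fs.dim (skel_cycles n r (top_set a) i (k - mdeg a)))"
    by (rule dim_family[OF finite_fy_mons fin_dim_skel_cycles])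
  have B: "fs.fin_dim (total_boundaries r n i k) \<and> fs.dim (total_boundaries r n i k) = (\<Sum>a\<in>fy_mons r n k. fs.dim (skel_boundaries n r (top_set a) i (k - mdeg a)))"
    by (rule dim_family[OF finite_fy_mons fin_dim_skel_boundaries])
  have ZT: "total_cycles r n i k \<subseteq> total_chains r n i k" using total_cycles_iff by blast
  have BZ: "total_boundaries r n i k \<subseteq> total_cycles r n i k" by (rule total_boundaries_subset_total_cycles)
  have "fs.dim (total_boundaries r n i k) \<le> fs.dim (total_cycles r n i k)"
    using Z B BZ by (intro fs.dim_mono_fin) (auto simp: fs.fin_dim_def)
  moreover have "koszul_betti r n i (i + k) = fs.dim (total_cycles r n i k) - fs.dim (total_boundaries r n i k)"
    unfolding koszul_betti_def koszul_cycles_eq[OF r] koszul_boundaries_eq[OF r]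
    using dim_to_form_plus_den[OF r, where W = "total_cycles r n i k" and i = i and k = k]
      dim_to_form_plus_den[OF r, where W = "total_boundaries r n i k" and i = i and k = k] Z B ZT BZ by simp
  ultimately show ?thesis using Z B by (simp add: skel_betti_def sum_subtractf)
qed

section \<open>Counting Feichtner--Yuzvinsky monomials\<close>

lemma sum_over_small_subsets:
  fixes \<phi> :: "nat \<Rightarrow> 'a :: comm_semiring_1"
  assumes "finite G"
  shows "(\<Sum>F | F \<subseteq> G \<and> card F < m. \<phi> (card F)) = (\<Sum>f<m. of_nat (card G choose f) * \<phi> f)"
proof -
  let ?S = "{F. F \<subseteq> G \<and> card F < m}"
  have fin: "finite ?S" using assms by (intro finite_subset[of ?S "Pow G"]) auto
  have "(\<Sum>F\<in>?S. \<phi> (card F)) = (\<Sum>f<m. \<Sum>F | F \<in> ?S \<and> card F = f. \<phi> (card F))"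
    by (rule sum.group[symmetric]) (use fin in auto)
  also have "\<dots> = (\<Sum>f<m. of_nat (card G choose f) * \<phi> f)"
  proof (rule sum.cong[OF refl])
    fix f assume "f \<in> {..<m}"
    then have "{F. F \<in> ?S \<and> card F = f} = {F. F \<subseteq> G \<and> card F = f}" by auto
    then show "(\<Sum>F | F \<in> ?S \<and> card F = f. \<phi> (card F)) = of_nat (card G choose f) * \<phi> f"
      using n_subsets[OF assms, of f] by simp
  qed
  finally show ?thesis .
qed

lemma geometric_sum_from_1:
  fixes X :: "'a :: comm_ring_1"
  assumes "0 < m"
  shows "(1 - X) * (\<Sum>e\<in>{1..<m}. X ^ e) = X - X ^ m"
  using assms
proof (induction m rule: nat_induct_non_zero)
  case (Suc m)
  have "(\<Sum>e\<in>{1..<Suc m}. X ^ e) = (\<Sum>e\<in>{1..<m}. X ^ e) + X ^ m" using Suc.hyps by simp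
  then have "(1 - X) * (\<Sum>e\<in>{1..<Suc m}. X ^ e) = (1 - X) * (\<Sum>e\<in>{1..<m}. X ^ e) + (1 - X) * X ^ m"
    by (simp only: distrib_left)
  also have "\<dots> = X - X ^ Suc m" unfolding Suc.IH by (simp add: left_diff_distrib)
  finally show ?case .
qed simp

text \<open>By \<open>pderange_weak_eq_pderange\<close> the weighted and the unweighted binomial sums of derangement
polynomials differ by a factor \<open>x\<close>.  Isolating the term \<open>f = g\<close> and dividing by \<open>1 - x\<close> gives the
recursion.\<close>

lemma derange_recursion:
  assumes g: "0 < g"
  shows "derange g = (\<Sum>f<g. of_nat (g choose f) * (derange f * (\<Sum>e\<in>{1..<g - f}. monom 1 e)))"
proof -
  define X where "X = [:0, 1 :: real:]"
  have x: "monom (1::real) e = X ^ e" for e by (simp add: monom_altdef X_def)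
  have nz: "1 - X \<noteq> 0" by (simp add: X_def one_pCons)
  have s: "{..g} = insert g {..<g}" by auto
  let ?c = "\<lambda>f. of_nat (g choose f) :: real poly"
  have "(\<Sum>f\<le>g. ?c f * (derange f * X ^ (g - f))) = X * (\<Sum>f\<le>g. ?c f * derange f)"
    using pderange_weak_eq_pderange[OF g] unfolding pderange_weak_sum pderange_sum X_def by simp
  then have "derange g + (\<Sum>f<g. ?c f * (derange f * X ^ (g - f))) = X * derange g + X * (\<Sum>f<g. ?c f * derange f)"
    unfolding s by (simp add: distrib_left)
  then have "(1 - X) * derange g = X * (\<Sum>f<g. ?c f * derange f) - (\<Sum>f<g. ?c f * (derange f * X ^ (g - f)))"
    by (simp add: algebra_simps)
  also have "\<dots> = (\<Sum>f<g. ?c f * derange f * (X - X ^ (g - f)))"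
    by (simp add: sum_distrib_left sum_subtractf[symmetric] algebra_simps)
  also have "\<dots> = (1 - X) * (\<Sum>f<g. ?c f * (derange f * (\<Sum>e\<in>{1..<g - f}. X ^ e)))"
    unfolding sum_distrib_left[of "1 - X"]
  proof (rule sum.cong[OF refl])
    fix f assume f: "f \<in> {..<g}"
    have e: "X - X ^ (g - f) = (1 - X) * (\<Sum>e\<in>{1..<g - f}. X ^ e)"
      using geometric_sum_from_1[of "g - f" X] f by simp
    show "?c f * derange f * (X - X ^ (g - f)) = (1 - X) * (?c f * (derange f * (\<Sum>e\<in>{1..<g - f}. X ^ e)))"
      unfolding e by (simp only: ac_simps)
  qed
  finally show ?thesis unfolding mult_cancel_left x using nz by simp
qed

definition fy_top :: "nat set \<Rightarrow> nat \<Rightarrow> monomial set" where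
  "fy_top G k = {a. fy_mon a \<and> top_set a = G \<and> mdeg a = k}"

lemma finite_fy_top: "finite G \<Longrightarrow> finite (fy_top G k)"
  by (rule finite_subset[OF _ finite_monomials_on[of "Pow G" k]]) (auto simp: fy_top_def top_set_def)

lemma fy_top_empty: "fy_top {} k = (if k = 0 then {0} else {})"
proof -
  have "a = 0" if a: "fy_mon a" "top_set a = {}" for a
  proof -
    have "keys a = {}"
    proof (rule ccontr)
      assume "keys a \<noteq> {}"
      then have "top_set a \<in> keys a" using a(1) by (intro top_set_in_keys) (simp_all add: fy_mon_def)
      then show False using a by (simp add: fy_mon_def)
    qed
    then show ?thesis by simp
  qed
  then have "a \<in> fy_top {} k \<Longrightarrow> a = 0" for a by (simp add: fy_top_def)
  moreover have "0 \<in> fy_top {} k \<longleftrightarrow> k = 0" by (auto simp: fy_top_def fy_mon_def chain_mon_def top_set_def mdeg_def)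
  ultimately show ?thesis by (cases "k = 0") auto
qed

text \<open>The top set \<open>G\<close> and its exponent \<open>e\<close> are split off; the remaining monomial has as its union
a smaller set \<open>F\<close>, and the bound for \<open>G\<close> reads \<open>e < card (G - F)\<close>.\<close>

lemma fy_top_decompose:
  assumes G: "finite G" "G \<noteq> {}"
  shows "bij_betw (\<lambda>((F, e), a). a + single G e)
    (SIGMA (F, e) : (SIGMA F : {F. F \<subseteq> G \<and> card F < card G}. {e \<in> {1..<card G - card F}. e \<le> k}). fy_top F (k - e)) (fy_top G k)"
  (is "bij_betw ?h ?X _")
proof -
  have X: "F \<subset> G" "1 \<le> e" "e < card (G - F)" "e \<le> k" "fy_mon a" "top_set a = F" "mdeg a = k - e" "lookup a G = 0"
    if "((F, e), a) \<in> ?X" for F e a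
  proof -
    show "F \<subset> G" "1 \<le> e" "e \<le> k" "fy_mon a" "top_set a = F" "mdeg a = k - e"
      using that by (auto simp: fy_top_def)
    then show "e < card (G - F)" using that G finite_subset[of F G] by (simp add: card_Diff_subset psubset_imp_subset)
    show "lookup a G = 0" using keys_subset_top_set[of G a] \<open>F \<subset> G\<close> \<open>top_set a = F\<close> by (auto simp: in_keys_iff)
  qed
  show ?thesis
    unfolding bij_betw_def
  proof
    show "inj_on ?h ?X"
    proof (rule inj_onI)
      fix x y assume x: "x \<in> ?X" and y: "y \<in> ?X" and eq: "?h x = ?h y"
      obtain F e a where xe: "x = ((F, e), a)" by (metis prod.exhaust)
      obtain F' e' a' where ye: "y = ((F', e'), a')" by (metis prod.exhaust)
      note X1 = X[OF x[unfolded xe]] and X2 = X[OF y[unfolded ye]]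
      have eq': "a + single G e = a' + single G e'" using eq by (simp add: xe ye)
      then have "lookup (a + single G e) G = lookup (a' + single G e') G" by simp
      then have ee: "e = e'" using X1(8) X2(8) by (simp add: lookup_add)
      then have "a = a'" using eq' by simp
      moreover from this have "F = F'" using X1(6) X2(6) by simp
      ultimately show "x = y" using ee by (simp add: xe ye)
    qed
    show "?h ` ?X = fy_top G k"
    proof (intro set_eqI iffI)
      fix b assume "b \<in> ?h ` ?X"
      then obtain F e a where x: "((F, e), a) \<in> ?X" and b: "b = a + single G e" by auto
      note P = X[OF x]
      have "fy_mon b" unfolding b using P G by (intro fy_mon_add_top) auto
      moreover have "top_set b = G" unfolding b using P by (auto simp: top_set_def keys_add_nat)
      moreover have "mdeg b = k" using P by (simp add: b mdeg_add mdeg_single)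
      ultimately show "b \<in> fy_top G k" by (simp add: fy_top_def)
    next
      fix b assume "b \<in> fy_top G k"
      then have b: "fy_mon b" "top_set b = G" "mdeg b = k" by (simp_all add: fy_top_def)
      have ch: "chain_mon b" using b by (simp add: fy_mon_def)
      have "keys b \<noteq> {}" using b(2) G by (auto simp: top_set_def)
      then have Gb: "G \<in> keys b" using top_set_in_keys[OF ch] b(2) by simp
      define e where "e = lookup b G"
      define a where "a = b - single G e"
      define F where "F = top_set a"
      have ba: "b = a + single G e"
        by (rule poly_mapping_eqI) (simp add: a_def e_def lookup_add lookup_minus lookup_single when_def)
      have ka: "keys a \<subseteq> keys b" unfolding ba keys_add_nat by simp
      have Ga: "G \<notin> keys a" by (simp add: a_def e_def in_keys_iff lookup_minus)
      have fy: "fy_mon a" by (rule fy_mon_mono[OF b(1)]) (simp add: a_def lookup_minus)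
      have Fin: "F \<in> insert {} (keys a)"
        using top_set_in_keys[of a] fy by (cases "keys a = {}") (auto simp: F_def top_set_def fy_mon_def)
      have FG: "F \<subset> G"
      proof
        show "F \<subseteq> G" using ka b(2) by (auto simp: F_def top_set_def)
        show "F \<noteq> G" using Fin Ga G by auto
      qed
      have "e < card (G - F)" using b(1) Gb FG Fin ka by (auto simp: fy_mon_def e_def)
      moreover have "1 \<le> e" using Gb by (simp add: e_def in_keys_iff)
      moreover have "mdeg a + e = k" using b(3) by (simp add: ba mdeg_add mdeg_single)
      moreover have "card F < card G" using FG G(1) by (rule psubset_card_mono[rotated])
      moreover have "card (G - F) = card G - card F" using FG G finite_subset[of F G] by (intro card_Diff_subset) auto
      ultimately have "((F, e), a) \<in> ?X" using FG fy by (auto simp: fy_top_def F_def)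
      then have "?h ((F, e), a) \<in> ?h ` ?X" by (rule imageI)
      then show "b \<in> ?h ` ?X" by (simp add: ba)
    qed
  qed
qed

text \<open>The decomposition \<open>fy_top_decompose\<close> has the same shape as \<open>derange_recursion\<close>.\<close>

theorem card_fy_top:
  "finite G \<Longrightarrow> real (card (fy_top G k)) = coeff (derange (card G)) k"
proof (induction "card G" arbitrary: G k rule: less_induct)
  case less
  show ?case
  proof (cases "G = {}")
    case True
    then show ?thesis by (simp add: fy_top_empty)
  next
    case False
    let ?g = "card G"
    let ?S = "{F. F \<subseteq> G \<and> card F < ?g}"
    let ?E = "\<lambda>F. {e \<in> {1..<?g - card F}. e \<le> k}"
    have g: "0 < ?g" using False less.prems by (simp add: card_gt_0_iff)
    have fS: "finite ?S" using less.prems by (intro finite_subset[of ?S "Pow G"]) auto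
    have fF: "finite F" if "F \<in> ?S" for F using that less.prems finite_subset[of F G] by blast
    have "card (fy_top G k) = card (SIGMA (F, e) : (SIGMA F : ?S. ?E F). fy_top F (k - e))"
      using bij_betw_same_card[OF fy_top_decompose[OF less.prems False, of k]] by simp
    also have "\<dots> = (\<Sum>x\<in>(SIGMA F : ?S. ?E F). card (case x of (F, e) \<Rightarrow> fy_top F (k - e)))"
    proof (rule card_SigmaI)
      show "finite (SIGMA F : ?S. ?E F)" using fS by (intro finite_SigmaI) simp_all
      show "\<forall>x\<in>(SIGMA F : ?S. ?E F). finite (case x of (F, e) \<Rightarrow> fy_top F (k - e))"
      proof
        fix x assume x: "x \<in> (SIGMA F : ?S. ?E F)"
        obtain F e where xe: "x = (F, e)" by (cases x)
        have "F \<in> ?S" using x unfolding xe by (rule SigmaD1)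
        then show "finite (case x of (F, e) \<Rightarrow> fy_top F (k - e))" unfolding xe by (simp only: prod.case finite_fy_top[OF fF])
      qed
    qed
    also have "\<dots> = (\<Sum>(F, e)\<in>(SIGMA F : ?S. ?E F). card (fy_top F (k - e)))"
      by (rule sum.cong) (simp_all add: split_beta)
    also have "\<dots> = (\<Sum>F\<in>?S. \<Sum>e\<in>?E F. card (fy_top F (k - e)))"
      using fS by (intro sum.Sigma[symmetric]) simp_all
    finally have "real (card (fy_top G k)) = (\<Sum>F\<in>?S. \<Sum>e\<in>?E F. real (card (fy_top F (k - e))))" by simp
    also have "\<dots> = (\<Sum>F\<in>?S. coeff (derange (card F) * (\<Sum>e\<in>{1..<?g - card F}. monom 1 e)) k)"
    proof (rule sum.cong[OF refl])
      fix F assume F: "F \<in> ?S"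
      have "(\<Sum>e\<in>?E F. real (card (fy_top F (k - e)))) = (\<Sum>e\<in>?E F. coeff (derange (card F)) (k - e))"
      proof (rule sum.cong[OF refl])
        have "card F < ?g" using F by simp
        then show "real (card (fy_top F (k - e))) = coeff (derange (card F)) (k - e)" for e
          using fF[OF F] by (rule less.hyps)
      qed
      also have "\<dots> = (\<Sum>e\<in>{1..<?g - card F}. coeff (monom 1 e * derange (card F)) k)"
        by (intro sum.mono_neutral_cong_left) (auto simp: coeff_monom_mult)
      also have "\<dots> = coeff (derange (card F) * (\<Sum>e\<in>{1..<?g - card F}. monom 1 e)) k"
        by (simp add: sum_distrib_left coeff_sum mult.commute[of "derange (card F)"])
      finally show "(\<Sum>e\<in>?E F. real (card (fy_top F (k - e)))) = coeff (derange (card F) * (\<Sum>e\<in>{1..<?g - card F}. monom 1 e)) k" .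
    qed
    also have "\<dots> = coeff (\<Sum>F\<in>?S. derange (card F) * (\<Sum>e\<in>{1..<?g - card F}. monom 1 e)) k"
      by (simp add: coeff_sum)
    also have "\<dots> = coeff (derange ?g) k"
      unfolding sum_over_small_subsets[OF less.prems, of "\<lambda>f. derange f * (\<Sum>e\<in>{1..<?g - f}. monom 1 e)"]
        derange_recursion[OF g, symmetric] ..
    finally show ?thesis .
  qed
qed

section \<open>The closed form of the Hodge--Poincare polynomial\<close>

text \<open>The monomials in \<open>koszul_betti_eq_sum\<close> are sorted by their union and their degree; the
contribution depends on the size of the union only.\<close>

theorem koszul_betti_eq_coeff:
  assumes r: "1 \<le> r" "r \<le> n"
  shows "real (koszul_betti r n i (i + k)) = coeff (hodge_formula r n i) k"
proof -
  define kb where "kb s l = (if i = 0 then (if l < r - s then 1 else 0)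
    else if Suc l = r - s then betti_link i (r - s) (n - s) else 0)" for s l
  let ?I = "{G. G \<subseteq> {1..n} \<and> card G < r}"
  have fI: "finite ?I" by (rule finite_subset[of _ "Pow {1..n}"]) auto
  have fG: "finite G" if "G \<in> ?I" for G
  proof -
    have "G \<subseteq> {1..n}" using that by simp
    then show ?thesis by (rule finite_subset) simp
  qed
  have n: "1 \<le> n" using r by simp
  have top: "top_set a \<in> ?I" if "a \<in> fy_mons r n k" for a
    using that top_set_subset[of a r n] card_top_set_less[of a r n] r(1) by (simp add: fy_mons_def fy_mon_def)
  have "real (koszul_betti r n i (i + k)) = (\<Sum>a\<in>fy_mons r n k. real_of_int (skel_betti n r (top_set a) i (k - mdeg a)))"
    using arg_cong[OF koszul_betti_eq_sum[OF r(1) n, of i k], of real_of_int] by simp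
  also have "\<dots> = (\<Sum>a\<in>fy_mons r n k. kb (card (top_set a)) (k - mdeg a))"
  proof (rule sum.cong[OF refl])
    fix a assume "a \<in> fy_mons r n k"
    then show "real_of_int (skel_betti n r (top_set a) i (k - mdeg a)) = kb (card (top_set a)) (k - mdeg a)"
      using top[of a] skel_betti_formula[of "top_set a" n r i "k - mdeg a"] r(2) unfolding kb_def by simp
  qed
  also have "\<dots> = (\<Sum>x\<in>?I \<times> {..k}. \<Sum>a | a \<in> fy_mons r n k \<and> (top_set a, mdeg a) = x. kb (card (top_set a)) (k - mdeg a))"
  proof (rule sum.group[symmetric])
    show "(\<lambda>a. (top_set a, mdeg a)) ` fy_mons r n k \<subseteq> ?I \<times> {..k}"
    proof (rule image_subsetI)
      fix a assume a: "a \<in> fy_mons r n k"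
      then show "(top_set a, mdeg a) \<in> ?I \<times> {..k}" using top[OF a] by (simp add: fy_mons_def)
    qed
  qed (use finite_fy_mons fI in simp_all)
  also have "\<dots> = (\<Sum>x\<in>?I \<times> {..k}. case x of (G, j) \<Rightarrow> coeff (derange (card G)) j * kb (card G) (k - j))"
  proof (rule sum.cong[OF refl], clarify)
    fix G j assume G: "G \<subseteq> {1..n}" "card G < r" and j: "j \<le> k"
    have e: "{a. a \<in> fy_mons r n k \<and> (top_set a, mdeg a) = (G, j)} = fy_top G j"
      using keys_flatsI[of _ n r] G j by (auto simp: fy_mons_def fy_top_def fy_mon_def)
    have "(\<Sum>a\<in>fy_top G j. kb (card (top_set a)) (k - mdeg a)) = real (card (fy_top G j)) * kb (card G) (k - j)"
      by (simp add: fy_top_def)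
    then show "(\<Sum>a | a \<in> fy_mons r n k \<and> (top_set a, mdeg a) = (G, j). kb (card (top_set a)) (k - mdeg a))
        = coeff (derange (card G)) j * kb (card G) (k - j)"
      unfolding e using card_fy_top[OF fG, of G j] G by simp
  qed
  also have "\<dots> = (\<Sum>G\<in>?I. \<Sum>j\<le>k. coeff (derange (card G)) j * kb (card G) (k - j))"
    by (rule sum.cartesian_product[symmetric])
  also have "\<dots> = (\<Sum>s<r. real (n choose s) * (\<Sum>j\<le>k. coeff (derange s) j * kb s (k - j)))"
    using sum_over_small_subsets[of "{1..n}" "\<lambda>s. \<Sum>j\<le>k. coeff (derange s) j * kb s (k - j)" r] by simp
  also have "\<dots> = coeff (hodge_formula r n i) k"
  proof -
    have kb: "coeff (if i = 0 then (\<Sum>e<r - s. monom 1 e) else monom (betti_link i (r - s) (n - s)) (r - 1 - s)) l = kb s l"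
      if "s < r" for s l
      using that by (auto simp: kb_def coeff_sum)
    show ?thesis unfolding hodge_formula_def coeff_sum coeff_smult coeff_mult
      by (intro sum.cong refl) (simp only: kb lessThan_iff)
  qed
  finally show ?thesis .
qed

text \<open>In particular the sum that defines \<open>hodge_poincare\<close> is finite.\<close>

theorem hodge_poincare_eq: 
  assumes r: "1 \<le> r" "r \<le> n"
  shows "hodge_poincare r n i = hodge_formula r n i"
proof (rule poly_eqI)
  fix k
  let ?J = "{j. i \<le> j \<and> koszul_betti r n i j \<noteq> 0}"
  have "?J \<subseteq> (\<lambda>k. i + k) ` {k. coeff (hodge_formula r n i) k \<noteq> 0}"
  proof
    fix j assume j: "j \<in> ?J"
    then have "real (koszul_betti r n i (i + (j - i))) \<noteq> 0" by simp
    then have "coeff (hodge_formula r n i) (j - i) \<noteq> 0"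
      unfolding koszul_betti_eq_coeff[OF r, of i "j - i"] .
    then show "j \<in> (\<lambda>k. i + k) ` {k. coeff (hodge_formula r n i) k \<noteq> 0}"
      using j by (intro image_eqI[where x = "j - i"]) simp_all
  qed
  moreover have "finite {k. coeff (hodge_formula r n i) k \<noteq> 0}"
    using MOST_coeff_eq_0[of "hodge_formula r n i"] by (simp add: eventually_cofinite)
  ultimately have fin: "finite ?J" by (rule finite_subset[OF _ finite_imageI])
  have "coeff (hodge_poincare r n i) k = (\<Sum>j\<in>?J. if j = i + k then real (koszul_betti r n i j) else 0)"
    unfolding hodge_poincare_def coeff_sum by (intro sum.cong refl) auto
  also have "\<dots> = real (koszul_betti r n i (i + k))"
    using fin by (simp add: sum.delta)
  finally show "coeff (hodge_poincare r n i) k = coeff (hodge_formula r n i) k"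
    by (simp add: koszul_betti_eq_coeff[OF r])
qed

theorem theorem1p4:
  fixes r n i :: nat and z :: complex
  assumes "1 \<le> r" and "r \<le> n" and "i \<le> n - r"
    and "poly (map_poly complex_of_real (hodge_poincare r n i)) z = 0"
  shows "z \<in> \<real>"
proof (cases "i = 0")
  case True
  then show ?thesis using hodge_formula_0_real_rooted[OF assms(1,2)] assms(4) hodge_poincare_eq[OF assms(1,2)] by simp
next
  case False
  then show ?thesis using hodge_formula_pos_real_rooted[OF assms(1), of i n z] assms hodge_poincare_eq[OF assms(1,2)] by simp
qed

end
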